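(* Let $\mathbb{D}$ be a triangulated derivator defined on the $2$-category of small categories. 1) Given an object $X$ of $\underline{\mathrm{Hom}}(\mathbb{N},\mathbb{D}(e))$, there exists an object of $\mathbb{D}(\mathbb{N}^{op})$ which lifts $X$. 2) Given a morphism $f:X\to X'$ in $\underline{\mathrm{Hom}}(\mathbb{N},\mathbb{D}(e))$, there exists a morphism $\tilde{f}:\tilde{X}\to\tilde{X}'$ in $\mathbb{D}(\mathbb{N}^{op})$ such that $d_{\mathbb{N}^{op}}(\tilde{f})$ is isomorphic to $f$. 3) The homotopy colimit of an object $X$ of $\mathbb{D}(\mathbb{N}^{op})$ is isomorphic to the Milnor colimit of its associated diagram $d_{\mathbb{N}^{op}}X$.
   Context: Triangulated derivators are taken in the sense and with the conventions of Cisinski–Neeman ("Additivity for derivator K-theory"): $\mathbb{D}$ is contravariant on functors and natural transformations, so a functor $u:I\to J$ gives $u^*:\mathbb{D}(J)\to\mathbb{D}(I)$ and a natural transformation $\alpha:u\Rightarrow v$ gives $\alpha^*:v^*\Rightarrow u^*$; $u^*$ has a left adjoint $u_!$. $e$ is the one-point category. $\underline{\mathrm{Hom}}(I^{op},\mathbb{D}(e))$ is the category of functors $I^{op}\to\mathbb{D}(e)$; $d_I:\mathbb{D}(I)\to\underline{\mathrm{Hom}}(I^{op},\mathbb{D}(e))$ is the diagram functor sending $F$ to the presheaf $i\mapsto i^*F$, where an object $i$ of $I$ is viewed as a functor $i:e\to I$. An object $G\in\mathbb{D}(I)$ lifts a presheaf $F$ if $d_I(G)\cong F$ in $\underline{\mathrm{Hom}}(I^{op},\mathbb{D}(e))$.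 The poset $\mathbb{N}$ is viewed as a category, so objects of $\underline{\mathrm{Hom}}(\mathbb{N},\mathbb{D}(e))$ are sequences $X_0\to X_1\to X_2\to\cdots$ in $\mathbb{D}(e)$. For $p:I\to e$ the unique functor, the homotopy colimit of $F\in\mathbb{D}(I)$ is $p_!F\in\mathbb{D}(e)$. The Milnor colimit $\mathrm{Mcolim}_{n\geq 0}L_n$ of a sequence $L_0\xrightarrow{f_0}L_1\xrightarrow{f_1}\cdots$ in a triangulated category is the object, unique up to non-unique isomorphism, fitting into a triangle $\coprod_{n\geq 0}L_n\xrightarrow{\mathbf{1}-\sigma}\coprod_{n\geq 0}L_n\to\mathrm{Mcolim}_{n\geq 0}L_n\to\Sigma\coprod_{n\geq 0}L_n$, where $\sigma$ has components $L_n\xrightarrow{f_n}L_{n+1}\xrightarrow{\mathrm{can}}\coprod_{n\geq 0}L_n$. *)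

theory Defs
  imports "HOL-Library.FuncSet" "HOL-Library.Infinite_Typeclass"
begin

section \<open>Categories, functors, natural transformations\<close>

text \<open>
  Objects and arrows of a category are carrier sets inside two types. Categories, functors and
  natural transformations are extensional (their operations are \<open>undefined\<close> outside the carriers),
  so that record equality is equality of categories, functors and transformations, as is needed to
  speak of strict 2-functors. \<open>mk_cat\<close> makes arbitrary operations extensional.
\<close>

record ('o, 'a) cat =
  Obj :: "'o set"
  Arr :: "'a set"
  Dom :: "'a \<Rightarrow> 'o"
  Cod :: "'a \<Rightarrow> 'o"
  Ident :: "'o \<Rightarrow> 'a"
  Comp :: "'a \<Rightarrow> 'a \<Rightarrow> 'a"  (infixl \<open>\<cdot>\<index>\<close> 70)

definition mk_cat ::
  "'o set \<Rightarrow> 'a set \<Rightarrow> ('a \<Rightarrow> 'o) \<Rightarrow> ('a \<Rightarrow> 'o) \<Rightarrow> ('o \<Rightarrow> 'a) \<Rightarrow> ('a \<Rightarrow> 'a \<Rightarrow> 'a) \<Rightarrow> ('o, 'a) cat"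
  where "mk_cat X A d c i m =
    \<lparr>Obj = X, Arr = A, Dom = restrict d A, Cod = restrict c A, Ident = restrict i X,
     Comp = (\<lambda>g f. if g \<in> A \<and> f \<in> A \<and> d g = c f then m g f else undefined)\<rparr>"

definition hom :: "('o, 'a) cat \<Rightarrow> 'o \<Rightarrow> 'o \<Rightarrow> 'a set"
  where "hom C x y = {f \<in> Arr C. Dom C f = x \<and> Cod C f = y}"

locale category =
  fixes C :: "('o, 'a) cat" (structure)
  assumes dom_closed: "f \<in> Arr C \<Longrightarrow> Dom C f \<in> Obj C"
    and cod_closed: "f \<in> Arr C \<Longrightarrow> Cod C f \<in> Obj C"
    and ident_hom: "x \<in> Obj C \<Longrightarrow> Ident C x \<in> hom C x x"
    and comp_hom: "\<lbrakk>f \<in> hom C x y; g \<in> hom C y z\<rbrakk> \<Longrightarrow> g \<cdot> f \<in> hom C x z"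
    and comp_assoc: "\<lbrakk>f \<in> hom C w x; g \<in> hom C x y; h \<in> hom C y z\<rbrakk> \<Longrightarrow> (h \<cdot> g) \<cdot> f = h \<cdot> (g \<cdot> f)"
    and ident_left: "f \<in> hom C x y \<Longrightarrow> Ident C y \<cdot> f = f"
    and ident_right: "f \<in> hom C x y \<Longrightarrow> f \<cdot> Ident C x = f"
    and dom_ext: "Dom C \<in> extensional (Arr C)"
    and cod_ext: "Cod C \<in> extensional (Arr C)"
    and ident_ext: "Ident C \<in> extensional (Obj C)"
    and comp_ext: "\<not> (g \<in> Arr C \<and> f \<in> Arr C \<and> Dom C g = Cod C f) \<Longrightarrow> g \<cdot> f = undefined"

definition op_cat :: "('o, 'a) cat \<Rightarrow> ('o, 'a) cat"
  where "op_cat C = \<lparr>Obj = Obj C, Arr = Arr C, Dom = Cod C, Cod = Dom C, Ident = Ident C,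
     Comp = (\<lambda>g f. f \<cdot>\<^bsub>C\<^esub> g)\<rparr>"

lemma op_cat_op_cat [simp]: "op_cat (op_cat C) = C"
  by (simp add: op_cat_def)

definition inverse_arrows :: "('o, 'a) cat \<Rightarrow> 'a \<Rightarrow> 'a \<Rightarrow> bool"
  where "inverse_arrows C f g \<longleftrightarrow> f \<in> Arr C \<and> g \<in> hom C (Cod C f) (Dom C f) \<and>
     g \<cdot>\<^bsub>C\<^esub> f = Ident C (Dom C f) \<and> f \<cdot>\<^bsub>C\<^esub> g = Ident C (Cod C f)"

definition is_iso :: "('o, 'a) cat \<Rightarrow> 'a \<Rightarrow> bool"
  where "is_iso C f \<longleftrightarrow> (\<exists>g. inverse_arrows C f g)"

definition inv_arr :: "('o, 'a) cat \<Rightarrow> 'a \<Rightarrow> 'a"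
  where "inv_arr C f = (THE g. inverse_arrows C f g)"

definition isomorphic :: "('o, 'a) cat \<Rightarrow> 'o \<Rightarrow> 'o \<Rightarrow> bool"
  where "isomorphic C x y \<longleftrightarrow> (\<exists>f \<in> hom C x y. is_iso C f)"

text \<open>Isomorphism in the category of arrows of \<open>C\<close>.\<close>

definition arr_isomorphic :: "('o, 'a) cat \<Rightarrow> 'a \<Rightarrow> 'a \<Rightarrow> bool"
  where "arr_isomorphic C f g \<longleftrightarrow> f \<in> Arr C \<and> g \<in> Arr C \<and>
    (\<exists>a \<in> hom C (Dom C f) (Dom C g). \<exists>b \<in> hom C (Cod C f) (Cod C g).
       is_iso C a \<and> is_iso C b \<and> b \<cdot>\<^bsub>C\<^esub> f = g \<cdot>\<^bsub>C\<^esub> a)"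

record ('o, 'a, 'p, 'b) ftor =
  Src :: "('o, 'a) cat"
  Tgt :: "('p, 'b) cat"
  FO :: "'o \<Rightarrow> 'p"
  FA :: "'a \<Rightarrow> 'b"

definition is_ftor :: "('o, 'a, 'p, 'b) ftor \<Rightarrow> bool"
  where "is_ftor F \<longleftrightarrow> category (Src F) \<and> category (Tgt F) \<and>
    FO F \<in> Obj (Src F) \<rightarrow>\<^sub>E Obj (Tgt F) \<and>
    FA F \<in> extensional (Arr (Src F)) \<and>
    (\<forall>f \<in> Arr (Src F). FA F f \<in> hom (Tgt F) (FO F (Dom (Src F) f)) (FO F (Cod (Src F) f))) \<and>
    (\<forall>x \<in> Obj (Src F). FA F (Ident (Src F) x) = Ident (Tgt F) (FO F x)) \<and>
    (\<forall>g \<in> Arr (Src F). \<forall>f \<in> Arr (Src F). Dom (Src F) g = Cod (Src F) f \<longrightarrow>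
       FA F (g \<cdot>\<^bsub>Src F\<^esub> f) = FA F g \<cdot>\<^bsub>Tgt F\<^esub> FA F f)"

definition mk_ftor ::
  "('o, 'a) cat \<Rightarrow> ('p, 'b) cat \<Rightarrow> ('o \<Rightarrow> 'p) \<Rightarrow> ('a \<Rightarrow> 'b) \<Rightarrow> ('o, 'a, 'p, 'b) ftor"
  where "mk_ftor A B u v = \<lparr>Src = A, Tgt = B, FO = restrict u (Obj A), FA = restrict v (Arr A)\<rparr>"

definition id_ftor :: "('o, 'a) cat \<Rightarrow> ('o, 'a, 'o, 'a) ftor"
  where "id_ftor C = mk_ftor C C (\<lambda>x. x) (\<lambda>f. f)"

definition comp_ftor ::
  "('p, 'b, 'q, 'c) ftor \<Rightarrow> ('o, 'a, 'p, 'b) ftor \<Rightarrow> ('o, 'a, 'q, 'c) ftor"  (infixr \<open>\<circ>\<^sub>F\<close> 75)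
  where "G \<circ>\<^sub>F F = mk_ftor (Src F) (Tgt G) (\<lambda>x. FO G (FO F x)) (\<lambda>f. FA G (FA F f))"

record ('o, 'a, 'p, 'b) ntrans =
  NDom :: "('o, 'a, 'p, 'b) ftor"
  NCod :: "('o, 'a, 'p, 'b) ftor"
  NC :: "'o \<Rightarrow> 'b"

definition is_ntrans :: "('o, 'a, 'p, 'b) ntrans \<Rightarrow> bool"
  where "is_ntrans \<alpha> \<longleftrightarrow> is_ftor (NDom \<alpha>) \<and> is_ftor (NCod \<alpha>) \<and>
    Src (NCod \<alpha>) = Src (NDom \<alpha>) \<and> Tgt (NCod \<alpha>) = Tgt (NDom \<alpha>) \<and>
    NC \<alpha> \<in> extensional (Obj (Src (NDom \<alpha>))) \<and>
    (\<forall>x \<in> Obj (Src (NDom \<alpha>)). NC \<alpha> x \<in> hom (Tgt (NDom \<alpha>)) (FO (NDom \<alpha>) x) (FO (NCod \<alpha>) x)) \<and>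
    (\<forall>f \<in> Arr (Src (NDom \<alpha>)).
       NC \<alpha> (Cod (Src (NDom \<alpha>)) f) \<cdot>\<^bsub>Tgt (NDom \<alpha>)\<^esub> FA (NDom \<alpha>) f =
       FA (NCod \<alpha>) f \<cdot>\<^bsub>Tgt (NDom \<alpha>)\<^esub> NC \<alpha> (Dom (Src (NDom \<alpha>)) f))"

definition mk_ntrans ::
  "('o, 'a, 'p, 'b) ftor \<Rightarrow> ('o, 'a, 'p, 'b) ftor \<Rightarrow> ('o \<Rightarrow> 'b) \<Rightarrow> ('o, 'a, 'p, 'b) ntrans"
  where "mk_ntrans F G c = \<lparr>NDom = F, NCod = G, NC = restrict c (Obj (Src F))\<rparr>"

definition id_ntrans :: "('o, 'a, 'p, 'b) ftor \<Rightarrow> ('o, 'a, 'p, 'b) ntrans"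
  where "id_ntrans F = mk_ntrans F F (\<lambda>x. Ident (Tgt F) (FO F x))"

definition vcomp ::
  "('o, 'a, 'p, 'b) ntrans \<Rightarrow> ('o, 'a, 'p, 'b) ntrans \<Rightarrow> ('o, 'a, 'p, 'b) ntrans"
  where "vcomp \<beta> \<alpha> = mk_ntrans (NDom \<alpha>) (NCod \<beta>) (\<lambda>x. NC \<beta> x \<cdot>\<^bsub>Tgt (NDom \<alpha>)\<^esub> NC \<alpha> x)"

definition hcomp ::
  "('p, 'b, 'q, 'c) ntrans \<Rightarrow> ('o, 'a, 'p, 'b) ntrans \<Rightarrow> ('o, 'a, 'q, 'c) ntrans"
  where "hcomp \<beta> \<alpha> = mk_ntrans (NDom \<beta> \<circ>\<^sub>F NDom \<alpha>) (NCod \<beta> \<circ>\<^sub>F NCod \<alpha>)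
    (\<lambda>x. NC \<beta> (FO (NCod \<alpha>) x) \<cdot>\<^bsub>Tgt (NDom \<beta>)\<^esub> FA (NDom \<beta>) (NC \<alpha> x))"

definition fun_cat ::
  "('o, 'a) cat \<Rightarrow> ('p, 'b) cat \<Rightarrow> (('o, 'a, 'p, 'b) ftor, ('o, 'a, 'p, 'b) ntrans) cat"
  where "fun_cat A B = mk_cat
    {F. is_ftor F \<and> Src F = A \<and> Tgt F = B}
    {\<alpha>. is_ntrans \<alpha> \<and> Src (NDom \<alpha>) = A \<and> Tgt (NDom \<alpha>) = B}
    NDom NCod id_ntrans vcomp"

definition full :: "('o, 'a, 'p, 'b) ftor \<Rightarrow> bool"
  where "full F \<longleftrightarrow> (\<forall>x \<in> Obj (Src F). \<forall>y \<in> Obj (Src F).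
    hom (Tgt F) (FO F x) (FO F y) \<subseteq> FA F ` hom (Src F) x y)"

definition faithful :: "('o, 'a, 'p, 'b) ftor \<Rightarrow> bool"
  where "faithful F \<longleftrightarrow> (\<forall>x \<in> Obj (Src F). \<forall>y \<in> Obj (Src F). inj_on (FA F) (hom (Src F) x y))"

definition essentially_surjective :: "('o, 'a, 'p, 'b) ftor \<Rightarrow> bool"
  where "essentially_surjective F \<longleftrightarrow> (\<forall>y \<in> Obj (Tgt F). \<exists>x \<in> Obj (Src F). isomorphic (Tgt F) (FO F x) y)"

definition is_equivalence :: "('o, 'a, 'p, 'b) ftor \<Rightarrow> bool"
  where "is_equivalence F \<longleftrightarrow> is_ftor F \<and>
    (\<exists>G. is_ftor G \<and> Src G = Tgt F \<and> Tgt G = Src F \<and>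
       isomorphic (fun_cat (Src F) (Src F)) (G \<circ>\<^sub>F F) (id_ftor (Src F)) \<and>
       isomorphic (fun_cat (Tgt F) (Tgt F)) (F \<circ>\<^sub>F G) (id_ftor (Tgt F)))"

text \<open>\<open>F\<close> is left adjoint to \<open>G\<close>, with unit \<open>\<eta>\<close> and counit \<open>\<epsilon>\<close>.\<close>

definition adjunction ::
  "('o, 'a, 'p, 'b) ftor \<Rightarrow> ('p, 'b, 'o, 'a) ftor \<Rightarrow> ('o, 'a, 'o, 'a) ntrans \<Rightarrow>
   ('p, 'b, 'p, 'b) ntrans \<Rightarrow> bool"
  where "adjunction F G \<eta> \<epsilon> \<longleftrightarrow>
    is_ftor F \<and> is_ftor G \<and> Src G = Tgt F \<and> Tgt G = Src F \<and>
    is_ntrans \<eta> \<and> NDom \<eta> = id_ftor (Src F) \<and> NCod \<eta> = G \<circ>\<^sub>F F \<and>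
    is_ntrans \<epsilon> \<and> NDom \<epsilon> = F \<circ>\<^sub>F G \<and> NCod \<epsilon> = id_ftor (Tgt F) \<and>
    (\<forall>x \<in> Obj (Src F). NC \<epsilon> (FO F x) \<cdot>\<^bsub>Tgt F\<^esub> FA F (NC \<eta> x) = Ident (Tgt F) (FO F x)) \<and>
    (\<forall>y \<in> Obj (Tgt F). FA G (NC \<epsilon> y) \<cdot>\<^bsub>Src F\<^esub> NC \<eta> (FO G y) = Ident (Src F) (FO G y))"

definition has_left_adjoint :: "('p, 'b, 'o, 'a) ftor \<Rightarrow> bool"
  where "has_left_adjoint G \<longleftrightarrow> (\<exists>F \<eta> \<epsilon>. adjunction F G \<eta> \<epsilon>)"

definition has_right_adjoint :: "('o, 'a, 'p, 'b) ftor \<Rightarrow> bool"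
  where "has_right_adjoint F \<longleftrightarrow> (\<exists>G \<eta> \<epsilon>. adjunction F G \<eta> \<epsilon>)"

definition left_adj ::
  "('p, 'b, 'o, 'a) ftor \<Rightarrow> ('o, 'a, 'p, 'b) ftor \<times> ('o, 'a, 'o, 'a) ntrans \<times> ('p, 'b, 'p, 'b) ntrans"
  where "left_adj G = (SOME (F, \<eta>, \<epsilon>). adjunction F G \<eta> \<epsilon>)"

definition right_adj ::
  "('o, 'a, 'p, 'b) ftor \<Rightarrow> ('p, 'b, 'o, 'a) ftor \<times> ('o, 'a, 'o, 'a) ntrans \<times> ('p, 'b, 'p, 'b) ntrans"
  where "right_adj F = (SOME (G, \<eta>, \<epsilon>). adjunction F G \<eta> \<epsilon>)"

definition prod_fam :: "'i set \<Rightarrow> ('i \<Rightarrow> ('o, 'a) cat) \<Rightarrow> ('i \<Rightarrow> 'o, 'i \<Rightarrow> 'a) cat"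
  where "prod_fam I C = mk_cat (\<Pi>\<^sub>E i\<in>I. Obj (C i)) (\<Pi>\<^sub>E i\<in>I. Arr (C i))
    (\<lambda>f. \<lambda>i\<in>I. Dom (C i) (f i)) (\<lambda>f. \<lambda>i\<in>I. Cod (C i) (f i))
    (\<lambda>x. \<lambda>i\<in>I. Ident (C i) (x i)) (\<lambda>g f. \<lambda>i\<in>I. g i \<cdot>\<^bsub>C i\<^esub> f i)"

section \<open>Additive notions\<close>

definition is_initial :: "('o, 'a) cat \<Rightarrow> 'o \<Rightarrow> bool"
  where "is_initial C z \<longleftrightarrow> z \<in> Obj C \<and> (\<forall>x \<in> Obj C. \<exists>!f. f \<in> hom C z x)"

definition is_terminal :: "('o, 'a) cat \<Rightarrow> 'o \<Rightarrow> bool"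
  where "is_terminal C z \<longleftrightarrow> z \<in> Obj C \<and> (\<forall>x \<in> Obj C. \<exists>!f. f \<in> hom C x z)"

definition is_zero :: "('o, 'a) cat \<Rightarrow> 'o \<Rightarrow> bool"
  where "is_zero C z \<longleftrightarrow> is_initial C z \<and> is_terminal C z"

definition is_zero_arrow :: "('o, 'a) cat \<Rightarrow> 'a \<Rightarrow> bool"
  where "is_zero_arrow C f \<longleftrightarrow> (\<exists>z k l. is_zero C z \<and> k \<in> hom C (Dom C f) z \<and>
    l \<in> hom C z (Cod C f) \<and> f = l \<cdot>\<^bsub>C\<^esub> k)"

definition is_coproduct :: "('o, 'a) cat \<Rightarrow> 'i set \<Rightarrow> ('i \<Rightarrow> 'o) \<Rightarrow> 'o \<Rightarrow> ('i \<Rightarrow> 'a) \<Rightarrow> bool"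
  where "is_coproduct C I L P inn \<longleftrightarrow> P \<in> Obj C \<and> (\<forall>i \<in> I. inn i \<in> hom C (L i) P) \<and>
    (\<forall>Q \<in> Obj C. \<forall>t. (\<forall>i \<in> I. t i \<in> hom C (L i) Q) \<longrightarrow>
       (\<exists>!k. k \<in> hom C P Q \<and> (\<forall>i \<in> I. k \<cdot>\<^bsub>C\<^esub> inn i = t i)))"

definition is_product :: "('o, 'a) cat \<Rightarrow> 'i set \<Rightarrow> ('i \<Rightarrow> 'o) \<Rightarrow> 'o \<Rightarrow> ('i \<Rightarrow> 'a) \<Rightarrow> bool"
  where "is_product C I L P prj \<longleftrightarrow> is_coproduct (op_cat C) I L P prj"

definition is_square_biproduct ::
  "('o, 'a) cat \<Rightarrow> 'o \<Rightarrow> 'o \<Rightarrow> (bool \<Rightarrow> 'a) \<Rightarrow> (bool \<Rightarrow> 'a) \<Rightarrow> bool"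
  where "is_square_biproduct C y b inn prj \<longleftrightarrow>
    is_coproduct C UNIV (\<lambda>_. y) b inn \<and> is_product C UNIV (\<lambda>_. y) b prj \<and>
    (\<forall>s. prj s \<cdot>\<^bsub>C\<^esub> inn s = Ident C y) \<and> (\<forall>s. is_zero_arrow C (prj (\<not> s) \<cdot>\<^bsub>C\<^esub> inn s))"

text \<open>
  The addition of parallel arrows in an additive category is determined by the category: \<open>f + g\<close>
  is the composite of \<open>(f, g) : x \<rightarrow> y \<oplus> y\<close> with the codiagonal \<open>y \<oplus> y \<rightarrow> y\<close>.
\<close>

definition is_sum :: "('o, 'a) cat \<Rightarrow> 'a \<Rightarrow> 'a \<Rightarrow> 'a \<Rightarrow> bool"
  where "is_sum C f g h \<longleftrightarrow> f \<in> Arr C \<and> g \<in> hom C (Dom C f) (Cod C f) \<and>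
    (\<exists>b inn prj k codiag. is_square_biproduct C (Cod C f) b inn prj \<and>
       k \<in> hom C (Dom C f) b \<and> prj True \<cdot>\<^bsub>C\<^esub> k = f \<and> prj False \<cdot>\<^bsub>C\<^esub> k = g \<and>
       codiag \<in> hom C b (Cod C f) \<and> (\<forall>s. codiag \<cdot>\<^bsub>C\<^esub> inn s = Ident C (Cod C f)) \<and>
       h = codiag \<cdot>\<^bsub>C\<^esub> k)"

definition minus_arr :: "('o, 'a) cat \<Rightarrow> 'a \<Rightarrow> 'a \<Rightarrow> 'a"
  where "minus_arr C f g = (THE d. is_sum C d g f)"

section \<open>Small categories\<close>

text \<open>
  A small category is one whose objects and arrows lie in a fixed, arbitrary infinite type \<open>'u\<close>.
  Infinity of \<open>'u\<close> is what makes this collection closed, up to isomorphism, under the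
  constructions below; pairs and natural numbers are encoded in \<open>'u\<close> by chosen injections.
\<close>

definition cnat :: "nat \<Rightarrow> 'u::infinite"
  where "cnat = (SOME c. inj c)"

definition pair_code :: "'u \<times> 'u \<Rightarrow> 'u::infinite"
  where "pair_code = (SOME c. inj c)"

lemma inj_cnat: "inj (cnat :: nat \<Rightarrow> 'u::infinite)"
proof -
  have "\<exists>c :: nat \<Rightarrow> 'u. inj c"
    using infinite_countable_subset[OF infinite_UNIV] by blast
  then show ?thesis
    unfolding cnat_def by (rule someI_ex)
qed

lemma inj_pair_code: "inj (pair_code :: 'u \<times> 'u \<Rightarrow> 'u::infinite)"
proof -
  have "\<exists>c :: 'u \<times> 'u \<Rightarrow> 'u. inj c"
    using card_of_Times_same_infinite[OF infinite_UNIV]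
    by (metis UNIV_Times_UNIV bij_betw_def card_of_ordIso)
  then show ?thesis
    unfolding pair_code_def by (rule someI_ex)
qed

abbreviation cpair :: "'u \<Rightarrow> 'u \<Rightarrow> 'u::infinite"
  where "cpair a b \<equiv> pair_code (a, b)"

definition cfst :: "'u \<Rightarrow> 'u::infinite"
  where "cfst x = fst (inv pair_code x)"

definition csnd :: "'u \<Rightarrow> 'u::infinite"
  where "csnd x = snd (inv pair_code x)"

lemma cfst_cpair [simp]: "cfst (cpair a b) = a" and csnd_cpair [simp]: "csnd (cpair a b) = b"
  by (simp_all add: cfst_def csnd_def inj_pair_code)

type_synonym 'u scat = "('u, 'u) cat"
type_synonym 'u sftor = "('u, 'u, 'u, 'u) ftor"
type_synonym 'u sntrans = "('u, 'u, 'u, 'u) ntrans"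

definition poset_cat :: "('x \<Rightarrow> 'u::infinite) \<Rightarrow> 'x set \<Rightarrow> ('x \<Rightarrow> 'x \<Rightarrow> bool) \<Rightarrow> 'u scat"
  where "poset_cat c P le = mk_cat (c ` P) {cpair (c x) (c y) | x y. x \<in> P \<and> y \<in> P \<and> le x y}
    cfst csnd (\<lambda>x. cpair x x) (\<lambda>g f. cpair (cfst f) (csnd g))"

definition chain :: "nat set \<Rightarrow> 'u::infinite scat"
  where "chain P = poset_cat cnat P (\<le>)"

definition e_cat :: "'u::infinite scat"
  where "e_cat = chain {0}"

definition nat_cat :: "'u::infinite scat"
  where "nat_cat = chain UNIV"

definition arrow_cat :: "'u::infinite scat"
  where "arrow_cat = op_cat (chain {0, 1})"

text \<open>
  For a set \<open>P\<close> of pairs of natural numbers, \<open>grid P\<close> is the opposite of the poset \<open>P\<close> with the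
  componentwise order. Since \<open>D I\<close> behaves like a category of presheaves on \<open>I\<close>, an object of
  \<open>D (grid P)\<close> has an underlying diagram of shape \<open>P\<close>; \<open>(i, j)\<close> stands for row \<open>i\<close>, column \<open>j\<close>.
\<close>

definition gcode :: "nat \<times> nat \<Rightarrow> 'u::infinite"
  where "gcode p = cpair (cnat (fst p)) (cnat (snd p))"

definition grid :: "(nat \<times> nat) set \<Rightarrow> 'u::infinite scat"
  where "grid P = op_cat (poset_cat gcode P (\<lambda>p q. fst p \<le> fst q \<and> snd p \<le> snd q))"

definition grid_map :: "(nat \<times> nat) set \<Rightarrow> (nat \<times> nat) set \<Rightarrow> (nat \<times> nat \<Rightarrow> nat \<times> nat) \<Rightarrow> 'u::infinite sftor"
  where "grid_map P Q h =
    (let h' = (\<lambda>x. gcode (h (inv gcode x)))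
     in mk_ftor (grid P) (grid Q) h' (\<lambda>k. cpair (h' (cfst k)) (h' (csnd k))))"

definition prod_cat :: "'u::infinite scat \<Rightarrow> 'u scat \<Rightarrow> 'u scat"
  where "prod_cat A I = mk_cat
    {cpair a i | a i. a \<in> Obj A \<and> i \<in> Obj I} {cpair f k | f k. f \<in> Arr A \<and> k \<in> Arr I}
    (\<lambda>f. cpair (Dom A (cfst f)) (Dom I (csnd f))) (\<lambda>f. cpair (Cod A (cfst f)) (Cod I (csnd f)))
    (\<lambda>x. cpair (Ident A (cfst x)) (Ident I (csnd x)))
    (\<lambda>g f. cpair (cfst g \<cdot>\<^bsub>A\<^esub> cfst f) (csnd g \<cdot>\<^bsub>I\<^esub> csnd f))"

definition coprod_cat :: "'u set \<Rightarrow> ('u \<Rightarrow> 'u scat) \<Rightarrow> 'u::infinite scat"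
  where "coprod_cat I A = mk_cat
    {cpair i a | i a. i \<in> I \<and> a \<in> Obj (A i)} {cpair i f | i f. i \<in> I \<and> f \<in> Arr (A i)}
    (\<lambda>f. cpair (cfst f) (Dom (A (cfst f)) (csnd f))) (\<lambda>f. cpair (cfst f) (Cod (A (cfst f)) (csnd f)))
    (\<lambda>x. cpair (cfst x) (Ident (A (cfst x)) (csnd x)))
    (\<lambda>g f. cpair (cfst f) (csnd g \<cdot>\<^bsub>A (cfst f)\<^esub> csnd f))"

definition coprod_incl :: "'u set \<Rightarrow> ('u \<Rightarrow> 'u scat) \<Rightarrow> 'u \<Rightarrow> 'u::infinite sftor"
  where "coprod_incl I A i = mk_ftor (A i) (coprod_cat I A) (cpair i) (cpair i)"

text \<open>
  The category \<open>A/b\<close> for \<open>u : A \<rightarrow> B\<close>: objects are pairs \<open>(a, f : u a \<rightarrow> b)\<close>; an arrow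
  \<open>(a, f) \<rightarrow> (a', f')\<close> is an arrow \<open>h : a \<rightarrow> a'\<close> with \<open>f' (u h) = f\<close>, encoded as \<open>(h, f')\<close>
  (which determines \<open>a\<close>, \<open>a'\<close> and \<open>f\<close>).
\<close>

definition slice :: "'u::infinite sftor \<Rightarrow> 'u \<Rightarrow> 'u scat"
  where "slice u b = mk_cat
    {cpair a f | a f. a \<in> Obj (Src u) \<and> f \<in> hom (Tgt u) (FO u a) b}
    {cpair h f | h f. h \<in> Arr (Src u) \<and> f \<in> hom (Tgt u) (FO u (Cod (Src u) h)) b}
    (\<lambda>k. cpair (Dom (Src u) (cfst k)) (csnd k \<cdot>\<^bsub>Tgt u\<^esub> FA u (cfst k)))
    (\<lambda>k. cpair (Cod (Src u) (cfst k)) (csnd k))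
    (\<lambda>x. cpair (Ident (Src u) (cfst x)) (csnd x))
    (\<lambda>k l. cpair (cfst k \<cdot>\<^bsub>Src u\<^esub> cfst l) (csnd k))"

text \<open>
  Dually, the objects of \<open>b\A\<close> are pairs \<open>(a, f : b \<rightarrow> u a)\<close>, and an arrow
  \<open>h : (a, f) \<rightarrow> (a', (u h) f)\<close> is encoded as \<open>(h, f)\<close>.
\<close>

definition coslice :: "'u::infinite sftor \<Rightarrow> 'u \<Rightarrow> 'u scat"
  where "coslice u b = mk_cat
    {cpair a f | a f. a \<in> Obj (Src u) \<and> f \<in> hom (Tgt u) b (FO u a)}
    {cpair h f | h f. h \<in> Arr (Src u) \<and> f \<in> hom (Tgt u) b (FO u (Dom (Src u) h))}
    (\<lambda>k. cpair (Dom (Src u) (cfst k)) (csnd k))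
    (\<lambda>k. cpair (Cod (Src u) (cfst k)) (FA u (cfst k) \<cdot>\<^bsub>Tgt u\<^esub> csnd k))
    (\<lambda>x. cpair (Ident (Src u) (cfst x)) (csnd x))
    (\<lambda>k l. cpair (cfst k \<cdot>\<^bsub>Src u\<^esub> cfst l) (csnd l))"

definition slice_proj :: "'u::infinite sftor \<Rightarrow> 'u \<Rightarrow> 'u sftor"
  where "slice_proj u b = mk_ftor (slice u b) (Src u) cfst cfst"

definition coslice_proj :: "'u::infinite sftor \<Rightarrow> 'u \<Rightarrow> 'u sftor"
  where "coslice_proj u b = mk_ftor (coslice u b) (Src u) cfst cfst"

definition to_e :: "'u::infinite scat \<Rightarrow> 'u sftor"
  where "to_e A = mk_ftor A e_cat (\<lambda>_. cnat 0) (\<lambda>_. Ident e_cat (cnat 0))"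

text \<open>Objects and arrows of \<open>I\<close> as functors \<open>e \<rightarrow> I\<close> and transformations between them.\<close>

definition pt :: "'u::infinite scat \<Rightarrow> 'u \<Rightarrow> 'u sftor"
  where "pt I i = mk_ftor e_cat I (\<lambda>_. i) (\<lambda>_. Ident I i)"

definition pt_arr :: "'u::infinite scat \<Rightarrow> 'u \<Rightarrow> 'u sntrans"
  where "pt_arr I k = mk_ntrans (pt I (Dom I k)) (pt I (Cod I k)) (\<lambda>_. k)"

text \<open>The functors \<open>A \<rightarrow> A \<times> I\<close> with constant second component \<open>i\<close>, and the transformations
  between them.\<close>

definition slot :: "'u::infinite scat \<Rightarrow> 'u scat \<Rightarrow> 'u \<Rightarrow> 'u sftor"
  where "slot A I i = mk_ftor A (prod_cat A I) (\<lambda>a. cpair a i) (\<lambda>f. cpair f (Ident I i))"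

definition slot_arr :: "'u::infinite scat \<Rightarrow> 'u scat \<Rightarrow> 'u \<Rightarrow> 'u sntrans"
  where "slot_arr A I k =
    mk_ntrans (slot A I (Dom I k)) (slot A I (Cod I k)) (\<lambda>a. cpair (Ident A a) k)"

text \<open>The canonical 2-cells \<open>u j \<Rightarrow> b p\<close> on \<open>A/b\<close> and \<open>b p \<Rightarrow> u j\<close> on \<open>b\A\<close>.\<close>

definition slice_cell :: "'u::infinite sftor \<Rightarrow> 'u \<Rightarrow> 'u sntrans"
  where "slice_cell u b =
    mk_ntrans (u \<circ>\<^sub>F slice_proj u b) (pt (Tgt u) b \<circ>\<^sub>F to_e (slice u b)) csnd"

definition coslice_cell :: "'u::infinite sftor \<Rightarrow> 'u \<Rightarrow> 'u sntrans"
  where "coslice_cell u b =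
    mk_ntrans (pt (Tgt u) b \<circ>\<^sub>F to_e (coslice u b)) (u \<circ>\<^sub>F coslice_proj u b) csnd"

text \<open>
  Terminology for presheaves: an open immersion is the inclusion of a sieve, a closed immersion
  the inclusion of a cosieve.
\<close>

definition open_immersion :: "('o, 'a, 'p, 'b) ftor \<Rightarrow> bool"
  where "open_immersion u \<longleftrightarrow> is_ftor u \<and> inj_on (FO u) (Obj (Src u)) \<and> full u \<and> faithful u \<and>
    (\<forall>a \<in> Obj (Tgt u). \<forall>x \<in> Obj (Src u). hom (Tgt u) a (FO u x) \<noteq> {} \<longrightarrow> a \<in> FO u ` Obj (Src u))"

definition closed_immersion :: "('o, 'a, 'p, 'b) ftor \<Rightarrow> bool"
  where "closed_immersion u \<longleftrightarrow> is_ftor u \<and> inj_on (FO u) (Obj (Src u)) \<and> full u \<and> faithful u \<and>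
    (\<forall>a \<in> Obj (Tgt u). \<forall>x \<in> Obj (Src u). hom (Tgt u) (FO u x) a \<noteq> {} \<longrightarrow> a \<in> FO u ` Obj (Src u))"

section \<open>Prederivators\<close>

text \<open>
  The values of a prederivator on categories, functors (\<open>u \<mapsto> u\<^sup>*\<close>) and natural transformations
  (\<open>\<alpha> \<mapsto> \<alpha>\<^sup>*\<close>). The categories \<open>D(A)\<close> need not be small: they live in the types \<open>'o\<close>, \<open>'a\<close>.
\<close>

record ('u, 'o, 'a) prederiv =
  DC :: "'u scat \<Rightarrow> ('o, 'a) cat"
  pull :: "'u sftor \<Rightarrow> ('o, 'a, 'o, 'a) ftor"
  pull2 :: "'u sntrans \<Rightarrow> ('o, 'a, 'o, 'a) ntrans"

locale prederivator =
  fixes D :: "('u::infinite, 'o, 'a) prederiv"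
  assumes DC_category: "\<And>A. category A \<Longrightarrow> category (DC D A)"
    and pull_ftor: "\<And>u. is_ftor u \<Longrightarrow>
          is_ftor (pull D u) \<and> Src (pull D u) = DC D (Tgt u) \<and> Tgt (pull D u) = DC D (Src u)"
    and pull2_ntrans: "\<And>\<alpha>. is_ntrans \<alpha> \<Longrightarrow>
          is_ntrans (pull2 D \<alpha>) \<and> NDom (pull2 D \<alpha>) = pull D (NCod \<alpha>) \<and>
          NCod (pull2 D \<alpha>) = pull D (NDom \<alpha>)"
    and pull_id: "\<And>A. category A \<Longrightarrow> pull D (id_ftor A) = id_ftor (DC D A)"
    and pull_comp: "\<And>u v. \<lbrakk>is_ftor u; is_ftor v; Src v = Tgt u\<rbrakk> \<Longrightarrow>
          pull D (v \<circ>\<^sub>F u) = pull D u \<circ>\<^sub>F pull D v"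
    and pull2_id: "\<And>u. is_ftor u \<Longrightarrow> pull2 D (id_ntrans u) = id_ntrans (pull D u)"
    and pull2_vcomp: "\<And>\<alpha> \<beta>. \<lbrakk>is_ntrans \<alpha>; is_ntrans \<beta>; NDom \<beta> = NCod \<alpha>\<rbrakk> \<Longrightarrow>
          pull2 D (vcomp \<beta> \<alpha>) = vcomp (pull2 D \<alpha>) (pull2 D \<beta>)"
    and pull2_hcomp: "\<And>\<alpha> \<beta>. \<lbrakk>is_ntrans \<alpha>; is_ntrans \<beta>; Src (NDom \<beta>) = Tgt (NDom \<alpha>)\<rbrakk> \<Longrightarrow>
          pull2 D (hcomp \<beta> \<alpha>) = hcomp (pull2 D \<alpha>) (pull2 D \<beta>)"

text \<open>\<open>u\<^sub>!\<close> and \<open>u\<^sub>*\<close>, with the units and counits of \<open>(u\<^sub>!, u\<^sup>*)\<close> and \<open>(u\<^sup>*, u\<^sub>*)\<close>.\<close>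

definition lower_shriek :: "('u, 'o, 'a) prederiv \<Rightarrow> 'u sftor \<Rightarrow> ('o, 'a, 'o, 'a) ftor"
  where "lower_shriek D u = fst (left_adj (pull D u))"

definition shriek_unit :: "('u, 'o, 'a) prederiv \<Rightarrow> 'u sftor \<Rightarrow> ('o, 'a, 'o, 'a) ntrans"
  where "shriek_unit D u = fst (snd (left_adj (pull D u)))"

definition shriek_counit :: "('u, 'o, 'a) prederiv \<Rightarrow> 'u sftor \<Rightarrow> ('o, 'a, 'o, 'a) ntrans"
  where "shriek_counit D u = snd (snd (left_adj (pull D u)))"

definition lower_star :: "('u, 'o, 'a) prederiv \<Rightarrow> 'u sftor \<Rightarrow> ('o, 'a, 'o, 'a) ftor"
  where "lower_star D u = fst (right_adj (pull D u))"

definition star_unit :: "('u, 'o, 'a) prederiv \<Rightarrow> 'u sftor \<Rightarrow> ('o, 'a, 'o, 'a) ntrans"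
  where "star_unit D u = fst (snd (right_adj (pull D u)))"

definition star_counit :: "('u, 'o, 'a) prederiv \<Rightarrow> 'u sftor \<Rightarrow> ('o, 'a, 'o, 'a) ntrans"
  where "star_counit D u = snd (snd (right_adj (pull D u)))"

definition hocolim :: "('u::infinite, 'o, 'a) prederiv \<Rightarrow> 'u scat \<Rightarrow> 'o \<Rightarrow> 'o"
  where "hocolim D I F = FO (lower_shriek D (to_e I)) F"

definition coprod_compare ::
  "('u::infinite, 'o, 'a) prederiv \<Rightarrow> 'u set \<Rightarrow> ('u \<Rightarrow> 'u scat) \<Rightarrow> ('o, 'a, 'u \<Rightarrow> 'o, 'u \<Rightarrow> 'a) ftor"
  where "coprod_compare D I A = mk_ftor (DC D (coprod_cat I A)) (prod_fam I (\<lambda>i. DC D (A i)))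
    (\<lambda>F. \<lambda>i\<in>I. FO (pull D (coprod_incl I A i)) F) (\<lambda>\<phi>. \<lambda>i\<in>I. FA (pull D (coprod_incl I A i)) \<phi>)"

text \<open>The diagram functor \<open>d\<^sub>I : D(I) \<rightarrow> Hom(I\<^sup>o\<^sup>p, D(e))\<close>, \<open>F \<mapsto> (i \<mapsto> i\<^sup>*F)\<close>.\<close>

definition diag_obj :: "('u::infinite, 'o, 'a) prederiv \<Rightarrow> 'u scat \<Rightarrow> 'o \<Rightarrow> ('u, 'u, 'o, 'a) ftor"
  where "diag_obj D I F = mk_ftor (op_cat I) (DC D e_cat)
    (\<lambda>i. FO (pull D (pt I i)) F) (\<lambda>k. NC (pull2 D (pt_arr I k)) F)"

definition diag :: "('u::infinite, 'o, 'a) prederiv \<Rightarrow> 'u scat \<Rightarrow>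
    ('o, 'a, ('u, 'u, 'o, 'a) ftor, ('u, 'u, 'o, 'a) ntrans) ftor"
  where "diag D I = mk_ftor (DC D I) (fun_cat (op_cat I) (DC D e_cat))
    (diag_obj D I)
    (\<lambda>\<phi>. mk_ntrans (diag_obj D I (Dom (DC D I) \<phi>)) (diag_obj D I (Cod (DC D I) \<phi>))
      (\<lambda>i. FA (pull D (pt I i)) \<phi>))"

definition lifts :: "('u::infinite, 'o, 'a) prederiv \<Rightarrow> 'u scat \<Rightarrow> 'o \<Rightarrow> ('u, 'u, 'o, 'a) ftor \<Rightarrow> bool"
  where "lifts D I G F \<longleftrightarrow> isomorphic (fun_cat (op_cat I) (DC D e_cat)) (FO (diag D I) G) F"

text \<open>The partial diagram functor \<open>D(A \<times> I) \<rightarrow> Hom(I\<^sup>o\<^sup>p, D(A))\<close>.\<close>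

definition pdiag_obj ::
  "('u::infinite, 'o, 'a) prederiv \<Rightarrow> 'u scat \<Rightarrow> 'u scat \<Rightarrow> 'o \<Rightarrow> ('u, 'u, 'o, 'a) ftor"
  where "pdiag_obj D A I F = mk_ftor (op_cat I) (DC D A)
    (\<lambda>i. FO (pull D (slot A I i)) F) (\<lambda>k. NC (pull2 D (slot_arr A I k)) F)"

definition pdiag :: "('u::infinite, 'o, 'a) prederiv \<Rightarrow> 'u scat \<Rightarrow> 'u scat \<Rightarrow>
    ('o, 'a, ('u, 'u, 'o, 'a) ftor, ('u, 'u, 'o, 'a) ntrans) ftor"
  where "pdiag D A I = mk_ftor (DC D (prod_cat A I)) (fun_cat (op_cat I) (DC D A))
    (pdiag_obj D A I)
    (\<lambda>\<phi>. mk_ntrans (pdiag_obj D A I (Dom (DC D (prod_cat A I)) \<phi>))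
                   (pdiag_obj D A I (Cod (DC D (prod_cat A I)) \<phi>))
      (\<lambda>i. FA (pull D (slot A I i)) \<phi>))"

text \<open>
  The base change morphisms \<open>p\<^sub>! j\<^sup>* F \<rightarrow> b\<^sup>* u\<^sub>! F\<close> (with \<open>p : b\A \<rightarrow> e\<close>) and
  \<open>b\<^sup>* u\<^sub>* F \<rightarrow> p\<^sub>* j\<^sup>* F\<close> (with \<open>p : A/b \<rightarrow> e\<close>): the transposes of
  \<open>j\<^sup>* F \<rightarrow> j\<^sup>* u\<^sup>* u\<^sub>! F \<rightarrow> p\<^sup>* b\<^sup>* u\<^sub>! F\<close> and of \<open>p\<^sup>* b\<^sup>* u\<^sub>* F \<rightarrow> j\<^sup>* u\<^sup>* u\<^sub>* F \<rightarrow> j\<^sup>* F\<close>.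
\<close>

definition shriek_base_change :: "('u::infinite, 'o, 'a) prederiv \<Rightarrow> 'u sftor \<Rightarrow> 'u \<Rightarrow> 'o \<Rightarrow> 'a"
  where "shriek_base_change D u b F =
    (let K = coslice u b; p = to_e K; j = coslice_proj u b; F' = FO (lower_shriek D u) F;
         t = NC (pull2 D (coslice_cell u b)) F' \<cdot>\<^bsub>DC D K\<^esub> FA (pull D j) (NC (shriek_unit D u) F)
     in NC (shriek_counit D p) (FO (pull D (pt (Tgt u) b)) F') \<cdot>\<^bsub>DC D e_cat\<^esub> FA (lower_shriek D p) t)"

definition star_base_change :: "('u::infinite, 'o, 'a) prederiv \<Rightarrow> 'u sftor \<Rightarrow> 'u \<Rightarrow> 'o \<Rightarrow> 'a"
  where "star_base_change D u b F =
    (let K = slice u b; p = to_e K; j = slice_proj u b; F' = FO (lower_star D u) F;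
         t = FA (pull D j) (NC (star_counit D u) F) \<cdot>\<^bsub>DC D K\<^esub> NC (pull2 D (slice_cell u b)) F'
     in FA (lower_star D p) t \<cdot>\<^bsub>DC D e_cat\<^esub> NC (star_unit D p) (FO (pull D (pt (Tgt u) b)) F'))"

section \<open>Triangulated derivators\<close>

text \<open>
  The square has initial vertex \<open>(1,1)\<close> and terminal vertex \<open>(0,0)\<close>; underlying diagrams of
  objects of \<open>D(square)\<close> are commutative squares starting at \<open>(0,0)\<close> and ending at \<open>(1,1)\<close>.
\<close>

definition square :: "(nat \<times> nat) set"
  where "square = {0, 1} \<times> {0, 1}"

definition ul_corner :: "(nat \<times> nat) set"
  where "ul_corner = square - {(1, 1)}"

definition lr_corner :: "(nat \<times> nat) set"
  where "lr_corner = square - {(0, 0)}"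

definition cocartesian :: "('u::infinite, 'o, 'a) prederiv \<Rightarrow> 'o \<Rightarrow> bool"
  where "cocartesian D C \<longleftrightarrow>
    is_iso (DC D (grid square)) (NC (shriek_counit D (grid_map ul_corner square id)) C)"

definition cartesian :: "('u::infinite, 'o, 'a) prederiv \<Rightarrow> 'o \<Rightarrow> bool"
  where "cartesian D C \<longleftrightarrow>
    is_iso (DC D (grid square)) (NC (star_unit D (grid_map lr_corner square id)) C)"

text \<open>
  Since the domain consists of all small categories, \<open>der1\<close> is required for arbitrary small
  families of categories: with finite families only, \<open>D(e)\<close> need not have infinite coproducts.
  In \<open>der5\<close>, \<open>arrow_cat\<close> is the category \<open>0 \<leftarrow> 1\<close>.
\<close>

locale derivator = prederivator +
  assumes der1: "\<And>I A. (\<And>i. i \<in> I \<Longrightarrow> category (A i)) \<Longrightarrow> is_equivalence (coprod_compare D I A)"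
    and der2: "\<And>A \<phi>. \<lbrakk>category A; \<phi> \<in> Arr (DC D A);
            \<And>a. a \<in> Obj A \<Longrightarrow> is_iso (DC D e_cat) (FA (pull D (pt A a)) \<phi>)\<rbrakk> \<Longrightarrow>
          is_iso (DC D A) \<phi>"
    and der3: "\<And>u. is_ftor u \<Longrightarrow> has_left_adjoint (pull D u) \<and> has_right_adjoint (pull D u)"
    and der4_shriek: "\<And>u b F. \<lbrakk>is_ftor u; b \<in> Obj (Tgt u); F \<in> Obj (DC D (Src u))\<rbrakk> \<Longrightarrow>
          is_iso (DC D e_cat) (shriek_base_change D u b F)"
    and der4_star: "\<And>u b F. \<lbrakk>is_ftor u; b \<in> Obj (Tgt u); F \<in> Obj (DC D (Src u))\<rbrakk> \<Longrightarrow>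
          is_iso (DC D e_cat) (star_base_change D u b F)"
    and der5: "\<And>A. category A \<Longrightarrow>
          full (pdiag D A arrow_cat) \<and> essentially_surjective (pdiag D A arrow_cat)"

locale pointed_derivator = derivator +
  assumes der6_closed: "\<And>u. closed_immersion u \<Longrightarrow> has_right_adjoint (lower_star D u)"
    and der6_open: "\<And>u. open_immersion u \<Longrightarrow> has_left_adjoint (lower_shriek D u)"

locale triangulated_derivator = pointed_derivator +
  assumes der7: "\<And>C. C \<in> Obj (DC D (grid square)) \<Longrightarrow> cartesian D C \<longleftrightarrow> cocartesian D C"

section \<open>The triangulation of \<open>D(e)\<close>\<close>

text \<open>
  The suspension is \<open>(1,1)\<^sup>* i\<^sub>! (0,0)\<^sub>*\<close>, where \<open>i\<close> is the inclusion of the upper left corner into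
  the square: extend by zero to the corner and take the pushout.
\<close>

definition corner_pushout :: "('u::infinite, 'o, 'a) prederiv \<Rightarrow> ('o, 'a, 'o, 'a) ftor"
  where "corner_pushout D = pull D (pt (grid square) (gcode (1, 1))) \<circ>\<^sub>F
    lower_shriek D (grid_map ul_corner square id)"

definition suspension :: "('u::infinite, 'o, 'a) prederiv \<Rightarrow> ('o, 'a, 'o, 'a) ftor"
  where "suspension D = corner_pushout D \<circ>\<^sub>F lower_star D (pt (grid ul_corner) (gcode (0, 0)))"

text \<open>
  Standard triangles come from objects \<open>T\<close> of \<open>D(grid rect)\<close> with underlying diagram

    \<open>X \<rightarrow> Y \<rightarrow> 0\<close>

    \<open>\<down>   \<down>   \<down>\<close>

    \<open>0 \<rightarrow> Z \<rightarrow> W\<close>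

  in which both squares are cocartesian. \<open>W\<close> is identified with the suspension of \<open>X\<close> through the
  outer square \<open>C\<close>, by
  \<open>W = (1,1)\<^sup>* C \<leftarrow> (1,1)\<^sup>* i\<^sub>! i\<^sup>* C \<rightarrow> (1,1)\<^sup>* i\<^sub>! (0,0)\<^sub>* (0,0)\<^sup>* i\<^sup>* C = (1,1)\<^sup>* i\<^sub>! (0,0)\<^sub>* X\<close>.
\<close>

definition rect :: "(nat \<times> nat) set"
  where "rect = {0, 1} \<times> {0, 1, 2}"

definition vertex :: "('u::infinite, 'o, 'a) prederiv \<Rightarrow> 'o \<Rightarrow> nat \<times> nat \<Rightarrow> 'o"
  where "vertex D T p = FO (FO (diag D (grid rect)) T) (gcode p)"

definition edge :: "('u::infinite, 'o, 'a) prederiv \<Rightarrow> 'o \<Rightarrow> nat \<times> nat \<Rightarrow> nat \<times> nat \<Rightarrow> 'a"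
  where "edge D T p q = FA (FO (diag D (grid rect)) T) (cpair (gcode p) (gcode q))"

definition subsquare :: "('u::infinite, 'o, 'a) prederiv \<Rightarrow> 'o \<Rightarrow> (nat \<Rightarrow> nat) \<Rightarrow> 'o"
  where "subsquare D T h = FO (pull D (grid_map square rect (\<lambda>(r, c). (r, h c)))) T"

definition standard_triangle :: "('u::infinite, 'o, 'a) prederiv \<Rightarrow> 'o \<Rightarrow> bool"
  where "standard_triangle D T \<longleftrightarrow> T \<in> Obj (DC D (grid rect)) \<and>
    is_zero (DC D e_cat) (vertex D T (0, 2)) \<and> is_zero (DC D e_cat) (vertex D T (1, 0)) \<and>
    cocartesian D (subsquare D T (\<lambda>c. c)) \<and> cocartesian D (subsquare D T (\<lambda>c. c + 1))"

definition connecting :: "('u::infinite, 'o, 'a) prederiv \<Rightarrow> 'o \<Rightarrow> 'a"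
  where "connecting D T =
    (let C = subsquare D T (\<lambda>c. 2 * c); i = grid_map ul_corner square id;
         to_susp = FA (corner_pushout D)
           (NC (star_unit D (pt (grid ul_corner) (gcode (0, 0)))) (FO (pull D i) C));
         to_W = FA (pull D (pt (grid square) (gcode (1, 1)))) (NC (shriek_counit D i) C)
     in to_susp \<cdot>\<^bsub>DC D e_cat\<^esub> (inv_arr (DC D e_cat) to_W \<cdot>\<^bsub>DC D e_cat\<^esub> edge D T (1, 1) (1, 2)))"

text \<open>\<open>X \<rightarrow> Y \<rightarrow> Z \<rightarrow> \<Sigma>X\<close> is distinguished if it is isomorphic to a standard triangle.\<close>

definition distinguished ::
  "('u::infinite, 'o, 'a) prederiv \<Rightarrow> 'o \<Rightarrow> 'o \<Rightarrow> 'o \<Rightarrow> 'a \<Rightarrow> 'a \<Rightarrow> 'a \<Rightarrow> bool"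
  where "distinguished D X Y Z f g h \<longleftrightarrow>
    f \<in> hom (DC D e_cat) X Y \<and> g \<in> hom (DC D e_cat) Y Z \<and>
    h \<in> hom (DC D e_cat) Z (FO (suspension D) X) \<and>
    (\<exists>T x y z. standard_triangle D T \<and>
       x \<in> hom (DC D e_cat) X (vertex D T (0, 0)) \<and> is_iso (DC D e_cat) x \<and>
       y \<in> hom (DC D e_cat) Y (vertex D T (0, 1)) \<and> is_iso (DC D e_cat) y \<and>
       z \<in> hom (DC D e_cat) Z (vertex D T (1, 1)) \<and> is_iso (DC D e_cat) z \<and>
       y \<cdot>\<^bsub>DC D e_cat\<^esub> f = edge D T (0, 0) (0, 1) \<cdot>\<^bsub>DC D e_cat\<^esub> x \<and>
       z \<cdot>\<^bsub>DC D e_cat\<^esub> g = edge D T (0, 1) (1, 1) \<cdot>\<^bsub>DC D e_cat\<^esub> y \<and>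
       FA (suspension D) x \<cdot>\<^bsub>DC D e_cat\<^esub> h = connecting D T \<cdot>\<^bsub>DC D e_cat\<^esub> z)"

text \<open>\<open>M\<close> is a Milnor colimit of \<open>L 0 \<rightarrow> L 1 \<rightarrow> \<dots>\<close> with transition arrows \<open>f n\<close>.\<close>

definition is_Mcolim ::
  "('u::infinite, 'o, 'a) prederiv \<Rightarrow> (nat \<Rightarrow> 'o) \<Rightarrow> (nat \<Rightarrow> 'a) \<Rightarrow> 'o \<Rightarrow> bool"
  where "is_Mcolim D L f M \<longleftrightarrow>
    (\<exists>P inn \<sigma> g h. is_coproduct (DC D e_cat) UNIV L P inn \<and>
       \<sigma> \<in> hom (DC D e_cat) P P \<and>
       (\<forall>n. \<sigma> \<cdot>\<^bsub>DC D e_cat\<^esub> inn n = inn (Suc n) \<cdot>\<^bsub>DC D e_cat\<^esub> f n) \<and>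
       distinguished D P P M (minus_arr (DC D e_cat) (Ident (DC D e_cat) P) \<sigma>) g h)"

definition seq_obj :: "('u::infinite, 'u, 'o, 'a) ftor \<Rightarrow> nat \<Rightarrow> 'o"
  where "seq_obj X n = FO X (cnat n)"

definition seq_arr :: "('u::infinite, 'u, 'o, 'a) ftor \<Rightarrow> nat \<Rightarrow> 'a"
  where "seq_arr X n = FA X (cpair (cnat n) (cnat (Suc n)))"

end

theory Submission
 imports Defs
begin

text \<open>
 For a sequence \<open>L\<close>, left Kan extension along \<open>n : e \<rightarrow> \<nat>\<^sup>o\<^sup>p\<close> turns \<open>L n\<close> into the sequence that is \<open>0\<close> before \<open>n\<close>
 and constant afterwards. The coproducts of these, started at \<open>n + 1\<close> and at \<open>n\<close>, represent families of arrows out of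
 \<open>L\<close>, so that \<open>1 - shift\<close> is an arrow between them in \<open>D(\<nat>\<^sup>o\<^sup>p)\<close>. Lift it to \<open>D(\<nat>\<^sup>o\<^sup>p \<times> [1])\<close> and take its
 cofiber \<open>Z\<close>. At \<open>n\<close> the arrow is a split monomorphism with complement \<open>L n\<close>, so the diagram of \<open>Z\<close> is \<open>L\<close>;
 morphisms of sequences extend to these resolutions and hence to \<open>Z\<close>. If \<open>L\<close> is the diagram of an object \<open>X\<close> of
 \<open>D(\<nat>\<^sup>o\<^sup>p)\<close>, then \<open>Z\<close> is isomorphic to \<open>X\<close>. As left Kan extension preserves cofibers, the homotopy colimit of \<open>X\<close> is the
 cofiber of \<open>1 - \<sigma>\<close> on the coproduct of the \<open>L n\<close>.
\<close>

text \<open>The obstacle is that a sequence in D(e) carries no coherence data, while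
  \<open>der5\<close> lifts only single arrows and \<open>der1\<close> only families. A coproduct of
  Kan extensions along points asks for no coherence either: arrows out of it are families of arrows
  of D(e). An arrow between two such coproducts can therefore be prescribed, and being single it is
  within reach of \<open>der5\<close>. The offset by one is forced: the n-th relation identifies
  \<open>L n\<close> with its image in \<open>L (n + 1)\<close>, so it lives from degree
  \<open>n + 1\<close> on. Neither additivity nor the triangulation is among the axioms. Subtraction
  is extracted from the coincidence of cartesian and cocartesian squares, and for D(e) alone, since
  arrows out of free objects are tested on generators. Cones in a triangulated category are not
  functorial; cofibers are therefore handled in D(A \<times> [1]), where the extra adjoint in
  \<open>der6_open\<close> gives them a strict universal property. Evaluation at points and left Kan
  extension then respect them for formal reasons, and distinguished triangles enter only in the
  comparison with Milnor colimits.\<close>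

abbreviation cmp_in (\<open>(_ \<cdot>[_] _)\<close> [70, 0, 71] 70) where "g \<cdot>[C] f \<equiv> Comp C g f"

section \<open>Isomorphisms, zero arrows and coproducts in a fixed category\<close>

section \<open>Categories\<close>

context category
begin

lemma hom_objs: "f \<in> hom C x y \<Longrightarrow> x \<in> Obj C \<and> y \<in> Obj C"
 using dom_closed cod_closed by (auto simp: hom_def)

lemma comp_arr:
 assumes "f \<in> Arr C" "g \<in> Arr C" "Dom C g = Cod C f"
 shows "g \<cdot> f \<in> Arr C" "Dom C (g \<cdot> f) = Dom C f" "Cod C (g \<cdot> f) = Cod C g"
proof -
 have "g \<cdot> f \<in> hom C (Dom C f) (Cod C g)"
  using assms by (intro comp_hom[of f _ "Cod C f"]) (auto simp: hom_def)
 thus "g \<cdot> f \<in> Arr C" "Dom C (g \<cdot> f) = Dom C f" "Cod C (g \<cdot> f) = Cod C g"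
  by (auto simp: hom_def)
qed

lemma assoc_arr:
 assumes "f \<in> Arr C" "g \<in> Arr C" "h \<in> Arr C" "Dom C g = Cod C f" "Dom C h = Cod C g"
 shows "(h \<cdot> g) \<cdot> f = h \<cdot> (g \<cdot> f)"
 using assms by (intro comp_assoc[of f "Dom C f" "Cod C f" g "Cod C g" h "Cod C h"]) (auto simp: hom_def)

lemma ident_arr:
 assumes "x \<in> Obj C"
 shows "Ident C x \<in> Arr C" "Dom C (Ident C x) = x" "Cod C (Ident C x) = x"
 using ident_hom[OF assms] by (auto simp: hom_def)

lemma ident_comp_arr:
 assumes "f \<in> Arr C"
 shows "Cod C f = x \<Longrightarrow> Ident C x \<cdot> f = f" "Dom C f = x \<Longrightarrow> f \<cdot> Ident C x = f"
 using assms ident_left[of f] ident_right[of f] by (auto simp: hom_def)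

lemmas arr_simps = comp_arr assoc_arr ident_arr ident_comp_arr dom_closed cod_closed

lemma isoI:
 assumes "f \<in> hom C x y" "g \<in> hom C y x" "g \<cdot> f = Ident C x" "f \<cdot> g = Ident C y"
 shows "is_iso C f"
 using assms unfolding is_iso_def inverse_arrows_def by (auto simp: hom_def)

lemma isoE:
 assumes "is_iso C f" "f \<in> hom C x y"
 obtains g where "g \<in> hom C y x" "g \<cdot> f = Ident C x" "f \<cdot> g = Ident C y" "is_iso C g"
proof -
 obtain g where "inverse_arrows C f g" using assms(1) by (auto simp: is_iso_def)
 hence "g \<in> hom C y x" "g \<cdot> f = Ident C x" "f \<cdot> g = Ident C y"
  using assms(2) by (auto simp: inverse_arrows_def hom_def)
 thus thesis using isoI[of g y x f] assms(2) by (intro that) auto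
qed

text \<open>Two-sided inverses are unique, so the definite description in \<open>inv_arr\<close>
  denotes one. This matters because \<open>connecting\<close> is defined with
  \<open>inv_arr\<close>.\<close>

lemma inv_arr_hom:
 assumes "is_iso C f" "f \<in> hom C x y"
 shows "inv_arr C f \<in> hom C y x"
proof -
 obtain g where g: "g \<in> hom C y x" "g \<cdot> f = Ident C x" "f \<cdot> g = Ident C y"
  using isoE[OF assms] .
 have "inverse_arrows C f g" using g assms(2) by (auto simp: inverse_arrows_def hom_def)
 moreover have "h = g" if "inverse_arrows C f h" for h
 proof -
  have h: "h \<in> hom C y x" "h \<cdot> f = Ident C x" "f \<cdot> h = Ident C y"
   using that assms(2) by (auto simp: inverse_arrows_def hom_def)
  have "h = h \<cdot> (f \<cdot> g)" using h g by (simp add: ident_right)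
  also have "\<dots> = (h \<cdot> f) \<cdot> g" using comp_assoc[of g y x f y h x] g h assms(2) by simp
  also have "\<dots> = g" using h g by (simp add: ident_left)
  finally show ?thesis .
 qed
 ultimately have "inv_arr C f = g" unfolding inv_arr_def by (rule the_equality)
 thus ?thesis using g by simp
qed

lemma iso_ident: "x \<in> Obj C \<Longrightarrow> is_iso C (Ident C x)"
 by (rule isoI[of _ x x "Ident C x"]) (auto simp: ident_hom ident_left[OF ident_hom])

lemma iso_comp:
 assumes "f \<in> hom C x y" "g \<in> hom C y z" "is_iso C f" "is_iso C g"
 shows "is_iso C (g \<cdot> f)"
proof -
 obtain f' where f': "f' \<in> hom C y x" "f' \<cdot> f = Ident C x" "f \<cdot> f' = Ident C y"
  using isoE[OF assms(3,1)] .
 obtain g' where g': "g' \<in> hom C z y" "g' \<cdot> g = Ident C y" "g \<cdot> g' = Ident C z"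
  using isoE[OF assms(4,2)] .
 have "(f' \<cdot> g') \<cdot> (g \<cdot> f) = f' \<cdot> ((g' \<cdot> g) \<cdot> f)"
  using assms(1,2) f'(1) g'(1) by (simp add: hom_def arr_simps)
 moreover have "(g \<cdot> f) \<cdot> (f' \<cdot> g') = g \<cdot> ((f \<cdot> f') \<cdot> g')"
  using assms(1,2) f'(1) g'(1) by (simp add: hom_def arr_simps)
 ultimately show ?thesis
  using assms(1,2) f' g'
  by (intro isoI[of _ x z "f' \<cdot> g'"]) (auto simp: ident_left intro: comp_hom)
qed

lemma iso_cancel_left:
 assumes "f \<in> hom C x y" "g \<in> hom C y z" "is_iso C (g \<cdot> f)" "is_iso C g"
 shows "is_iso C f"
proof -
 obtain g' where g': "g' \<in> hom C z y" "g' \<cdot> g = Ident C y" "g \<cdot> g' = Ident C z" "is_iso C g'"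
  using isoE[OF assms(4,2)] .
 have "g' \<cdot> (g \<cdot> f) = f"
  using comp_assoc[OF assms(1,2) g'(1)] g' assms(1) by (simp add: ident_left)
 thus ?thesis
  using iso_comp[OF comp_hom[OF assms(1,2)] g'(1) assms(3) g'(4)] by simp
qed

lemma iso_cancel_right:
 assumes "f \<in> hom C x y" "g \<in> hom C y z" "is_iso C (g \<cdot> f)" "is_iso C f"
 shows "is_iso C g"
proof -
 obtain f' where f': "f' \<in> hom C y x" "f' \<cdot> f = Ident C x" "f \<cdot> f' = Ident C y" "is_iso C f'"
  using isoE[OF assms(4,1)] .
 have "(g \<cdot> f) \<cdot> f' = g"
  using comp_assoc[OF f'(1) assms(1,2)] f' assms(2) by (simp add: ident_right)
 thus ?thesis
  using iso_comp[OF f'(1) comp_hom[OF assms(1,2)] f'(4) assms(3)] by simp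
qed

lemma iso_cancel_mono:
 assumes "is_iso C h" "h \<in> hom C y z" "f \<in> hom C x y" "g \<in> hom C x y" "h \<cdot> f = h \<cdot> g"
 shows "f = g"
proof -
 obtain k where k: "k \<in> hom C z y" "k \<cdot> h = Ident C y" using isoE[OF assms(1,2)] .
 have "f = k \<cdot> (h \<cdot> f)" "g = k \<cdot> (h \<cdot> g)"
  using comp_assoc[OF assms(3,2) k(1)] comp_assoc[OF assms(4,2) k(1)] k assms(3,4)
  by (simp_all add: ident_left)
 thus ?thesis using assms(5) by simp
qed

lemma iso_cancel_epi:
 assumes "is_iso C h" "h \<in> hom C x y" "f \<in> hom C y z" "g \<in> hom C y z" "f \<cdot> h = g \<cdot> h"
 shows "f = g"
proof -
 obtain k where k: "k \<in> hom C y x" "h \<cdot> k = Ident C y" using isoE[OF assms(1,2)] .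
 have "f = (f \<cdot> h) \<cdot> k" "g = (g \<cdot> h) \<cdot> k"
  using comp_assoc[OF k(1) assms(2,3)] comp_assoc[OF k(1) assms(2,4)] k assms(3,4)
  by (simp_all add: ident_right)
 thus ?thesis using assms(5) by simp
qed

lemma isomorphicI: "f \<in> hom C x y \<Longrightarrow> is_iso C f \<Longrightarrow> isomorphic C x y"
 by (auto simp: isomorphic_def)

lemma isomorphic_sym: "isomorphic C x y \<Longrightarrow> isomorphic C y x"
 by (metis isoE isomorphic_def)

lemma isomorphic_trans: "isomorphic C x y \<Longrightarrow> isomorphic C y z \<Longrightarrow> isomorphic C x z"
 by (metis iso_comp comp_hom isomorphic_def)

subsection \<open>Zero objects\<close>

lemma zeroD:
 assumes "is_zero C z"
 shows "z \<in> Obj C" "\<And>x. x \<in> Obj C \<Longrightarrow> \<exists>!f. f \<in> hom C z x" "\<And>x. x \<in> Obj C \<Longrightarrow> \<exists>!f. f \<in> hom C x z"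
 using assms by (auto simp: is_zero_def is_initial_def is_terminal_def)

lemma from_zero_eq: "is_zero C z \<Longrightarrow> f \<in> hom C z x \<Longrightarrow> g \<in> hom C z x \<Longrightarrow> f = g"
 using zeroD(2) hom_objs by metis

lemma to_zero_eq: "is_zero C z \<Longrightarrow> f \<in> hom C x z \<Longrightarrow> g \<in> hom C x z \<Longrightarrow> f = g"
 using zeroD(3) hom_objs by metis

lemma iso_zero:
 assumes "is_zero C z" "is_zero C w" "f \<in> hom C z w"
 shows "is_iso C f"
proof -
 obtain g where g: "g \<in> hom C w z" using zeroD(2)[OF assms(2) zeroD(1)[OF assms(1)]] by blast
 show ?thesis
  using from_zero_eq[OF assms(1) comp_hom[OF assms(3) g]] from_zero_eq[OF assms(2) comp_hom[OF g assms(3)]]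
   zeroD(1) assms ident_hom
  by (intro isoI[OF assms(3) g]) blast+
qed

lemma zero_if_iso:
 assumes "is_zero C z" "f \<in> hom C z w" "is_iso C f"
 shows "is_zero C w"
proof -
 obtain g where g: "g \<in> hom C w z" "g \<cdot> f = Ident C z" "f \<cdot> g = Ident C w"
  using isoE[OF assms(3,2)] .
 have 1: "\<exists>!h. h \<in> hom C w x" if x: "x \<in> Obj C" for x
 proof -
  obtain h where h: "h \<in> hom C z x" using zeroD(2)[OF assms(1) x] by auto
  have "k = h \<cdot> g" if k: "k \<in> hom C w x" for k
  proof -
   have "k \<cdot> f = h" using from_zero_eq[OF assms(1) comp_hom[OF assms(2) k] h] .
   hence "h \<cdot> g = k \<cdot> (f \<cdot> g)" using comp_assoc[OF g(1) assms(2) k] by simp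
   thus ?thesis using g k ident_right by simp
  qed
  thus ?thesis using comp_hom[OF g(1) h] by blast
 qed
 have 2: "\<exists>!h. h \<in> hom C x w" if x: "x \<in> Obj C" for x
 proof -
  obtain h where h: "h \<in> hom C x z" using zeroD(3)[OF assms(1) x] by auto
  have "k = f \<cdot> h" if k: "k \<in> hom C x w" for k
  proof -
   have "g \<cdot> k = h" using to_zero_eq[OF assms(1) comp_hom[OF k g(1)] h] .
   hence "f \<cdot> h = (f \<cdot> g) \<cdot> k" using comp_assoc[OF k g(1) assms(2)] by simp
   thus ?thesis using g k ident_left by simp
  qed
  thus ?thesis using comp_hom[OF h assms(2)] by blast
 qed
 show ?thesis
  using 1 2 hom_objs[OF assms(2)] by (auto simp: is_zero_def is_initial_def is_terminal_def)
qed

text \<open>There are arrows to and from a zero object; one composite is forced by the zero object,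
  the other by the hypothesis on endomorphisms, so they are mutually inverse. This upgrades initial
  and terminal objects to zero objects once some zero object is known.\<close>

lemma zero_if_ident_unique:
 assumes "is_zero C z" "w \<in> Obj C" "\<And>f g. f \<in> hom C w w \<Longrightarrow> g \<in> hom C w w \<Longrightarrow> f = g"
 shows "is_zero C w"
proof -
 obtain f g where f: "f \<in> hom C z w" and g: "g \<in> hom C w z"
  using zeroD(2)[OF assms(1,2)] zeroD(3)[OF assms(1,2)] by blast
 have "g \<cdot> f = Ident C z" "f \<cdot> g = Ident C w"
  using from_zero_eq[OF assms(1) comp_hom[OF f g]] assms(3)[OF comp_hom[OF g f]]
   zeroD(1)[OF assms(1)] assms(2) ident_hom by blast+
 thus ?thesis using isoI[OF f g] zero_if_iso[OF assms(1) f] by blast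
qed

lemma zero_arrowI:
 assumes "is_zero C z" "k \<in> hom C x z" "l \<in> hom C z y"
 shows "is_zero_arrow C (l \<cdot> k)"
 unfolding is_zero_arrow_def
 using assms comp_hom[OF assms(2,3)] by (intro exI[of _ z] exI[of _ k] exI[of _ l]) (auto simp: hom_def)

lemma zero_arrow_ex:
 assumes "is_zero C z" "x \<in> Obj C" "y \<in> Obj C"
 obtains f where "f \<in> hom C x y" "is_zero_arrow C f"
proof -
 obtain k l where "k \<in> hom C x z" "l \<in> hom C z y"
  using zeroD(3)[OF assms(1,2)] zeroD(2)[OF assms(1,3)] by blast
 thus thesis using that[of "l \<cdot> k"] zero_arrowI[OF assms(1)] comp_hom by blast
qed

lemma zero_arrowE:
 assumes "is_zero_arrow C f" "f \<in> hom C x y" "is_zero C w"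
 obtains k l where "k \<in> hom C x w" "l \<in> hom C w y" "f = l \<cdot> k"
proof -
 obtain z k l where z: "is_zero C z" "k \<in> hom C x z" "l \<in> hom C z y" "f = l \<cdot> k"
  using assms(1,2) by (auto simp: is_zero_arrow_def hom_def)
 obtain a b where a: "a \<in> hom C z w" and b: "b \<in> hom C w z"
  using zeroD(2)[OF z(1) zeroD(1)[OF assms(3)]] zeroD(3)[OF z(1) zeroD(1)[OF assms(3)]] by blast
 have "b \<cdot> (a \<cdot> k) = k"
  by (rule to_zero_eq[OF z(1)]) (use a b z comp_hom in blast)+
 hence "f = (l \<cdot> b) \<cdot> (a \<cdot> k)"
  using z a b by (simp add: hom_def arr_simps)
 thus thesis using that[of "a \<cdot> k" "l \<cdot> b"] z a b comp_hom by blast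
qed

text \<open>Factorizations can be moved to any chosen zero object, and through a common zero object
  both factors are unique.\<close>

lemma zero_arrow_unique:
 assumes "is_zero_arrow C f" "is_zero_arrow C g" "f \<in> hom C x y" "g \<in> hom C x y"
 shows "f = g"
proof -
 obtain w where w: "is_zero C w" using assms(1) by (auto simp: is_zero_arrow_def)
 obtain k l where kl: "k \<in> hom C x w" "l \<in> hom C w y" "f = l \<cdot> k"
  using zero_arrowE[OF assms(1,3) w] .
 obtain k' l' where kl': "k' \<in> hom C x w" "l' \<in> hom C w y" "g = l' \<cdot> k'"
  using zero_arrowE[OF assms(2,4) w] .
 show ?thesis using kl kl' to_zero_eq[OF w kl(1) kl'(1)] from_zero_eq[OF w kl(2) kl'(2)] by simp
qed

lemma zero_arrow_comp:
 assumes "f \<in> hom C x y" "g \<in> hom C y z" "is_zero_arrow C f \<or> is_zero_arrow C g"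
 shows "is_zero_arrow C (g \<cdot> f)"
proof -
 obtain w where w: "is_zero C w" using assms(3) by (auto simp: is_zero_arrow_def)
 show ?thesis
 proof (cases "is_zero_arrow C f")
  case True
  then obtain k l where kl: "k \<in> hom C x w" "l \<in> hom C w y" "f = l \<cdot> k"
   using zero_arrowE[OF _ assms(1) w] by blast
  have "g \<cdot> f = (g \<cdot> l) \<cdot> k" using comp_assoc[OF kl(1,2) assms(2)] kl(3) by simp
  thus ?thesis using zero_arrowI[OF w kl(1) comp_hom[OF kl(2) assms(2)]] by simp
 next
  case False
  then obtain k l where kl: "k \<in> hom C y w" "l \<in> hom C w z" "g = l \<cdot> k"
   using zero_arrowE[OF _ assms(2) w] assms(3) by blast
  have "g \<cdot> f = l \<cdot> (k \<cdot> f)" using comp_assoc[OF assms(1) kl(1,2)] kl(3) by simp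
  thus ?thesis using zero_arrowI[OF w comp_hom[OF assms(1) kl(1)] kl(2)] by simp
 qed
qed

lemma zero_arrow_via_zero:
 assumes "f \<in> hom C x y" "is_zero C x \<or> is_zero C y"
 shows "is_zero_arrow C f"
proof -
 have "x \<in> Obj C" "y \<in> Obj C" using hom_objs[OF assms(1)] by auto
 hence "is_zero_arrow C (f \<cdot> Ident C x) \<or> is_zero_arrow C (Ident C y \<cdot> f)"
  using assms zero_arrowI[of x "Ident C x" x f y] zero_arrowI[of y f x "Ident C y" y] ident_hom by blast
 thus ?thesis using assms(1) by (simp add: ident_left ident_right)
qed

subsection \<open>Coproducts\<close>

lemma coproductD:
 assumes "is_coproduct C I L P inn"
 shows "P \<in> Obj C" "\<And>i. i \<in> I \<Longrightarrow> inn i \<in> hom C (L i) P"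
 using assms by (auto simp: is_coproduct_def)

lemma coproduct_desc:
 assumes "is_coproduct C I L P inn" "Q \<in> Obj C" "\<And>i. i \<in> I \<Longrightarrow> t i \<in> hom C (L i) Q"
 obtains k where "k \<in> hom C P Q" "\<And>i. i \<in> I \<Longrightarrow> k \<cdot> inn i = t i"
 using assms unfolding is_coproduct_def by blast

lemma coproduct_ex1:
 assumes "is_coproduct C I L P inn" "Q \<in> Obj C" "\<forall>i\<in>I. t i \<in> hom C (L i) Q"
 shows "\<exists>!k. k \<in> hom C P Q \<and> (\<forall>i\<in>I. k \<cdot> inn i = t i)"
proof -
 have "\<forall>Q\<in>Obj C. \<forall>t. (\<forall>i\<in>I. t i \<in> hom C (L i) Q) \<longrightarrow>
   (\<exists>!k. k \<in> hom C P Q \<and> (\<forall>i\<in>I. k \<cdot> inn i = t i))"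
  using assms(1) unfolding is_coproduct_def by (elim conjE)
 from this[THEN bspec, OF assms(2), THEN spec, THEN mp, OF assms(3)] show ?thesis .
qed

lemma coproduct_eqI:
 assumes "is_coproduct C I L P inn" "k \<in> hom C P Q" "l \<in> hom C P Q"
  "\<And>i. i \<in> I \<Longrightarrow> k \<cdot> inn i = l \<cdot> inn i"
 shows "k = l"
proof -
 have "Q \<in> Obj C" using hom_objs[OF assms(2)] by simp
 moreover have "\<forall>i\<in>I. k \<cdot> inn i \<in> hom C (L i) Q"
  using coproductD(2)[OF assms(1)] assms(2) comp_hom by blast
 ultimately have "\<exists>!m. m \<in> hom C P Q \<and> (\<forall>i\<in>I. m \<cdot> inn i = k \<cdot> inn i)"
  using coproduct_ex1[OF assms(1), of Q "\<lambda>i. k \<cdot> inn i"] by simp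
 moreover have "\<forall>i\<in>I. l \<cdot> inn i = k \<cdot> inn i" using assms(4) by simp
 ultimately show ?thesis using assms(2,3) by (elim ex1E) metis
qed

lemma coproductI:
 assumes "P \<in> Obj C" "\<And>i. i \<in> I \<Longrightarrow> inn i \<in> hom C (L i) P"
  "\<And>Q t. Q \<in> Obj C \<Longrightarrow> (\<And>i. i \<in> I \<Longrightarrow> t i \<in> hom C (L i) Q) \<Longrightarrow>
    \<exists>k. k \<in> hom C P Q \<and> (\<forall>i\<in>I. k \<cdot> inn i = t i)"
  "\<And>Q k l. k \<in> hom C P Q \<Longrightarrow> l \<in> hom C P Q \<Longrightarrow> (\<And>i. i \<in> I \<Longrightarrow> k \<cdot> inn i = l \<cdot> inn i) \<Longrightarrow> k = l"
 shows "is_coproduct C I L P inn"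
 unfolding is_coproduct_def
proof (intro conjI ballI allI impI)
 fix Q t assume "Q \<in> Obj C" "\<forall>i\<in>I. t i \<in> hom C (L i) Q"
 then obtain k where k: "k \<in> hom C P Q" "\<forall>i\<in>I. k \<cdot> inn i = t i" using assms(3)[of Q t] by blast
 show "\<exists>!k. k \<in> hom C P Q \<and> (\<forall>i\<in>I. k \<cdot> inn i = t i)"
 proof (rule ex1I[of _ k])
  fix l assume l: "l \<in> hom C P Q \<and> (\<forall>i\<in>I. l \<cdot> inn i = t i)"
  show "l = k" using assms(4)[of l Q k] l k by metis
 qed (use k in blast)
qed (use assms in auto)

lemma coproduct_precomp:
 assumes c: "is_coproduct C I L P inn" and e: "\<And>i. i \<in> I \<Longrightarrow> e i \<in> hom C (L' i) (L i)" "\<And>i. i \<in> I \<Longrightarrow> is_iso C (e i)"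
 shows "is_coproduct C I L' P (\<lambda>i. inn i \<cdot> e i)"
proof (rule coproductI)
 note inn = coproductD(2)[OF c]
 have "\<exists>e'. e' \<in> hom C (L i) (L' i) \<and> e' \<cdot> e i = Ident C (L' i)" if "i \<in> I" for i
  using isoE[OF e(2)[OF that] e(1)[OF that]] by metis
 then obtain e' where e': "\<And>i. i \<in> I \<Longrightarrow> e' i \<in> hom C (L i) (L' i)"
  "\<And>i. i \<in> I \<Longrightarrow> e' i \<cdot> e i = Ident C (L' i)" by metis
 show "P \<in> Obj C" "\<And>i. i \<in> I \<Longrightarrow> inn i \<cdot> e i \<in> hom C (L' i) P"
  using coproductD(1)[OF c] comp_hom[OF e(1) inn] by auto
 show "\<exists>k. k \<in> hom C P Q \<and> (\<forall>i\<in>I. k \<cdot> (inn i \<cdot> e i) = t i)"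
  if Q: "Q \<in> Obj C" and t: "\<And>i. i \<in> I \<Longrightarrow> t i \<in> hom C (L' i) Q" for Q t
 proof -
  obtain k where k: "k \<in> hom C P Q" "\<And>i. i \<in> I \<Longrightarrow> k \<cdot> inn i = t i \<cdot> e' i"
   using coproduct_desc[OF c Q, of "\<lambda>i. t i \<cdot> e' i"] comp_hom[OF e'(1) t] by metis
  hence "k \<cdot> (inn i \<cdot> e i) = t i" if "i \<in> I" for i
   using comp_assoc[OF e(1) inn k(1)] comp_assoc[OF e(1) e'(1) t] e'(2) ident_right[OF t] that by metis
  thus ?thesis using k(1) by blast
 qed
 show "k = l" if k: "k \<in> hom C P Q" and l: "l \<in> hom C P Q"
  and eq: "\<And>i. i \<in> I \<Longrightarrow> k \<cdot> (inn i \<cdot> e i) = l \<cdot> (inn i \<cdot> e i)" for Q k l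
 proof (rule coproduct_eqI[OF c k l])
  show "k \<cdot> inn i = l \<cdot> inn i" if i: "i \<in> I" for i
   using iso_cancel_epi[OF e(2)[OF i] e(1)[OF i] comp_hom[OF inn[OF i] k] comp_hom[OF inn[OF i] l]]
    eq[OF i] comp_assoc[OF e(1)[OF i] inn[OF i]] k l by simp
 qed
qed

lemma coproduct_postcomp:
 assumes c: "is_coproduct C I L P inn" and h: "h \<in> hom C P P'" "is_iso C h"
 shows "is_coproduct C I L P' (\<lambda>i. h \<cdot> inn i)"
proof (rule coproductI)
 note inn = coproductD(2)[OF c]
 obtain h' where h': "h' \<in> hom C P' P" "h' \<cdot> h = Ident C P" using isoE[OF h(2,1)] .
 show "P' \<in> Obj C" "\<And>i. i \<in> I \<Longrightarrow> h \<cdot> inn i \<in> hom C (L i) P'"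
  using hom_objs[OF h(1)] comp_hom[OF inn h(1)] by auto
 have as: "k \<cdot> (h \<cdot> inn i) = (k \<cdot> h) \<cdot> inn i" if "k \<in> hom C P' Q" "i \<in> I" for k i Q
  using comp_assoc[OF inn[OF that(2)] h(1) that(1)] by simp
 show "\<exists>k. k \<in> hom C P' Q \<and> (\<forall>i\<in>I. k \<cdot> (h \<cdot> inn i) = t i)"
  if Q: "Q \<in> Obj C" and t: "\<And>i. i \<in> I \<Longrightarrow> t i \<in> hom C (L i) Q" for Q t
 proof -
  obtain k where k: "k \<in> hom C P Q" "\<And>i. i \<in> I \<Longrightarrow> k \<cdot> inn i = t i"
   using coproduct_desc[OF c Q, of t] t by blast
  have "(k \<cdot> h') \<cdot> h = k" using comp_assoc[OF h(1) h'(1) k(1)] h'(2) ident_right[OF k(1)] by simp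
  thus ?thesis using as[OF comp_hom[OF h'(1) k(1)]] comp_hom[OF h'(1) k(1)] k(2) by metis
 qed
 show "k = l" if k: "k \<in> hom C P' Q" and l: "l \<in> hom C P' Q"
  and "\<And>i. i \<in> I \<Longrightarrow> k \<cdot> (h \<cdot> inn i) = l \<cdot> (h \<cdot> inn i)" for Q k l
  using iso_cancel_epi[OF h(2,1) k l] coproduct_eqI[OF c comp_hom[OF h(1) k] comp_hom[OF h(1) l]] that as by metis
qed

lemma coproduct_iso:
 assumes "is_coproduct C I L P inn" "is_coproduct C I L P' inn'" "h \<in> hom C P P'"
  "\<And>i. i \<in> I \<Longrightarrow> h \<cdot> inn i = inn' i"
 shows "is_iso C h"
proof -
 note inn = coproductD[OF assms(1)] and inn' = coproductD[OF assms(2)]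
 obtain k where k: "k \<in> hom C P' P" "\<And>i. i \<in> I \<Longrightarrow> k \<cdot> inn' i = inn i"
  using coproduct_desc[OF assms(2), of P inn] inn by metis
 have "k \<cdot> h = Ident C P"
 proof (rule coproduct_eqI[OF assms(1)])
  show "(k \<cdot> h) \<cdot> inn i = Ident C P \<cdot> inn i" if "i \<in> I" for i
   using k assms(4)[OF that] inn(2)[OF that] comp_assoc[OF inn(2)[OF that] assms(3) k(1)] that
   by (simp add: ident_left)
 qed (use k assms(3) inn ident_hom comp_hom in blast)+
 moreover have "h \<cdot> k = Ident C P'"
 proof (rule coproduct_eqI[OF assms(2)])
  show "(h \<cdot> k) \<cdot> inn' i = Ident C P' \<cdot> inn' i" if "i \<in> I" for i
   using k assms(4)[OF that] inn'(2)[OF that] comp_assoc[OF inn'(2)[OF that] k(1) assms(3)] that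
   by (simp add: ident_left)
 qed (use k assms(3) inn' ident_hom comp_hom in blast)+
 ultimately show ?thesis using isoI[OF assms(3) k(1)] by blast
qed

text \<open>A zero object has exactly one arrow to every object, so a zero summand imposes nothing
  on a cocone. Coproducts of Kan extensions, many of which vanish at a given point, are reduced in
  this way to the summands that remain.\<close>

lemma coproduct_drop_zeros:
 assumes "is_coproduct C I L P inn" "J \<subseteq> I" "\<And>i. i \<in> I \<Longrightarrow> i \<notin> J \<Longrightarrow> is_zero C (L i)"
 shows "is_coproduct C J L P inn"
proof (rule coproductI)
 note inn = coproductD[OF assms(1)]
 show "P \<in> Obj C" by (rule inn)
 show "inn i \<in> hom C (L i) P" if "i \<in> J" for i using inn assms(2) that by auto
 fix Q
 show "\<exists>k. k \<in> hom C P Q \<and> (\<forall>i\<in>J. k \<cdot> inn i = t i)"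
  if Q: "Q \<in> Obj C" and t: "\<And>i. i \<in> J \<Longrightarrow> t i \<in> hom C (L i) Q" for t
 proof -
  \<comment> \<open>Outside \<open>J\<close> the component is the only arrow out of a zero object,
    so the arbitrary choice is harmless.\<close>
  define s where "s i = (if i \<in> J then t i else (SOME f. f \<in> hom C (L i) Q))" for i
  have "s i \<in> hom C (L i) Q" if "i \<in> I" for i
  proof (cases "i \<in> J")
   case False
   hence "\<exists>f. f \<in> hom C (L i) Q" using zeroD(2)[OF assms(3)[OF that] Q] by blast
   thus ?thesis using False by (auto simp: s_def intro: someI_ex)
  qed (simp add: s_def t)
  then obtain k where "k \<in> hom C P Q" "\<And>i. i \<in> I \<Longrightarrow> k \<cdot> inn i = s i"
   using coproduct_desc[OF assms(1) Q, of s] by metis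
  thus ?thesis using assms(2) by (intro exI[of _ k]) (auto simp: s_def)
 qed
 show "k = l" if k: "k \<in> hom C P Q" "l \<in> hom C P Q" and eq: "\<And>i. i \<in> J \<Longrightarrow> k \<cdot> inn i = l \<cdot> inn i" for k l
 proof (rule coproduct_eqI[OF assms(1) k])
  fix i assume i: "i \<in> I"
  show "k \<cdot> inn i = l \<cdot> inn i"
   using eq from_zero_eq[OF assms(3)[OF i]] comp_hom[OF inn(2)[OF i] k(1)] comp_hom[OF inn(2)[OF i] k(2)]
   by (cases "i \<in> J") auto
 qed
qed

lemma coproduct_single:
 assumes "is_coproduct C {i} L P inn"
 shows "is_iso C (inn i)"
proof -
 note inn = coproductD[OF assms]
 have i: "inn i \<in> hom C (L i) P" using inn(2) by simp
 have "is_coproduct C {i} L (L i) (\<lambda>_. Ident C (L i))"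
  by (rule coproductI) (use hom_objs[OF i] ident_hom ident_right in auto)
 from coproduct_iso[OF this assms i] show ?thesis using ident_right[OF i] by simp
qed

lemma coproduct_zeros:
 assumes "is_coproduct C I L P inn" "\<And>i. i \<in> I \<Longrightarrow> is_zero C (L i)"
 shows "is_initial C P"
proof -
 have "is_coproduct C {} L P inn" by (rule coproduct_drop_zeros[OF assms(1)]) (use assms(2) in auto)
 thus ?thesis by (auto simp: is_coproduct_def is_initial_def)
qed

text \<open>The index sets in \<open>der1\<close> lie in the type in which small categories live;
  families over \<open>nat\<close> and \<open>bool\<close> are carried there by an injection and
  brought back by this lemma.\<close>

lemma coproduct_reindex:
 assumes "is_coproduct C I L P inn" "bij_betw c J I"
 shows "is_coproduct C J (\<lambda>j. L (c j)) P (\<lambda>j. inn (c j))"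
proof (rule coproductI)
 note inn = coproductD[OF assms(1)]
 have c: "c j \<in> I" if "j \<in> J" for j using assms(2) that by (auto simp: bij_betw_def)
 have cJ: "\<exists>j\<in>J. c j = i" if "i \<in> I" for i using assms(2) that by (auto simp: bij_betw_def)
 show "P \<in> Obj C" by (rule inn)
 show "inn (c j) \<in> hom C (L (c j)) P" if "j \<in> J" for j using inn c that by blast
 fix Q
 show "\<exists>k. k \<in> hom C P Q \<and> (\<forall>j\<in>J. k \<cdot> inn (c j) = t j)"
  if Q: "Q \<in> Obj C" and t: "\<And>j. j \<in> J \<Longrightarrow> t j \<in> hom C (L (c j)) Q" for t
 proof -
  have inv: "the_inv_into J c (c j) = j" if "j \<in> J" for j
   using assms(2) that by (auto simp: bij_betw_def the_inv_into_f_f)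
  have "t (the_inv_into J c i) \<in> hom C (L i) Q" if "i \<in> I" for i
   using cJ[OF that] inv t by force
  then obtain k where "k \<in> hom C P Q" "\<And>i. i \<in> I \<Longrightarrow> k \<cdot> inn i = t (the_inv_into J c i)"
   using coproduct_desc[OF assms(1) Q, of "\<lambda>i. t (the_inv_into J c i)"] by metis
  thus ?thesis using c inv by (intro exI[of _ k]) auto
 qed
 show "k = l" if k: "k \<in> hom C P Q" "l \<in> hom C P Q"
  and eq: "\<And>j. j \<in> J \<Longrightarrow> k \<cdot> inn (c j) = l \<cdot> inn (c j)" for k l
  using coproduct_eqI[OF assms(1) k] eq cJ by metis
qed

end

lemma hom_op_cat: "hom (op_cat C) x y = hom C y x"
 by (auto simp: hom_def op_cat_def)

lemma op_cat_simps: "Obj (op_cat C) = Obj C" "Arr (op_cat C) = Arr C" "Ident (op_cat C) = Ident C"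
 "g \<cdot>[op_cat C] f = f \<cdot>[C] g" "Dom (op_cat C) = Cod C" "Cod (op_cat C) = Dom C"
 by (simp_all add: op_cat_def)

lemma is_iso_op_cat: "is_iso (op_cat C) f \<longleftrightarrow> is_iso C f"
 by (auto simp: is_iso_def inverse_arrows_def op_cat_simps hom_def)

lemma category_op_cat: "category C \<Longrightarrow> category (op_cat C)"
proof -
 assume "category C"
 then interpret category C .
 show "category (op_cat C)"
  by unfold_locales
   (use dom_closed cod_closed ident_hom comp_hom comp_assoc ident_left ident_right dom_ext cod_ext
    ident_ext comp_ext in \<open>auto simp: hom_op_cat op_cat_simps\<close>)
qed

section \<open>Universal arrows as a pointwise form of adjunctions\<close>

section \<open>Functors and universal arrows\<close>

lemma ftorD:
 assumes "is_ftor F"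
 shows "category (Src F)" "category (Tgt F)" "x \<in> Obj (Src F) \<Longrightarrow> FO F x \<in> Obj (Tgt F)"
  "f \<in> hom (Src F) x y \<Longrightarrow> FA F f \<in> hom (Tgt F) (FO F x) (FO F y)"
  "x \<in> Obj (Src F) \<Longrightarrow> FA F (Ident (Src F) x) = Ident (Tgt F) (FO F x)"
  "f \<in> hom (Src F) x y \<Longrightarrow> g \<in> hom (Src F) y z \<Longrightarrow> FA F (g \<cdot>[Src F] f) = FA F g \<cdot>[Tgt F] FA F f"
 using assms unfolding is_ftor_def by (auto simp: hom_def)

lemma ftor_iso:
 assumes "is_ftor F" "f \<in> hom (Src F) x y" "is_iso (Src F) f"
 shows "is_iso (Tgt F) (FA F f)"
proof -
 interpret S: category "Src F" using ftorD(1)[OF assms(1)] .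
 interpret T: category "Tgt F" using ftorD(2)[OF assms(1)] .
 obtain g where g: "g \<in> hom (Src F) y x" "g \<cdot>[Src F] f = Ident (Src F) x" "f \<cdot>[Src F] g = Ident (Src F) y"
  using S.isoE[OF assms(3,2)] .
 show ?thesis
  using ftorD(4,6)[OF assms(1)] g assms(2) S.hom_objs[OF g(1)]
   ftorD(5)[OF assms(1)] by (intro T.isoI[of _ "FO F x" "FO F y" "FA F g"]) metis+
qed

lemma ftor_extensional:
 assumes "is_ftor F"
 shows "FO F \<in> extensional (Obj (Src F))" "FA F \<in> extensional (Arr (Src F))"
 using assms unfolding is_ftor_def by (auto simp: PiE_def)

lemma ftor_eqI:
 assumes "is_ftor F" "is_ftor G" "Src F = Src G" "Tgt F = Tgt G"
  "\<And>x. x \<in> Obj (Src F) \<Longrightarrow> FO F x = FO G x" "\<And>f. f \<in> Arr (Src F) \<Longrightarrow> FA F f = FA G f"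
 shows "F = G"
proof -
 have "FO F = FO G" using ftor_extensional[OF assms(1)] ftor_extensional[OF assms(2)] assms(3,5)
  by (intro extensionalityI[of _ "Obj (Src F)"]) auto
 moreover have "FA F = FA G" using ftor_extensional[OF assms(1)] ftor_extensional[OF assms(2)] assms(3,6)
  by (intro extensionalityI[of _ "Arr (Src F)"]) auto
 ultimately show ?thesis using assms(3,4) by (cases F, cases G) simp
qed

lemma mk_ftor_simps [simp]:
 "Src (mk_ftor A B u v) = A" "Tgt (mk_ftor A B u v) = B"
 "x \<in> Obj A \<Longrightarrow> FO (mk_ftor A B u v) x = u x" "f \<in> Arr A \<Longrightarrow> FA (mk_ftor A B u v) f = v f"
 by (simp_all add: mk_ftor_def)

lemma mk_ftorI:
 assumes "category A" "category B" "\<And>x. x \<in> Obj A \<Longrightarrow> u x \<in> Obj B"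
  "\<And>f x y. f \<in> hom A x y \<Longrightarrow> v f \<in> hom B (u x) (u y)"
  "\<And>x. x \<in> Obj A \<Longrightarrow> v (Ident A x) = Ident B (u x)"
  "\<And>f g x y z. f \<in> hom A x y \<Longrightarrow> g \<in> hom A y z \<Longrightarrow> v (g \<cdot>[A] f) = v g \<cdot>[B] v f"
 shows "is_ftor (mk_ftor A B u v)"
proof -
 interpret A: category A by fact
 show ?thesis
  unfolding is_ftor_def using assms
  by (auto simp: mk_ftor_def A.arr_simps hom_def)
qed

lemma comp_ftor_simps [simp]:
 "Src (G \<circ>\<^sub>F F) = Src F" "Tgt (G \<circ>\<^sub>F F) = Tgt G"
 "x \<in> Obj (Src F) \<Longrightarrow> FO (G \<circ>\<^sub>F F) x = FO G (FO F x)"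
 "f \<in> Arr (Src F) \<Longrightarrow> FA (G \<circ>\<^sub>F F) f = FA G (FA F f)"
 by (simp_all add: comp_ftor_def)

lemma id_ftor_simps [simp]:
 "Src (id_ftor C) = C" "Tgt (id_ftor C) = C" "x \<in> Obj C \<Longrightarrow> FO (id_ftor C) x = x"
 "f \<in> Arr C \<Longrightarrow> FA (id_ftor C) f = f"
 by (simp_all add: id_ftor_def)

lemma is_ftor_id: "category C \<Longrightarrow> is_ftor (id_ftor C)"
 unfolding id_ftor_def by (rule mk_ftorI) auto

lemma is_ftor_comp:
 assumes "is_ftor F" "is_ftor G" "Src G = Tgt F"
 shows "is_ftor (G \<circ>\<^sub>F F)"
 unfolding comp_ftor_def
proof (rule mk_ftorI)
 show "category (Src F)" "category (Tgt G)" using ftorD assms by auto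
 show "FO G (FO F x) \<in> Obj (Tgt G)" if "x \<in> Obj (Src F)" for x
  using ftorD(3) assms that by metis
 show "FA G (FA F f) \<in> hom (Tgt G) (FO G (FO F x)) (FO G (FO F y))" if "f \<in> hom (Src F) x y" for f x y
  using ftorD(4) assms that by metis
 show "FA G (FA F (Ident (Src F) x)) = Ident (Tgt G) (FO G (FO F x))" if "x \<in> Obj (Src F)" for x
  using ftorD(3,5) assms that by metis
 show "FA G (FA F (g \<cdot>[Src F] f)) = FA G (FA F g) \<cdot>[Tgt G] FA G (FA F f)"
  if "f \<in> hom (Src F) x y" "g \<in> hom (Src F) y z" for f g x y z
  using ftorD(4)[OF assms(1)] ftorD(6)[OF assms(1) that] ftorD(6)[OF assms(2)] that assms(3) by metis
qed

text \<open>This is the value at \<open>x\<close> of a left adjoint of \<open>U\<close>, isolated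
  from the adjoint functor. The adjoints chosen for a derivator are determined only up to
  isomorphism, whereas a universal arrow can be recognized, compared and transported one object at a
  time.\<close>

definition luniv :: "('p, 'b, 'o, 'a) ftor \<Rightarrow> 'o \<Rightarrow> 'p \<Rightarrow> 'a \<Rightarrow> bool"
 where "luniv U x r \<eta> \<longleftrightarrow> r \<in> Obj (Src U) \<and> \<eta> \<in> hom (Tgt U) x (FO U r) \<and>
  (\<forall>t \<in> Obj (Src U). \<forall>f \<in> hom (Tgt U) x (FO U t). \<exists>!g. g \<in> hom (Src U) r t \<and> FA U g \<cdot>[Tgt U] \<eta> = f)"

lemma iso_bij:
 assumes "category C" "k \<in> hom C r s" "is_iso C k"
 shows "bij_betw (\<lambda>g. g \<cdot>[C] k) (hom C s t) (hom C r t)"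
proof -
 interpret category C by fact
 obtain l where l: "l \<in> hom C s r" "l \<cdot>[C] k = Ident C r" "k \<cdot>[C] l = Ident C s" using isoE[OF assms(3,2)] .
 show ?thesis
  by (rule bij_betw_byWitness[where f' = "\<lambda>g. g \<cdot>[C] l"])
   (use comp_assoc[OF l(1) assms(2)] comp_assoc[OF assms(2) l(1)] l comp_hom[OF assms(2)] comp_hom[OF l(1)]
    ident_right in auto)
qed

text \<open>Duality is performed on functors, so that statements on right universal arrows become
  instances of those on left universal arrows.\<close>

definition op_ftor :: "('o, 'a, 'p, 'b) ftor \<Rightarrow> ('o, 'a, 'p, 'b) ftor"
 where "op_ftor F = \<lparr>Src = op_cat (Src F), Tgt = op_cat (Tgt F), FO = FO F, FA = FA F\<rparr>"

lemma op_ftor_simps: "Src (op_ftor F) = op_cat (Src F)" "Tgt (op_ftor F) = op_cat (Tgt F)"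
 "FO (op_ftor F) = FO F" "FA (op_ftor F) = FA F"
 by (simp_all add: op_ftor_def)

lemmas op_simps = op_ftor_simps op_cat_simps hom_op_cat is_iso_op_cat

lemma is_ftor_op: "is_ftor F \<Longrightarrow> is_ftor (op_ftor F)"
 unfolding is_ftor_def by (auto simp: op_simps category_op_cat)

definition runiv :: "('p, 'b, 'o, 'a) ftor \<Rightarrow> 'o \<Rightarrow> 'p \<Rightarrow> 'a \<Rightarrow> bool"
 where "runiv U = luniv (op_ftor U)"

lemma lunivD:
 assumes "luniv U x r \<eta>"
 shows "r \<in> Obj (Src U)" "\<eta> \<in> hom (Tgt U) x (FO U r)"
 using assms by (auto simp: luniv_def)

lemma lunivE:
 assumes "luniv U x r \<eta>" "t \<in> Obj (Src U)" "f \<in> hom (Tgt U) x (FO U t)"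
 obtains g where "g \<in> hom (Src U) r t" "FA U g \<cdot>[Tgt U] \<eta> = f"
 using assms unfolding luniv_def by blast

lemma luniv_eqI:
 assumes "is_ftor U" "luniv U x r \<eta>" "g \<in> hom (Src U) r t" "h \<in> hom (Src U) r t"
  "FA U g \<cdot>[Tgt U] \<eta> = FA U h \<cdot>[Tgt U] \<eta>"
 shows "g = h"
proof -
 interpret S: category "Src U" using ftorD(1)[OF assms(1)] .
 interpret T: category "Tgt U" using ftorD(2)[OF assms(1)] .
 have "t \<in> Obj (Src U)" using S.hom_objs[OF assms(3)] by simp
 moreover have "FA U g \<cdot>[Tgt U] \<eta> \<in> hom (Tgt U) x (FO U t)"
  using T.comp_hom[OF lunivD(2)[OF assms(2)] ftorD(4)[OF assms(1,3)]] .
 ultimately have "\<exists>!k. k \<in> hom (Src U) r t \<and> FA U k \<cdot>[Tgt U] \<eta> = FA U g \<cdot>[Tgt U] \<eta>"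
  using assms(2) unfolding luniv_def by blast
 thus ?thesis using assms(3-5) by metis
qed

lemma lunivI:
 assumes "r \<in> Obj (Src U)" "\<eta> \<in> hom (Tgt U) x (FO U r)"
  "\<And>t f. t \<in> Obj (Src U) \<Longrightarrow> f \<in> hom (Tgt U) x (FO U t) \<Longrightarrow>
    \<exists>g. g \<in> hom (Src U) r t \<and> FA U g \<cdot>[Tgt U] \<eta> = f"
  "\<And>t g h. g \<in> hom (Src U) r t \<Longrightarrow> h \<in> hom (Src U) r t \<Longrightarrow>
    FA U g \<cdot>[Tgt U] \<eta> = FA U h \<cdot>[Tgt U] \<eta> \<Longrightarrow> g = h"
 shows "luniv U x r \<eta>"
 unfolding luniv_def using assms by metis

lemma runivI:
 assumes "r \<in> Obj (Src U)" "\<epsilon> \<in> hom (Tgt U) (FO U r) x"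
  "\<And>t f. t \<in> Obj (Src U) \<Longrightarrow> f \<in> hom (Tgt U) (FO U t) x \<Longrightarrow>
    \<exists>g. g \<in> hom (Src U) t r \<and> \<epsilon> \<cdot>[Tgt U] FA U g = f"
  "\<And>t g h. g \<in> hom (Src U) t r \<Longrightarrow> h \<in> hom (Src U) t r \<Longrightarrow>
    \<epsilon> \<cdot>[Tgt U] FA U g = \<epsilon> \<cdot>[Tgt U] FA U h \<Longrightarrow> g = h"
 shows "runiv U x r \<epsilon>"
 unfolding runiv_def by (rule lunivI) (use assms in \<open>simp_all add: op_simps\<close>)

lemma runivD:
 assumes "runiv U x r \<epsilon>"
 shows "r \<in> Obj (Src U)" "\<epsilon> \<in> hom (Tgt U) (FO U r) x"
 using lunivD[OF assms[unfolded runiv_def]] by (simp_all add: op_simps)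

lemma runivE:
 assumes "runiv U x r \<epsilon>" "t \<in> Obj (Src U)" "f \<in> hom (Tgt U) (FO U t) x"
 obtains g where "g \<in> hom (Src U) t r" "\<epsilon> \<cdot>[Tgt U] FA U g = f"
 using lunivE[OF assms(1)[unfolded runiv_def], of t f] assms(2,3) by (auto simp: op_simps)

lemma runiv_eqI:
 assumes "is_ftor U" "runiv U x r \<epsilon>" "g \<in> hom (Src U) t r" "h \<in> hom (Src U) t r"
  "\<epsilon> \<cdot>[Tgt U] FA U g = \<epsilon> \<cdot>[Tgt U] FA U h"
 shows "g = h"
 using luniv_eqI[OF is_ftor_op[OF assms(1)] assms(2)[unfolded runiv_def], of g t h] assms(3-5) by (simp add: op_simps)

lemma luniv_iso:
 assumes "is_ftor U" "luniv U x r \<eta>" "luniv U x s \<theta>" "k \<in> hom (Src U) r s" "FA U k \<cdot>[Tgt U] \<eta> = \<theta>"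
 shows "is_iso (Src U) k"
proof -
 interpret S: category "Src U" using ftorD(1)[OF assms(1)] .
 interpret T: category "Tgt U" using ftorD(2)[OF assms(1)] .
 note r = lunivD[OF assms(2)] and s = lunivD[OF assms(3)]
 obtain l where l: "l \<in> hom (Src U) s r" "FA U l \<cdot>[Tgt U] \<theta> = \<eta>"
  using lunivE[OF assms(3) r] .
 have "FA U (l \<cdot>[Src U] k) \<cdot>[Tgt U] \<eta> = FA U (Ident (Src U) r) \<cdot>[Tgt U] \<eta>"
  using ftorD(5,6)[OF assms(1)] assms(4,5) l r
   T.comp_assoc[OF r(2) ftorD(4)[OF assms(1,4)] ftorD(4)[OF assms(1) l(1)]]
  by (simp add: T.ident_left)
 moreover have "FA U (k \<cdot>[Src U] l) \<cdot>[Tgt U] \<theta> = FA U (Ident (Src U) s) \<cdot>[Tgt U] \<theta>"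
  using ftorD(5,6)[OF assms(1)] assms(4,5) l s
   T.comp_assoc[OF s(2) ftorD(4)[OF assms(1) l(1)] ftorD(4)[OF assms(1,4)]]
  by (simp add: T.ident_left)
 ultimately show ?thesis
  using luniv_eqI[OF assms(1,2)] luniv_eqI[OF assms(1,3)] assms(4) l(1) S.comp_hom S.ident_hom r s
  by (intro S.isoI[OF assms(4) l(1)]) metis+
qed

lemma runiv_iso:
 assumes "is_ftor U" "runiv U x r \<epsilon>" "runiv U x s \<theta>" "k \<in> hom (Src U) s r" "\<epsilon> \<cdot>[Tgt U] FA U k = \<theta>"
 shows "is_iso (Src U) k"
 using luniv_iso[OF is_ftor_op[OF assms(1)] assms(2,3)[unfolded runiv_def], of k] assms(4,5) by (simp add: op_simps)

lemma luniv_ex_iso: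
 assumes "is_ftor U" "luniv U x r \<eta>" "luniv U x s \<theta>"
 obtains k where "k \<in> hom (Src U) r s" "is_iso (Src U) k" "FA U k \<cdot>[Tgt U] \<eta> = \<theta>"
 using lunivE[OF assms(2) lunivD[OF assms(3)]] luniv_iso[OF assms] by metis

lemma bij_betw_ex1: "f \<in> A \<rightarrow> B \<Longrightarrow> bij_betw f A B \<longleftrightarrow> (\<forall>y\<in>B. \<exists>!x. x \<in> A \<and> f x = y)"
 unfolding bij_betw_def inj_on_def by (auto 0 3 simp: image_iff)

text \<open>As a bijection, universality is visibly stable under isomorphisms, because bijections
  compose; this is how the next two lemmas change \<open>x\<close> and \<open>r\<close>.\<close>

lemma luniv_bij: "luniv U x r \<eta> \<longleftrightarrow> r \<in> Obj (Src U) \<and> \<eta> \<in> hom (Tgt U) x (FO U r) \<and>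
  (\<forall>t \<in> Obj (Src U). bij_betw (\<lambda>g. FA U g \<cdot>[Tgt U] \<eta>) (hom (Src U) r t) (hom (Tgt U) x (FO U t)))"
 if "is_ftor U"
proof -
 interpret T: category "Tgt U" using ftorD(2)[OF that] .
 show ?thesis
  unfolding luniv_def
  by (rule conj_cong[OF refl], rule conj_cong[OF refl], rule ball_cong[OF refl], subst bij_betw_ex1)
   (use T.comp_hom ftorD(4)[OF that] in auto)
qed

lemma luniv_precomp:
 assumes "is_ftor U" "luniv U x r \<eta>" "h \<in> hom (Tgt U) y x" "is_iso (Tgt U) h"
 shows "luniv U y r (\<eta> \<cdot>[Tgt U] h)"
proof -
 interpret T: category "Tgt U" using ftorD(2)[OF assms(1)] .
 note l = assms(2)[unfolded luniv_bij[OF assms(1)]]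
 have eq: "FA U g \<cdot>[Tgt U] (\<eta> \<cdot>[Tgt U] h) = (FA U g \<cdot>[Tgt U] \<eta>) \<cdot>[Tgt U] h" if "g \<in> hom (Src U) r t" for g t
  using T.comp_assoc[OF assms(3) lunivD(2)[OF assms(2)] ftorD(4)[OF assms(1) that]] by simp
 have "bij_betw (\<lambda>g. FA U g \<cdot>[Tgt U] (\<eta> \<cdot>[Tgt U] h)) (hom (Src U) r t) (hom (Tgt U) y (FO U t))" if "t \<in> Obj (Src U)" for t
  using bij_betw_trans[OF bspec[OF conjunct2[OF conjunct2[OF l]] that] iso_bij[OF T.category_axioms assms(3,4)]]
  by (simp add: o_def eq cong: bij_betw_cong)
 thus ?thesis unfolding luniv_bij[OF assms(1)] using l T.comp_hom[OF assms(3)] by blast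
qed

lemma luniv_postcomp:
 assumes "is_ftor U" "luniv U x r \<eta>" "k \<in> hom (Src U) r s" "is_iso (Src U) k"
 shows "luniv U x s (FA U k \<cdot>[Tgt U] \<eta>)"
proof -
 interpret S: category "Src U" using ftorD(1)[OF assms(1)] .
 interpret T: category "Tgt U" using ftorD(2)[OF assms(1)] .
 note l = assms(2)[unfolded luniv_bij[OF assms(1)]] and Uk = ftorD(4)[OF assms(1,3)]
 have eq: "FA U g \<cdot>[Tgt U] (FA U k \<cdot>[Tgt U] \<eta>) = FA U (g \<cdot>[Src U] k) \<cdot>[Tgt U] \<eta>" if "g \<in> hom (Src U) s t" for g t
  using T.comp_assoc[OF lunivD(2)[OF assms(2)] Uk ftorD(4)[OF assms(1) that]] ftorD(6)[OF assms(1,3) that] by simp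
 have "bij_betw (\<lambda>g. FA U g \<cdot>[Tgt U] (FA U k \<cdot>[Tgt U] \<eta>)) (hom (Src U) s t) (hom (Tgt U) x (FO U t))" if "t \<in> Obj (Src U)" for t
  using bij_betw_trans[OF iso_bij[OF S.category_axioms assms(3,4)] bspec[OF conjunct2[OF conjunct2[OF l]] that]]
  by (simp add: o_def eq cong: bij_betw_cong)
 thus ?thesis unfolding luniv_bij[OF assms(1)] using l T.comp_hom[OF _ Uk] S.hom_objs[OF assms(3)] by blast
qed

lemma runiv_precomp:
 assumes "is_ftor U" "runiv U x r \<epsilon>" "h \<in> hom (Tgt U) x y" "is_iso (Tgt U) h"
 shows "runiv U y r (h \<cdot>[Tgt U] \<epsilon>)"
 using luniv_precomp[OF is_ftor_op[OF assms(1)] assms(2)[unfolded runiv_def], of h y] assms(3,4)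
 by (simp add: runiv_def op_simps)

lemma runiv_postcomp:
 assumes "is_ftor U" "runiv U x r \<epsilon>" "k \<in> hom (Src U) s r" "is_iso (Src U) k"
 shows "runiv U x s (\<epsilon> \<cdot>[Tgt U] FA U k)"
 using luniv_postcomp[OF is_ftor_op[OF assms(1)] assms(2)[unfolded runiv_def], of k s] assms(3,4)
 by (simp add: runiv_def op_simps)

text \<open>The unit and the counit enter as mere families of arrows rather than as
  \<open>ntrans\<close> records, so that the lemma applies to opposite functors with the two
  exchanged; this yields \<open>adjunction_runiv\<close>.\<close>

lemma unit_counit_luniv:
 assumes F: "is_ftor F" and G: "is_ftor G" and st: "Src G = Tgt F" "Tgt G = Src F"
  and \<eta>: "\<And>y. y \<in> Obj (Src F) \<Longrightarrow> \<eta> y \<in> hom (Src F) y (FO G (FO F y))"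
   "\<And>f y z. f \<in> hom (Src F) y z \<Longrightarrow> \<eta> z \<cdot>[Src F] f = FA G (FA F f) \<cdot>[Src F] \<eta> y"
  and \<epsilon>: "\<And>y. y \<in> Obj (Tgt F) \<Longrightarrow> \<epsilon> y \<in> hom (Tgt F) (FO F (FO G y)) y"
   "\<And>f y z. f \<in> hom (Tgt F) y z \<Longrightarrow> \<epsilon> z \<cdot>[Tgt F] FA F (FA G f) = f \<cdot>[Tgt F] \<epsilon> y"
  and tri: "\<And>y. y \<in> Obj (Src F) \<Longrightarrow> \<epsilon> (FO F y) \<cdot>[Tgt F] FA F (\<eta> y) = Ident (Tgt F) (FO F y)"
   "\<And>y. y \<in> Obj (Tgt F) \<Longrightarrow> FA G (\<epsilon> y) \<cdot>[Src F] \<eta> (FO G y) = Ident (Src F) (FO G y)"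
  and x: "x \<in> Obj (Src F)"
 shows "luniv G x (FO F x) (\<eta> x)"
proof (rule lunivI)
 interpret S: category "Src F" using ftorD(1)[OF F] .
 interpret T: category "Tgt F" using ftorD(2)[OF F] .
 note Gh = ftorD(4)[OF G, unfolded st] and Fx = ftorD(3)[OF F x]
 show "FO F x \<in> Obj (Src G)" using Fx st by simp
 show "\<eta> x \<in> hom (Tgt G) x (FO G (FO F x))" using \<eta>(1)[OF x] st by simp
 show "\<exists>g. g \<in> hom (Src G) (FO F x) t \<and> FA G g \<cdot>[Tgt G] \<eta> x = f"
  if t: "t \<in> Obj (Src G)" and f: "f \<in> hom (Tgt G) x (FO G t)" for f t
 proof -
  have t': "t \<in> Obj (Tgt F)" and f': "f \<in> hom (Src F) x (FO G t)" using t f st by auto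
  note Ff = ftorD(4)[OF F f'] and \<epsilon>t = \<epsilon>(1)[OF t'] and Gt = conjunct2[OF S.hom_objs[OF f']]
  have "FA G (\<epsilon> t \<cdot>[Tgt F] FA F f) \<cdot>[Src F] \<eta> x = (FA G (\<epsilon> t) \<cdot>[Src F] FA G (FA F f)) \<cdot>[Src F] \<eta> x"
   using ftorD(6)[OF G] Ff \<epsilon>t st by simp
  also have "\<dots> = (FA G (\<epsilon> t) \<cdot>[Src F] \<eta> (FO G t)) \<cdot>[Src F] f"
   using S.comp_assoc[OF \<eta>(1)[OF x] Gh[OF Ff] Gh[OF \<epsilon>t]] S.comp_assoc[OF f' \<eta>(1)[OF Gt] Gh[OF \<epsilon>t]] \<eta>(2)[OF f'] by simp
  finally show ?thesis using T.comp_hom[OF Ff \<epsilon>t] st tri(2)[OF t'] S.ident_left[OF f'] by auto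
 qed
 show "g = h" if g: "g \<in> hom (Src G) (FO F x) t" and h: "h \<in> hom (Src G) (FO F x) t"
  and e: "FA G g \<cdot>[Tgt G] \<eta> x = FA G h \<cdot>[Tgt G] \<eta> x" for g h t
 proof -
  \<comment> \<open>An arrow is recovered from its transpose by applying \<open>F\<close> and
    composing with the counit, so transposition is injective.\<close>
  have "k = \<epsilon> t \<cdot>[Tgt F] FA F (FA G k \<cdot>[Tgt G] \<eta> x)" if "k \<in> hom (Src G) (FO F x) t" for k
  proof -
   have k: "k \<in> hom (Tgt F) (FO F x) t" using that st by simp
   note Gk = Gh[OF k] and F\<eta> = ftorD(4)[OF F \<eta>(1)[OF x]] and \<epsilon>t = \<epsilon>(1)[OF conjunct2[OF T.hom_objs[OF k]]]
   have "\<epsilon> t \<cdot>[Tgt F] FA F (FA G k \<cdot>[Src F] \<eta> x) = (\<epsilon> t \<cdot>[Tgt F] FA F (FA G k)) \<cdot>[Tgt F] FA F (\<eta> x)"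
    using ftorD(6)[OF F \<eta>(1)[OF x] Gk] T.comp_assoc[OF F\<eta> ftorD(4)[OF F Gk] \<epsilon>t] by simp
   also have "\<dots> = k" using \<epsilon>(2)[OF k] T.comp_assoc[OF F\<eta> \<epsilon>(1)[OF Fx] k] tri(1)[OF x] T.ident_right[OF k] by simp
   finally show ?thesis using st by simp
  qed
  thus ?thesis using g h e by metis
 qed
qed

lemma adjunctionD:
 assumes "adjunction F G \<eta> \<epsilon>"
 shows "is_ftor F" "is_ftor G" "Src G = Tgt F" "Tgt G = Src F"
  "y \<in> Obj (Src F) \<Longrightarrow> NC \<eta> y \<in> hom (Src F) y (FO G (FO F y))"
  "f \<in> hom (Src F) y z \<Longrightarrow> NC \<eta> z \<cdot>[Src F] f = FA G (FA F f) \<cdot>[Src F] NC \<eta> y"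
  "u \<in> Obj (Tgt F) \<Longrightarrow> NC \<epsilon> u \<in> hom (Tgt F) (FO F (FO G u)) u"
  "g \<in> hom (Tgt F) u v \<Longrightarrow> NC \<epsilon> v \<cdot>[Tgt F] FA F (FA G g) = g \<cdot>[Tgt F] NC \<epsilon> u"
  "y \<in> Obj (Src F) \<Longrightarrow> NC \<epsilon> (FO F y) \<cdot>[Tgt F] FA F (NC \<eta> y) = Ident (Tgt F) (FO F y)"
  "u \<in> Obj (Tgt F) \<Longrightarrow> FA G (NC \<epsilon> u) \<cdot>[Src F] NC \<eta> (FO G u) = Ident (Src F) (FO G u)"
 using assms unfolding adjunction_def is_ntrans_def by (auto simp: hom_def)

lemma adjunction_luniv:
 assumes "adjunction F G \<eta> \<epsilon>" "x \<in> Obj (Tgt G)"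
 shows "luniv G x (FO F x) (NC \<eta> x)"
 by (rule unit_counit_luniv) (use adjunctionD[OF assms(1)] assms(2) in auto)

lemma adjunction_runiv:
 assumes "adjunction F G \<eta> \<epsilon>" "y \<in> Obj (Tgt F)"
 shows "runiv F y (FO G y) (NC \<epsilon> y)"
 using unit_counit_luniv[of "op_ftor G" "op_ftor F" "NC \<epsilon>" "NC \<eta>" y] adjunctionD[OF assms(1)] assms(2)
 by (simp add: runiv_def op_simps is_ftor_op)

section \<open>Pointwise inverses of transformations, and equivalences as fully faithful
  functors\<close>

subsection \<open>Functor categories and equivalences\<close>

lemma category_mk_catI:
 assumes "\<And>f. f \<in> A \<Longrightarrow> d f \<in> X" "\<And>f. f \<in> A \<Longrightarrow> c f \<in> X"
  "\<And>x. x \<in> X \<Longrightarrow> i x \<in> A \<and> d (i x) = x \<and> c (i x) = x"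
  "\<And>f g. f \<in> A \<Longrightarrow> g \<in> A \<Longrightarrow> d g = c f \<Longrightarrow> m g f \<in> A \<and> d (m g f) = d f \<and> c (m g f) = c g"
  "\<And>f g h. f \<in> A \<Longrightarrow> g \<in> A \<Longrightarrow> h \<in> A \<Longrightarrow> d g = c f \<Longrightarrow> d h = c g \<Longrightarrow> m (m h g) f = m h (m g f)"
  "\<And>f. f \<in> A \<Longrightarrow> m (i (c f)) f = f" "\<And>f. f \<in> A \<Longrightarrow> m f (i (d f)) = f"
 shows "category (mk_cat X A d c i m)"
 by unfold_locales (use assms in \<open>auto simp: mk_cat_def hom_def\<close>)

lemma mk_cat_simps [simp]:
 "Obj (mk_cat X A d c i m) = X" "Arr (mk_cat X A d c i m) = A"
 "f \<in> A \<Longrightarrow> Dom (mk_cat X A d c i m) f = d f" "f \<in> A \<Longrightarrow> Cod (mk_cat X A d c i m) f = c f"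
 "x \<in> X \<Longrightarrow> Ident (mk_cat X A d c i m) x = i x"
 "f \<in> A \<Longrightarrow> g \<in> A \<Longrightarrow> d g = c f \<Longrightarrow> g \<cdot>[mk_cat X A d c i m] f = m g f"
 by (simp_all add: mk_cat_def)

lemma mk_ntrans_simps [simp]:
 "NDom (mk_ntrans F G c) = F" "NCod (mk_ntrans F G c) = G" "x \<in> Obj (Src F) \<Longrightarrow> NC (mk_ntrans F G c) x = c x"
 by (simp_all add: mk_ntrans_def)

lemma mk_ntransI:
 assumes "is_ftor F" "is_ftor G" "Src G = Src F" "Tgt G = Tgt F"
  "\<And>x. x \<in> Obj (Src F) \<Longrightarrow> c x \<in> hom (Tgt F) (FO F x) (FO G x)"
  "\<And>x y f. f \<in> hom (Src F) x y \<Longrightarrow> c y \<cdot>[Tgt F] FA F f = FA G f \<cdot>[Tgt F] c x"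
 shows "is_ntrans (mk_ntrans F G c)"
proof -
 interpret S: category "Src F" using ftorD(1)[OF assms(1)] .
 show ?thesis
  unfolding is_ntrans_def using assms
  by (auto simp: mk_ntrans_def S.dom_closed S.cod_closed hom_def)
qed

lemma ntransD:
 assumes "is_ntrans \<alpha>"
 shows "is_ftor (NDom \<alpha>)" "is_ftor (NCod \<alpha>)" "Src (NCod \<alpha>) = Src (NDom \<alpha>)" "Tgt (NCod \<alpha>) = Tgt (NDom \<alpha>)"
  "x \<in> Obj (Src (NDom \<alpha>)) \<Longrightarrow> NC \<alpha> x \<in> hom (Tgt (NDom \<alpha>)) (FO (NDom \<alpha>) x) (FO (NCod \<alpha>) x)"
  "f \<in> hom (Src (NDom \<alpha>)) x y \<Longrightarrow> NC \<alpha> y \<cdot>[Tgt (NDom \<alpha>)] FA (NDom \<alpha>) f =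
    FA (NCod \<alpha>) f \<cdot>[Tgt (NDom \<alpha>)] NC \<alpha> x"
 using assms unfolding is_ntrans_def by (auto simp: hom_def)

lemma ntrans_eqI:
 assumes "is_ntrans \<alpha>" "is_ntrans \<beta>" "NDom \<alpha> = NDom \<beta>" "NCod \<alpha> = NCod \<beta>"
  "\<And>x. x \<in> Obj (Src (NDom \<alpha>)) \<Longrightarrow> NC \<alpha> x = NC \<beta> x"
 shows "\<alpha> = \<beta>"
proof -
 have "NC \<alpha> = NC \<beta>"
  using assms unfolding is_ntrans_def by (intro extensionalityI[of _ "Obj (Src (NDom \<alpha>))"]) auto
 thus ?thesis using assms(3,4) by (cases \<alpha>, cases \<beta>) simp
qed

lemma hom_fun_cat:
 "hom (fun_cat A B) F G = {\<alpha>. is_ntrans \<alpha> \<and> NDom \<alpha> = F \<and> NCod \<alpha> = G \<and> Src F = A \<and> Tgt F = B}"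
 by (auto simp: fun_cat_def hom_def)

text \<open>The pointwise inverses are natural: insert a component with its inverse on one side, use
  naturality of \<alpha>, and cancel on the other side.\<close>

lemma is_iso_fun_catI:
 assumes "is_ntrans \<alpha>" "Src (NDom \<alpha>) = A" "Tgt (NDom \<alpha>) = B"
  "\<And>x. x \<in> Obj A \<Longrightarrow> is_iso B (NC \<alpha> x)"
 shows "is_iso (fun_cat A B) \<alpha>"
proof -
 let ?F = "NDom \<alpha>" and ?G = "NCod \<alpha>"
 note \<alpha> = ntransD[OF assms(1), unfolded assms(2,3)]
 interpret A: category A using ftorD(1)[OF \<alpha>(1)] assms(2) by simp
 interpret B: category B using ftorD(2)[OF \<alpha>(1)] assms(3) by simp
 have "\<exists>g. g \<in> hom B (FO ?G x) (FO ?F x) \<and> g \<cdot>[B] NC \<alpha> x = Ident B (FO ?F x) \<and> NC \<alpha> x \<cdot>[B] g = Ident B (FO ?G x)"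
  if "x \<in> Obj A" for x
  using B.isoE[OF assms(4)[OF that] \<alpha>(5)[OF that]] by metis
 then obtain c where c: "\<And>x. x \<in> Obj A \<Longrightarrow> c x \<in> hom B (FO ?G x) (FO ?F x)"
  "\<And>x. x \<in> Obj A \<Longrightarrow> c x \<cdot>[B] NC \<alpha> x = Ident B (FO ?F x)"
  "\<And>x. x \<in> Obj A \<Longrightarrow> NC \<alpha> x \<cdot>[B] c x = Ident B (FO ?G x)" by metis
 have nat: "c y \<cdot>[B] FA ?G f = FA ?F f \<cdot>[B] c x" if f: "f \<in> hom A x y" for f x y
 proof -
  have x: "x \<in> Obj A" and y: "y \<in> Obj A" using A.hom_objs[OF f] by auto
  have Ff: "FA ?F f \<in> hom B (FO ?F x) (FO ?F y)" and Gf: "FA ?G f \<in> hom B (FO ?G x) (FO ?G y)"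
   using ftorD(4)[OF \<alpha>(1)] ftorD(4)[OF \<alpha>(2)] f assms(2,3) \<alpha>(3,4) by auto
  have "c y \<cdot>[B] FA ?G f = c y \<cdot>[B] (FA ?G f \<cdot>[B] (NC \<alpha> x \<cdot>[B] c x))"
   using c(3)[OF x] Gf B.ident_right by simp
  also have "\<dots> = c y \<cdot>[B] ((FA ?G f \<cdot>[B] NC \<alpha> x) \<cdot>[B] c x)"
   using B.comp_assoc[OF c(1)[OF x] \<alpha>(5)[OF x] Gf] by simp
  also have "\<dots> = c y \<cdot>[B] ((NC \<alpha> y \<cdot>[B] FA ?F f) \<cdot>[B] c x)"
   using \<alpha>(6)[OF f] by simp
  also have "\<dots> = (c y \<cdot>[B] NC \<alpha> y) \<cdot>[B] (FA ?F f \<cdot>[B] c x)"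
   using c(1)[OF x] c(1)[OF y] \<alpha>(5)[OF y] Ff by (simp add: hom_def B.arr_simps)
  finally show ?thesis using c(2)[OF y] B.ident_left[OF B.comp_hom[OF c(1)[OF x] Ff]] by simp
 qed
 let ?\<beta> = "mk_ntrans ?G ?F c"
 have \<beta>: "is_ntrans ?\<beta>"
  using \<alpha> c(1) nat assms(2,3) by (intro mk_ntransI) auto
 have mem: "\<alpha> \<in> {\<alpha>. is_ntrans \<alpha> \<and> Src (NDom \<alpha>) = A \<and> Tgt (NDom \<alpha>) = B}"
  "?\<beta> \<in> {\<alpha>. is_ntrans \<alpha> \<and> Src (NDom \<alpha>) = A \<and> Tgt (NDom \<alpha>) = B}"
  "?F \<in> {F. is_ftor F \<and> Src F = A \<and> Tgt F = B}" "?G \<in> {F. is_ftor F \<and> Src F = A \<and> Tgt F = B}"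
  using \<alpha> \<beta> assms by auto
 have "?\<beta> \<cdot>[fun_cat A B] \<alpha> = vcomp ?\<beta> \<alpha>" "\<alpha> \<cdot>[fun_cat A B] ?\<beta> = vcomp \<alpha> ?\<beta>"
  using mem unfolding fun_cat_def by (subst mk_cat_simps; simp)+
 moreover have "Ident (fun_cat A B) ?F = id_ntrans ?F" "Ident (fun_cat A B) ?G = id_ntrans ?G"
  using mem unfolding fun_cat_def by auto
 moreover have "vcomp ?\<beta> \<alpha> = id_ntrans ?F" "vcomp \<alpha> ?\<beta> = id_ntrans ?G"
  using c \<alpha> assms(2,3) by (auto simp: vcomp_def id_ntrans_def mk_ntrans_def intro!: restrict_ext)
 ultimately show ?thesis
  unfolding is_iso_def inverse_arrows_def using mem \<beta>
  by (intro exI[of _ ?\<beta>]) (auto simp: fun_cat_def hom_def)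
qed

lemma isomorphic_fun_catE:
 assumes "isomorphic (fun_cat A B) F G"
 obtains c where "\<And>x. x \<in> Obj A \<Longrightarrow> c x \<in> hom B (FO F x) (FO G x)"
  "\<And>x. x \<in> Obj A \<Longrightarrow> is_iso B (c x)"
  "\<And>f x y. f \<in> hom A x y \<Longrightarrow> c y \<cdot>[B] FA F f = FA G f \<cdot>[B] c x"
proof -
 obtain \<alpha> where \<alpha>: "is_ntrans \<alpha>" "NDom \<alpha> = F" "NCod \<alpha> = G" "Src F = A" "Tgt F = B" "is_iso (fun_cat A B) \<alpha>"
  using assms by (auto simp: isomorphic_def hom_fun_cat)
 then obtain \<beta> where \<beta>: "inverse_arrows (fun_cat A B) \<alpha> \<beta>" by (auto simp: is_iso_def)
 have mem: "\<alpha> \<in> {\<alpha>. is_ntrans \<alpha> \<and> Src (NDom \<alpha>) = A \<and> Tgt (NDom \<alpha>) = B}"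
  "F \<in> {F. is_ftor F \<and> Src F = A \<and> Tgt F = B}" "G \<in> {F. is_ftor F \<and> Src F = A \<and> Tgt F = B}"
  using \<alpha> ntransD[OF \<alpha>(1)] by auto
 have \<beta>': "is_ntrans \<beta>" "NDom \<beta> = G" "NCod \<beta> = F" "\<beta> \<in> {\<alpha>. is_ntrans \<alpha> \<and> Src (NDom \<alpha>) = A \<and> Tgt (NDom \<alpha>) = B}"
  using \<beta> mem \<alpha>(2,3) unfolding inverse_arrows_def by (auto simp: fun_cat_def hom_def)
 have "\<beta> \<cdot>[fun_cat A B] \<alpha> = vcomp \<beta> \<alpha>" "\<alpha> \<cdot>[fun_cat A B] \<beta> = vcomp \<alpha> \<beta>"
  using mem \<beta>' \<alpha> unfolding fun_cat_def by (subst mk_cat_simps; simp)+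
 moreover have "Ident (fun_cat A B) F = id_ntrans F" "Ident (fun_cat A B) G = id_ntrans G"
  using mem unfolding fun_cat_def by auto
 ultimately have v: "vcomp \<beta> \<alpha> = id_ntrans F" "vcomp \<alpha> \<beta> = id_ntrans G"
  using \<beta> \<alpha> unfolding inverse_arrows_def by (auto simp: fun_cat_def)
 note \<alpha>D = ntransD[OF \<alpha>(1), unfolded \<alpha>] and \<beta>D = ntransD[OF \<beta>'(1), unfolded \<beta>']
 have GA: "Src G = A" "Tgt G = B" using mem(3) by auto
 interpret B: category B using ftorD(2)[OF \<alpha>D(1)] \<alpha> by simp
 show thesis
 proof (rule that[of "NC \<alpha>"])
  show "NC \<alpha> x \<in> hom B (FO F x) (FO G x)" if "x \<in> Obj A" for x using \<alpha>D(5)[OF that] .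
  show "is_iso B (NC \<alpha> x)" if x: "x \<in> Obj A" for x
  proof (rule B.isoI)
   show "NC \<alpha> x \<in> hom B (FO F x) (FO G x)" using \<alpha>D(5)[OF x] .
   show "NC \<beta> x \<in> hom B (FO G x) (FO F x)" using \<beta>D(5) x GA by simp
   have "NC (vcomp \<beta> \<alpha>) x = NC (id_ntrans F) x" "NC (vcomp \<alpha> \<beta>) x = NC (id_ntrans G) x"
    using v by simp_all
   thus "NC \<beta> x \<cdot>[B] NC \<alpha> x = Ident B (FO F x)" "NC \<alpha> x \<cdot>[B] NC \<beta> x = Ident B (FO G x)"
    using x \<alpha> \<beta>' GA by (auto simp: vcomp_def id_ntrans_def)
  qed
  show "NC \<alpha> y \<cdot>[B] FA F f = FA G f \<cdot>[B] NC \<alpha> x" if "f \<in> hom A x y" for f x y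
   using \<alpha>D(6)[OF that] .
 qed
qed

text \<open>The isomorphism from the composite \<open>G \<circ>\<^sub>F F\<close> to the identity
  conjugates \<open>FA G (FA F f)\<close> back into \<open>f\<close>, so \<open>f\<close> can be
  read off from \<open>FA F f\<close>.\<close>

lemma faithful_if_retract:
 assumes "is_ftor F" "is_ftor G" "Src G = Tgt F" "Tgt G = Src F"
  "isomorphic (fun_cat (Src F) (Src F)) (G \<circ>\<^sub>F F) (id_ftor (Src F))"
  "f \<in> hom (Src F) x y" "g \<in> hom (Src F) x y" "FA F f = FA F g"
 shows "f = g"
proof -
 interpret S: category "Src F" using ftorD(1)[OF assms(1)] .
 obtain c where c: "\<And>x. x \<in> Obj (Src F) \<Longrightarrow> c x \<in> hom (Src F) (FO (G \<circ>\<^sub>F F) x) (FO (id_ftor (Src F)) x)"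
  "\<And>x. x \<in> Obj (Src F) \<Longrightarrow> is_iso (Src F) (c x)"
  "\<And>f x y. f \<in> hom (Src F) x y \<Longrightarrow> c y \<cdot>[Src F] FA (G \<circ>\<^sub>F F) f = FA (id_ftor (Src F)) f \<cdot>[Src F] c x"
  using isomorphic_fun_catE[OF assms(5)] by metis
 have x: "x \<in> Obj (Src F)" using S.hom_objs[OF assms(6)] by simp
 have "FA (G \<circ>\<^sub>F F) f = FA (G \<circ>\<^sub>F F) g" "FA (id_ftor (Src F)) f = f" "FA (id_ftor (Src F)) g = g"
  using assms(6-8) by (auto simp: hom_def)
 hence "f \<cdot>[Src F] c x = g \<cdot>[Src F] c x" using c(3)[OF assms(6)] c(3)[OF assms(7)] by simp
 thus ?thesis using S.iso_cancel_epi[OF c(2,1)[OF x]] assms(6,7) x by simp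
qed

lemma equivalenceD:
 assumes "is_equivalence F"
 shows "x \<in> Obj (Src F) \<Longrightarrow> y \<in> Obj (Src F) \<Longrightarrow> h \<in> hom (Tgt F) (FO F x) (FO F y) \<Longrightarrow>
   \<exists>!f. f \<in> hom (Src F) x y \<and> FA F f = h"
  and "z \<in> Obj (Tgt F) \<Longrightarrow> \<exists>x \<in> Obj (Src F). isomorphic (Tgt F) (FO F x) z"
proof -
 obtain G where G: "is_ftor F" "is_ftor G" "Src G = Tgt F" "Tgt G = Src F"
  "isomorphic (fun_cat (Src F) (Src F)) (G \<circ>\<^sub>F F) (id_ftor (Src F))"
  "isomorphic (fun_cat (Tgt F) (Tgt F)) (F \<circ>\<^sub>F G) (id_ftor (Tgt F))"
  using assms unfolding is_equivalence_def by blast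
 interpret S: category "Src F" using ftorD(1)[OF G(1)] .
 interpret T: category "Tgt F" using ftorD(2)[OF G(1)] .
 obtain c where c: "\<And>x. x \<in> Obj (Src F) \<Longrightarrow> c x \<in> hom (Src F) (FO (G \<circ>\<^sub>F F) x) (FO (id_ftor (Src F)) x)"
  "\<And>x. x \<in> Obj (Src F) \<Longrightarrow> is_iso (Src F) (c x)"
  "\<And>f x y. f \<in> hom (Src F) x y \<Longrightarrow> c y \<cdot>[Src F] FA (G \<circ>\<^sub>F F) f = FA (id_ftor (Src F)) f \<cdot>[Src F] c x"
  using isomorphic_fun_catE[OF G(5)] by metis
 obtain e where e: "\<And>x. x \<in> Obj (Tgt F) \<Longrightarrow> e x \<in> hom (Tgt F) (FO (F \<circ>\<^sub>F G) x) (FO (id_ftor (Tgt F)) x)"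
  "\<And>x. x \<in> Obj (Tgt F) \<Longrightarrow> is_iso (Tgt F) (e x)"
  using isomorphic_fun_catE[OF G(6)] by metis
 show "\<exists>x \<in> Obj (Src F). isomorphic (Tgt F) (FO F x) z" if z: "z \<in> Obj (Tgt F)"
  using e[OF z] z ftorD(3)[OF G(2)] G(3,4) by (intro bexI[of _ "FO G z"] T.isomorphicI[of "e z"]) auto
 show "\<exists>!f. f \<in> hom (Src F) x y \<and> FA F f = h"
  if x: "x \<in> Obj (Src F)" and y: "y \<in> Obj (Src F)" and h: "h \<in> hom (Tgt F) (FO F x) (FO F y)"
 proof -
  have cx: "c x \<in> hom (Src F) (FO G (FO F x)) x" and cy: "c y \<in> hom (Src F) (FO G (FO F y)) y"
   using c(1) x y by auto
  obtain c' where c': "c' \<in> hom (Src F) x (FO G (FO F x))" "c' \<cdot>[Src F] c x = Ident (Src F) (FO G (FO F x))"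
   using S.isoE[OF c(2)[OF x] cx] by metis
  have Gh: "FA G h \<in> hom (Src F) (FO G (FO F x)) (FO G (FO F y))" using ftorD(4)[OF G(2)] h G(3,4) by simp
  \<comment> \<open>The candidate preimage is the conjugate of \<open>FA G h\<close>. It satisfies
    \<open>FA G (FA F f) = FA G h\<close>, and \<open>G\<close> is faithful since
    \<open>F \<circ>\<^sub>F G\<close> is isomorphic to the identity.\<close>
  define f where "f = c y \<cdot>[Src F] (FA G h \<cdot>[Src F] c')"
  have f: "f \<in> hom (Src F) x y" unfolding f_def using S.comp_hom[OF S.comp_hom[OF c'(1) Gh] cy] .
  have Ff: "FA F f \<in> hom (Tgt F) (FO F x) (FO F y)" using ftorD(4)[OF G(1) f] .
  have GFf: "FA G (FA F f) \<in> hom (Src F) (FO G (FO F x)) (FO G (FO F y))"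
   using ftorD(4)[OF G(2)] Ff G(3,4) by simp
  have "c y \<cdot>[Src F] FA G (FA F f) = f \<cdot>[Src F] c x"
   using c(3)[OF f] f by (simp add: hom_def)
  also have "\<dots> = c y \<cdot>[Src F] (FA G h \<cdot>[Src F] (c' \<cdot>[Src F] c x))"
   unfolding f_def using cx cy c'(1) Gh by (simp add: hom_def S.arr_simps)
  also have "\<dots> = c y \<cdot>[Src F] FA G h" using c'(2) Gh S.ident_right by simp
  finally have "FA G (FA F f) = FA G h" using S.iso_cancel_mono[OF c(2)[OF y] cy GFf Gh] by simp
  moreover have "isomorphic (fun_cat (Src G) (Src G)) (F \<circ>\<^sub>F G) (id_ftor (Src G))" using G by simp
  ultimately have "FA F f = h"
   using faithful_if_retract[OF G(2,1), of "FA F f" "FO F x" "FO F y" h] G Ff h by simp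
  thus ?thesis
   using f faithful_if_retract[OF G(1-5)] by blast
 qed
qed

section \<open>Addition and subtraction of arrows derived from biproducts\<close>

section \<open>Addition of arrows\<close>

context category
begin

lemma productD:
 assumes "is_product C I L P prj"
 shows "P \<in> Obj C" "\<And>i. i \<in> I \<Longrightarrow> prj i \<in> hom C P (L i)"
 using assms by (auto simp: is_product_def is_coproduct_def hom_op_cat op_cat_simps)

lemma product_pair:
 assumes "is_product C I L P prj" "Q \<in> Obj C" "\<And>i. i \<in> I \<Longrightarrow> t i \<in> hom C Q (L i)"
 obtains k where "k \<in> hom C Q P" "\<And>i. i \<in> I \<Longrightarrow> prj i \<cdot> k = t i"
proof -
 interpret op: category "op_cat C" by (rule category_op_cat) unfold_locales
 have "Q \<in> Obj (op_cat C)" using assms(2) by (simp add: op_cat_def)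
 thus thesis
  using op.coproduct_desc[OF assms(1)[unfolded is_product_def], of Q t] that assms(3)
  by (auto simp: hom_op_cat op_cat_simps)
qed

lemma product_eqI:
 assumes "is_product C I L P prj" "k \<in> hom C Q P" "l \<in> hom C Q P"
  "\<And>i. i \<in> I \<Longrightarrow> prj i \<cdot> k = prj i \<cdot> l"
 shows "k = l"
proof -
 interpret op: category "op_cat C" by (rule category_op_cat) unfold_locales
 show ?thesis
  using op.coproduct_eqI[OF assms(1)[unfolded is_product_def], of k Q l] assms(2-4)
  by (auto simp: hom_op_cat op_cat_simps)
qed

lemma product_postcomp:
 assumes "is_product C I L P prj" "\<And>i. i \<in> I \<Longrightarrow> e i \<in> hom C (L i) (L' i)" "\<And>i. i \<in> I \<Longrightarrow> is_iso C (e i)"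
 shows "is_product C I L' P (\<lambda>i. e i \<cdot> prj i)"
proof -
 interpret op: category "op_cat C" by (rule category_op_cat) unfold_locales
 show ?thesis
  using op.coproduct_precomp[OF assms(1)[unfolded is_product_def], of e L'] assms(2,3) by (simp add: is_product_def op_simps)
qed

end

text \<open>\<open>is_sum\<close> is built from biproducts of an object with itself, so these are
  the structure that a derivator has to provide.\<close>

locale semiadditive = category +
 assumes biproduct_ex: "y \<in> Obj C \<Longrightarrow> \<exists>b inn prj. is_square_biproduct C y b inn prj"
begin

lemma biproductD:
 assumes "is_square_biproduct C y b inn prj"
 shows "is_coproduct C UNIV (\<lambda>_. y) b inn" "is_product C UNIV (\<lambda>_. y) b prj"
  "prj s \<cdot> inn s = Ident C y" "is_zero_arrow C (prj (\<not> s) \<cdot> inn s)"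
  "b \<in> Obj C" "inn s \<in> hom C y b" "prj s \<in> hom C b y" "y \<in> Obj C"
proof -
 show *: "is_coproduct C UNIV (\<lambda>_. y) b inn" "is_product C UNIV (\<lambda>_. y) b prj"
  "prj s \<cdot> inn s = Ident C y" "is_zero_arrow C (prj (\<not> s) \<cdot> inn s)"
  using assms by (auto simp: is_square_biproduct_def)
 show "b \<in> Obj C" "inn s \<in> hom C y b" "prj s \<in> hom C b y"
  using coproductD[OF *(1)] productD[OF *(2)] by auto
 thus "y \<in> Obj C" using hom_objs by blast
qed

lemma zero_ex:
 assumes "x \<in> Obj C" "y \<in> Obj C"
 obtains e where "e \<in> hom C x y" "is_zero_arrow C e"
proof -
 obtain b inn prj where "is_square_biproduct C x b inn prj" using biproduct_ex assms(1) by blast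
 hence "is_zero_arrow C (prj (\<not> True) \<cdot> inn True)" by (rule biproductD(4))
 then obtain z where "is_zero C z" by (auto simp: is_zero_arrow_def)
 thus thesis using zero_arrow_ex[OF _ assms] that by blast
qed

text \<open>Arrows out of a biproduct are compared on the two summands; on the one where both vanish
  they agree because zero arrows are unique.\<close>

lemma biproduct_prj_eqI:
 assumes "is_square_biproduct C y b inn prj" "k \<in> hom C b y'"
  "k \<cdot> inn s = r" "is_zero_arrow C (k \<cdot> inn (\<not> s))"
 shows "k = r \<cdot> prj s"
proof (rule coproduct_eqI[OF biproductD(1)[OF assms(1)] assms(2)])
 note b = biproductD[OF assms(1)]
 have r: "r \<in> hom C y y'" using comp_hom[OF b(6) assms(2)] assms(3) by blast
 show rp: "r \<cdot> prj s \<in> hom C b y'" using comp_hom[OF b(7) r] .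
 fix t :: bool
 show "k \<cdot> inn t = (r \<cdot> prj s) \<cdot> inn t"
 proof (cases "t = s")
  case True
  thus ?thesis using comp_assoc[OF b(6) b(7) r, of s s] b(3)[of s] assms(3) r ident_right by simp
 next
  case False
  hence t: "t = (\<not> s)" by auto
  have "(r \<cdot> prj s) \<cdot> inn t = r \<cdot> (prj s \<cdot> inn t)" using comp_assoc[OF b(6) b(7) r] .
  moreover have "is_zero_arrow C (prj s \<cdot> inn t)" using b(4)[of t] t by simp
  ultimately have "is_zero_arrow C ((r \<cdot> prj s) \<cdot> inn t)"
   using zero_arrow_comp[OF comp_hom[OF b(6) b(7)] r] by simp
  thus ?thesis
   using zero_arrow_unique[of "k \<cdot> inn t" "(r \<cdot> prj s) \<cdot> inn t" y y'] assms(4) t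
    comp_hom[OF b(6) assms(2)] comp_hom[OF b(6) rp] by simp
 qed
qed

text \<open>The comparison from one biproduct to another, defined on the summands, also respects the
  projections, which are determined by their values on summands, and the codiagonals. Hence the sum
  can be computed in any one biproduct.\<close>

lemma is_sum_iff:
 assumes "is_square_biproduct C y b inn prj" "c \<in> hom C b y" "\<And>s. c \<cdot> inn s = Ident C y"
  "k \<in> hom C x b"
 shows "is_sum C (prj True \<cdot> k) (prj False \<cdot> k) h \<longleftrightarrow> h = c \<cdot> k"
proof -
 note b = biproductD[OF assms(1)]
 let ?f = "prj True \<cdot> k" and ?g = "prj False \<cdot> k"
 have f: "?f \<in> hom C x y" "?g \<in> hom C x y" using comp_hom[OF assms(4) b(7)] by blast+
 show ?thesis
 proof
  assume "h = c \<cdot> k"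
  moreover have "?f \<in> Arr C" "?g \<in> hom C (Dom C ?f) (Cod C ?f)" "Dom C ?f = x" "Cod C ?f = y"
   using f by (auto simp: hom_def)
  moreover have "is_square_biproduct C y b inn prj \<and> k \<in> hom C x b \<and> prj True \<cdot> k = ?f \<and>
    prj False \<cdot> k = ?g \<and> c \<in> hom C b y \<and> (\<forall>s. c \<cdot> inn s = Ident C y) \<and> h = c \<cdot> k"
   using assms \<open>h = c \<cdot> k\<close> by simp
  ultimately show "is_sum C ?f ?g h"
   unfolding is_sum_def by metis
 next
  assume "is_sum C ?f ?g h"
  moreover have "Dom C ?f = x" "Cod C ?f = y" using f by (auto simp: hom_def)
  ultimately obtain b' inn' prj' k' c' where b': "is_square_biproduct C y b' inn' prj'"
   and k': "k' \<in> hom C x b'" "prj' True \<cdot> k' = ?f" "prj' False \<cdot> k' = ?g"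
   and c': "c' \<in> hom C b' y" "\<And>s. c' \<cdot> inn' s = Ident C y" and h: "h = c' \<cdot> k'"
   unfolding is_sum_def by auto
  note bb = biproductD[OF b']
  obtain \<phi> where \<phi>: "\<phi> \<in> hom C b b'" "\<And>s. \<phi> \<cdot> inn s = inn' s"
   using coproduct_desc[OF b(1) bb(5), of inn'] bb(6) by auto
  have "prj' s \<cdot> \<phi> = Ident C y \<cdot> prj s" for s
  proof (rule biproduct_prj_eqI[OF assms(1) comp_hom[OF \<phi>(1) bb(7)]])
   show "(prj' s \<cdot> \<phi>) \<cdot> inn s = Ident C y"
    using comp_assoc[OF b(6) \<phi>(1) bb(7)] \<phi>(2) bb(3) by simp
   have "(prj' s \<cdot> \<phi>) \<cdot> inn (\<not> s) = prj' s \<cdot> inn' (\<not> s)"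
    using comp_assoc[OF b(6) \<phi>(1) bb(7)] \<phi>(2) by simp
   thus "is_zero_arrow C ((prj' s \<cdot> \<phi>) \<cdot> inn (\<not> s))" using bb(4)[of "\<not> s"] by simp
  qed
  hence p: "prj' s \<cdot> \<phi> = prj s" for s using b(7)[of s] ident_left by simp
  have "\<phi> \<cdot> k = k'"
  proof (rule product_eqI[OF bb(2) comp_hom[OF assms(4) \<phi>(1)] k'(1)])
   fix s :: bool
   have "prj' s \<cdot> (\<phi> \<cdot> k) = prj s \<cdot> k" using comp_assoc[OF assms(4) \<phi>(1) bb(7)] p by metis
   thus "prj' s \<cdot> (\<phi> \<cdot> k) = prj' s \<cdot> k'" using k' by (cases s) auto
  qed
  moreover have "c' \<cdot> \<phi> = c"
  proof (rule coproduct_eqI[OF b(1) comp_hom[OF \<phi>(1) c'(1)] assms(2)])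
   show "(c' \<cdot> \<phi>) \<cdot> inn s = c \<cdot> inn s" for s
    using comp_assoc[OF b(6) \<phi>(1) c'(1)] \<phi>(2) c'(2) assms(3) by simp
  qed
  ultimately show "h = c \<cdot> k" using h comp_assoc[OF assms(4) \<phi>(1) c'(1)] by simp
 qed
qed

lemma codiagonal_ex:
 assumes "is_square_biproduct C y b inn prj"
 obtains c where "c \<in> hom C b y" "\<And>s. c \<cdot> inn s = Ident C y"
proof -
 note b = biproductD[OF assms]
 show thesis using coproduct_desc[OF b(1), of y "\<lambda>_. Ident C y"] that b(8) ident_hom by auto
qed

lemma biproductE:
 assumes "f \<in> hom C x y"
 obtains b inn prj c where "is_square_biproduct C y b inn prj" "c \<in> hom C b y" "\<And>s. c \<cdot> inn s = Ident C y"
proof -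
 have "y \<in> Obj C" using hom_objs[OF assms] by simp
 then obtain b inn prj where b: "is_square_biproduct C y b inn prj" using biproduct_ex by blast
 thus thesis using codiagonal_ex[OF b] that[OF b] by blast
qed

lemma pair_ex:
 assumes "is_square_biproduct C y b inn prj" "f \<in> hom C x y" "g \<in> hom C x y"
 obtains k where "k \<in> hom C x b" "prj True \<cdot> k = f" "prj False \<cdot> k = g"
proof -
 have "x \<in> Obj C" using hom_objs[OF assms(2)] by simp
 moreover have "(if s then f else g) \<in> hom C x y" for s using assms(2,3) by simp
 ultimately obtain k where k: "k \<in> hom C x b" "\<And>s. s \<in> UNIV \<Longrightarrow> prj s \<cdot> k = (if s then f else g)"
  using product_pair[OF biproductD(2)[OF assms(1)], of x "\<lambda>s. if s then f else g"] by metis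
 thus thesis using that[of k] k(2)[of True] k(2)[of False] by simp
qed

definition sum_arr (infixl \<open>\<oplus>\<close> 65) where "f \<oplus> g = (THE h. is_sum C f g h)"

lemma is_sum_plus:
 assumes "f \<in> hom C x y" "g \<in> hom C x y"
 shows "is_sum C f g h \<longleftrightarrow> h = f \<oplus> g" "f \<oplus> g \<in> hom C x y"
proof -
 obtain b inn prj c where b: "is_square_biproduct C y b inn prj" and c: "c \<in> hom C b y" "\<And>s. c \<cdot> inn s = Ident C y"
  by (rule biproductE[OF assms(1)]) blast
 obtain k where k: "k \<in> hom C x b" "prj True \<cdot> k = f" "prj False \<cdot> k = g" using pair_ex[OF b assms] .
 have *: "is_sum C f g h \<longleftrightarrow> h = c \<cdot> k" for h using is_sum_iff[OF b c k(1)] k(2,3) by simp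
 hence "f \<oplus> g = c \<cdot> k" unfolding sum_arr_def by (intro the_equality) simp_all
 thus "is_sum C f g h \<longleftrightarrow> h = f \<oplus> g" "f \<oplus> g \<in> hom C x y" using * comp_hom[OF k(1) c(1)] by auto
qed

lemma plus_eq:
 assumes "is_square_biproduct C y b inn prj" "c \<in> hom C b y" "\<And>s. c \<cdot> inn s = Ident C y" "k \<in> hom C x b"
 shows "(prj True \<cdot> k) \<oplus> (prj False \<cdot> k) = c \<cdot> k"
proof -
 have *: "prj s \<cdot> k \<in> hom C x y" for s using comp_hom[OF assms(4) biproductD(7)[OF assms(1)]] .
 show ?thesis using is_sum_plus(1)[OF * *, of True False "c \<cdot> k"] is_sum_iff[OF assms, of "c \<cdot> k"] by simp
qed

lemma plus_comp_right:
 assumes "f \<in> hom C x y" "g \<in> hom C x y" "r \<in> hom C w x"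
 shows "(f \<oplus> g) \<cdot> r = (f \<cdot> r) \<oplus> (g \<cdot> r)"
proof -
 obtain b inn prj c where b: "is_square_biproduct C y b inn prj" and c: "c \<in> hom C b y" "\<And>s. c \<cdot> inn s = Ident C y"
  by (rule biproductE[OF assms(1)]) blast
 obtain k where k: "k \<in> hom C x b" "prj True \<cdot> k = f" "prj False \<cdot> k = g" using pair_ex[OF b assms(1,2)] .
 have "prj s \<cdot> (k \<cdot> r) = (prj s \<cdot> k) \<cdot> r" for s
  using comp_assoc[OF assms(3) k(1) biproductD(7)[OF b]] by simp
 hence "(f \<cdot> r) \<oplus> (g \<cdot> r) = c \<cdot> (k \<cdot> r)"
  using plus_eq[OF b c comp_hom[OF assms(3) k(1)]] k by simp
 moreover have "f \<oplus> g = c \<cdot> k" using plus_eq[OF b c k(1)] k by simp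
 ultimately show ?thesis using comp_assoc[OF assms(3) k(1) c(1)] by simp
qed

text \<open>\<open>r\<close> induces summandwise an arrow \<open>R\<close> between the biproducts.
  It commutes with projections and codiagonals, so it carries one construction of a sum to the
  other.\<close>

lemma plus_comp_left:
 assumes "f \<in> hom C x y" "g \<in> hom C x y" "r \<in> hom C y z"
 shows "r \<cdot> (f \<oplus> g) = (r \<cdot> f) \<oplus> (r \<cdot> g)"
proof -
 obtain b inn prj c where b: "is_square_biproduct C y b inn prj" and c: "c \<in> hom C b y" "\<And>s. c \<cdot> inn s = Ident C y"
  by (rule biproductE[OF assms(1)]) blast
 obtain b' inn' prj' c' where b': "is_square_biproduct C z b' inn' prj'" and c': "c' \<in> hom C b' z" "\<And>s. c' \<cdot> inn' s = Ident C z"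
  by (rule biproductE[OF assms(3)]) blast
 obtain k where k: "k \<in> hom C x b" "prj True \<cdot> k = f" "prj False \<cdot> k = g" using pair_ex[OF b assms(1,2)] .
 note B = biproductD[OF b] and B' = biproductD[OF b']
 obtain R where R: "R \<in> hom C b b'" "\<And>s. R \<cdot> inn s = inn' s \<cdot> r"
  using coproduct_desc[OF B(1) B'(5), of "\<lambda>s. inn' s \<cdot> r"] comp_hom[OF assms(3) B'(6)] by auto
 have pR: "prj' s \<cdot> R = r \<cdot> prj s" for s
 proof (rule biproduct_prj_eqI[OF b comp_hom[OF R(1) B'(7)]])
  have *: "(prj' s \<cdot> R) \<cdot> inn t = (prj' s \<cdot> inn' t) \<cdot> r" for t
   using comp_assoc[OF B(6) R(1) B'(7)] comp_assoc[OF assms(3) B'(6) B'(7)] R(2) by simp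
  show "(prj' s \<cdot> R) \<cdot> inn s = r" using * B'(3) assms(3) ident_left by simp
  show "is_zero_arrow C ((prj' s \<cdot> R) \<cdot> inn (\<not> s))"
   using * zero_arrow_comp[OF assms(3) comp_hom[OF B'(6) B'(7)]] B'(4)[of "\<not> s"] by simp
 qed
 have cR: "c' \<cdot> R = r \<cdot> c"
 proof (rule coproduct_eqI[OF B(1) comp_hom[OF R(1) c'(1)] comp_hom[OF c(1) assms(3)]])
  show "(c' \<cdot> R) \<cdot> inn s = (r \<cdot> c) \<cdot> inn s" for s
   using comp_assoc[OF B(6) R(1) c'(1)] comp_assoc[OF B(6) c(1) assms(3)] comp_assoc[OF assms(3) B'(6) c'(1)]
    R(2) c(2) c'(2) assms(3) ident_left ident_right by simp
 qed
 have "prj' s \<cdot> (R \<cdot> k) = r \<cdot> (prj s \<cdot> k)" for s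
  using comp_assoc[OF k(1) R(1) B'(7)] comp_assoc[OF k(1) B(7) assms(3)] pR by metis
 hence "(r \<cdot> f) \<oplus> (r \<cdot> g) = c' \<cdot> (R \<cdot> k)"
  using plus_eq[OF b' c' comp_hom[OF k(1) R(1)]] k by simp
 also have "\<dots> = r \<cdot> (c \<cdot> k)"
  using comp_assoc[OF k(1) R(1) c'(1)] comp_assoc[OF k(1) c(1) assms(3)] cR by metis
 finally show ?thesis using plus_eq[OF b c k(1)] k by simp
qed

lemma plus_zero:
 assumes "f \<in> hom C x y" "e \<in> hom C x y" "is_zero_arrow C e"
 shows "f \<oplus> e = f" "e \<oplus> f = f"
proof -
 obtain b inn prj c where b: "is_square_biproduct C y b inn prj" and c: "c \<in> hom C b y" "\<And>s. c \<cdot> inn s = Ident C y"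
  by (rule biproductE[OF assms(1)]) blast
 note B = biproductD[OF b] and i = comp_hom[OF assms(1) B(6)]
 have pk: "prj t \<cdot> (inn s \<cdot> f) = (prj t \<cdot> inn s) \<cdot> f" for s t
  using comp_assoc[OF assms(1) B(6) B(7)] by simp
 have e: "prj (\<not> s) \<cdot> (inn s \<cdot> f) = e" for s
  using zero_arrow_unique[OF zero_arrow_comp(1)[OF assms(1) comp_hom[OF B(6) B(7)]] assms(3) _ assms(2), of "\<not> s" s]
   B(4)[of s] comp_hom[OF assms(1) comp_hom[OF B(6) B(7)]] pk by simp
 have f: "prj s \<cdot> (inn s \<cdot> f) = f" "c \<cdot> (inn s \<cdot> f) = f" for s
  using pk B(3) comp_assoc[OF assms(1) B(6) c(1)] c(2) ident_left[OF assms(1)] by simp_all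
 show "f \<oplus> e = f" "e \<oplus> f = f"
  using plus_eq[OF b c i, of True] plus_eq[OF b c i, of False] f e[of True] e[of False] by simp_all
qed

text \<open>Compute the codiagonal of the sum of \<open>(a, c)\<close> and \<open>(b, d)\<close> in two ways.\<close>

lemma plus_interchange:
 assumes "a \<in> hom C x y" "b \<in> hom C x y" "c \<in> hom C x y" "d \<in> hom C x y"
 shows "(a \<oplus> b) \<oplus> (c \<oplus> d) = (a \<oplus> c) \<oplus> (b \<oplus> d)"
proof -
 obtain B inn prj q where b: "is_square_biproduct C y B inn prj" and q: "q \<in> hom C B y" "\<And>s. q \<cdot> inn s = Ident C y"
  by (rule biproductE[OF assms(1)]) blast
 obtain k where k: "k \<in> hom C x B" "prj True \<cdot> k = a" "prj False \<cdot> k = c" using pair_ex[OF b assms(1,3)] .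
 obtain l where l: "l \<in> hom C x B" "prj True \<cdot> l = b" "prj False \<cdot> l = d" using pair_ex[OF b assms(2,4)] .
 note P = biproductD(7)[OF b]
 have "prj True \<cdot> (k \<oplus> l) = a \<oplus> b" "prj False \<cdot> (k \<oplus> l) = c \<oplus> d"
  using plus_comp_left[OF k(1) l(1) P] k l by simp_all
 hence "(a \<oplus> b) \<oplus> (c \<oplus> d) = q \<cdot> (k \<oplus> l)"
  using plus_eq[OF b q is_sum_plus(2)[OF k(1) l(1)]] by simp
 also have "\<dots> = (a \<oplus> c) \<oplus> (b \<oplus> d)"
  using plus_comp_left[OF k(1) l(1) q(1)] plus_eq[OF b q k(1)] plus_eq[OF b q l(1)] k l by simp
 finally show ?thesis .
qed

text \<open>The Eckmann-Hilton argument: put a zero arrow in front of \<open>h\<close> and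
  interchange it with \<open>g\<close>.\<close>

lemma plus_assoc:
 assumes "f \<in> hom C x y" "g \<in> hom C x y" "h \<in> hom C x y"
 shows "(f \<oplus> g) \<oplus> h = f \<oplus> (g \<oplus> h)"
proof -
 obtain e where e: "e \<in> hom C x y" "is_zero_arrow C e" using zero_ex hom_objs[OF assms(1)] by blast
 show ?thesis
  using plus_interchange[OF assms(1,2) e(1) assms(3)] plus_zero(2)[OF assms(3) e] plus_zero(1)[OF assms(1) e]
  by simp
qed

end

text \<open>The axiom speaks of identities because composing an arrow with the negative of an
  identity gives a negative of that arrow.\<close>

locale additive = semiadditive +
 assumes negative_ex: "y \<in> Obj C \<Longrightarrow> \<exists>n e. n \<in> hom C y y \<and> is_sum C n (Ident C y) e \<and> is_zero_arrow C e"
begin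

lemma difference_ex1:
 assumes "f \<in> hom C x y" "g \<in> hom C x y"
 shows "\<exists>!d. d \<in> hom C x y \<and> d \<oplus> g = f"
proof -
 have y: "y \<in> Obj C" using hom_objs[OF assms(1)] by simp
 obtain n e where n: "n \<in> hom C y y" "is_sum C n (Ident C y) e" "is_zero_arrow C e"
  using negative_ex[OF y] by blast
 have e: "e = n \<oplus> Ident C y" "e \<in> hom C y y"
  using is_sum_plus[OF n(1) ident_hom[OF y]] n(2) by auto
 have ng: "n \<cdot> g \<in> hom C x y" using comp_hom[OF assms(2) n(1)] .
 have z: "is_zero_arrow C (n \<cdot> g \<oplus> g)" "n \<cdot> g \<oplus> g \<in> hom C x y"
  using plus_comp_right[OF n(1) ident_hom[OF y] assms(2)] e n(3) zero_arrow_comp[OF assms(2) e(2)]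
   ident_left[OF assms(2)] is_sum_plus(2)[OF ng assms(2)] by auto
 have 1: "(f \<oplus> n \<cdot> g) \<oplus> g = f"
  using plus_assoc[OF assms(1) ng assms(2)] plus_zero(1)[OF assms(1) z(2,1)] by simp
 \<comment> \<open>Uniqueness calls for the negative on the other side; this instance of
   commutativity is obtained by interchange with the zero arrow \<open>p\<close>.\<close>
 have z': "is_zero_arrow C (g \<oplus> n \<cdot> g)" "g \<oplus> n \<cdot> g \<in> hom C x y"
 proof -
  have "n \<cdot> e \<in> hom C y y" "is_zero_arrow C (n \<cdot> e)"
   using comp_hom[OF e(2) n(1)] zero_arrow_comp[OF e(2) n(1)] n(3) by auto
  obtain p where p: "p \<in> hom C x y" "is_zero_arrow C p" using zero_ex hom_objs[OF assms(1)] by blast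
  have "g \<oplus> n \<cdot> g = (p \<oplus> g) \<oplus> (n \<cdot> g \<oplus> p)"
   using plus_zero(2)[OF assms(2) p] plus_zero(1)[OF ng p] by simp
  also have "\<dots> = (p \<oplus> n \<cdot> g) \<oplus> (g \<oplus> p)" using plus_interchange[OF p(1) assms(2) ng p(1)] .
  also have "\<dots> = n \<cdot> g \<oplus> g" using plus_zero(2)[OF ng p] plus_zero(1)[OF assms(2) p] by simp
  finally show "is_zero_arrow C (g \<oplus> n \<cdot> g)" "g \<oplus> n \<cdot> g \<in> hom C x y" using z by simp_all
 qed
 have "d = f \<oplus> n \<cdot> g" if d: "d \<in> hom C x y" "d \<oplus> g = f" for d
  using plus_assoc[OF d(1) assms(2) ng] d(2) plus_zero(1)[OF d(1) z'(2,1)] by simp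
 thus ?thesis using 1 is_sum_plus(2)[OF assms(1) ng] by blast
qed

definition diff_arr (infixl \<open>\<ominus>\<close> 65) where "f \<ominus> g = minus_arr C f g"

text \<open>Existence and uniqueness of differences make the definite description in
  \<open>minus_arr\<close> denote. Subtraction is from here on handled through the equation
  \<open>d \<oplus> g = f\<close>.\<close>

lemma minus_eq_iff:
 assumes "f \<in> hom C x y" "g \<in> hom C x y"
 shows "f \<ominus> g \<in> hom C x y" "d \<in> hom C x y \<Longrightarrow> f \<ominus> g = d \<longleftrightarrow> d \<oplus> g = f"
proof -
 obtain d where d: "d \<in> hom C x y" "d \<oplus> g = f" "\<And>e. e \<in> hom C x y \<Longrightarrow> e \<oplus> g = f \<Longrightarrow> e = d"
  using difference_ex1[OF assms] by metis
 have "is_sum C e g f \<Longrightarrow> e \<in> hom C x y" for e using assms unfolding is_sum_def by (auto simp: hom_def)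
 hence "is_sum C e g f \<longleftrightarrow> e = d" for e
  using is_sum_plus(1)[OF _ assms(2), of e f] d by metis
 hence "f \<ominus> g = d" unfolding diff_arr_def minus_arr_def by (intro the_equality) simp_all
 thus "f \<ominus> g \<in> hom C x y" using d(1) by simp
 show "f \<ominus> g = e \<longleftrightarrow> e \<oplus> g = f" if "e \<in> hom C x y" for e
  using \<open>f \<ominus> g = d\<close> d that by metis
qed

lemma minus_comp_left:
 assumes "f \<in> hom C x y" "g \<in> hom C x y" "r \<in> hom C y z"
 shows "r \<cdot> (f \<ominus> g) = (r \<cdot> f) \<ominus> (r \<cdot> g)"
proof -
 have fg: "f \<ominus> g \<in> hom C x y" "(f \<ominus> g) \<oplus> g = f" using minus_eq_iff[OF assms(1,2)] by auto
 have "(r \<cdot> (f \<ominus> g)) \<oplus> (r \<cdot> g) = r \<cdot> f" using plus_comp_left[OF fg(1) assms(2,3)] fg(2) by simp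
 thus ?thesis
  using minus_eq_iff(2)[OF comp_hom[OF assms(1,3)] comp_hom[OF assms(2,3)] comp_hom[OF fg(1) assms(3)]] by simp
qed

lemma minus_comp_right:
 assumes "f \<in> hom C x y" "g \<in> hom C x y" "r \<in> hom C w x"
 shows "(f \<ominus> g) \<cdot> r = (f \<cdot> r) \<ominus> (g \<cdot> r)"
proof -
 have fg: "f \<ominus> g \<in> hom C x y" "(f \<ominus> g) \<oplus> g = f" using minus_eq_iff[OF assms(1,2)] by auto
 have "((f \<ominus> g) \<cdot> r) \<oplus> (g \<cdot> r) = f \<cdot> r" using plus_comp_right[OF fg(1) assms(2,3)] fg(2) by simp
 thus ?thesis
  using minus_eq_iff(2)[OF comp_hom[OF assms(3,1)] comp_hom[OF assms(3,2)] comp_hom[OF assms(3) fg(1)]] by simp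
qed

lemma minus_self:
 assumes "f \<in> hom C x y"
 shows "is_zero_arrow C (f \<ominus> f)"
proof -
 obtain p where p: "p \<in> hom C x y" "is_zero_arrow C p" using zero_ex hom_objs[OF assms(1)] by blast
 have "f \<ominus> f = p" using minus_eq_iff(2)[OF assms assms p(1)] plus_zero(2)[OF assms p] by simp
 thus ?thesis using p by simp
qed

end

section \<open>Preorders, monotone maps and the cells between them\<close>

section \<open>Thin categories\<close>

text \<open>
 All shapes in the proof are thin categories, i.e. preorders. Since \<open>D(K)\<close> behaves like a category of
 presheaves on \<open>K\<close>, they are ordered so that the objects of \<open>D(K)\<close> become covariant: \<open>le K x y\<close>
 means that there is an arrow \<open>y \<rightarrow> x\<close>.
\<close>

definition thin :: "('o, 'a) cat \<Rightarrow> bool"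
 where "thin K \<longleftrightarrow> category K \<and> (\<forall>x y. \<forall>f \<in> hom K x y. \<forall>g \<in> hom K x y. f = g)"

definition le :: "('o, 'a) cat \<Rightarrow> 'o \<Rightarrow> 'o \<Rightarrow> bool"
 where "le K x y \<longleftrightarrow> hom K y x \<noteq> {}"

definition the_arr :: "('o, 'a) cat \<Rightarrow> 'o \<Rightarrow> 'o \<Rightarrow> 'a"
 where "the_arr K x y = (THE f. f \<in> hom K x y)"

lemma thin_category: "thin K \<Longrightarrow> category K"
 by (simp add: thin_def)

lemma thin_eqI: "thin K \<Longrightarrow> f \<in> hom K x y \<Longrightarrow> g \<in> hom K x y \<Longrightarrow> f = g"
 unfolding thin_def by blast

lemma thin_arr_eqI:
 "thin K \<Longrightarrow> f \<in> Arr K \<Longrightarrow> g \<in> Arr K \<Longrightarrow> Dom K f = Dom K g \<Longrightarrow> Cod K f = Cod K g \<Longrightarrow> f = g"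
 by (rule thin_eqI) (auto simp: hom_def)

lemma the_arr_eq: "thin K \<Longrightarrow> f \<in> hom K x y \<Longrightarrow> the_arr K x y = f"
 unfolding the_arr_def by (rule the_equality) (auto intro: thin_eqI)

lemma the_arr_hom: "thin K \<Longrightarrow> le K x y \<Longrightarrow> the_arr K y x \<in> hom K y x"
 unfolding le_def using the_arr_eq by (metis all_not_in_conv)

lemma le_objs: "thin K \<Longrightarrow> le K x y \<Longrightarrow> x \<in> Obj K \<and> y \<in> Obj K"
 unfolding le_def using category.hom_objs[OF thin_category, of K] by (metis ex_in_conv)

lemma le_refl: "thin K \<Longrightarrow> x \<in> Obj K \<Longrightarrow> le K x x"
 unfolding le_def using category.ident_hom[OF thin_category, of K x] by auto

lemma le_trans: "thin K \<Longrightarrow> le K x y \<Longrightarrow> le K y z \<Longrightarrow> le K x z"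
 unfolding le_def using category.comp_hom[OF thin_category, of K] by (metis ex_in_conv)

lemma thin_op_cat: "thin K \<Longrightarrow> thin (op_cat K)"
 unfolding thin_def using category_op_cat by (auto simp: hom_op_cat)

lemma le_op_cat: "le (op_cat K) x y \<longleftrightarrow> le K y x"
 by (simp add: le_def hom_op_cat)

definition shape :: "('o, 'a, 'p, 'b) ftor \<Rightarrow> bool"
 where "shape u \<longleftrightarrow> is_ftor u \<and> thin (Src u) \<and> thin (Tgt u)"

lemma shapeD: "shape u \<Longrightarrow> is_ftor u" "shape u \<Longrightarrow> thin (Src u)" "shape u \<Longrightarrow> thin (Tgt u)"
 by (simp_all add: shape_def)

lemma shape_obj: "shape u \<Longrightarrow> x \<in> Obj (Src u) \<Longrightarrow> FO u x \<in> Obj (Tgt u)"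
 by (simp add: shape_def ftorD(3))

lemma shape_le: "shape u \<Longrightarrow> le (Src u) x y \<Longrightarrow> le (Tgt u) (FO u x) (FO u y)"
 unfolding le_def shape_def using ftorD(4) by (metis ex_in_conv)

lemma shape_id: "thin K \<Longrightarrow> shape (id_ftor K)"
 by (simp add: shape_def is_ftor_id thin_category)

lemma shape_comp: "shape u \<Longrightarrow> shape v \<Longrightarrow> Src v = Tgt u \<Longrightarrow> shape (v \<circ>\<^sub>F u)"
 by (simp add: shape_def is_ftor_comp)

lemma shape_mk_ftor:
 assumes "thin K" "thin L" "\<And>x. x \<in> Obj K \<Longrightarrow> h x \<in> Obj L"
  "\<And>f x y. f \<in> hom K x y \<Longrightarrow> v f \<in> hom L (h x) (h y)"
 shows "shape (mk_ftor K L h v)"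
proof -
 interpret K: category K using thin_category assms(1) .
 interpret L: category L using thin_category assms(2) .
 have "is_ftor (mk_ftor K L h v)"
 proof (rule mk_ftorI)
  show "v (Ident K x) = Ident L (h x)" if "x \<in> Obj K" for x
   using thin_eqI[OF assms(2) assms(4)[OF K.ident_hom[OF that]] L.ident_hom[OF assms(3)[OF that]]] .
  show "v (g \<cdot>[K] f) = v g \<cdot>[L] v f" if "f \<in> hom K x y" "g \<in> hom K y z" for f g x y z
   using thin_eqI[OF assms(2) assms(4)[OF K.comp_hom[OF that]] L.comp_hom[OF assms(4)[OF that(1)] assms(4)[OF that(2)]]] .
  show "category K" "category L" by unfold_locales
 qed (use assms in auto)
 thus ?thesis using assms(1,2) by (simp add: shape_def)
qed

lemma shape_eqI:
 assumes "shape u" "shape v" "Src u = Src v" "Tgt u = Tgt v" "\<And>x. x \<in> Obj (Src u) \<Longrightarrow> FO u x = FO v x"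
 shows "u = v"
proof (rule ftor_eqI)
 interpret K: category "Src u" using thin_category shapeD(2)[OF assms(1)] .
 fix f assume f: "f \<in> Arr (Src u)"
 hence fh: "f \<in> hom (Src u) (Dom (Src u) f) (Cod (Src u) f)" by (simp add: hom_def)
 show "FA u f = FA v f"
  using thin_eqI[OF shapeD(3)[OF assms(1)] ftorD(4)[OF shapeD(1)[OF assms(1)] fh], of "FA v f"]
   ftorD(4)[OF shapeD(1)[OF assms(2)], of f] fh assms(3-5) K.hom_objs[OF fh] by simp
qed (use assms shapeD(1) in auto)

text \<open>Between thin categories a functor is a monotone map on objects; its action on arrows is
  forced.\<close>

definition mono_ftor :: "('o, 'a) cat \<Rightarrow> ('p, 'b) cat \<Rightarrow> ('o \<Rightarrow> 'p) \<Rightarrow> ('o, 'a, 'p, 'b) ftor"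
 where "mono_ftor K L h = mk_ftor K L h (\<lambda>f. the_arr L (h (Dom K f)) (h (Cod K f)))"

lemma mono_ftor_simps [simp]:
 "Src (mono_ftor K L h) = K" "Tgt (mono_ftor K L h) = L" "x \<in> Obj K \<Longrightarrow> FO (mono_ftor K L h) x = h x"
 by (simp_all add: mono_ftor_def)

lemma shape_mono_ftor:
 assumes "thin K" "thin L" "\<And>x. x \<in> Obj K \<Longrightarrow> h x \<in> Obj L"
  "\<And>x y. x \<in> Obj K \<Longrightarrow> y \<in> Obj K \<Longrightarrow> le K x y \<Longrightarrow> le L (h x) (h y)"
 shows "shape (mono_ftor K L h)"
 unfolding mono_ftor_def
proof (rule shape_mk_ftor)
 interpret K: category K using thin_category assms(1) .
 fix f x y assume f: "f \<in> hom K x y"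
 hence "le K y x" by (auto simp: le_def)
 hence "le L (h y) (h x)" using assms(4) K.hom_objs[OF f] by simp
 thus "the_arr L (h (Dom K f)) (h (Cod K f)) \<in> hom L (h x) (h y)"
  using the_arr_hom[OF assms(2)] f by (simp add: hom_def)
qed (use assms in auto)

text \<open>The direction follows \<open>le\<close>: \<open>fle u v\<close> stands for a
  transformation from \<open>v\<close> to \<open>u\<close>, which the contravariant
  \<open>pull2\<close> turns into one from restriction along \<open>u\<close> to restriction along
  \<open>v\<close>.\<close>

definition fle :: "('o, 'a, 'p, 'b) ftor \<Rightarrow> ('o, 'a, 'p, 'b) ftor \<Rightarrow> bool"
 where "fle u v \<longleftrightarrow> shape u \<and> shape v \<and> Src u = Src v \<and> Tgt u = Tgt v \<and>
  (\<forall>x \<in> Obj (Src u). le (Tgt u) (FO u x) (FO v x))"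

definition cell :: "('o, 'a, 'p, 'b) ftor \<Rightarrow> ('o, 'a, 'p, 'b) ftor \<Rightarrow> ('o, 'a, 'p, 'b) ntrans"
 where "cell u v = mk_ntrans v u (\<lambda>x. the_arr (Tgt u) (FO v x) (FO u x))"

lemma fleI:
 assumes "shape u" "shape v" "Src u = Src v" "Tgt u = Tgt v"
  "\<And>x. x \<in> Obj (Src u) \<Longrightarrow> le (Tgt u) (FO u x) (FO v x)"
 shows "fle u v"
 using assms by (simp add: fle_def)

lemma fleD:
 assumes "fle u v"
 shows "shape u" "shape v" "Src u = Src v" "Tgt u = Tgt v"
  "x \<in> Obj (Src u) \<Longrightarrow> le (Tgt u) (FO u x) (FO v x)"
 using assms unfolding fle_def by blast+

lemma fle_refl: "shape u \<Longrightarrow> fle u u"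
 by (simp add: fle_def le_refl shape_obj shapeD)

lemma fle_trans:
 assumes "fle u v" "fle v w"
 shows "fle u w"
proof (rule fleI)
 note uv = fleD[OF assms(1)] and vw = fleD[OF assms(2)]
 show "le (Tgt u) (FO u x) (FO w x)" if "x \<in> Obj (Src u)" for x
  using le_trans[OF shapeD(3)[OF uv(1)] uv(5)[OF that], of "FO w x"] vw(5)[of x] that uv(3,4) by simp
qed (use fleD[OF assms(1)] fleD[OF assms(2)] in simp_all)

lemma fle_comp_right:
 assumes "fle u v" "shape w" "Tgt w = Src u"
 shows "fle (u \<circ>\<^sub>F w) (v \<circ>\<^sub>F w)"
 using fleD[OF assms(1)] assms(2,3) shape_obj[OF assms(2)] by (intro fleI shape_comp) simp_all

lemma fle_comp_left:
 assumes "fle u v" "shape w" "Src w = Tgt u"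
 shows "fle (w \<circ>\<^sub>F u) (w \<circ>\<^sub>F v)"
 using fleD[OF assms(1)] assms(2,3) shape_le[OF assms(2)] by (intro fleI shape_comp) simp_all

lemma ntrans_cell:
 assumes "fle u v"
 shows "is_ntrans (cell u v)"
 unfolding cell_def
proof (rule mk_ntransI)
 note uv = fleD[OF assms]
 show "is_ftor v" "is_ftor u" "Src u = Src v" "Tgt u = Tgt v" using uv shapeD by auto
 interpret K: category "Src u" using thin_category shapeD(2)[OF uv(1)] .
 interpret L: category "Tgt u" using thin_category shapeD(3)[OF uv(1)] .
 have c: "the_arr (Tgt u) (FO v x) (FO u x) \<in> hom (Tgt u) (FO v x) (FO u x)" if "x \<in> Obj (Src u)" for x
  using the_arr_hom[OF shapeD(3)[OF uv(1)] uv(5)[OF that]] .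
 thus "the_arr (Tgt u) (FO v x) (FO u x) \<in> hom (Tgt v) (FO v x) (FO u x)" if "x \<in> Obj (Src v)" for x
  using that uv by simp
 show "the_arr (Tgt u) (FO v y) (FO u y) \<cdot>[Tgt v] FA v f = FA u f \<cdot>[Tgt v] the_arr (Tgt u) (FO v x) (FO u x)"
  if f: "f \<in> hom (Src v) x y" for f x y
 proof -
  have f': "f \<in> hom (Src u) x y" using f uv by simp
  have "FA v f \<in> hom (Tgt u) (FO v x) (FO v y)" "FA u f \<in> hom (Tgt u) (FO u x) (FO u y)"
   using ftorD(4)[OF shapeD(1)[OF uv(2)] f] ftorD(4)[OF shapeD(1)[OF uv(1)] f'] uv by auto
  thus ?thesis
   using thin_eqI[OF shapeD(3)[OF uv(1)] L.comp_hom[OF _ c[of y]] L.comp_hom[OF c[of x]]]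
    K.hom_objs[OF f'] uv by simp
 qed
qed

text \<open>Components in a thin category leave no choice. Identities between 2-cells thereby become
  identities between cells named by their ends.\<close>

lemma cell_eqI:
 assumes "is_ntrans \<alpha>" "fle u v" "NDom \<alpha> = v" "NCod \<alpha> = u"
 shows "\<alpha> = cell u v"
proof (rule ntrans_eqI[OF assms(1) ntrans_cell[OF assms(2)]])
 note uv = fleD[OF assms(2)]
 fix x assume x: "x \<in> Obj (Src (NDom \<alpha>))"
 hence "NC \<alpha> x \<in> hom (Tgt u) (FO v x) (FO u x)"
  using ntransD(5)[OF assms(1) x] assms(3,4) uv by simp
 thus "NC \<alpha> x = NC (cell u v) x"
  using the_arr_eq[OF shapeD(3)[OF uv(1)]] x assms(3) uv by (simp add: cell_def)
qed (use assms in \<open>auto simp: cell_def\<close>)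

section \<open>The concrete shapes, with their encodings unfolded to orders\<close>

subsection \<open>The shapes\<close>

lemma cpair_eq [simp]: "cpair a b = cpair c d \<longleftrightarrow> a = c \<and> b = d"
 by (metis cfst_cpair csnd_cpair)

lemma cnat_eq [simp]: "cnat m = cnat n \<longleftrightarrow> m = n"
 by (rule inj_eq[OF inj_cnat])

lemma gcode_inj: "inj gcode"
 by (rule injI) (simp add: gcode_def prod_eq_iff)

lemma gcode_eq [simp]: "gcode p = gcode q \<longleftrightarrow> p = q"
 by (rule inj_eq[OF gcode_inj])

lemma inv_gcode [simp]: "inv gcode (gcode p) = p"
 by (rule inv_f_f[OF gcode_inj])

lemma thin_mk_catI:
 assumes "category (mk_cat X A d c i m)"
  "\<And>f g. f \<in> A \<Longrightarrow> g \<in> A \<Longrightarrow> d f = d g \<Longrightarrow> c f = c g \<Longrightarrow> f = g"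
 shows "thin (mk_cat X A d c i m)"
 unfolding thin_def using assms by (auto simp: hom_def)

lemma hom_mk_cat: "hom (mk_cat X A d c i m) x y = {f \<in> A. d f = x \<and> c f = y}"
 by (auto simp: hom_def)

lemma poset_cat:
 assumes "inj c" "\<And>x. x \<in> P \<Longrightarrow> r x x" "\<And>x y z. r x y \<Longrightarrow> r y z \<Longrightarrow> r x z"
 shows "thin (poset_cat c P r)" "Obj (poset_cat c P r) = c ` P"
  "x \<in> P \<Longrightarrow> y \<in> P \<Longrightarrow> le (poset_cat c P r) (c x) (c y) \<longleftrightarrow> r y x"
  "hom (poset_cat c P r) (c x) (c y) = (if x \<in> P \<and> y \<in> P \<and> r x y then {cpair (c x) (c y)} else {})"
proof -
 have c: "c x = c y \<longleftrightarrow> x = y" for x y using assms(1) by (auto simp: inj_def)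
 have "category (poset_cat c P r)"
  unfolding poset_cat_def
  by (rule category_mk_catI) (use assms(2) in \<open>auto simp: c intro: assms(3)\<close>)
 thus "thin (poset_cat c P r)"
  unfolding poset_cat_def by (rule thin_mk_catI) (auto simp: c)
 show "Obj (poset_cat c P r) = c ` P" by (simp add: poset_cat_def)
 show h: "hom (poset_cat c P r) (c x) (c y) = (if x \<in> P \<and> y \<in> P \<and> r x y then {cpair (c x) (c y)} else {})" for x y
  unfolding poset_cat_def hom_mk_cat by (auto simp: c)
 show "x \<in> P \<Longrightarrow> y \<in> P \<Longrightarrow> le (poset_cat c P r) (c x) (c y) \<longleftrightarrow> r y x"
  unfolding le_def h by simp
qed

lemma thin_chain: "thin (chain P)"
 and Obj_chain: "Obj (chain P) = cnat ` P"
 and le_chain: "m \<in> P \<Longrightarrow> n \<in> P \<Longrightarrow> le (chain P) (cnat m) (cnat n) \<longleftrightarrow> n \<le> m"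
 and hom_chain: "m \<in> P \<Longrightarrow> n \<in> P \<Longrightarrow> m \<le> n \<Longrightarrow> hom (chain P) (cnat m) (cnat n) = {cpair (cnat m) (cnat n)}"
 unfolding chain_def by (simp_all add: poset_cat inj_cnat)

lemma thin_e [simp]: "thin e_cat" and Obj_e [simp]: "Obj e_cat = {cnat 0}"
 by (simp_all add: e_cat_def thin_chain Obj_chain)

lemma thin_arrow [simp]: "thin arrow_cat" and Obj_arrow [simp]: "Obj arrow_cat = {cnat 0, cnat 1}"
 by (simp_all add: arrow_cat_def thin_op_cat thin_chain op_cat_simps Obj_chain)

lemma le_arrow [simp]: "m \<in> {0, 1} \<Longrightarrow> n \<in> {0, 1} \<Longrightarrow> le arrow_cat (cnat m) (cnat n) \<longleftrightarrow> m \<le> n"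
 unfolding arrow_cat_def le_op_cat by (rule le_chain)

abbreviation (input) nat_op :: "'u::infinite scat" where "nat_op \<equiv> op_cat nat_cat"

lemma thin_nat_op [simp]: "thin nat_op" and Obj_nat_op [simp]: "Obj nat_op = range cnat"
 and le_nat_op [simp]: "le nat_op (cnat m) (cnat n) \<longleftrightarrow> m \<le> n"
 by (simp_all add: nat_cat_def le_op_cat op_cat_simps thin_op_cat thin_chain Obj_chain le_chain)

lemma thin_grid [simp]: "thin (grid P)"
 unfolding grid_def by (rule thin_op_cat, rule poset_cat(1)[OF gcode_inj]) auto

lemma Obj_grid [simp]: "Obj (grid P) = gcode ` P"
 unfolding grid_def op_cat_simps by (rule poset_cat(2)[OF gcode_inj]) auto

lemma le_grid [simp]: "p \<in> P \<Longrightarrow> q \<in> P \<Longrightarrow>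
  le (grid P) (gcode p) (gcode q) \<longleftrightarrow> fst p \<le> fst q \<and> snd p \<le> snd q"
 unfolding grid_def le_op_cat by (rule poset_cat(3)[OF gcode_inj]) auto

lemma hom_grid:
 assumes "p \<in> P" "q \<in> P" "fst p \<le> fst q \<and> snd p \<le> snd q"
 shows "cpair (gcode p) (gcode q) \<in> hom (grid P) (gcode q) (gcode p)"
 unfolding grid_def hom_op_cat by (subst poset_cat(4)[OF gcode_inj]) (use assms in auto)

lemma Obj_prod_cat [simp]: "Obj (prod_cat A I) = {cpair a i | a i. a \<in> Obj A \<and> i \<in> Obj I}"
 by (simp add: prod_cat_def)

lemma hom_prod_cat:
 assumes "thin A" "thin I"
 shows "hom (prod_cat A I) (cpair a i) (cpair b j) = {cpair f k | f k. f \<in> hom A a b \<and> k \<in> hom I i j}"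
 unfolding prod_cat_def hom_mk_cat by (auto simp: hom_def)

lemma thin_prod_cat [simp]:
 assumes "thin A" "thin I"
 shows "thin (prod_cat A I)"
proof -
 interpret A: category A using thin_category assms(1) .
 interpret I: category I using thin_category assms(2) .
 have "category (prod_cat A I)"
  unfolding prod_cat_def
  by (rule category_mk_catI; clarsimp simp: A.arr_simps I.arr_simps)
 thus ?thesis
  unfolding prod_cat_def
  by (rule thin_mk_catI) (auto intro: thin_arr_eqI[OF assms(1)] thin_arr_eqI[OF assms(2)])
qed

lemma le_prod_cat [simp]:
 "thin A \<Longrightarrow> thin I \<Longrightarrow> le (prod_cat A I) (cpair a i) (cpair b j) \<longleftrightarrow> le A a b \<and> le I i j"
 unfolding le_def hom_prod_cat by auto

lemma Obj_coprod_cat [simp]: "Obj (coprod_cat I A) = {cpair i a | i a. i \<in> I \<and> a \<in> Obj (A i)}"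
 by (simp add: coprod_cat_def)

lemma thin_coprod_cat [simp]:
 assumes "\<And>i. i \<in> I \<Longrightarrow> thin (A i)"
 shows "thin (coprod_cat I A)"
proof -
 have A: "category (A i)" if "i \<in> I" for i using thin_category assms that by blast
 have "category (coprod_cat I A)"
  unfolding coprod_cat_def
  by (rule category_mk_catI; clarsimp simp: category.arr_simps[OF A])
 thus ?thesis
  unfolding coprod_cat_def
  by (rule thin_mk_catI) (auto intro: thin_arr_eqI[OF assms])
qed

lemma hom_coprod_cat:
 "hom (coprod_cat I A) (cpair i a) (cpair j b) = (if i = j \<and> i \<in> I then cpair i ` hom (A i) a b else {})"
 unfolding coprod_cat_def hom_mk_cat by (auto simp: hom_def)

lemma le_coprod_cat [simp]:
 "i \<in> I \<Longrightarrow> le (coprod_cat I A) (cpair i a) (cpair j b) \<longleftrightarrow> i = j \<and> le (A i) a b"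
 unfolding le_def hom_coprod_cat by auto

text \<open>Compatibility of an arrow of the source with the structure arrows is an equation in a
  thin category and holds automatically, so the comma category inherits the order of
  \<open>Src u\<close>.\<close>

lemma coslice:
 assumes "shape u" "b \<in> Obj (Tgt u)"
 shows "thin (coslice u b)" "Obj (coslice u b) = {cpair a f | a f. a \<in> Obj (Src u) \<and> f \<in> hom (Tgt u) b (FO u a)}"
  "cpair a f \<in> Obj (coslice u b) \<Longrightarrow> cpair c g \<in> Obj (coslice u b) \<Longrightarrow> le (Src u) a c \<Longrightarrow>
   le (coslice u b) (cpair a f) (cpair c g)"
  "shape (coslice_proj u b)"
proof -
 interpret A: category "Src u" using thin_category shapeD(2)[OF assms(1)] .
 interpret B: category "Tgt u" using thin_category shapeD(3)[OF assms(1)] .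
 note uf = ftorD[OF shapeD(1)[OF assms(1)]]
 have FA: "FA u h \<in> Arr (Tgt u)" "Dom (Tgt u) (FA u h) = FO u (Dom (Src u) h)"
  "Cod (Tgt u) (FA u h) = FO u (Cod (Src u) h)" if "h \<in> Arr (Src u)" for h
  using uf(4)[of h "Dom (Src u) h" "Cod (Src u) h"] that by (auto simp: hom_def)
 have FAc: "FA u (h \<cdot>[Src u] k) = FA u h \<cdot>[Tgt u] FA u k"
  if "h \<in> Arr (Src u)" "k \<in> Arr (Src u)" "Dom (Src u) h = Cod (Src u) k" for h k
  using uf(6)[of k _ _ h] that by (auto simp: hom_def)
 have cat: "category (coslice u b)"
  unfolding coslice_def
  by (rule category_mk_catI; clarsimp simp: hom_def A.arr_simps B.arr_simps FA FAc uf(3,5))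
 thus thin: "thin (coslice u b)"
  unfolding coslice_def
  by (rule thin_mk_catI, simp only: mem_Collect_eq, elim exE conjE, simp only: cfst_cpair csnd_cpair cpair_eq)
    (elim conjE, intro conjI, rule thin_arr_eqI[OF shapeD(2)[OF assms(1)]]; (assumption | rule refl))
 show "Obj (coslice u b) = {cpair a f | a f. a \<in> Obj (Src u) \<and> f \<in> hom (Tgt u) b (FO u a)}"
  by (simp add: coslice_def)
 show "le (coslice u b) (cpair a f) (cpair c g)"
  if "cpair a f \<in> Obj (coslice u b)" "cpair c g \<in> Obj (coslice u b)" "le (Src u) a c"
 proof -
  obtain h where h: "h \<in> hom (Src u) c a" using \<open>le (Src u) a c\<close> by (auto simp: le_def)
  have fg: "f \<in> hom (Tgt u) b (FO u a)" "g \<in> hom (Tgt u) b (FO u c)" using that(1,2) by (auto simp: coslice_def)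
  have "FA u h \<cdot>[Tgt u] g = f"
   using thin_eqI[OF shapeD(3)[OF assms(1)] B.comp_hom[OF fg(2) uf(4)[OF h]] fg(1)] .
  hence "cpair h g \<in> hom (coslice u b) (cpair c g) (cpair a f)"
   unfolding coslice_def hom_mk_cat using h fg by (auto simp: hom_def)
  thus ?thesis by (auto simp: le_def)
 qed
 show "shape (coslice_proj u b)"
  unfolding coslice_proj_def
  by (rule shape_mk_ftor[OF thin shapeD(2)[OF assms(1)]]) (auto simp: coslice_def hom_def)
qed

lemma shape_op: "shape u \<Longrightarrow> shape (op_ftor u)"
 by (simp add: shape_def is_ftor_op op_simps thin_op_cat)

lemma op_mk_cat: "op_cat (mk_cat X A d c i m) = mk_cat X A c d i (\<lambda>g f. m f g)"
 by (auto simp: mk_cat_def op_cat_def fun_eq_iff)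

text \<open>The slice stores the structure arrow at the end of an arrow, the coslice the one at its
  start. Passing to opposites exchanges the two, hence the equality rather than a mere
  isomorphism.\<close>

lemma slice_op: "slice u b = op_cat (coslice (op_ftor u) b)" "slice_proj u b = op_ftor (coslice_proj (op_ftor u) b)"
proof -
 show *: "slice u b = op_cat (coslice (op_ftor u) b)"
  unfolding slice_def coslice_def op_mk_cat op_simps ..
 show "slice_proj u b = op_ftor (coslice_proj (op_ftor u) b)"
  by (simp add: slice_proj_def coslice_proj_def * mk_ftor_def op_ftor_def op_cat_simps)
qed

lemma slice:
 assumes "shape u" "b \<in> Obj (Tgt u)"
 shows "thin (slice u b)" "Obj (slice u b) = {cpair a f | a f. a \<in> Obj (Src u) \<and> f \<in> hom (Tgt u) (FO u a) b}"
  "cpair a f \<in> Obj (slice u b) \<Longrightarrow> cpair c g \<in> Obj (slice u b) \<Longrightarrow> le (Src u) a c \<Longrightarrow>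
   le (slice u b) (cpair a f) (cpair c g)"
  "shape (slice_proj u b)"
 using coslice[OF shape_op[OF assms(1)], of b] assms(2)
 by (simp_all add: slice_op op_simps thin_op_cat le_op_cat shape_op)

lemma pt_simps [simp]: "Src (pt K x) = e_cat" "Tgt (pt K x) = K" "FO (pt K x) (cnat 0) = x"
 by (simp_all add: pt_def)

lemma shape_pt [simp]: "thin K \<Longrightarrow> x \<in> Obj K \<Longrightarrow> shape (pt K x)"
 unfolding pt_def by (rule shape_mk_ftor) (auto intro: category.ident_hom[OF thin_category])

lemma to_e_simps [simp]: "Src (to_e K) = K" "Tgt (to_e K) = e_cat" "x \<in> Obj K \<Longrightarrow> FO (to_e K) x = cnat 0"
 by (simp_all add: to_e_def)

lemma shape_to_e [simp]: "thin K \<Longrightarrow> shape (to_e K)"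
 unfolding to_e_def by (rule shape_mk_ftor) (auto intro: category.ident_hom[OF thin_category])

lemma slot_simps [simp]: "Src (slot A I i) = A" "Tgt (slot A I i) = prod_cat A I"
 "a \<in> Obj A \<Longrightarrow> FO (slot A I i) a = cpair a i"
 by (simp_all add: slot_def)

lemma shape_slot [simp]: "thin A \<Longrightarrow> thin I \<Longrightarrow> i \<in> Obj I \<Longrightarrow> shape (slot A I i)"
 unfolding slot_def
 by (rule shape_mk_ftor) (auto simp: hom_prod_cat intro: category.ident_hom[OF thin_category])

lemma grid_map_simps [simp]: "Src (grid_map P Q h) = grid P" "Tgt (grid_map P Q h) = grid Q"
 "p \<in> P \<Longrightarrow> FO (grid_map P Q h) (gcode p) = gcode (h p)"
 by (simp_all add: grid_map_def Let_def)

lemma shape_grid_map: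
 assumes "\<And>p. p \<in> P \<Longrightarrow> h p \<in> Q"
  "\<And>p q. p \<in> P \<Longrightarrow> q \<in> P \<Longrightarrow> fst p \<le> fst q \<Longrightarrow> snd p \<le> snd q \<Longrightarrow> fst (h p) \<le> fst (h q) \<and> snd (h p) \<le> snd (h q)"
 shows "shape (grid_map P Q h)"
 unfolding grid_map_def Let_def
proof (rule shape_mk_ftor)
 fix f x y assume f: "f \<in> hom (grid P) x y"
 hence "x \<in> Obj (grid P)" "y \<in> Obj (grid P)" using category.hom_objs[OF thin_category[OF thin_grid] f] by auto
 then obtain p q where pq: "p \<in> P" "q \<in> P" "x = gcode q" "y = gcode p" by auto
 have "le (grid P) y x" using f by (auto simp: le_def)
 hence l: "fst p \<le> fst q \<and> snd p \<le> snd q" using pq by simp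
 hence "f = cpair (gcode p) (gcode q)"
  using thin_eqI[OF thin_grid f, of "cpair (gcode p) (gcode q)"] hom_grid[OF pq(1,2) l] pq by simp
 thus "cpair (gcode (h (inv gcode (cfst f)))) (gcode (h (inv gcode (csnd f)))) \<in>
   hom (grid Q) (gcode (h (inv gcode x))) (gcode (h (inv gcode y)))"
  using hom_grid[of "h p" Q "h q"] assms pq l by simp
qed (use assms in auto)

lemma coprod_incl_simps [simp]: "Src (coprod_incl I A i) = A i" "Tgt (coprod_incl I A i) = coprod_cat I A"
 "a \<in> Obj (A i) \<Longrightarrow> FO (coprod_incl I A i) a = cpair i a"
 by (simp_all add: coprod_incl_def)

lemma shape_coprod_incl [simp]:
 assumes "\<And>i. i \<in> I \<Longrightarrow> thin (A i)" "i \<in> I"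
 shows "shape (coprod_incl I A i)"
 unfolding coprod_incl_def
proof (rule shape_mk_ftor)
 show "thin (A i)" "thin (coprod_cat I A)" using assms by auto
qed (use assms in \<open>auto simp: coprod_cat_def hom_mk_cat\<close>, auto simp: hom_def)

lemma coslice_proj_simps [simp]: "Src (coslice_proj u b) = coslice u b" "Tgt (coslice_proj u b) = Src u"
 "x \<in> Obj (coslice u b) \<Longrightarrow> FO (coslice_proj u b) x = cfst x"
 by (simp_all add: coslice_proj_def)

lemma slice_proj_simps [simp]: "Src (slice_proj u b) = slice u b" "Tgt (slice_proj u b) = Src u"
 "x \<in> Obj (slice u b) \<Longrightarrow> FO (slice_proj u b) x = cfst x"
 by (simp_all add: slice_proj_def)

section \<open>Restriction along monotone maps as a 2-functor\<close>

section \<open>Restriction functors\<close>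

definition Mor :: "('o, 'a) cat \<Rightarrow> ('p, 'b) cat \<Rightarrow> ('o, 'a, 'p, 'b) ftor set"
 where "Mor K L = {u. shape u \<and> Src u = K \<and> Tgt u = L}"

lemma MorD: "u \<in> Mor K L \<Longrightarrow> shape u" "u \<in> Mor K L \<Longrightarrow> Src u = K" "u \<in> Mor K L \<Longrightarrow> Tgt u = L"
 "u \<in> Mor K L \<Longrightarrow> thin K" "u \<in> Mor K L \<Longrightarrow> thin L" "u \<in> Mor K L \<Longrightarrow> is_ftor u"
 by (auto simp: Mor_def shape_def)

lemma Mor_obj: "u \<in> Mor K L \<Longrightarrow> x \<in> Obj K \<Longrightarrow> FO u x \<in> Obj L"
 using MorD shape_obj by metis

lemma Mor_le: "u \<in> Mor K L \<Longrightarrow> le K x y \<Longrightarrow> le L (FO u x) (FO u y)"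
 using MorD shape_le by metis

lemma Mor_id: "thin K \<Longrightarrow> id_ftor K \<in> Mor K K"
 by (simp add: Mor_def shape_id)

lemma Mor_comp: "u \<in> Mor K L \<Longrightarrow> v \<in> Mor L M \<Longrightarrow> v \<circ>\<^sub>F u \<in> Mor K M"
 by (auto simp: Mor_def shape_comp)

lemma Mor_pt: "thin K \<Longrightarrow> x \<in> Obj K \<Longrightarrow> pt K x \<in> Mor e_cat K"
 by (simp add: Mor_def)

lemma Mor_to_e: "thin K \<Longrightarrow> to_e K \<in> Mor K e_cat"
 by (simp add: Mor_def)

lemma Mor_slot: "thin A \<Longrightarrow> thin I \<Longrightarrow> i \<in> Obj I \<Longrightarrow> slot A I i \<in> Mor A (prod_cat A I)"
 by (simp add: Mor_def)

lemma Mor_eqI: "u \<in> Mor K L \<Longrightarrow> v \<in> Mor K L \<Longrightarrow> (\<And>x. x \<in> Obj K \<Longrightarrow> FO u x = FO v x) \<Longrightarrow> u = v"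
 by (rule shape_eqI) (auto simp: Mor_def)

lemma FO_comp: "u \<in> Mor K L \<Longrightarrow> x \<in> Obj K \<Longrightarrow> FO (v \<circ>\<^sub>F u) x = FO v (FO u x)"
 by (auto simp: Mor_def)

lemma Mor_fleI:
 "u \<in> Mor K L \<Longrightarrow> v \<in> Mor K L \<Longrightarrow> (\<And>x. x \<in> Obj K \<Longrightarrow> le L (FO u x) (FO v x)) \<Longrightarrow> fle u v"
 by (rule fleI) (auto simp: Mor_def)

lemma fle_Mor: "fle u v \<Longrightarrow> u \<in> Mor K L \<longleftrightarrow> v \<in> Mor K L"
 by (auto simp: Mor_def dest: fleD)

lemma fle_pt: "thin K \<Longrightarrow> le K x y \<Longrightarrow> fle (pt K x) (pt K y)"
 using le_objs[of K x y] by (intro Mor_fleI[OF Mor_pt Mor_pt]) auto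

lemma comp_pt: "u \<in> Mor K L \<Longrightarrow> x \<in> Obj K \<Longrightarrow> u \<circ>\<^sub>F pt K x = pt L (FO u x)"
 by (rule Mor_eqI[OF Mor_comp[OF Mor_pt]]) (auto simp: FO_comp[OF Mor_pt] Mor_obj intro: Mor_pt dest: MorD)

lemma to_e_comp: "u \<in> Mor K L \<Longrightarrow> to_e L \<circ>\<^sub>F u = to_e K"
 by (rule Mor_eqI[OF Mor_comp Mor_to_e]) (auto simp: FO_comp Mor_obj intro: Mor_to_e dest: MorD)

lemma pt_e: "pt e_cat (cnat 0) = id_ftor e_cat"
 by (rule Mor_eqI[OF Mor_pt Mor_id]) auto

lemma to_e_e: "to_e e_cat = id_ftor e_cat"
 by (rule Mor_eqI[OF Mor_to_e Mor_id]) auto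

lemma id_comp: "u \<in> Mor K L \<Longrightarrow> id_ftor L \<circ>\<^sub>F u = u" "u \<in> Mor K L \<Longrightarrow> u \<circ>\<^sub>F id_ftor K = u"
proof -
 show "id_ftor L \<circ>\<^sub>F u = u" if u: "u \<in> Mor K L"
  by (rule Mor_eqI[OF Mor_comp[OF u Mor_id[OF MorD(5)[OF u]]] u]) (simp add: FO_comp[OF u] Mor_obj[OF u])
 show "u \<circ>\<^sub>F id_ftor K = u" if u: "u \<in> Mor K L"
  by (rule Mor_eqI[OF Mor_comp[OF Mor_id[OF MorD(4)[OF u]] u] u]) (simp add: FO_comp[OF Mor_id[OF MorD(4)[OF u]]])
qed

lemma comp_assoc_Mor:
 "u \<in> Mor K L \<Longrightarrow> v \<in> Mor L M \<Longrightarrow> w \<in> Mor M N \<Longrightarrow> (w \<circ>\<^sub>F v) \<circ>\<^sub>F u = w \<circ>\<^sub>F (v \<circ>\<^sub>F u)"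
 by (rule Mor_eqI[of _ K N]) (auto simp: FO_comp Mor_obj FO_comp[OF Mor_comp] intro: Mor_comp)

context prederivator
begin

abbreviation DD (\<open>\<D>\<close>) where "\<D> K \<equiv> DC D K"
abbreviation EE (\<open>\<E>\<close>) where "\<E> \<equiv> \<D> e_cat"
abbreviation homD (\<open>\<H>\<close>) where "\<H> K \<equiv> hom (\<D> K)"
abbreviation ObjD (\<open>\<O>\<close>) where "\<O> K \<equiv> Obj (\<D> K)"
abbreviation isoD (\<open>\<I>\<close>) where "\<I> K \<equiv> is_iso (\<D> K)"
abbreviation "idn K \<equiv> Ident (\<D> K)"
abbreviation compD (\<open>(_ *[_] _)\<close> [70, 0, 71] 70) where "g *[K] f \<equiv> g \<cdot>[\<D> K] f"
abbreviation compE (infixl \<open>**\<close> 70) where "g ** f \<equiv> g \<cdot>[\<E>] f"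
abbreviation "res u F \<equiv> FO (pull D u) F"
abbreviation "resa u f \<equiv> FA (pull D u) f"
abbreviation "val K x F \<equiv> FO (pull D (pt K x)) F"
abbreviation "vala K x f \<equiv> FA (pull D (pt K x)) f"

text \<open>The arrow from \<open>res u F\<close> to \<open>res v F\<close> for \<open>u\<close>
  below \<open>v\<close>. Cells between thin shapes are determined by their ends, so with this
  notation the 2-functor axioms become a calculus of composable steps.\<close>

definition "tr u v F = NC (pull2 D (cell u v)) F"

abbreviation "step K x y F \<equiv> tr (pt K x) (pt K y) F"

lemma cat: "thin K \<Longrightarrow> category (\<D> K)"
 by (simp add: DC_category thin_category)

lemma pull:
 assumes "u \<in> Mor K L"
 shows "is_ftor (pull D u)" "Src (pull D u) = \<D> L" "Tgt (pull D u) = \<D> K"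
 using pull_ftor[OF MorD(6)[OF assms]] MorD[OF assms] by auto

lemma res_obj: "u \<in> Mor K L \<Longrightarrow> F \<in> \<O> L \<Longrightarrow> res u F \<in> \<O> K"
 using pull ftorD(3) by metis

lemma resa_hom: "u \<in> Mor K L \<Longrightarrow> f \<in> \<H> L X Y \<Longrightarrow> resa u f \<in> \<H> K (res u X) (res u Y)"
 using pull ftorD(4) by metis

lemma resa_ident: "u \<in> Mor K L \<Longrightarrow> F \<in> \<O> L \<Longrightarrow> resa u (idn L F) = idn K (res u F)"
 using pull ftorD(5) by metis

lemma resa_comp:
 "u \<in> Mor K L \<Longrightarrow> f \<in> \<H> L X Y \<Longrightarrow> g \<in> \<H> L Y Z \<Longrightarrow>
  resa u (g *[L] f) = resa u g *[K] resa u f"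
 using pull ftorD(6) by metis

lemma resa_iso:
 "u \<in> Mor K L \<Longrightarrow> f \<in> \<H> L X Y \<Longrightarrow> \<I> L f \<Longrightarrow> \<I> K (resa u f)"
 using pull ftor_iso by metis

lemma res_id: "thin K \<Longrightarrow> F \<in> \<O> K \<Longrightarrow> res (id_ftor K) F = F"
 using pull_id[of K] by (simp add: thin_category)

lemma resa_id: "thin K \<Longrightarrow> f \<in> \<H> K X Y \<Longrightarrow> resa (id_ftor K) f = f"
 using pull_id[of K] by (simp add: thin_category hom_def)

lemma res_comp:
 assumes "u \<in> Mor K L" "v \<in> Mor L M" "F \<in> \<O> M"
 shows "res (v \<circ>\<^sub>F u) F = res u (res v F)"
 using pull_comp[OF MorD(6)[OF assms(1)] MorD(6)[OF assms(2)]] MorD(2,3)[OF assms(1)] MorD(2,3)[OF assms(2)]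
  pull[OF assms(2)] assms(3) by simp

lemma resa_resa:
 assumes "u \<in> Mor K L" "v \<in> Mor L M" "f \<in> \<H> M X Y"
 shows "resa (v \<circ>\<^sub>F u) f = resa u (resa v f)"
 using pull_comp[OF MorD(6)[OF assms(1)] MorD(6)[OF assms(2)]] MorD(2,3)[OF assms(1)] MorD(2,3)[OF assms(2)]
  pull[OF assms(2)] assms(3) by (simp add: hom_def)

lemma tr_ntrans:
 assumes "fle u v"
 shows "is_ntrans (pull2 D (cell u v))" "NDom (pull2 D (cell u v)) = pull D u" "NCod (pull2 D (cell u v)) = pull D v"
 using pull2_ntrans[OF ntrans_cell[OF assms]] by (simp_all add: cell_def)

lemma tr_hom:
 assumes "fle u v" "u \<in> Mor K L" "F \<in> \<O> L"
 shows "tr u v F \<in> \<H> K (res u F) (res v F)"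
 using ntransD(5)[OF tr_ntrans(1)[OF assms(1)]] tr_ntrans(2,3)[OF assms(1)] pull[OF assms(2)] assms(3)
 by (simp add: tr_def)

lemma tr_nat:
 assumes "fle u v" "u \<in> Mor K L" "f \<in> \<H> L X Y"
 shows "tr u v Y *[K] resa u f = resa v f *[K] tr u v X"
 using ntransD(6)[OF tr_ntrans(1)[OF assms(1)]] tr_ntrans(2,3)[OF assms(1)] pull[OF assms(2)] assms(3)
 by (simp add: tr_def)

lemma tr_id:
 assumes "u \<in> Mor K L" "F \<in> \<O> L"
 shows "tr u u F = idn K (res u F)"
proof -
 note u = MorD[OF assms(1)]
 have "is_ntrans (id_ntrans u)"
  unfolding id_ntrans_def
 proof (rule mk_ntransI)
  interpret L: category L using thin_category u(5) .
  interpret K: category K using thin_category u(4) .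
  note uf = ftorD(4)[OF u(6)]
  show "Ident (Tgt u) (FO u x) \<in> hom (Tgt u) (FO u x) (FO u x)" if "x \<in> Obj (Src u)" for x
   using Mor_obj[OF assms(1)] that u L.ident_hom by simp
  show "Ident (Tgt u) (FO u y) \<cdot>[Tgt u] FA u f = FA u f \<cdot>[Tgt u] Ident (Tgt u) (FO u x)"
   if "f \<in> hom (Src u) x y" for f x y
   using uf[OF that] u L.ident_left L.ident_right by simp
 qed (use u in auto)
 hence "id_ntrans u = cell u u"
  using cell_eqI[of "id_ntrans u" u u] fle_refl[OF u(1)] by (simp add: id_ntrans_def)
 thus ?thesis
  unfolding tr_def using pull2_id[OF u(6)] pull[OF assms(1)] assms(2) by (simp add: id_ntrans_def)
qed

lemma tr_comp:
 assumes "fle u v" "fle v w" "u \<in> Mor K L" "F \<in> \<O> L"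
 shows "tr v w F *[K] tr u v F = tr u w F"
proof -
 note uv = fleD[OF assms(1)] and vw = fleD[OF assms(2)] and u = MorD[OF assms(3)]
 note c = ntrans_cell[OF assms(1)] ntrans_cell[OF assms(2)]
 interpret L: category L using thin_category u(5) .
 have "is_ntrans (vcomp (cell u v) (cell v w))"
  unfolding vcomp_def
 proof (rule mk_ntransI)
  have a: "NC (cell v w) x \<in> hom L (FO w x) (FO v x)" "NC (cell u v) x \<in> hom L (FO v x) (FO u x)" if "x \<in> Obj K" for x
   using ntransD(5)[OF c(2)] ntransD(5)[OF c(1)] that uv vw u by (simp_all add: cell_def)
  show "NC (cell u v) x \<cdot>[Tgt (NDom (cell v w))] NC (cell v w) x \<in>
    hom (Tgt (NDom (cell v w))) (FO (NDom (cell v w)) x) (FO (NCod (cell u v)) x)"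
   if "x \<in> Obj (Src (NDom (cell v w)))" for x
   using L.comp_hom[OF a(1)[of x] a(2)[of x]] that uv vw u by (simp add: cell_def)
  show "(NC (cell u v) y \<cdot>[Tgt (NDom (cell v w))] NC (cell v w) y) \<cdot>[Tgt (NDom (cell v w))] FA (NDom (cell v w)) f =
    FA (NCod (cell u v)) f \<cdot>[Tgt (NDom (cell v w))] (NC (cell u v) x \<cdot>[Tgt (NDom (cell v w))] NC (cell v w) x)"
   if f: "f \<in> hom (Src (NDom (cell v w))) x y" for f x y
  proof -
   have f': "f \<in> hom K x y" using f uv vw u by (simp add: cell_def)
   have xy: "x \<in> Obj K" "y \<in> Obj K" using category.hom_objs[OF thin_category[OF u(4)] f'] by auto
   have "FA w f \<in> hom L (FO w x) (FO w y)" "FA u f \<in> hom L (FO u x) (FO u y)"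
    using ftorD(4)[OF shapeD(1)[OF vw(2)]] ftorD(4)[OF u(6)] f' uv vw u by auto
   hence "(NC (cell u v) y \<cdot>[L] NC (cell v w) y) \<cdot>[L] FA w f = FA u f \<cdot>[L] (NC (cell u v) x \<cdot>[L] NC (cell v w) x)"
    using thin_eqI[OF u(5) L.comp_hom[OF _ L.comp_hom[OF a(1)[OF xy(2)] a(2)[OF xy(2)]]]
      L.comp_hom[OF L.comp_hom[OF a(1)[OF xy(1)] a(2)[OF xy(1)]]]] by blast
   thus ?thesis using uv vw u by (simp add: cell_def)
  qed
 qed (use uv vw u c in \<open>auto simp: cell_def dest: ntransD\<close>)
 hence "vcomp (cell u v) (cell v w) = cell u w"
  using cell_eqI[OF _ fle_trans[OF assms(1,2)]] by (simp add: vcomp_def cell_def)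
 moreover have "pull2 D (vcomp (cell u v) (cell v w)) = vcomp (pull2 D (cell v w)) (pull2 D (cell u v))"
  using pull2_vcomp[OF c(2,1)] by (simp add: cell_def)
 ultimately show ?thesis
  unfolding tr_def using tr_ntrans[OF assms(1)] tr_ntrans[OF assms(2)] pull[OF assms(3)] assms(4)
  by (simp add: vcomp_def)
qed

text \<open>Naturality of the horizontal composite is an equation between parallel arrows of a thin
  category.\<close>

lemma ntrans_hcomp:
 assumes "is_ntrans \<alpha>" "is_ntrans \<beta>" "Src (NDom \<beta>) = Tgt (NDom \<alpha>)" "thin (Tgt (NDom \<beta>))"
 shows "is_ntrans (hcomp \<beta> \<alpha>)"
 unfolding hcomp_def
proof (rule mk_ntransI)
 note a = ntransD[OF assms(1)] and b = ntransD[OF assms(2)]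
 interpret T: category "Tgt (NDom \<beta>)" using thin_category assms(4) .
 show f: "is_ftor (NDom \<beta> \<circ>\<^sub>F NDom \<alpha>)" "is_ftor (NCod \<beta> \<circ>\<^sub>F NCod \<alpha>)"
  using a(1-4) b(1-4) assms(3) by (auto intro: is_ftor_comp)
 have h: "NC \<beta> (FO (NCod \<alpha>) x) \<cdot>[Tgt (NDom \<beta>)] FA (NDom \<beta>) (NC \<alpha> x) \<in>
   hom (Tgt (NDom \<beta>)) (FO (NDom \<beta>) (FO (NDom \<alpha>) x)) (FO (NCod \<beta>) (FO (NCod \<alpha>) x))"
  if x: "x \<in> Obj (Src (NDom \<alpha>))" for x
 proof (rule T.comp_hom)
  show "FA (NDom \<beta>) (NC \<alpha> x) \<in> hom (Tgt (NDom \<beta>)) (FO (NDom \<beta>) (FO (NDom \<alpha>) x)) (FO (NDom \<beta>) (FO (NCod \<alpha>) x))"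
   using ftorD(4)[OF b(1)] a(5)[OF x] assms(3) by simp
  show "NC \<beta> (FO (NCod \<alpha>) x) \<in> hom (Tgt (NDom \<beta>)) (FO (NDom \<beta>) (FO (NCod \<alpha>) x)) (FO (NCod \<beta>) (FO (NCod \<alpha>) x))"
   using b(5) ftorD(3)[OF a(2)] x a(3,4) assms(3) by simp
 qed
 show "NC \<beta> (FO (NCod \<alpha>) x) \<cdot>[Tgt (NDom \<beta>)] FA (NDom \<beta>) (NC \<alpha> x) \<in> hom (Tgt (NDom \<beta> \<circ>\<^sub>F NDom \<alpha>))
   (FO (NDom \<beta> \<circ>\<^sub>F NDom \<alpha>) x) (FO (NCod \<beta> \<circ>\<^sub>F NCod \<alpha>) x)" if "x \<in> Obj (Src (NDom \<beta> \<circ>\<^sub>F NDom \<alpha>))" for x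
  using h that a(3) by simp
 show "(NC \<beta> (FO (NCod \<alpha>) y) \<cdot>[Tgt (NDom \<beta>)] FA (NDom \<beta>) (NC \<alpha> y)) \<cdot>[Tgt (NDom \<beta> \<circ>\<^sub>F NDom \<alpha>)] FA (NDom \<beta> \<circ>\<^sub>F NDom \<alpha>) f =
   FA (NCod \<beta> \<circ>\<^sub>F NCod \<alpha>) f \<cdot>[Tgt (NDom \<beta> \<circ>\<^sub>F NDom \<alpha>)] (NC \<beta> (FO (NCod \<alpha>) x) \<cdot>[Tgt (NDom \<beta>)] FA (NDom \<beta>) (NC \<alpha> x))"
  if fh: "f \<in> hom (Src (NDom \<beta> \<circ>\<^sub>F NDom \<alpha>)) x y" for f x y
 proof -
  have xy: "x \<in> Obj (Src (NDom \<alpha>))" "y \<in> Obj (Src (NDom \<alpha>))"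
   using category.hom_objs[OF ftorD(1)[OF a(1)]] fh by auto
  have "FA (NDom \<beta> \<circ>\<^sub>F NDom \<alpha>) f \<in> hom (Tgt (NDom \<beta>)) (FO (NDom \<beta>) (FO (NDom \<alpha>) x)) (FO (NDom \<beta>) (FO (NDom \<alpha>) y))"
   "FA (NCod \<beta> \<circ>\<^sub>F NCod \<alpha>) f \<in> hom (Tgt (NDom \<beta>)) (FO (NCod \<beta>) (FO (NCod \<alpha>) x)) (FO (NCod \<beta>) (FO (NCod \<alpha>) y))"
   using ftorD(4)[OF f(1) fh] ftorD(4)[OF f(2), of f x y] fh xy a(3) b(4) by auto
  thus ?thesis
   using thin_eqI[OF assms(4) T.comp_hom[OF _ h[OF xy(2)]] T.comp_hom[OF h[OF xy(1)]]] by simp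
 qed
qed (use ntransD[OF assms(1)] ntransD[OF assms(2)] in simp_all)

text \<open>Whiskering is horizontal composition with an identity cell. \<open>pull2_hcomp\<close>
  respects it, the composite cell is determined by its ends, and the identity cell contributes an
  identity arrow.\<close>

lemma resa_tr:
 assumes "fle u v" "u \<in> Mor L M" "w \<in> Mor K L" "F \<in> \<O> M"
 shows "resa w (tr u v F) = tr (u \<circ>\<^sub>F w) (v \<circ>\<^sub>F w) F"
proof -
 note uv = fleD[OF assms(1)] and u = MorD[OF assms(2)] and w = MorD[OF assms(3)]
 note c = ntrans_cell[OF assms(1)] and cw = ntrans_cell[OF fle_refl[OF w(1)]]
 have "hcomp (cell u v) (cell w w) = cell (u \<circ>\<^sub>F w) (v \<circ>\<^sub>F w)"
  using cell_eqI[OF ntrans_hcomp[OF cw c], of "u \<circ>\<^sub>F w" "v \<circ>\<^sub>F w"] fle_comp_right[OF assms(1) w(1)] uv u w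
  by (simp add: cell_def hcomp_def)
 moreover have "pull2 D (hcomp (cell u v) (cell w w)) = hcomp (pull2 D (cell w w)) (pull2 D (cell u v))"
  using pull2_hcomp[OF cw c] uv u w by (simp add: cell_def)
 moreover have "v \<in> Mor L M" using fle_Mor[OF assms(1)] assms(2) by simp
 moreover have "tr w w (res v F) = idn K (res w (res v F))"
  using tr_id[OF assms(3) res_obj[OF \<open>v \<in> Mor L M\<close> assms(4)]] .
 moreover have "resa w (tr u v F) \<in> \<H> K (res w (res u F)) (res w (res v F))"
  using resa_hom[OF assms(3) tr_hom[OF assms(1,2,4)]] .
 ultimately show ?thesis
  unfolding tr_def using tr_ntrans[OF assms(1)] tr_ntrans[OF fle_refl[OF w(1)]] pull[OF assms(3)] pull[OF assms(2)]
   assms(4) category.ident_left[OF cat[OF w(4)]] by (simp add: hcomp_def)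
qed

lemma tr_res:
 assumes "fle u v" "u \<in> Mor K L" "w \<in> Mor L M" "F \<in> \<O> M"
 shows "tr u v (res w F) = tr (w \<circ>\<^sub>F u) (w \<circ>\<^sub>F v) F"
proof -
 note uv = fleD[OF assms(1)] and u = MorD[OF assms(2)] and w = MorD[OF assms(3)]
 note c = ntrans_cell[OF assms(1)] and cw = ntrans_cell[OF fle_refl[OF w(1)]]
 have "hcomp (cell w w) (cell u v) = cell (w \<circ>\<^sub>F u) (w \<circ>\<^sub>F v)"
  using cell_eqI[OF ntrans_hcomp[OF c cw], of "w \<circ>\<^sub>F u" "w \<circ>\<^sub>F v"] fle_comp_left[OF assms(1) w(1)] uv u w
  by (simp add: cell_def hcomp_def)
 moreover have "pull2 D (hcomp (cell w w) (cell u v)) = hcomp (pull2 D (cell u v)) (pull2 D (cell w w))"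
  using pull2_hcomp[OF c cw] uv u w by (simp add: cell_def)
 moreover have "tr w w F = idn L (res w F)" using tr_id[OF assms(3,4)] .
 moreover have "resa u (idn L (res w F)) = idn K (res u (res w F))"
  using resa_ident[OF assms(2) res_obj[OF assms(3,4)]] .
 moreover have "tr u v (res w F) \<in> \<H> K (res u (res w F)) (res v (res w F))"
  using tr_hom[OF assms(1,2) res_obj[OF assms(3,4)]] .
 ultimately show ?thesis
  unfolding tr_def using tr_ntrans[OF assms(1)] tr_ntrans[OF fle_refl[OF w(1)]] pull[OF assms(3)] pull[OF assms(2)]
   assms(4) category.ident_right[OF cat[OF u(4)]] by (simp add: hcomp_def)
qed

lemma val_res: "u \<in> Mor K L \<Longrightarrow> x \<in> Obj K \<Longrightarrow> F \<in> \<O> L \<Longrightarrow> val K x (res u F) = val L (FO u x) F"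
 using res_comp[OF Mor_pt, of K x u L F] comp_pt[of u K L x] by (auto dest: MorD)

lemma vala_resa: "u \<in> Mor K L \<Longrightarrow> x \<in> Obj K \<Longrightarrow> f \<in> \<H> L X Y \<Longrightarrow> vala K x (resa u f) = vala L (FO u x) f"
 using resa_resa[OF Mor_pt, of K x u L f] comp_pt[of u K L x] by (auto dest: MorD)

lemma step_res:
 assumes "u \<in> Mor K L" "le K x y" "F \<in> \<O> L"
 shows "step K x y (res u F) = step L (FO u x) (FO u y) F"
proof -
 have xy: "x \<in> Obj K" "y \<in> Obj K" using le_objs[OF MorD(4)[OF assms(1)] assms(2)] by auto
 show ?thesis
  using tr_res[OF fle_pt[OF MorD(4)[OF assms(1)] assms(2)] Mor_pt[OF MorD(4)[OF assms(1)] xy(1)] assms(1,3)]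
   comp_pt[OF assms(1)] xy by simp
qed

lemma vala_tr:
 assumes "fle u v" "u \<in> Mor K L" "x \<in> Obj K" "F \<in> \<O> L"
 shows "vala K x (tr u v F) = step L (FO u x) (FO v x) F"
 using resa_tr[OF assms(1,2) Mor_pt[OF MorD(4)[OF assms(2)] assms(3)] assms(4)]
  comp_pt[OF assms(2,3)] comp_pt[of v K L x] fle_Mor[OF assms(1), of K L] assms(2,3) by simp

lemma step_hom: "thin K \<Longrightarrow> le K x y \<Longrightarrow> F \<in> \<O> K \<Longrightarrow> step K x y F \<in> hom \<E> (val K x F) (val K y F)"
 using tr_hom[OF fle_pt Mor_pt] le_objs by metis

lemma step_comp: "thin K \<Longrightarrow> le K x y \<Longrightarrow> le K y z \<Longrightarrow> F \<in> \<O> K \<Longrightarrow>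
  step K y z F ** step K x y F = step K x z F"
 using tr_comp[OF fle_pt fle_pt Mor_pt] le_objs by metis

lemma step_id: "thin K \<Longrightarrow> x \<in> Obj K \<Longrightarrow> F \<in> \<O> K \<Longrightarrow> step K x x F = Ident \<E> (val K x F)"
 using tr_id[OF Mor_pt] .

lemma step_nat: "thin K \<Longrightarrow> le K x y \<Longrightarrow> f \<in> \<H> K X Y \<Longrightarrow>
  step K x y Y ** vala K x f = vala K y f ** step K x y X"
 using tr_nat[OF fle_pt Mor_pt] le_objs by metis

lemma val_obj: "thin K \<Longrightarrow> x \<in> Obj K \<Longrightarrow> F \<in> \<O> K \<Longrightarrow> val K x F \<in> Obj \<E>"
 by (rule res_obj[OF Mor_pt])

lemma vala_hom: "thin K \<Longrightarrow> x \<in> Obj K \<Longrightarrow> f \<in> \<H> K X Y \<Longrightarrow> vala K x f \<in> hom \<E> (val K x X) (val K x Y)"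
 by (rule resa_hom[OF Mor_pt])

lemma val_e: "F \<in> Obj \<E> \<Longrightarrow> val e_cat (cnat 0) F = F"
 by (simp add: pt_e res_id)

lemma vala_e: "f \<in> hom \<E> X Y \<Longrightarrow> vala e_cat (cnat 0) f = f"
 using resa_id[OF thin_e] by (simp add: pt_e)

section \<open>Adjoint monotone maps: Kan extension by restriction\<close>

subsection \<open>Adjoint shapes\<close>

text \<open>The two inequalities say that the monotone map \<open>s\<close> is left adjoint to
  \<open>c\<close>. Restriction, as a 2-functor, makes \<open>res c\<close> left adjoint to
  \<open>res s\<close>; the triangle identities hold because the cells of each triangle compose to
  the only cell from a map to itself.\<close>

lemma res_transpose:
 assumes s: "s \<in> Mor L K" and c: "c \<in> Mor K L" and sc: "fle (s \<circ>\<^sub>F c) (id_ftor K)" and cs: "fle (id_ftor L) (c \<circ>\<^sub>F s)"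
  and G: "G \<in> \<O> L" and T: "T \<in> \<O> K"
 shows "tr (id_ftor L) (c \<circ>\<^sub>F s) G \<in> \<H> L G (res s (res c G))"
  and "tr (s \<circ>\<^sub>F c) (id_ftor K) T \<in> \<H> K (res c (res s T)) T"
  and "f \<in> \<H> L G (res s T) \<Longrightarrow>
   resa s (tr (s \<circ>\<^sub>F c) (id_ftor K) T *[K] resa c f) *[L] tr (id_ftor L) (c \<circ>\<^sub>F s) G = f"
  and "g \<in> \<H> K (res c G) T \<Longrightarrow>
   tr (s \<circ>\<^sub>F c) (id_ftor K) T *[K] resa c (resa s g *[L] tr (id_ftor L) (c \<circ>\<^sub>F s) G) = g"
proof -
 interpret K: category "\<D> K" using cat MorD(4)[OF c] .
 interpret L: category "\<D> L" using cat MorD(4)[OF s] .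
 note idL = Mor_id[OF MorD(4)[OF s]] and idK = Mor_id[OF MorD(4)[OF c]]
 note scM = Mor_comp[OF c s] and csM = Mor_comp[OF s c]
 have s3: "fle ((s \<circ>\<^sub>F c) \<circ>\<^sub>F s) (id_ftor K \<circ>\<^sub>F s)" "fle (s \<circ>\<^sub>F id_ftor L) (s \<circ>\<^sub>F (c \<circ>\<^sub>F s))"
  using fle_comp_right[OF sc MorD(1)[OF s]] fle_comp_left[OF cs MorD(1)[OF s]] MorD[OF s] MorD[OF c] by simp_all
 have c3: "fle (c \<circ>\<^sub>F (s \<circ>\<^sub>F c)) (c \<circ>\<^sub>F id_ftor K)" "fle (id_ftor L \<circ>\<^sub>F c) ((c \<circ>\<^sub>F s) \<circ>\<^sub>F c)"
  using fle_comp_left[OF sc MorD(1)[OF c]] fle_comp_right[OF cs MorD(1)[OF c]] MorD[OF s] MorD[OF c] by simp_all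
 have as: "(s \<circ>\<^sub>F c) \<circ>\<^sub>F s = s \<circ>\<^sub>F (c \<circ>\<^sub>F s)" "(c \<circ>\<^sub>F s) \<circ>\<^sub>F c = c \<circ>\<^sub>F (s \<circ>\<^sub>F c)"
  using comp_assoc_Mor[OF s c s] comp_assoc_Mor[OF c s c] by auto
 have cG: "res c G \<in> \<O> K" using res_obj[OF c G] .
 show \<eta>: "tr (id_ftor L) (c \<circ>\<^sub>F s) G \<in> \<H> L G (res s (res c G))"
  using tr_hom[OF cs idL G] res_id[OF MorD(4)[OF s] G] res_comp[OF s c G] by simp
 show \<epsilon>: "tr (s \<circ>\<^sub>F c) (id_ftor K) T \<in> \<H> K (res c (res s T)) T"
  using tr_hom[OF sc scM T] res_id[OF MorD(4)[OF c] T] res_comp[OF c s T] by simp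
 show "resa s (tr (s \<circ>\<^sub>F c) (id_ftor K) T *[K] resa c f) *[L] tr (id_ftor L) (c \<circ>\<^sub>F s) G = f"
  if f: "f \<in> \<H> L G (res s T)"
 proof -
   let ?g = "tr (s \<circ>\<^sub>F c) (id_ftor K) T *[K] resa c f"
   note cf = resa_hom[OF c f] and sT = res_obj[OF s T]
   have "resa s ?g = resa s (tr (s \<circ>\<^sub>F c) (id_ftor K) T) *[L] resa s (resa c f)"
    using resa_comp[OF s cf \<epsilon>] .
   moreover have "resa s (tr (s \<circ>\<^sub>F c) (id_ftor K) T) = tr (s \<circ>\<^sub>F (c \<circ>\<^sub>F s)) s T"
    using resa_tr[OF sc scM s T] as id_comp[OF s] by simp
   moreover have "resa s (resa c f) *[L] tr (id_ftor L) (c \<circ>\<^sub>F s) G = tr s (s \<circ>\<^sub>F (c \<circ>\<^sub>F s)) T *[L] f"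
    using tr_nat[OF cs idL f] resa_resa[OF s c f] resa_id[OF MorD(4)[OF s] f] tr_res[OF cs idL s T]
     id_comp[OF s] by simp
   moreover have "tr (s \<circ>\<^sub>F (c \<circ>\<^sub>F s)) s T *[L] tr s (s \<circ>\<^sub>F (c \<circ>\<^sub>F s)) T = idn L (res s T)"
    using tr_comp[OF s3(2) _ _ T, of s L] s3(1) tr_id[OF s T] as id_comp[OF s] s by simp
   moreover have "resa s (tr (s \<circ>\<^sub>F c) (id_ftor K) T) \<in> \<H> L (res s (res c (res s T))) (res s T)"
    using resa_hom[OF s \<epsilon>] .
   moreover have "tr s (s \<circ>\<^sub>F (c \<circ>\<^sub>F s)) T \<in> \<H> L (res s T) (res s (res c (res s T)))"
    using tr_hom[OF s3(2), of L K T] id_comp[OF s] s T res_comp[OF csM s T] res_comp[OF s c sT] by simp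
   moreover have "resa s (resa c f) \<in> \<H> L (res s (res c G)) (res s (res c (res s T)))"
    using resa_hom[OF s cf] .
   ultimately show "resa s ?g *[L] tr (id_ftor L) (c \<circ>\<^sub>F s) G = f"
    using L.comp_assoc[OF \<eta>] L.comp_assoc[OF f] L.ident_left[OF f] by metis
 qed
 show "tr (s \<circ>\<^sub>F c) (id_ftor K) T *[K] resa c (resa s g *[L] tr (id_ftor L) (c \<circ>\<^sub>F s) G) = g"
  if g: "g \<in> \<H> K (res c G) T"
 proof -
   note sg = resa_hom[OF s g]
   have "resa c (resa s g *[L] tr (id_ftor L) (c \<circ>\<^sub>F s) G) = resa c (resa s g) *[K] tr c (c \<circ>\<^sub>F (s \<circ>\<^sub>F c)) G"
    using resa_comp[OF c \<eta> sg] resa_tr[OF cs idL c G] id_comp[OF c] as by simp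
   moreover have "tr (s \<circ>\<^sub>F c) (id_ftor K) T *[K] resa c (resa s g) = g *[K] tr (c \<circ>\<^sub>F (s \<circ>\<^sub>F c)) c G"
    using tr_nat[OF sc scM g] resa_resa[OF c s g] resa_id[OF MorD(4)[OF c] g] tr_res[OF sc scM c G]
     id_comp[OF c] by simp
   moreover have "tr (c \<circ>\<^sub>F (s \<circ>\<^sub>F c)) c G *[K] tr c (c \<circ>\<^sub>F (s \<circ>\<^sub>F c)) G = idn K (res c G)"
    using tr_comp[OF _ c3(1), of c K L G] c3(2) tr_id[OF c G] as id_comp[OF c] c G by simp
   moreover have h1: "tr c (c \<circ>\<^sub>F (s \<circ>\<^sub>F c)) G \<in> \<H> K (res c G) (res c (res s (res c G)))"
    using tr_hom[OF c3(2), of K L G] id_comp[OF c] c G as res_comp[OF scM c G] res_comp[OF c s cG] by simp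
   moreover have h2: "tr (c \<circ>\<^sub>F (s \<circ>\<^sub>F c)) c G \<in> \<H> K (res c (res s (res c G))) (res c G)"
    using tr_hom[OF c3(1), of K L G] id_comp[OF c] Mor_comp[OF scM c] G res_comp[OF scM c G] res_comp[OF c s cG] by simp
   moreover have "resa c (resa s g) \<in> \<H> K (res c (res s (res c G))) (res c (res s T))"
    using resa_hom[OF c sg] .
   ultimately show ?thesis
    using K.comp_assoc[OF h1 _ \<epsilon>] K.comp_assoc[OF h1 h2 g] K.ident_right[OF g] by metis
 qed
qed

text \<open>Kan extension along a map with an adjoint is restriction along the adjoint; the explicit
  values of Kan extensions are derived from this.\<close>

lemma luniv_res:
 assumes s: "s \<in> Mor L K" and c: "c \<in> Mor K L" and sc: "fle (s \<circ>\<^sub>F c) (id_ftor K)" and cs: "fle (id_ftor L) (c \<circ>\<^sub>F s)"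
  and G: "G \<in> \<O> L"
 shows "luniv (pull D s) G (res c G) (tr (id_ftor L) (c \<circ>\<^sub>F s) G)"
proof (rule lunivI, unfold pull(2,3)[OF s])
 interpret K: category "\<D> K" using cat MorD(4)[OF c] .
 note transp = res_transpose[OF s c sc cs G]
 show cG: "res c G \<in> \<O> K" using res_obj[OF c G] .
 show "tr (id_ftor L) (c \<circ>\<^sub>F s) G \<in> \<H> L G (res s (res c G))" using transp(1)[OF cG] .
 fix T
 show "\<exists>g. g \<in> \<H> K (res c G) T \<and> resa s g *[L] tr (id_ftor L) (c \<circ>\<^sub>F s) G = f"
  if "T \<in> \<O> K" "f \<in> \<H> L G (res s T)" for f
  by (intro exI conjI, rule K.comp_hom[OF resa_hom[OF c that(2)] transp(2)[OF that(1)]], rule transp(3)[OF that])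
 show "g = h" if "g \<in> \<H> K (res c G) T" "h \<in> \<H> K (res c G) T"
  "resa s g *[L] tr (id_ftor L) (c \<circ>\<^sub>F s) G = resa s h *[L] tr (id_ftor L) (c \<circ>\<^sub>F s) G" for g h
  using transp(4)[of T g] transp(4)[of T h] that K.hom_objs[OF that(1)] by metis
qed

lemma runiv_res:
 assumes s: "s \<in> Mor L K" and c: "c \<in> Mor K L" and sc: "fle (s \<circ>\<^sub>F c) (id_ftor K)" and cs: "fle (id_ftor L) (c \<circ>\<^sub>F s)"
  and T: "T \<in> \<O> K"
 shows "runiv (pull D c) T (res s T) (tr (s \<circ>\<^sub>F c) (id_ftor K) T)"
proof (rule runivI, unfold pull(2,3)[OF c])
 interpret L: category "\<D> L" using cat MorD(4)[OF s] .
 note transp = res_transpose[OF s c sc cs _ T]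
 show sT: "res s T \<in> \<O> L" using res_obj[OF s T] .
 show "tr (s \<circ>\<^sub>F c) (id_ftor K) T \<in> \<H> K (res c (res s T)) T" using transp(2)[OF sT] .
 fix G
 show "\<exists>f. f \<in> \<H> L G (res s T) \<and> tr (s \<circ>\<^sub>F c) (id_ftor K) T *[K] resa c f = g"
  if "G \<in> \<O> L" "g \<in> \<H> K (res c G) T" for g
  by (intro exI conjI, rule L.comp_hom[OF _ resa_hom[OF s that(2)]], rule res_transpose(1)[OF s c sc cs that(1) T],
    rule res_transpose(4)[OF s c sc cs that(1) T that(2)])
 show "f = f'" if "f \<in> \<H> L G (res s T)" "f' \<in> \<H> L G (res s T)"
  "tr (s \<circ>\<^sub>F c) (id_ftor K) T *[K] resa c f = tr (s \<circ>\<^sub>F c) (id_ftor K) T *[K] resa c f'" for f f'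
  using transp(3)[of G f] transp(3)[of G f'] that L.hom_objs[OF that(1)] by metis
qed

end

section \<open>Base change as a universal property, and coproducts in D(A)\<close>

section \<open>Kan extensions and coproducts\<close>

text \<open>By naturality of the unit and a triangle identity, \<open>t\<close> is the unit at
  \<open>x\<close> followed by the image of its transpose. \<open>der4_shriek\<close> asserts that a
  certain transpose is invertible, so it becomes a universal property.\<close>

lemma luniv_if_transpose_iso:
 assumes "adjunction F G \<eta> \<epsilon>" "t \<in> hom (Src F) x (FO G y)" "y \<in> Obj (Tgt F)"
  "is_iso (Tgt F) (NC \<epsilon> y \<cdot>[Tgt F] FA F t)"
 shows "luniv G x y t"
proof -
 note A = adjunctionD[OF assms(1)]
 interpret S: category "Src F" using ftorD(1)[OF A(1)] .
 interpret T: category "Tgt F" using ftorD(2)[OF A(1)] .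
 have x: "x \<in> Obj (Src F)" and Gy: "FO G y \<in> Obj (Src F)" using S.hom_objs[OF assms(2)] by auto
 note Ft = ftorD(4)[OF A(1) assms(2)] and \<epsilon> = A(7)[OF assms(3)] and Gh = ftorD(4)[OF A(2), unfolded A(3,4)]
 have "FA G (NC \<epsilon> y \<cdot>[Tgt F] FA F t) \<cdot>[Src F] NC \<eta> x = (FA G (NC \<epsilon> y) \<cdot>[Src F] FA G (FA F t)) \<cdot>[Src F] NC \<eta> x"
  using ftorD(6)[OF A(2)] Ft \<epsilon> A(3,4) by simp
 also have "\<dots> = FA G (NC \<epsilon> y) \<cdot>[Src F] (NC \<eta> (FO G y) \<cdot>[Src F] t)"
  using S.comp_assoc[OF A(5)[OF x] Gh[OF Ft] Gh[OF \<epsilon>]] A(6)[OF assms(2)] by simp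
 also have "\<dots> = t"
  using S.comp_assoc[OF assms(2) A(5)[OF Gy] Gh[OF \<epsilon>]] A(10)[OF assms(3)] S.ident_left[OF assms(2)] by simp
 finally show ?thesis
  using luniv_postcomp[OF A(2) adjunction_luniv[OF assms(1)], of x "NC \<epsilon> y \<cdot>[Tgt F] FA F t" y]
   T.comp_hom[OF Ft \<epsilon>] assms(4) A(3,4) x by simp
qed

lemma runiv_if_transpose_iso:
 assumes "adjunction F G \<eta> \<epsilon>" "t \<in> hom (Tgt F) (FO F x) y" "x \<in> Obj (Src F)"
  "is_iso (Src F) (FA G t \<cdot>[Src F] NC \<eta> x)"
 shows "runiv F y x t"
proof -
 note A = adjunctionD[OF assms(1)]
 interpret S: category "Src F" using ftorD(1)[OF A(1)] .
 interpret T: category "Tgt F" using ftorD(2)[OF A(1)] .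
 have y: "y \<in> Obj (Tgt F)" and Fx: "FO F x \<in> Obj (Tgt F)" using T.hom_objs[OF assms(2)] by auto
 have Gt: "FA G t \<in> hom (Src F) (FO G (FO F x)) (FO G y)" using ftorD(4)[OF A(2)] assms(2) A(3,4) by simp
 note \<eta> = A(5)[OF assms(3)] and Fh = ftorD(4)[OF A(1)]
 have "NC \<epsilon> y \<cdot>[Tgt F] FA F (FA G t \<cdot>[Src F] NC \<eta> x) = (t \<cdot>[Tgt F] NC \<epsilon> (FO F x)) \<cdot>[Tgt F] FA F (NC \<eta> x)"
  using ftorD(6)[OF A(1) \<eta> Gt] T.comp_assoc[OF Fh[OF \<eta>] Fh[OF Gt] A(7)[OF y]] A(8)[OF assms(2)] by simp
 also have "\<dots> = t"
  using T.comp_assoc[OF Fh[OF \<eta>] A(7)[OF Fx] assms(2)] A(9)[OF assms(3)] T.ident_right[OF assms(2)] by simp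
 finally show ?thesis
  using runiv_postcomp[OF A(1) adjunction_runiv[OF assms(1) y] S.comp_hom[OF \<eta> Gt] assms(4)] by simp
qed

lemma coproduct_cong: "(\<And>i. i \<in> I \<Longrightarrow> L i = L' i) \<Longrightarrow> is_coproduct C I L P inn \<Longrightarrow> is_coproduct C I L' P inn"
 unfolding is_coproduct_def by simp

text \<open>Left adjoints preserve coproducts: a cocone under the images transposes to one under the
  original family. The right adjoint enters through its values at single objects.\<close>

lemma coproduct_preserved:
 assumes U: "is_ftor U" and r: "\<And>x. x \<in> Obj (Tgt U) \<Longrightarrow> \<exists>r \<epsilon>. runiv U x r \<epsilon>"
  and P: "is_coproduct (Src U) I L P inn"
 shows "is_coproduct (Tgt U) I (\<lambda>i. FO U (L i)) (FO U P) (\<lambda>i. FA U (inn i))"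
proof -
 interpret S: category "Src U" using ftorD(1)[OF U] .
 interpret T: category "Tgt U" using ftorD(2)[OF U] .
 note inn = S.coproductD[OF P]
 have comp: "(\<epsilon> \<cdot>[Tgt U] FA U k) \<cdot>[Tgt U] FA U (inn i) = \<epsilon> \<cdot>[Tgt U] FA U (k \<cdot>[Src U] inn i)"
  if "i \<in> I" "\<epsilon> \<in> hom (Tgt U) (FO U r) x" "k \<in> hom (Src U) P r" for i k r x \<epsilon>
  using T.comp_assoc[OF ftorD(4)[OF U inn(2)[OF that(1)]] ftorD(4)[OF U that(3)] that(2)]
   ftorD(6)[OF U inn(2)[OF that(1)] that(3)] by simp
 show ?thesis
 proof (rule T.coproductI)
  show "FO U P \<in> Obj (Tgt U)" using ftorD(3)[OF U inn(1)] .
  show "FA U (inn i) \<in> hom (Tgt U) (FO U (L i)) (FO U P)" if "i \<in> I" for i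
   using ftorD(4)[OF U inn(2)[OF that]] .
  fix Q
  show "\<exists>k. k \<in> hom (Tgt U) (FO U P) Q \<and> (\<forall>i\<in>I. k \<cdot>[Tgt U] FA U (inn i) = t i)"
   if Q: "Q \<in> Obj (Tgt U)" and t: "\<And>i. i \<in> I \<Longrightarrow> t i \<in> hom (Tgt U) (FO U (L i)) Q" for t
  proof -
   obtain r \<epsilon> where \<epsilon>: "runiv U Q r \<epsilon>" using r[OF Q] by blast
   have "\<exists>s. s \<in> hom (Src U) (L i) r \<and> \<epsilon> \<cdot>[Tgt U] FA U s = t i" if "i \<in> I" for i
    using runivE[OF \<epsilon> _ t[OF that]] S.hom_objs[OF inn(2)[OF that]] by metis
   then obtain s where s: "\<And>i. i \<in> I \<Longrightarrow> s i \<in> hom (Src U) (L i) r" "\<And>i. i \<in> I \<Longrightarrow> \<epsilon> \<cdot>[Tgt U] FA U (s i) = t i"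
    by metis
   obtain k where k: "k \<in> hom (Src U) P r" "\<And>i. i \<in> I \<Longrightarrow> k \<cdot>[Src U] inn i = s i"
    using S.coproduct_desc[OF P runivD(1)[OF \<epsilon>], of s] s(1) by metis
   show ?thesis
    using T.comp_hom[OF ftorD(4)[OF U k(1)] runivD(2)[OF \<epsilon>]] comp[OF _ runivD(2)[OF \<epsilon>] k(1)] k(2) s(2)
    by (intro exI[of _ "\<epsilon> \<cdot>[Tgt U] FA U k"]) simp
  qed
  show "k = l" if k: "k \<in> hom (Tgt U) (FO U P) Q" and l: "l \<in> hom (Tgt U) (FO U P) Q"
   and e: "\<And>i. i \<in> I \<Longrightarrow> k \<cdot>[Tgt U] FA U (inn i) = l \<cdot>[Tgt U] FA U (inn i)" for k l
  proof -
   have Q: "Q \<in> Obj (Tgt U)" using T.hom_objs[OF k] by simp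
   obtain r \<epsilon> where \<epsilon>: "runiv U Q r \<epsilon>" using r[OF Q] by blast
   obtain k' where k': "k' \<in> hom (Src U) P r" "\<epsilon> \<cdot>[Tgt U] FA U k' = k" using runivE[OF \<epsilon> inn(1) k] .
   obtain l' where l': "l' \<in> hom (Src U) P r" "\<epsilon> \<cdot>[Tgt U] FA U l' = l" using runivE[OF \<epsilon> inn(1) l] .
   have "k' \<cdot>[Src U] inn i = l' \<cdot>[Src U] inn i" if i: "i \<in> I" for i
    using runiv_eqI[OF U \<epsilon> S.comp_hom[OF inn(2)[OF i] k'(1)] S.comp_hom[OF inn(2)[OF i] l'(1)]]
     comp[OF i runivD(2)[OF \<epsilon>] k'(1)] comp[OF i runivD(2)[OF \<epsilon>] l'(1)] e[OF i] k'(2) l'(2) by simp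
   hence "k' = l'" using S.coproduct_eqI[OF P k'(1) l'(1)] by blast
   thus ?thesis using k'(2) l'(2) by simp
  qed
 qed
qed

text \<open>Categories are extensional records, so there is just one without objects in given types.
  Thus \<open>der1\<close> for the empty family speaks about every empty shape, in particular about
  empty comma categories.\<close>

lemma empty_category_unique:
 assumes "category C" "Obj C = {}"
 shows "C = coprod_cat {} A"
proof -
 interpret category C by fact
 have A: "Arr C = {}" using dom_closed assms(2) by auto
 have "Dom C = (\<lambda>_. undefined)" "Cod C = (\<lambda>_. undefined)" "Ident C = (\<lambda>_. undefined)"
  using dom_ext cod_ext ident_ext A assms(2) by (auto simp: extensional_def)
 moreover have "Comp C = (\<lambda>_ _. undefined)" using comp_ext A by auto
 ultimately show ?thesis
  using A assms(2) by (intro cat.equality) (auto simp: coprod_cat_def mk_cat_def restrict_def)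
qed

lemma hom_prod_fam:
 assumes "x \<in> (\<Pi>\<^sub>E i\<in>I. Obj (C i))" "y \<in> (\<Pi>\<^sub>E i\<in>I. Obj (C i))"
 shows "hom (prod_fam I C) x y = (\<Pi>\<^sub>E i\<in>I. hom (C i) (x i) (y i))"
proof -
 have e: "(\<lambda>i\<in>I. g i) = z \<longleftrightarrow> (\<forall>i\<in>I. g i = z i)" if "z \<in> (\<Pi>\<^sub>E i\<in>I. Obj (C i))" for g z
  using that by (auto simp: fun_eq_iff restrict_def PiE_def extensional_def)
 show ?thesis
  unfolding prod_fam_def hom_mk_cat e[OF assms(1)] e[OF assms(2)]
  by (auto simp: hom_def PiE_iff extensional_def)
qed

lemma isomorphic_prod_famD:
 assumes "x \<in> (\<Pi>\<^sub>E i\<in>I. Obj (C i))" "y \<in> (\<Pi>\<^sub>E i\<in>I. Obj (C i))" "isomorphic (prod_fam I C) x y" "i \<in> I"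
  "category (C i)"
 shows "isomorphic (C i) (x i) (y i)"
proof -
 obtain f g where f: "f \<in> hom (prod_fam I C) x y" and fg: "inverse_arrows (prod_fam I C) f g"
  using assms(3) by (auto simp: isomorphic_def is_iso_def)
 have Df: "Dom (prod_fam I C) f = x" "Cod (prod_fam I C) f = y" using f by (auto simp: hom_def)
 hence g: "g \<in> hom (prod_fam I C) y x" using fg by (auto simp: inverse_arrows_def)
 hence Dg: "Dom (prod_fam I C) g = y" "Cod (prod_fam I C) g = x" by (auto simp: hom_def)
 have A: "f \<in> (\<Pi>\<^sub>E i\<in>I. Arr (C i))" "g \<in> (\<Pi>\<^sub>E i\<in>I. Arr (C i))" using f g by (auto simp: hom_def prod_fam_def)
 have D: "(\<lambda>i\<in>I. Dom (C i) (f i)) = x" "(\<lambda>i\<in>I. Cod (C i) (f i)) = y"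
  "(\<lambda>i\<in>I. Dom (C i) (g i)) = y" "(\<lambda>i\<in>I. Cod (C i) (g i)) = x"
  using Df Dg A by (auto simp: prod_fam_def)
 have "g \<cdot>[prod_fam I C] f = (\<lambda>i\<in>I. g i \<cdot>[C i] f i)" "f \<cdot>[prod_fam I C] g = (\<lambda>i\<in>I. f i \<cdot>[C i] g i)"
  using A D unfolding prod_fam_def by (subst mk_cat_simps; simp)+
 moreover have "Ident (prod_fam I C) x = (\<lambda>i\<in>I. Ident (C i) (x i))" "Ident (prod_fam I C) y = (\<lambda>i\<in>I. Ident (C i) (y i))"
  using assms(1,2) by (simp_all add: prod_fam_def)
 ultimately have e: "(\<lambda>i\<in>I. g i \<cdot>[C i] f i) = (\<lambda>i\<in>I. Ident (C i) (x i))"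
  "(\<lambda>i\<in>I. f i \<cdot>[C i] g i) = (\<lambda>i\<in>I. Ident (C i) (y i))"
  using fg Df by (auto simp: inverse_arrows_def)
 have "g i \<cdot>[C i] f i = Ident (C i) (x i)" "f i \<cdot>[C i] g i = Ident (C i) (y i)"
  using fun_cong[OF e(1), of i] fun_cong[OF e(2), of i] assms(4) by simp_all
 moreover have "f i \<in> hom (C i) (x i) (y i)" "g i \<in> hom (C i) (y i) (x i)"
  using f g hom_prod_fam[OF assms(1,2)] hom_prod_fam[OF assms(2,1)] assms(4) by auto
 ultimately show ?thesis
  using category.isoI[OF assms(5)] category.isomorphicI[OF assms(5)] by metis
qed

context derivator
begin

abbreviation "shr u F \<equiv> FO (lower_shriek D u) F"
abbreviation "eta u F \<equiv> NC (shriek_unit D u) F"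
abbreviation "sta u F \<equiv> FO (lower_star D u) F"
abbreviation "eps u F \<equiv> NC (star_counit D u) F"

text \<open>\<open>der3\<close> provides some adjoint, so the choice made in \<open>left_adj\<close>
  meets its specification.\<close>

lemma shriek_adjunction:
 assumes "u \<in> Mor K L"
 shows "adjunction (lower_shriek D u) (pull D u) (shriek_unit D u) (shriek_counit D u)"
proof -
 have "\<exists>F \<eta> \<epsilon>. adjunction F (pull D u) \<eta> \<epsilon>"
  using der3[OF MorD(6)[OF assms]] by (simp add: has_left_adjoint_def)
 hence "\<exists>x. case x of (F, \<eta>, \<epsilon>) \<Rightarrow> adjunction F (pull D u) \<eta> \<epsilon>" by auto
 from someI_ex[OF this] show ?thesis
  by (auto simp: lower_shriek_def shriek_unit_def shriek_counit_def left_adj_def split: prod.splits)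
qed

lemma star_adjunction:
 assumes "u \<in> Mor K L"
 shows "adjunction (pull D u) (lower_star D u) (star_unit D u) (star_counit D u)"
proof -
 have "\<exists>F \<eta> \<epsilon>. adjunction (pull D u) F \<eta> \<epsilon>"
  using der3[OF MorD(6)[OF assms]] by (simp add: has_right_adjoint_def)
 hence "\<exists>x. case x of (F, \<eta>, \<epsilon>) \<Rightarrow> adjunction (pull D u) F \<eta> \<epsilon>" by auto
 from someI_ex[OF this] show ?thesis
  by (auto simp: lower_star_def star_unit_def star_counit_def right_adj_def split: prod.splits)
qed

lemma shriek_ftor:
 assumes "u \<in> Mor K L"
 shows "is_ftor (lower_shriek D u)" "Src (lower_shriek D u) = \<D> K" "Tgt (lower_shriek D u) = \<D> L"
 using shriek_adjunction[OF assms] pull[OF assms] by (auto simp: adjunction_def)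

lemma star_ftor:
 assumes "u \<in> Mor K L"
 shows "is_ftor (lower_star D u)" "Src (lower_star D u) = \<D> K" "Tgt (lower_star D u) = \<D> L"
 using star_adjunction[OF assms] pull[OF assms] by (auto simp: adjunction_def)

lemma shr_luniv:
 assumes "u \<in> Mor K L" "F \<in> \<O> K"
 shows "luniv (pull D u) F (shr u F) (eta u F)" "shr u F \<in> \<O> L" "eta u F \<in> \<H> K F (res u (shr u F))"
proof -
 show *: "luniv (pull D u) F (shr u F) (eta u F)"
  using adjunction_luniv[OF shriek_adjunction[OF assms(1)]] pull[OF assms(1)] assms(2) by simp
 show "shr u F \<in> \<O> L" "eta u F \<in> \<H> K F (res u (shr u F))"
  using lunivD[OF *] pull[OF assms(1)] by auto
qed

lemma sta_runiv:
 assumes "u \<in> Mor K L" "F \<in> \<O> K"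
 shows "runiv (pull D u) F (sta u F) (eps u F)" "sta u F \<in> \<O> L" "eps u F \<in> \<H> K (res u (sta u F)) F"
proof -
 show *: "runiv (pull D u) F (sta u F) (eps u F)"
  using adjunction_runiv[OF star_adjunction[OF assms(1)]] pull[OF assms(1)] assms(2) by simp
 show "sta u F \<in> \<O> L" "eps u F \<in> \<H> K (res u (sta u F)) F"
  using runivD[OF *] pull[OF assms(1)] by auto
qed

lemma res_coproduct:
 assumes "u \<in> Mor K L" "is_coproduct (\<D> L) I G P inn"
 shows "is_coproduct (\<D> K) I (\<lambda>i. res u (G i)) (res u P) (\<lambda>i. resa u (inn i))"
 using coproduct_preserved[OF pull(1)[OF assms(1)], of I G P inn] pull(2,3)[OF assms(1)] assms(2)
  sta_runiv(1)[OF assms(1)] by auto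

text \<open>This is the full faithfulness of the equivalence in \<open>der1\<close>, with arrows of
  the product category unpacked into families.\<close>

lemma coprod_hom:
 assumes A: "\<And>i. i \<in> I \<Longrightarrow> thin (A i)" and X: "X \<in> \<O> (coprod_cat I A)" and Y: "Y \<in> \<O> (coprod_cat I A)"
  and f: "\<And>i. i \<in> I \<Longrightarrow> f i \<in> \<H> (A i) (res (coprod_incl I A i) X) (res (coprod_incl I A i) Y)"
 shows "\<exists>!g. g \<in> \<H> (coprod_cat I A) X Y \<and> (\<forall>i\<in>I. resa (coprod_incl I A i) g = f i)"
proof -
 let ?F = "coprod_compare D I A" and ?c = "coprod_incl I A"
 have eq: "is_equivalence ?F" using der1[of I A] A thin_category by blast
 have inc: "?c i \<in> Mor (A i) (coprod_cat I A)" if "i \<in> I" for i using A that by (simp add: Mor_def)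
 have S: "Src ?F = \<D> (coprod_cat I A)" "Tgt ?F = prod_fam I (\<lambda>i. \<D> (A i))" by (simp_all add: coprod_compare_def)
 have FO: "FO ?F Z = (\<lambda>i\<in>I. res (?c i) Z)" if "Z \<in> \<O> (coprod_cat I A)" for Z
  using that by (simp add: coprod_compare_def)
 have FA: "FA ?F g = (\<lambda>i\<in>I. resa (?c i) g)" if "g \<in> \<H> (coprod_cat I A) X Y" for g
  using that by (simp add: coprod_compare_def hom_def)
 have PE: "(\<lambda>i\<in>I. res (?c i) Z) \<in> (\<Pi>\<^sub>E i\<in>I. \<O> (A i))" if "Z \<in> \<O> (coprod_cat I A)" for Z
  using res_obj[OF inc that] by auto
 have "(\<lambda>i\<in>I. f i) \<in> hom (Tgt ?F) (FO ?F X) (FO ?F Y)"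
  unfolding S FO[OF X] FO[OF Y] hom_prod_fam[OF PE[OF X] PE[OF Y]] using f by auto
 hence ex: "\<exists>!g. g \<in> \<H> (coprod_cat I A) X Y \<and> FA ?F g = (\<lambda>i\<in>I. f i)"
  using equivalenceD(1)[OF eq, of X Y] X Y S by simp
 have iff: "FA ?F g = (\<lambda>i\<in>I. f i) \<longleftrightarrow> (\<forall>i\<in>I. resa (?c i) g = f i)" if "g \<in> \<H> (coprod_cat I A) X Y" for g
  unfolding FA[OF that] by (auto simp: fun_eq_iff restrict_def)
 show ?thesis
 proof (rule ex_ex1I)
  show "\<exists>g. g \<in> \<H> (coprod_cat I A) X Y \<and> (\<forall>i\<in>I. resa (?c i) g = f i)" using ex iff by blast
  show "g = h" if "g \<in> \<H> (coprod_cat I A) X Y \<and> (\<forall>i\<in>I. resa (?c i) g = f i)"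
   "h \<in> \<H> (coprod_cat I A) X Y \<and> (\<forall>i\<in>I. resa (?c i) h = f i)" for g h
   using ex that iff[of g] iff[of h] by (elim ex1E conjE) metis
 qed
qed

lemma coprod_obj:
 assumes A: "\<And>i. i \<in> I \<Longrightarrow> thin (A i)" and X: "\<And>i. i \<in> I \<Longrightarrow> X i \<in> \<O> (A i)"
 obtains Y where "Y \<in> \<O> (coprod_cat I A)" "\<And>i. i \<in> I \<Longrightarrow> isomorphic (\<D> (A i)) (res (coprod_incl I A i) Y) (X i)"
proof -
 let ?F = "coprod_compare D I A" and ?c = "coprod_incl I A"
 have eq: "is_equivalence ?F" using der1[of I A] A thin_category by blast
 have inc: "?c i \<in> Mor (A i) (coprod_cat I A)" if "i \<in> I" for i using A that by (simp add: Mor_def)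
 have S: "Src ?F = \<D> (coprod_cat I A)" "Tgt ?F = prod_fam I (\<lambda>i. \<D> (A i))" by (simp_all add: coprod_compare_def)
 have FO: "FO ?F Z = (\<lambda>i\<in>I. res (?c i) Z)" if "Z \<in> \<O> (coprod_cat I A)" for Z
  using that by (simp add: coprod_compare_def)
 have XP: "(\<lambda>i\<in>I. X i) \<in> (\<Pi>\<^sub>E i\<in>I. \<O> (A i))" using X by auto
 hence "(\<lambda>i\<in>I. X i) \<in> Obj (Tgt ?F)" unfolding S by (simp add: prod_fam_def)
 then obtain Y where Y: "Y \<in> \<O> (coprod_cat I A)" "isomorphic (prod_fam I (\<lambda>i. \<D> (A i))) (FO ?F Y) (\<lambda>i\<in>I. X i)"
  using equivalenceD(2)[OF eq] S by metis
 have "(\<lambda>i\<in>I. res (?c i) Y) \<in> (\<Pi>\<^sub>E i\<in>I. \<O> (A i))" using res_obj[OF inc Y(1)] by auto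
 hence "isomorphic (\<D> (A i)) (res (?c i) Y) (X i)" if "i \<in> I" for i
  using isomorphic_prod_famD[OF _ XP, of "FO ?F Y" i] Y(2) FO[OF Y(1)] that cat[OF A[OF that]] by simp
 thus thesis using that Y(1) by blast
qed

lemma empty_shape:
 assumes "thin C" "Obj C = {}"
 shows "\<exists>X. X \<in> \<O> C" "X \<in> \<O> C \<Longrightarrow> Y \<in> \<O> C \<Longrightarrow> \<exists>!f. f \<in> \<H> C X Y"
proof -
 have C: "C = coprod_cat {} (\<lambda>_. C)" using empty_category_unique[OF thin_category[OF assms(1)] assms(2)] .
 obtain Z where "Z \<in> \<O> (coprod_cat {} (\<lambda>_. C))" using coprod_obj[of "{}" "\<lambda>_. C"] by auto
 thus "\<exists>X. X \<in> \<O> C" using C by auto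
 show "X \<in> \<O> C \<Longrightarrow> Y \<in> \<O> C \<Longrightarrow> \<exists>!f. f \<in> \<H> C X Y"
  using coprod_hom[of "{}" "\<lambda>_. C" X Y] C by simp
qed

text \<open>The family is glued to one object over a disjoint union of copies of \<open>A\<close>,
  and the coproduct is its left Kan extension along the fold map: arrows from it to \<open>Q\<close>
  are arrows over the union to the constant family \<open>Q\<close>, that is, families of arrows.
  The injection \<open>c\<close> moves the index set into the type required by
  \<open>der1\<close>.\<close>

lemma coproduct_ex:
 fixes c :: "'i \<Rightarrow> 'a"
 assumes A: "thin A" and c: "inj_on c J" and L: "\<And>i. i \<in> J \<Longrightarrow> L i \<in> \<O> A"
 shows "\<exists>P inn. is_coproduct (\<D> A) J L P inn"
proof -
 let ?I = "c ` J" and ?L = "\<lambda>i. L (the_inv_into J c i)"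
 let ?U = "coprod_cat ?I (\<lambda>_. A)" and ?c = "coprod_incl ?I (\<lambda>_. A)"
 interpret A: category "\<D> A" using cat[OF A] .
 have LI: "?L i \<in> \<O> A" if "i \<in> ?I" for i
  using that L the_inv_into_f_f[OF c] by auto
 have U: "thin ?U" using A by simp
 interpret U: category "\<D> ?U" using cat[OF U] .
 have inc: "?c i \<in> Mor A ?U" if "i \<in> ?I" for i using A that by (simp add: Mor_def)
 let ?f = "mono_ftor ?U A csnd"
 have "shape ?f"
  by (rule shape_mono_ftor[OF U A]) auto
 hence f: "?f \<in> Mor ?U A" by (simp add: Mor_def)
 have fi: "?f \<circ>\<^sub>F ?c i = id_ftor A" if "i \<in> ?I" for i
  by (rule Mor_eqI[OF Mor_comp[OF inc[OF that] f] Mor_id[OF A]]) (use that in \<open>auto simp: FO_comp[OF inc[OF that]]\<close>)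
 \<comment> \<open>\<open>der1\<close> gives an equivalence, not an isomorphism: the restrictions of
   \<open>X\<close> agree with the given objects only up to the isomorphisms
   \<open>e\<close>.\<close>
 obtain X where X: "X \<in> \<O> ?U" "\<And>i. i \<in> ?I \<Longrightarrow> isomorphic (\<D> A) (res (?c i) X) (?L i)"
  using coprod_obj[of ?I "\<lambda>_. A" ?L] A LI by metis
 have "\<exists>e. e \<in> \<H> A (?L i) (res (?c i) X) \<and> \<I> A e" if "i \<in> ?I" for i
  using A.isomorphic_sym[OF X(2)[OF that]] by (auto simp: isomorphic_def)
 then obtain e where e: "\<And>i. i \<in> ?I \<Longrightarrow> e i \<in> \<H> A (?L i) (res (?c i) X)" "\<And>i. i \<in> ?I \<Longrightarrow> \<I> A (e i)"
  by metis
 define P where "P = shr ?f X"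
 have P: "P \<in> \<O> A" and \<eta>: "eta ?f X \<in> \<H> ?U X (res ?f P)"
  and lu: "luniv (pull D ?f) X P (eta ?f X)"
  using shr_luniv[OF f X(1)] by (simp_all add: P_def)
 have fr: "res (?c i) (res ?f Z) = Z" if "i \<in> ?I" "Z \<in> \<O> A" for i Z
  using res_comp[OF inc f, of i Z] fi[OF that(1)] that res_id[OF A] by simp
 have fra: "resa (?c i) (resa ?f k) = k" if "i \<in> ?I" "k \<in> \<H> A Z W" for i k Z W
  using resa_resa[OF inc f, of i k Z W] fi[OF that(1)] that resa_id[OF A] by simp
 have c\<eta>: "resa (?c i) (eta ?f X) \<in> \<H> A (res (?c i) X) P" if "i \<in> ?I" for i
  using resa_hom[OF inc[OF that] \<eta>] fr[OF that P] by simp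
 have step: "resa (?c i) (resa ?f k *[?U] eta ?f X) = k *[A] resa (?c i) (eta ?f X)"
  if "i \<in> ?I" "k \<in> \<H> A P Q" for i k Q
  using resa_comp[OF inc[OF that(1)] \<eta> resa_hom[OF f that(2)]] fra[OF that] by simp
 have "is_coproduct (\<D> A) ?I (\<lambda>i. res (?c i) X) P (\<lambda>i. resa (?c i) (eta ?f X))"
 proof (rule A.coproductI)
  show "P \<in> \<O> A" by fact
  show "resa (?c i) (eta ?f X) \<in> \<H> A (res (?c i) X) P" if "i \<in> ?I" for i using c\<eta>[OF that] .
  fix Q
  show "\<exists>k. k \<in> \<H> A P Q \<and> (\<forall>i\<in>?I. k *[A] resa (?c i) (eta ?f X) = t i)"
   if Q: "Q \<in> \<O> A" and t: "\<And>i. i \<in> ?I \<Longrightarrow> t i \<in> \<H> A (res (?c i) X) Q" for t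
  proof -
   have "\<exists>!g. g \<in> \<H> ?U X (res ?f Q) \<and> (\<forall>i\<in>?I. resa (?c i) g = t i)"
    by (rule coprod_hom[OF _ X(1) res_obj[OF f Q]]) (use A t fr[OF _ Q] in auto)
   then obtain g where g: "g \<in> \<H> ?U X (res ?f Q)" "\<forall>i\<in>?I. resa (?c i) g = t i" by blast
   obtain k where k: "k \<in> \<H> A P Q" "resa ?f k *[?U] eta ?f X = g"
    using lunivE[OF lu, of Q g] pull[OF f] Q g(1) by auto
   thus ?thesis using step[OF _ k(1)] g(2) by (intro exI[of _ k]) auto
  qed
  show "k = l" if k: "k \<in> \<H> A P Q" and l: "l \<in> \<H> A P Q"
   and eq: "\<And>i. i \<in> ?I \<Longrightarrow> k *[A] resa (?c i) (eta ?f X) = l *[A] resa (?c i) (eta ?f X)" for k l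
  proof -
   have Q: "Q \<in> \<O> A" using A.hom_objs[OF k] by simp
   let ?k = "resa ?f k *[?U] eta ?f X" and ?l = "resa ?f l *[?U] eta ?f X"
   have kl: "?k \<in> \<H> ?U X (res ?f Q)" "?l \<in> \<H> ?U X (res ?f Q)"
    using U.comp_hom[OF \<eta>] resa_hom[OF f] k l by blast+
   have "\<exists>!g. g \<in> \<H> ?U X (res ?f Q) \<and> (\<forall>i\<in>?I. resa (?c i) g = resa (?c i) ?k)"
    by (rule coprod_hom[OF _ X(1) res_obj[OF f Q]]) (use A resa_hom[OF inc kl(1)] in auto)
   moreover have "\<forall>i\<in>?I. resa (?c i) ?l = resa (?c i) ?k" using step[OF _ k] step[OF _ l] eq by auto
   ultimately have "?k = ?l" using kl by metis
   thus ?thesis using luniv_eqI[OF pull(1)[OF f] lu, of k Q l] k l pull[OF f] by simp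
  qed
 qed
 from A.coproduct_precomp[OF this e]
 have "is_coproduct (\<D> A) ?I ?L P (\<lambda>i. resa (?c i) (eta ?f X) *[A] e i)" .
 from A.coproduct_reindex[OF this, of c J] c
 have "is_coproduct (\<D> A) J (\<lambda>j. ?L (c j)) P (\<lambda>j. resa (?c (c j)) (eta ?f X) *[A] e (c j))"
  by (auto simp: bij_betw_def)
 moreover have "?L (c j) = L j" if "j \<in> J" for j using the_inv_into_f_f[OF c that] by simp
 ultimately show ?thesis using coproduct_cong[of J "\<lambda>j. ?L (c j)" L] by blast
qed

end

text \<open>Order-reflecting maps are the fully faithful functors of preorders, those along which a
  Kan extension restricts back to the given object.\<close>

definition embedding :: "('o, 'a) cat \<Rightarrow> ('p, 'b) cat \<Rightarrow> ('o, 'a, 'p, 'b) ftor \<Rightarrow> bool"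
 where "embedding K L u \<longleftrightarrow> u \<in> Mor K L \<and> (\<forall>a \<in> Obj K. \<forall>a' \<in> Obj K. le L (FO u a) (FO u a') \<longrightarrow> le K a a')"

section \<open>Values of Kan extensions at points\<close>

context derivator
begin

lemma iso_pointwise:
 assumes "thin K" "f \<in> \<H> K X Y" "\<And>x. x \<in> Obj K \<Longrightarrow> is_iso \<E> (vala K x f)"
 shows "\<I> K f"
 using der2[OF thin_category[OF assms(1)], of f] assms(2,3) by (simp add: hom_def)

text \<open>This is \<open>der4_shriek\<close> in terms of universal arrows: the value at
  \<open>b\<close> is the colimit of \<open>F\<close> over the points \<open>a\<close> with
  \<open>FO u a\<close> below \<open>b\<close>, the usual formula for covariant diagrams.\<close>

lemma shriek_base:
 assumes u: "u \<in> Mor K L" and b: "b \<in> Obj L" and F: "F \<in> \<O> K"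
 defines "C \<equiv> coslice u b"
 defines "j \<equiv> coslice_proj u b"
 defines "t \<equiv> tr (u \<circ>\<^sub>F j) (pt L b \<circ>\<^sub>F to_e C) (shr u F) *[C] resa j (eta u F)"
 shows "thin C" "j \<in> Mor C K" "fle (u \<circ>\<^sub>F j) (pt L b \<circ>\<^sub>F to_e C)"
  "luniv (pull D (to_e C)) (res j F) (val L b (shr u F)) t"
proof -
 note sh = MorD[OF u] and b' = b[folded MorD(3)[OF u]]
 note cs = coslice[OF sh(1) b', unfolded MorD(2,3)[OF u], folded C_def j_def]
 show C: "thin C" by (rule cs(1))
 show j: "j \<in> Mor C K" using cs(4) sh(2) by (simp add: Mor_def j_def C_def)
 note p = Mor_to_e[OF C] and pb = Mor_pt[OF sh(5) b]
 note uj = Mor_comp[OF j u] and bp = Mor_comp[OF p pb]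
 \<comment> \<open>The structure arrow stored in an object of the coslice is the only arrow between
   its ends, so \<open>coslice_cell\<close> is a \<open>cell\<close>.\<close>
 have leb: "the_arr L b (FO u (cfst x)) = csnd x \<and> le L (FO u (cfst x)) b" if x: "x \<in> Obj C" for x
 proof -
  obtain a f where "x = cpair a f" "f \<in> hom L b (FO u a)" using x cs(2) by auto
  thus ?thesis using the_arr_eq[OF sh(5)] by (auto simp: le_def)
 qed
 have FOj: "FO j x = cfst x" if "x \<in> Obj C" for x using that by (simp add: j_def C_def)
 show fle: "fle (u \<circ>\<^sub>F j) (pt L b \<circ>\<^sub>F to_e C)"
  by (rule Mor_fleI[OF uj bp]) (use leb FOj in \<open>simp add: FO_comp[OF j] FO_comp[OF p]\<close>)
 have cell: "coslice_cell u b = cell (u \<circ>\<^sub>F j) (pt L b \<circ>\<^sub>F to_e C)"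
  unfolding coslice_cell_def cell_def mk_ntrans_def C_def[symmetric] j_def[symmetric]
  using leb FOj FO_comp[OF j] FO_comp[OF p] sh(3) MorD[OF j] MorD[OF uj] MorD[OF bp]
  by (auto intro!: restrict_ext)
 interpret C: category "\<D> C" using cat[OF C] .
 note U = shr_luniv[OF u F]
 have t: "t \<in> \<H> C (res j F) (res (to_e C) (val L b (shr u F)))"
  unfolding t_def
  using C.comp_hom[OF resa_hom[OF j U(3)]] tr_hom[OF fle uj U(2)] res_comp[OF j u U(2)] res_comp[OF p pb U(2)]
  by simp
 have "is_iso \<E> (shriek_base_change D u b F)"
  using der4_shriek[OF sh(6) b'] F sh(2) by simp
 hence "is_iso \<E> (NC (shriek_counit D (to_e C)) (val L b (shr u F)) ** FA (lower_shriek D (to_e C)) t)"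
  unfolding shriek_base_change_def Let_def cell t_def tr_def C_def[symmetric] j_def[symmetric] sh(3) .
 thus "luniv (pull D (to_e C)) (res j F) (val L b (shr u F)) t"
  using luniv_if_transpose_iso[OF shriek_adjunction[OF p], of t "res j F" "val L b (shr u F)"] t
   shriek_ftor[OF p] res_obj[OF pb U(2)] by simp
qed

lemma star_base:
 assumes u: "u \<in> Mor K L" and b: "b \<in> Obj L" and F: "F \<in> \<O> K"
 defines "C \<equiv> slice u b"
 defines "j \<equiv> slice_proj u b"
 defines "t \<equiv> resa j (eps u F) *[C] tr (pt L b \<circ>\<^sub>F to_e C) (u \<circ>\<^sub>F j) (sta u F)"
 shows "thin C" "j \<in> Mor C K" "fle (pt L b \<circ>\<^sub>F to_e C) (u \<circ>\<^sub>F j)"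
  "runiv (pull D (to_e C)) (res j F) (val L b (sta u F)) t"
proof -
 note sh = MorD[OF u] and b' = b[folded MorD(3)[OF u]]
 note cs = slice[OF sh(1) b', unfolded MorD(2,3)[OF u], folded C_def j_def]
 show C: "thin C" by (rule cs(1))
 show j: "j \<in> Mor C K" using cs(4) sh(2) by (simp add: Mor_def j_def C_def)
 note p = Mor_to_e[OF C] and pb = Mor_pt[OF sh(5) b]
 note uj = Mor_comp[OF j u] and bp = Mor_comp[OF p pb]
 have leb: "the_arr L (FO u (cfst x)) b = csnd x \<and> le L b (FO u (cfst x))" if x: "x \<in> Obj C" for x
 proof -
  obtain a f where "x = cpair a f" "f \<in> hom L (FO u a) b" using x cs(2) by auto
  thus ?thesis using the_arr_eq[OF sh(5)] by (auto simp: le_def)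
 qed
 have FOj: "FO j x = cfst x" if "x \<in> Obj C" for x using that by (simp add: j_def C_def)
 show fle: "fle (pt L b \<circ>\<^sub>F to_e C) (u \<circ>\<^sub>F j)"
  by (rule Mor_fleI[OF bp uj]) (use leb FOj in \<open>simp add: FO_comp[OF j] FO_comp[OF p]\<close>)
 have cell: "slice_cell u b = cell (pt L b \<circ>\<^sub>F to_e C) (u \<circ>\<^sub>F j)"
  unfolding slice_cell_def cell_def mk_ntrans_def C_def[symmetric] j_def[symmetric]
  using leb FOj FO_comp[OF j] FO_comp[OF p] sh(3) MorD[OF j] MorD[OF uj] MorD[OF bp]
  by (auto intro!: restrict_ext)
 interpret C: category "\<D> C" using cat[OF C] .
 note U = sta_runiv[OF u F]
 have t: "t \<in> \<H> C (res (to_e C) (val L b (sta u F))) (res j F)"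
  unfolding t_def
  using C.comp_hom[OF _ resa_hom[OF j U(3)]] tr_hom[OF fle bp U(2)] res_comp[OF j u U(2)] res_comp[OF p pb U(2)]
  by simp
 have "is_iso \<E> (star_base_change D u b F)"
  using der4_star[OF sh(6) b'] F sh(2) by simp
 hence "is_iso \<E> (FA (lower_star D (to_e C)) t ** NC (star_unit D (to_e C)) (val L b (sta u F)))"
  unfolding star_base_change_def Let_def cell t_def tr_def C_def[symmetric] j_def[symmetric] sh(3) .
 thus "runiv (pull D (to_e C)) (res j F) (val L b (sta u F)) t"
  using runiv_if_transpose_iso[OF star_adjunction[OF p], of t "val L b (sta u F)" "res j F"] t
   pull[OF p] res_obj[OF pb U(2)] by simp
qed

text \<open>A colimit over an index set with a greatest element is the value there. Formally, the
  inclusion of the point \<open>k\<close> is adjoint to the projection to \<open>e_cat\<close>,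
  which gives a second universal arrow to compare with that of \<open>shriek_base\<close>.\<close>

lemma shr_val:
 assumes u: "u \<in> Mor K L" and F: "F \<in> \<O> K" and a: "a \<in> Obj K" and ab: "le L (FO u a) b"
  and top: "\<And>a'. a' \<in> Obj K \<Longrightarrow> le L (FO u a') b \<Longrightarrow> le K a' a"
 shows "is_iso \<E> (step L (FO u a) b (shr u F) ** vala K a (eta u F))"
proof -
 have b: "b \<in> Obj L" using le_objs[OF MorD(5)[OF u] ab] by simp
 note sh = MorD[OF u] and b' = b[folded MorD(3)[OF u]]
 define C where "C = coslice u b"
 define j where "j = coslice_proj u b"
 define t where "t = tr (u \<circ>\<^sub>F j) (pt L b \<circ>\<^sub>F to_e C) (shr u F) *[C] resa j (eta u F)"
 note base = shriek_base[OF u b F, folded C_def j_def, folded t_def]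
 note C = base(1) and j = base(2) and fle = base(3) and lu = base(4)
 note p = Mor_to_e[OF C] and pb = Mor_pt[OF sh(5) b]
 note uj = Mor_comp[OF j u] and bp = Mor_comp[OF p pb]
 note cs = coslice[OF sh(1) b', unfolded MorD(2,3)[OF u], folded C_def j_def]
 obtain f where f: "f \<in> hom L b (FO u a)" using ab by (auto simp: le_def)
 define k where "k = cpair a f"
 have k: "k \<in> Obj C" using cs(2) a f by (auto simp: k_def)
 have k_top: "le C x k" if "x \<in> Obj C" for x
 proof -
  obtain a' f' where x: "x = cpair a' f'" "a' \<in> Obj K" "f' \<in> hom L b (FO u a')" using \<open>x \<in> Obj C\<close> cs(2) by auto
  hence "le K a' a" using top[OF x(2)] by (auto simp: le_def)
  thus ?thesis using cs(3)[of a' f' a f] \<open>x \<in> Obj C\<close> k x(1) by (simp add: k_def)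
 qed
 note pk = Mor_pt[OF C k]
 have c1: "fle (to_e C \<circ>\<^sub>F pt C k) (id_ftor e_cat)"
  by (simp add: to_e_comp[OF pk] to_e_e fle_refl shape_id)
 have c2: "fle (id_ftor C) (pt C k \<circ>\<^sub>F to_e C)"
  by (rule Mor_fleI[OF Mor_id[OF C] Mor_comp[OF p pk]]) (simp add: FO_comp[OF p] k_top)
 have jF: "res j F \<in> \<O> C" using res_obj[OF j F] .
 interpret C: category "\<D> C" using cat[OF C] .
 interpret e: category "\<E>" using cat[OF thin_e] .
 note lu' = luniv_res[OF p pk c1 c2 jF]
 obtain h where h: "h \<in> hom \<E> (val C k (res j F)) (val L b (shr u F))" "is_iso \<E> h"
  "resa (to_e C) h *[C] tr (id_ftor C) (pt C k \<circ>\<^sub>F to_e C) (res j F) = t"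
  using luniv_ex_iso[OF pull(1)[OF p] lu' lu] pull[OF p] by auto
 note U = shr_luniv[OF u F]
 have "tr (id_ftor C) (pt C k \<circ>\<^sub>F to_e C) (res j F) \<in> \<H> C (res j F) (res (to_e C) (val C k (res j F)))"
  using lunivD(2)[OF lu'] pull[OF p] by simp
 moreover have "vala C k (tr (id_ftor C) (pt C k \<circ>\<^sub>F to_e C) (res j F)) = Ident \<E> (val C k (res j F))"
  using vala_tr[OF c2 Mor_id[OF C] k jF] step_id[OF C k jF] k by (simp add: FO_comp[OF p])
 moreover have "vala C k (resa (to_e C) h) = h"
  using vala_resa[OF p k h(1)] vala_e[OF h(1)] k by simp
 \<comment> \<open>At \<open>k\<close> itself the second universal arrow is an identity, so the
   comparison isomorphism is the value of \<open>t\<close> there.\<close>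
 ultimately have "vala C k t = h"
  using resa_comp[OF pk, of _ _ _ "resa (to_e C) h"] resa_hom[OF p h(1)] h(3) e.ident_right[OF h(1)] by metis
 moreover have "FO j k = a" using k by (simp add: j_def C_def k_def)
 moreover have "vala C k t = vala C k (tr (u \<circ>\<^sub>F j) (pt L b \<circ>\<^sub>F to_e C) (shr u F)) ** vala C k (resa j (eta u F))"
  unfolding t_def
  using resa_comp[OF pk resa_hom[OF j U(3)]] tr_hom[OF fle uj U(2)] res_comp[OF j u U(2)] by simp
 ultimately show ?thesis
  using h(2) vala_tr[OF fle uj k U(2)] vala_resa[OF j k U(3)] k by (simp add: FO_comp[OF j] FO_comp[OF p])
qed

text \<open>Dually, a limit over the points with image above \<open>b\<close> is the value at a
  least such point.\<close>

lemma sta_val: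
 assumes u: "u \<in> Mor K L" and F: "F \<in> \<O> K" and a: "a \<in> Obj K" and ab: "le L b (FO u a)"
  and bot: "\<And>a'. a' \<in> Obj K \<Longrightarrow> le L b (FO u a') \<Longrightarrow> le K a a'"
 shows "is_iso \<E> (vala K a (eps u F) ** step L b (FO u a) (sta u F))"
proof -
 have b: "b \<in> Obj L" using le_objs[OF MorD(5)[OF u] ab] by simp
 note sh = MorD[OF u] and b' = b[folded MorD(3)[OF u]]
 define C where "C = slice u b"
 define j where "j = slice_proj u b"
 define t where "t = resa j (eps u F) *[C] tr (pt L b \<circ>\<^sub>F to_e C) (u \<circ>\<^sub>F j) (sta u F)"
 note base = star_base[OF u b F, folded C_def j_def, folded t_def]
 note C = base(1) and j = base(2) and fle = base(3) and ru = base(4)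
 note p = Mor_to_e[OF C] and pb = Mor_pt[OF sh(5) b]
 note uj = Mor_comp[OF j u] and bp = Mor_comp[OF p pb]
 note cs = slice[OF sh(1) b', unfolded MorD(2,3)[OF u], folded C_def j_def]
 obtain f where f: "f \<in> hom L (FO u a) b" using ab by (auto simp: le_def)
 define k where "k = cpair a f"
 have k: "k \<in> Obj C" using cs(2) a f by (auto simp: k_def)
 have k_bot: "le C k x" if "x \<in> Obj C" for x
 proof -
  obtain a' f' where x: "x = cpair a' f'" "a' \<in> Obj K" "f' \<in> hom L (FO u a') b" using \<open>x \<in> Obj C\<close> cs(2) by auto
  hence "le K a a'" using bot[OF x(2)] by (auto simp: le_def)
  thus ?thesis using cs(3)[of a f a' f'] \<open>x \<in> Obj C\<close> k x(1) by (simp add: k_def)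
 qed
 note pk = Mor_pt[OF C k]
 have c1: "fle (id_ftor e_cat) (to_e C \<circ>\<^sub>F pt C k)"
  by (simp add: to_e_comp[OF pk] to_e_e fle_refl shape_id)
 have c2: "fle (pt C k \<circ>\<^sub>F to_e C) (id_ftor C)"
  by (rule Mor_fleI[OF Mor_comp[OF p pk] Mor_id[OF C]]) (simp add: FO_comp[OF p] k_bot)
 have jF: "res j F \<in> \<O> C" using res_obj[OF j F] .
 interpret C: category "\<D> C" using cat[OF C] .
 interpret e: category "\<E>" using cat[OF thin_e] .
 note ru' = runiv_res[OF pk p c2 c1 jF]
 obtain h where h: "h \<in> hom \<E> (val L b (sta u F)) (val C k (res j F))"
  "tr (pt C k \<circ>\<^sub>F to_e C) (id_ftor C) (res j F) *[C] resa (to_e C) h = t"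
  using runivE[OF ru' runivD[OF ru]] pull[OF p] by auto
 have hi: "is_iso \<E> h" using runiv_iso[OF pull(1)[OF p] ru' ru, of h] h pull[OF p] by simp
 note U = sta_runiv[OF u F]
 have "tr (pt C k \<circ>\<^sub>F to_e C) (id_ftor C) (res j F) \<in> \<H> C (res (to_e C) (val C k (res j F))) (res j F)"
  using runivD(2)[OF ru'] pull[OF p] by simp
 moreover have "vala C k (tr (pt C k \<circ>\<^sub>F to_e C) (id_ftor C) (res j F)) = Ident \<E> (val C k (res j F))"
  using vala_tr[OF c2 Mor_comp[OF p pk] k jF] step_id[OF C k jF] k by (simp add: FO_comp[OF p])
 moreover have "vala C k (resa (to_e C) h) = h"
  using vala_resa[OF p k h(1)] vala_e[OF h(1)] k by simp
 ultimately have "vala C k t = h"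
  using resa_comp[OF pk resa_hom[OF p h(1)]] h(2) e.ident_left[OF h(1)] by metis
 moreover have "FO j k = a" using k by (simp add: j_def C_def k_def)
 moreover have "vala C k t = vala C k (resa j (eps u F)) ** vala C k (tr (pt L b \<circ>\<^sub>F to_e C) (u \<circ>\<^sub>F j) (sta u F))"
  unfolding t_def
  using resa_comp[OF pk _ resa_hom[OF j U(3)]] tr_hom[OF fle bp U(2)] res_comp[OF j u U(2)] by simp
 ultimately show ?thesis
  using hi vala_tr[OF fle bp k U(2)] vala_resa[OF j k U(3)] k by (simp add: FO_comp[OF j] FO_comp[OF p])
qed

text \<open>For an embedding, \<open>a\<close> itself is greatest among the points with image below
  \<open>FO u a\<close>, so the extension has the original value there; \<open>der2\<close> passes
  from points to the whole shape.\<close>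

lemma eta_iso:
 assumes "embedding K L u" "F \<in> \<O> K"
 shows "\<I> K (eta u F)"
proof -
 have u: "u \<in> Mor K L" using assms(1) by (simp add: embedding_def)
 interpret e: category "\<E>" using cat[OF thin_e] .
 note U = shr_luniv[OF u assms(2)]
 show ?thesis
 proof (rule iso_pointwise[OF MorD(4)[OF u] U(3)])
  fix a assume a: "a \<in> Obj K"
  have "le K a' a" if "a' \<in> Obj K" "le L (FO u a') (FO u a)" for a'
   using assms(1) that a by (simp add: embedding_def)
  hence "is_iso \<E> (step L (FO u a) (FO u a) (shr u F) ** vala K a (eta u F))"
   using shr_val[OF u assms(2) a le_refl[OF MorD(5)[OF u] Mor_obj[OF u a]]] by blast
  thus "is_iso \<E> (vala K a (eta u F))"
   using step_id[OF MorD(5)[OF u] Mor_obj[OF u a] U(2)] vala_hom[OF MorD(4)[OF u] a U(3)]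
    val_res[OF u a U(2)] e.ident_left by metis
 qed
qed

lemma eps_iso:
 assumes "embedding K L u" "F \<in> \<O> K"
 shows "\<I> K (eps u F)"
proof -
 have u: "u \<in> Mor K L" using assms(1) by (simp add: embedding_def)
 interpret e: category "\<E>" using cat[OF thin_e] .
 note U = sta_runiv[OF u assms(2)]
 show ?thesis
 proof (rule iso_pointwise[OF MorD(4)[OF u] U(3)])
  fix a assume a: "a \<in> Obj K"
  have "le K a a'" if "a' \<in> Obj K" "le L (FO u a) (FO u a')" for a'
   using assms(1) that a by (simp add: embedding_def)
  hence "is_iso \<E> (vala K a (eps u F) ** step L (FO u a) (FO u a) (sta u F))"
   using sta_val[OF u assms(2) a le_refl[OF MorD(5)[OF u] Mor_obj[OF u a]]] by blast
  thus "is_iso \<E> (vala K a (eps u F))"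
   using step_id[OF MorD(5)[OF u] Mor_obj[OF u a] U(2)] vala_hom[OF MorD(4)[OF u] a U(3)]
    val_res[OF u a U(2)] e.ident_right by metis
 qed
qed

text \<open>The comma category at \<open>b\<close> is empty, and over an empty shape all hom sets
  are singletons; the universal property of the value then makes it initial.\<close>

lemma shr_val_initial:
 assumes u: "u \<in> Mor K L" and F: "F \<in> \<O> K" and b: "b \<in> Obj L"
  and no: "\<And>a. a \<in> Obj K \<Longrightarrow> \<not> le L (FO u a) b"
 shows "is_initial \<E> (val L b (shr u F))"
proof -
 note base = shriek_base[OF u b F] and sh = MorD[OF u]
 note p = Mor_to_e[OF base(1)]
 have "Obj (coslice u b) = {}"
  using coslice(2)[OF sh(1) b[folded sh(3)]] no sh(2,3) by (auto simp: le_def)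
 note emp = empty_shape(2)[OF base(1) this]
 have "\<exists>!f. f \<in> hom \<E> (val L b (shr u F)) W" if W: "W \<in> Obj \<E>" for W
 proof (rule ex_ex1I)
  have pW: "res (to_e (coslice u b)) W \<in> \<O> (coslice u b)" using res_obj[OF p W] .
  then obtain g where "g \<in> \<H> (coslice u b) (res (coslice_proj u b) F) (res (to_e (coslice u b)) W)"
   using emp[OF res_obj[OF base(2) F] pW] by blast
  thus "\<exists>f. f \<in> hom \<E> (val L b (shr u F)) W"
   using lunivE[OF base(4), of W g] pull[OF p] W by auto
  fix f g assume fg: "f \<in> hom \<E> (val L b (shr u F)) W" "g \<in> hom \<E> (val L b (shr u F)) W"
  interpret C: category "\<D> (coslice u b)" using cat[OF base(1)] .
  have "k = l" if "k \<in> \<H> (coslice u b) (res (coslice_proj u b) F) (res (to_e (coslice u b)) W)"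
   "l \<in> \<H> (coslice u b) (res (coslice_proj u b) F) (res (to_e (coslice u b)) W)" for k l
   using emp[OF res_obj[OF base(2) F] pW] that by blast
  thus "f = g"
   using luniv_eqI[OF pull(1)[OF p] base(4), of f W g] pull[OF p] fg
    C.comp_hom[OF lunivD(2)[OF base(4), unfolded pull[OF p]] resa_hom[OF p fg(1)]]
    C.comp_hom[OF lunivD(2)[OF base(4), unfolded pull[OF p]] resa_hom[OF p fg(2)]] by simp
 qed
 thus ?thesis
  using val_obj[OF sh(5) b shr_luniv(2)[OF u F]] by (simp add: is_initial_def)
qed

lemma sta_val_terminal:
 assumes u: "u \<in> Mor K L" and F: "F \<in> \<O> K" and b: "b \<in> Obj L"
  and no: "\<And>a. a \<in> Obj K \<Longrightarrow> \<not> le L b (FO u a)"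
 shows "is_terminal \<E> (val L b (sta u F))"
proof -
 note base = star_base[OF u b F] and sh = MorD[OF u]
 note p = Mor_to_e[OF base(1)]
 have "Obj (slice u b) = {}"
  using slice(2)[OF sh(1) b[folded sh(3)]] no sh(2,3) by (auto simp: le_def)
 note emp = empty_shape(2)[OF base(1) this]
 have "\<exists>!f. f \<in> hom \<E> W (val L b (sta u F))" if W: "W \<in> Obj \<E>" for W
 proof (rule ex_ex1I)
  have pW: "res (to_e (slice u b)) W \<in> \<O> (slice u b)" using res_obj[OF p W] .
  then obtain g where "g \<in> \<H> (slice u b) (res (to_e (slice u b)) W) (res (slice_proj u b) F)"
   using emp[OF pW res_obj[OF base(2) F]] by blast
  thus "\<exists>f. f \<in> hom \<E> W (val L b (sta u F))"
   using runivE[OF base(4), of W g] pull[OF p] W by auto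
  fix f g assume fg: "f \<in> hom \<E> W (val L b (sta u F))" "g \<in> hom \<E> W (val L b (sta u F))"
  interpret C: category "\<D> (slice u b)" using cat[OF base(1)] .
  have "k = l" if "k \<in> \<H> (slice u b) (res (to_e (slice u b)) W) (res (slice_proj u b) F)"
   "l \<in> \<H> (slice u b) (res (to_e (slice u b)) W) (res (slice_proj u b) F)" for k l
   using emp[OF pW res_obj[OF base(2) F]] that by blast
  thus "f = g"
   using runiv_eqI[OF pull(1)[OF p] base(4), of f W g] pull[OF p] fg
    C.comp_hom[OF resa_hom[OF p fg(1)] runivD(2)[OF base(4), unfolded pull[OF p]]]
    C.comp_hom[OF resa_hom[OF p fg(2)] runivD(2)[OF base(4), unfolded pull[OF p]]] by simp
 qed
 thus ?thesis
  using val_obj[OF sh(5) b sta_runiv(2)[OF u F]] by (simp add: is_terminal_def)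
qed

text \<open>\<open>Q\<close> is the left Kan extension of its own restriction: arrows out of
  \<open>Q\<close> are the same as arrows out of \<open>res t Q\<close>. The condition refers to no
  chosen adjoint; cocartesian squares, extensions by zero and triangles are all manipulated in this
  form.\<close>

abbreviation lext :: "'a scat \<Rightarrow> 'a sftor \<Rightarrow> 'b \<Rightarrow> bool"
 where "lext K t Q \<equiv> luniv (pull D t) (res t Q) Q (idn K (res t Q))"

abbreviation rext :: "'a scat \<Rightarrow> 'a sftor \<Rightarrow> 'b \<Rightarrow> bool"
 where "rext K t Q \<equiv> runiv (pull D t) (res t Q) Q (idn K (res t Q))"

context
 fixes u :: "'a sftor" and K L :: "'a scat"
 assumes u: "u \<in> Mor K L"
begin

interpretation K: category "\<D> K" using cat[OF MorD(4)[OF u]] .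

lemma pull_lunivE:
 assumes "luniv (pull D u) X R \<eta>" "S \<in> \<O> L" "f \<in> \<H> K X (res u S)"
 obtains g where "g \<in> \<H> L R S" "resa u g *[K] \<eta> = f"
 using lunivE[OF assms(1), of S f] pull[OF u] assms(2,3) by auto

lemma pull_runivE:
 assumes "runiv (pull D u) X R \<epsilon>" "S \<in> \<O> L" "f \<in> \<H> K (res u S) X"
 obtains g where "g \<in> \<H> L S R" "\<epsilon> *[K] resa u g = f"
 using runivE[OF assms(1), of S f] pull[OF u] assms(2,3) by auto

lemma pull_luniv_eqI:
 assumes "luniv (pull D u) X R \<eta>" "g \<in> \<H> L R S" "h \<in> \<H> L R S" "resa u g *[K] \<eta> = resa u h *[K] \<eta>"
 shows "g = h"
 using luniv_eqI[OF pull(1)[OF u] assms(1), of g S h] pull[OF u] assms(2-4) by simp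

lemma pull_runiv_eqI:
 assumes "runiv (pull D u) X R \<epsilon>" "g \<in> \<H> L S R" "h \<in> \<H> L S R" "\<epsilon> *[K] resa u g = \<epsilon> *[K] resa u h"
 shows "g = h"
 using runiv_eqI[OF pull(1)[OF u] assms(1), of g S h] pull[OF u] assms(2-4) by simp

lemma lext_ex:
 assumes "lext K u Q" "S \<in> \<O> L" "f \<in> \<H> K (res u Q) (res u S)"
 obtains g where "g \<in> \<H> L Q S" "resa u g = f"
 using pull_lunivE[OF assms] K.ident_right[OF resa_hom[OF u]] by metis

lemma rext_ex:
 assumes "rext K u Q" "S \<in> \<O> L" "f \<in> \<H> K (res u S) (res u Q)"
 obtains g where "g \<in> \<H> L S Q" "resa u g = f"
 using pull_runivE[OF assms] K.ident_left[OF resa_hom[OF u]] by metis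

lemma lext_eqI: "lext K u Q \<Longrightarrow> g \<in> \<H> L Q S \<Longrightarrow> h \<in> \<H> L Q S \<Longrightarrow> resa u g = resa u h \<Longrightarrow> g = h"
 by (rule pull_luniv_eqI) simp_all

lemma rext_eqI: "rext K u Q \<Longrightarrow> g \<in> \<H> L S Q \<Longrightarrow> h \<in> \<H> L S Q \<Longrightarrow> resa u g = resa u h \<Longrightarrow> g = h"
 by (rule pull_runiv_eqI) simp_all

lemmas shr_ex = pull_lunivE[OF shr_luniv(1)[OF u]] and shr_eqI = pull_luniv_eqI[OF shr_luniv(1)[OF u]]

lemmas sta_ex = pull_runivE[OF sta_runiv(1)[OF u]] and sta_eqI = pull_runiv_eqI[OF sta_runiv(1)[OF u]]

end

end

section \<open>Objects of D(A \<times> [1]) and their underlying arrows\<close>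

abbreviation ar :: "'u::infinite scat \<Rightarrow> 'u scat" where "ar A \<equiv> prod_cat A arrow_cat"
abbreviation s0 :: "'u::infinite scat \<Rightarrow> 'u sftor" where "s0 A \<equiv> slot A arrow_cat (cnat 0)"
abbreviation s1 :: "'u::infinite scat \<Rightarrow> 'u sftor" where "s1 A \<equiv> slot A arrow_cat (cnat 1)"

lemma Mor_s: "thin A \<Longrightarrow> s0 A \<in> Mor A (ar A)" "thin A \<Longrightarrow> s1 A \<in> Mor A (ar A)"
 by (simp_all add: Mor_slot)

lemma fle_slot: "thin A \<Longrightarrow> thin I \<Longrightarrow> le I i j \<Longrightarrow> fle (slot A I i) (slot A I j)"
 using le_objs[of I i j] by (intro Mor_fleI[OF Mor_slot Mor_slot]) (auto intro: le_refl)

lemma fle_s: "thin A \<Longrightarrow> fle (s0 A) (s1 A)"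
 by (rule fle_slot) simp_all

lemma embedding_s: "thin A \<Longrightarrow> embedding A (ar A) (s0 A)" "thin A \<Longrightarrow> embedding A (ar A) (s1 A)"
 using Mor_s by (auto simp: embedding_def)

lemma slot_arr_cell:
 assumes "thin A" "thin I" "k \<in> Arr I"
 shows "slot_arr A I k = cell (slot A I (Cod I k)) (slot A I (Dom I k))"
proof -
 interpret A: category A using thin_category assms(1) .
 have "cpair (Ident A a) k = the_arr (prod_cat A I) (cpair a (Dom I k)) (cpair a (Cod I k))" if "a \<in> Obj A" for a
 proof -
  have "cpair (Ident A a) k \<in> hom (prod_cat A I) (cpair a (Dom I k)) (cpair a (Cod I k))"
   unfolding hom_prod_cat[OF assms(1,2)] using A.ident_hom[OF that] assms(3) by (auto simp: hom_def)
  thus ?thesis using the_arr_eq[OF thin_prod_cat[OF assms(1,2)]] by metis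
 qed
 thus ?thesis
  unfolding slot_arr_def cell_def mk_ntrans_def by (auto intro!: restrict_ext)
qed

lemma pt_arr_cell:
 assumes "thin I" "k \<in> Arr I"
 shows "pt_arr I k = cell (pt I (Cod I k)) (pt I (Dom I k))"
proof -
 have "k = the_arr I (Dom I k) (Cod I k)"
  using the_arr_eq[OF assms(1), of k] assms(2) by (simp add: hom_def)
 thus ?thesis
  unfolding pt_arr_def cell_def mk_ntrans_def by (auto intro!: restrict_ext)
qed

context derivator
begin

text \<open>The functor axioms are \<open>tr_id\<close> and \<open>tr_comp\<close>. The general
  form, for a monotone family of maps, serves both the diagram functor and its partial
  version.\<close>

lemma family_ftor:
 assumes I: "thin I" and A: "thin A" and \<sigma>: "\<And>i. i \<in> Obj I \<Longrightarrow> \<sigma> i \<in> Mor A B"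
  and le: "\<And>i j. le I i j \<Longrightarrow> fle (\<sigma> i) (\<sigma> j)" and F: "F \<in> \<O> B"
 shows "is_ftor (mk_ftor (op_cat I) (\<D> A) (\<lambda>i. res (\<sigma> i) F) (\<lambda>k. tr (\<sigma> (Cod I k)) (\<sigma> (Dom I k)) F))"
proof (rule mk_ftorI)
 interpret I: category I using thin_category I .
 show "category (op_cat I)" using thin_category[OF thin_op_cat[OF I]] .
 show "category (\<D> A)" using cat[OF A] .
 show "res (\<sigma> i) F \<in> \<O> A" if "i \<in> Obj (op_cat I)" for i
  using res_obj[OF \<sigma> F] that by (simp add: op_cat_simps)
 show "tr (\<sigma> (Cod I k)) (\<sigma> (Dom I k)) F \<in> \<H> A (res (\<sigma> i) F) (res (\<sigma> j) F)"
  if k: "k \<in> hom (op_cat I) i j" for k i j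
 proof -
  have "k \<in> hom I j i" using k by (simp add: hom_op_cat)
  hence "le I i j" "Cod I k = i" "Dom I k = j" "i \<in> Obj I" using I.hom_objs[of k j i] by (auto simp: le_def hom_def)
  thus ?thesis using tr_hom[OF le \<sigma> F] by simp
 qed
 show "tr (\<sigma> (Cod I (Ident (op_cat I) i))) (\<sigma> (Dom I (Ident (op_cat I) i))) F = idn A (res (\<sigma> i) F)"
  if "i \<in> Obj (op_cat I)" for i
  using tr_id[OF \<sigma> F] I.ident_arr that by (simp add: op_cat_def)
 show "tr (\<sigma> (Cod I (l \<cdot>[op_cat I] k))) (\<sigma> (Dom I (l \<cdot>[op_cat I] k))) F =
   tr (\<sigma> (Cod I l)) (\<sigma> (Dom I l)) F *[A] tr (\<sigma> (Cod I k)) (\<sigma> (Dom I k)) F"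
  if k: "k \<in> hom (op_cat I) x y" and l: "l \<in> hom (op_cat I) y z" for k l x y z
 proof -
  have kl: "k \<in> hom I y x" "l \<in> hom I z y" using k l by (simp_all add: hom_op_cat)
  hence "k \<cdot>[I] l \<in> hom I z x" using I.comp_hom by blast
  moreover have "le I x y" "le I y z" "x \<in> Obj I" using kl I.hom_objs[OF kl(1)] by (auto simp: le_def)
  ultimately show ?thesis
   using tr_comp[OF le le \<sigma> F, of x y z] kl by (simp add: hom_def op_cat_simps)
 qed
qed

lemma pdiag_obj_ftor:
 assumes "thin A" "thin I" "F \<in> \<O> (prod_cat A I)"
 shows "is_ftor (pdiag_obj D A I F)"
  "k \<in> hom I j i \<Longrightarrow> FA (pdiag_obj D A I F) k = tr (slot A I i) (slot A I j) F"
proof -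
 have k: "NC (pull2 D (slot_arr A I k)) F = tr (slot A I (Cod I k)) (slot A I (Dom I k)) F" if "k \<in> Arr I" for k
  unfolding slot_arr_cell[OF assms(1,2) that] tr_def ..
 have "pdiag_obj D A I F = mk_ftor (op_cat I) (\<D> A) (\<lambda>i. res (slot A I i) F) (\<lambda>k. tr (slot A I (Cod I k)) (slot A I (Dom I k)) F)"
  unfolding pdiag_obj_def mk_ftor_def using k by (auto simp: op_cat_def intro!: restrict_ext)
 thus "is_ftor (pdiag_obj D A I F)"
  using family_ftor[OF assms(2,1) Mor_slot[OF assms(1,2)] fle_slot[OF assms(1,2)] assms(3)] by simp
 show "k \<in> hom I j i \<Longrightarrow> FA (pdiag_obj D A I F) k = tr (slot A I i) (slot A I j) F"
  using k by (simp add: pdiag_obj_def hom_def op_cat_def)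
qed

lemma diag_obj_ftor:
 assumes "thin I" "F \<in> \<O> I"
 shows "is_ftor (diag_obj D I F)" "k \<in> hom I j i \<Longrightarrow> FA (diag_obj D I F) k = step I i j F"
proof -
 have k: "NC (pull2 D (pt_arr I k)) F = step I (Cod I k) (Dom I k) F" if "k \<in> Arr I" for k
  unfolding pt_arr_cell[OF assms(1) that] tr_def ..
 have "diag_obj D I F = mk_ftor (op_cat I) \<E> (\<lambda>i. val I i F) (\<lambda>k. step I (Cod I k) (Dom I k) F)"
  unfolding diag_obj_def mk_ftor_def using k by (auto simp: op_cat_def intro!: restrict_ext)
 thus "is_ftor (diag_obj D I F)"
  using family_ftor[OF assms(1) thin_e Mor_pt[OF assms(1)] fle_pt[OF assms(1)] assms(2)] by simp
 show "k \<in> hom I j i \<Longrightarrow> FA (diag_obj D I F) k = step I i j F"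
  using k by (simp add: diag_obj_def hom_def op_cat_def)
qed

abbreviation "bd A F \<equiv> tr (s0 A) (s1 A) F"

lemma bd_hom: "thin A \<Longrightarrow> F \<in> \<O> (ar A) \<Longrightarrow> bd A F \<in> \<H> A (res (s0 A) F) (res (s1 A) F)"
 by (rule tr_hom[OF fle_s Mor_s(1)])

lemma bd_nat: "thin A \<Longrightarrow> f \<in> \<H> (ar A) F G \<Longrightarrow>
  bd A G *[A] resa (s0 A) f = resa (s1 A) f *[A] bd A F"
 by (rule tr_nat[OF fle_s Mor_s(1)])

lemma op_arrow_cases:
 assumes "k \<in> hom (op_cat arrow_cat) x y"
 shows "(x = cnat 0 \<and> y = cnat 0) \<or> (x = cnat 0 \<and> y = cnat 1) \<or> (x = cnat 1 \<and> y = cnat 1)"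
proof -
 have "le arrow_cat x y" using assms by (auto simp: hom_op_cat le_def)
 moreover from this have "x \<in> {cnat 0, cnat 1}" "y \<in> {cnat 0, cnat 1}" using le_objs[OF thin_arrow] by auto
 ultimately show ?thesis by auto
qed

text \<open>A commutative square is a natural transformation between the two underlying arrow
  diagrams, so the fullness in \<open>der5\<close> applies. No uniqueness of the lift is asserted,
  which is why constructions based on it are claimed only to exist.\<close>

lemma der5_full:
 assumes A: "thin A" and F: "F \<in> \<O> (ar A)" and G: "G \<in> \<O> (ar A)"
  and a: "a \<in> \<H> A (res (s0 A) F) (res (s0 A) G)" and b: "b \<in> \<H> A (res (s1 A) F) (res (s1 A) G)"
  and eq: "b *[A] bd A F = bd A G *[A] a"
 obtains f where "f \<in> \<H> (ar A) F G" "resa (s0 A) f = a" "resa (s1 A) f = b"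
proof -
 interpret A: category "\<D> A" using cat[OF A] .
 let ?I = "arrow_cat :: 'a scat" and ?p = "pdiag_obj D A arrow_cat"
 let ?c = "\<lambda>i. if i = cnat 0 then a else b"
 have st: "Src (?p X) = op_cat ?I" "Tgt (?p X) = \<D> A" for X by (simp_all add: pdiag_obj_def)
 have FOp: "FO (?p X) i = res (slot A ?I i) X" if "i \<in> {cnat 0, cnat 1}" for X i
  using that by (simp add: pdiag_obj_def op_cat_simps)
 have FAp: "FA (?p X) k = tr (slot A ?I i) (slot A ?I j) X" if "X \<in> \<O> (ar A)" "k \<in> hom (op_cat ?I) i j" for X k i j
  using pdiag_obj_ftor(2)[OF A thin_arrow that(1), of k j i] that(2) by (simp add: hom_op_cat)
 have id: "tr (slot A ?I i) (slot A ?I i) X = idn A (res (slot A ?I i) X)"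
  if "X \<in> \<O> (ar A)" "i \<in> {cnat 0, cnat 1}" for X i
  using tr_id[OF Mor_slot[OF A thin_arrow]] that by simp
 have "is_ntrans (mk_ntrans (?p F) (?p G) ?c)"
 proof (rule mk_ntransI)
  show "is_ftor (?p F)" "is_ftor (?p G)" using pdiag_obj_ftor(1)[OF A thin_arrow] F G by auto
  show "Src (?p G) = Src (?p F)" "Tgt (?p G) = Tgt (?p F)" using st by simp_all
  show "?c i \<in> hom (Tgt (?p F)) (FO (?p F) i) (FO (?p G) i)" if "i \<in> Obj (Src (?p F))" for i
   using that a b st FOp by (auto simp: op_cat_simps)
  show "?c y \<cdot>[Tgt (?p F)] FA (?p F) k = FA (?p G) k \<cdot>[Tgt (?p F)] ?c x" if k: "k \<in> hom (Src (?p F)) x y" for k x y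
  proof -
   have k': "k \<in> hom (op_cat ?I) x y" using k st by simp
   show ?thesis
    unfolding st FAp[OF F k'] FAp[OF G k']
    using op_arrow_cases[OF k'] eq id F G A.ident_left[OF a] A.ident_left[OF b] A.ident_right[OF a] A.ident_right[OF b]
    by auto
  qed
 qed
 hence "mk_ntrans (?p F) (?p G) ?c \<in> hom (fun_cat (op_cat ?I) (\<D> A)) (?p F) (?p G)"
  using st by (simp add: hom_fun_cat)
 moreover have "full (pdiag D A ?I)" using der5[OF thin_category[OF A]] by simp
 hence "hom (Tgt (pdiag D A ?I)) (FO (pdiag D A ?I) F) (FO (pdiag D A ?I) G) \<subseteq> FA (pdiag D A ?I) ` \<H> (ar A) F G"
  using F G unfolding full_def by (simp add: pdiag_def)
 moreover have "Tgt (pdiag D A ?I) = fun_cat (op_cat ?I) (\<D> A)" "FO (pdiag D A ?I) F = ?p F" "FO (pdiag D A ?I) G = ?p G"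
  using F G by (simp_all add: pdiag_def)
 ultimately have "mk_ntrans (?p F) (?p G) ?c \<in> FA (pdiag D A ?I) ` \<H> (ar A) F G" by auto
 then obtain f where f: "f \<in> \<H> (ar A) F G" "FA (pdiag D A ?I) f = mk_ntrans (?p F) (?p G) ?c" by auto
 have "NC (FA (pdiag D A ?I) f) i = resa (slot A ?I i) f" if "i \<in> {cnat 0, cnat 1}" for i
  using f(1) that st by (simp add: pdiag_def hom_def op_cat_simps)
 hence "resa (slot A ?I i) f = ?c i" if "i \<in> {cnat 0, cnat 1}" for i
  using f(2) that st by (simp add: op_cat_simps)
 from this[of "cnat 0"] this[of "cnat 1"] show thesis using that[OF f(1)] by simp
qed

lemma der5_lift:
 assumes A: "thin A" and f: "f \<in> \<H> A X Y"
 obtains F x y where "F \<in> \<O> (ar A)" "x \<in> \<H> A (res (s0 A) F) X" "\<I> A x"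
  "y \<in> \<H> A (res (s1 A) F) Y" "\<I> A y" "y *[A] bd A F = f *[A] x"
proof -
 interpret A: category "\<D> A" using cat[OF A] .
 let ?I = "arrow_cat :: 'a scat" and ?p = "pdiag_obj D A arrow_cat"
 interpret I: category ?I using thin_category[OF thin_arrow] .
 interpret J: category "op_cat ?I" using thin_category[OF thin_op_cat[OF thin_arrow]] .
 have XY: "X \<in> \<O> A" "Y \<in> \<O> A" using A.hom_objs[OF f] by auto
 let ?u = "\<lambda>i. if i = cnat 0 then X else Y"
 \<comment> \<open>Ends are read off in \<open>arrow_cat\<close>, opposite to the shape of the
   diagram. The three cases are the identity at 1, the identity at 0 and the arrow from 0 to
   1.\<close>
 let ?v = "\<lambda>k. if Cod ?I k = cnat 1 then idn A Y else if Dom ?I k = cnat 0 then idn A X else f"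
 let ?\<Phi> = "mk_ftor (op_cat ?I) (\<D> A) ?u ?v"
 have v: "?v k = (if i = cnat 1 then idn A Y else if j = cnat 0 then idn A X else f)"
  if "k \<in> hom (op_cat ?I) i j" for k i j
  using that by (auto simp: op_cat_def hom_def)
 have "is_ftor ?\<Phi>"
 proof (rule mk_ftorI)
  show "category (op_cat ?I)" "category (\<D> A)" by unfold_locales
  show "?u i \<in> \<O> A" if "i \<in> Obj (op_cat ?I)" for i using XY by simp
  show "?v k \<in> \<H> A (?u i) (?u j)" if k: "k \<in> hom (op_cat ?I) i j" for k i j
   unfolding v[OF k] using op_arrow_cases[OF k] XY f by (auto intro: A.ident_hom)
  show "?v (Ident (op_cat ?I) i) = idn A (?u i)" if i: "i \<in> Obj (op_cat ?I)" for i
   unfolding v[OF J.ident_hom[OF i]] using i by (auto simp: op_cat_simps)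
  show "?v (l \<cdot>[op_cat ?I] k) = ?v l *[A] ?v k"
   if k: "k \<in> hom (op_cat ?I) i j" and l: "l \<in> hom (op_cat ?I) j m" for k l i j m
   unfolding v[OF k] v[OF l] v[OF J.comp_hom[OF k l]]
   using op_arrow_cases[OF k] op_arrow_cases[OF l] A.ident_left[OF f] A.ident_right[OF f]
    A.ident_left[OF A.ident_hom[OF XY(1)]] A.ident_left[OF A.ident_hom[OF XY(2)]] by auto
 qed
 hence "?\<Phi> \<in> Obj (Tgt (pdiag D A ?I))" by (simp add: pdiag_def fun_cat_def)
 moreover have "essentially_surjective (pdiag D A ?I)" using der5[OF thin_category[OF A]] by simp
 ultimately obtain F where F: "F \<in> \<O> (ar A)" "isomorphic (fun_cat (op_cat ?I) (\<D> A)) (?p F) ?\<Phi>"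
  unfolding essentially_surjective_def by (auto simp: pdiag_def)
 obtain c where c: "\<And>i. i \<in> Obj (op_cat ?I) \<Longrightarrow> c i \<in> \<H> A (FO (?p F) i) (FO ?\<Phi> i)"
  "\<And>i. i \<in> Obj (op_cat ?I) \<Longrightarrow> \<I> A (c i)"
  "\<And>k i j. k \<in> hom (op_cat ?I) i j \<Longrightarrow> c j *[A] FA (?p F) k = FA ?\<Phi> k *[A] c i"
  by (rule isomorphic_fun_catE[OF F(2)]) (rule that)
 have o: "cnat 0 \<in> Obj (op_cat ?I)" "cnat 1 \<in> Obj (op_cat ?I)" by (simp_all add: op_cat_simps)
 have "le ?I (cnat 0) (cnat 1)" by simp
 then obtain k where k: "k \<in> hom ?I (cnat 1) (cnat 0)" by (auto simp: le_def)
 hence k': "k \<in> hom (op_cat ?I) (cnat 0) (cnat 1)" by (simp add: hom_op_cat)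
 have "FA ?\<Phi> k = f" using k v[OF k'] by (simp add: hom_def op_cat_def)
 moreover have "FA (?p F) k = bd A F" using pdiag_obj_ftor(2)[OF A thin_arrow F(1) k] .
 ultimately have "c (cnat 1) *[A] bd A F = f *[A] c (cnat 0)" using c(3)[OF k'] by simp
 moreover have "c (cnat 0) \<in> \<H> A (res (s0 A) F) X" "c (cnat 1) \<in> \<H> A (res (s1 A) F) Y"
  using c(1)[OF o(1)] c(1)[OF o(2)] by (simp_all add: pdiag_obj_def op_cat_simps)
 ultimately show thesis using that[OF F(1), of "c (cnat 0)" "c (cnat 1)"] c(2) o by blast
qed

lemma iso_slots:
 assumes A: "thin A" and f: "f \<in> \<H> (ar A) F G"
  and i: "\<I> A (resa (s0 A) f)" "\<I> A (resa (s1 A) f)"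
 shows "\<I> (ar A) f"
proof (rule iso_pointwise[OF _ f])
 show "thin (ar A)" using A by simp
 fix x assume "x \<in> Obj (ar A)"
 then obtain a where x: "a \<in> Obj A" "x = cpair a (cnat 0) \<or> x = cpair a (cnat 1)" by auto
 have "is_iso \<E> (vala A a (resa (s0 A) f))" "is_iso \<E> (vala A a (resa (s1 A) f))"
  using resa_iso[OF Mor_pt[OF A x(1)] resa_hom[OF Mor_s(1)[OF A] f] i(1)]
   resa_iso[OF Mor_pt[OF A x(1)] resa_hom[OF Mor_s(2)[OF A] f] i(2)] by auto
 thus "is_iso \<E> (vala (ar A) x f)"
  using vala_resa[OF Mor_s(1)[OF A] x(1) f] vala_resa[OF Mor_s(2)[OF A] x(1) f] x by auto
qed

end

section \<open>Zero objects and extension by zero\<close>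

context pointed_derivator
begin

sublocale E: category "\<E>" by (rule cat) simp

text \<open>Left Kan extension along the inclusion of the empty category has initial values. The
  inclusion is also an open immersion, so by \<open>der6_open\<close> the extension functor itself
  has a left adjoint; as a right adjoint it has terminal values, all objects over the empty shape
  being terminal.\<close>

lemma zero_exists: "\<exists>z. is_zero \<E> z"
proof -
 let ?O = "coprod_cat ({} :: 'a set) (\<lambda>_. e_cat)" and ?u = "mono_ftor (coprod_cat ({} :: 'a set) (\<lambda>_. e_cat)) e_cat (\<lambda>x. x)"
 have O: "thin ?O" "Obj ?O = {}" by simp_all
 have u: "?u \<in> Mor ?O e_cat" using shape_mono_ftor[of ?O e_cat "\<lambda>x. x"] by (simp add: Mor_def)
 have "open_immersion ?u"
  using MorD(6)[OF u] by (simp add: open_immersion_def full_def faithful_def)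
 then obtain v \<eta> \<epsilon> where "adjunction v (lower_shriek D ?u) \<eta> \<epsilon>"
  using der6_open[of ?u] unfolding has_left_adjoint_def by blast
 from adjunction_luniv[OF this]
 have lu: "luniv (lower_shriek D ?u) W (FO v W) (NC \<eta> W)" if "W \<in> Obj \<E>" for W
  using that shriek_ftor[OF u] by simp
 obtain X where X: "X \<in> \<O> ?O" using empty_shape(1)[OF O] by blast
 note emp = empty_shape(2)[OF O]
 interpret O: category "\<D> ?O" using cat[OF O(1)] .
 let ?z = "shr ?u X"
 note z = shr_luniv[OF u X]
 have uniq: "f = g" if "f \<in> \<H> ?O Y Z" "g \<in> \<H> ?O Y Z" for f g Y Z
  using emp[of Y Z] O.hom_objs[OF that(1)] that by blast
 have "\<exists>!f. f \<in> hom \<E> ?z W" if W: "W \<in> Obj \<E>" for W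
 proof (rule ex_ex1I)
  obtain g where "g \<in> \<H> ?O X (res ?u W)" using emp[OF X res_obj[OF u W]] by blast
  thus "\<exists>f. f \<in> hom \<E> ?z W" using pull_lunivE[OF u z(1) W] by metis
  fix f g assume fg: "f \<in> hom \<E> ?z W" "g \<in> hom \<E> ?z W"
  show "f = g"
   using pull_luniv_eqI[OF u z(1) fg] uniq[OF O.comp_hom[OF z(3) resa_hom[OF u fg(1)]] O.comp_hom[OF z(3) resa_hom[OF u fg(2)]]] by simp
 qed
 moreover have "\<exists>!f. f \<in> hom \<E> W ?z" if W: "W \<in> Obj \<E>" for W
 proof (rule ex_ex1I)
  note l = lu[OF W] and s = shriek_ftor[OF u]
  have vW: "FO v W \<in> \<O> ?O" "NC \<eta> W \<in> hom \<E> W (shr ?u (FO v W))" using lunivD[OF l] s by auto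
  obtain g where g: "g \<in> \<H> ?O (FO v W) X" using emp[OF vW(1) X] by blast
  thus "\<exists>f. f \<in> hom \<E> W ?z"
   using E.comp_hom[OF vW(2)] ftorD(4)[OF s(1)] s by metis
  fix f g assume fg: "f \<in> hom \<E> W ?z" "g \<in> hom \<E> W ?z"
  obtain h where h: "h \<in> \<H> ?O (FO v W) X" "FA (lower_shriek D ?u) h ** NC \<eta> W = f"
   using lunivE[OF l, of X f] s X fg by auto
  obtain k where k: "k \<in> \<H> ?O (FO v W) X" "FA (lower_shriek D ?u) k ** NC \<eta> W = g"
   using lunivE[OF l, of X g] s X fg by auto
  show "f = g" using h k uniq[OF h(1) k(1)] by simp
 qed
 ultimately have "is_zero \<E> ?z" using z(2) by (simp add: is_zero_def is_initial_def is_terminal_def)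
 thus ?thesis by blast
qed

lemma zero_if_initial:
 assumes "is_initial \<E> z"
 shows "is_zero \<E> z"
proof -
 have z: "z \<in> Obj \<E>" "\<exists>!f. f \<in> hom \<E> z z" using assms by (auto simp: is_initial_def)
 obtain w where "is_zero \<E> w" using zero_exists by blast
 thus ?thesis using E.zero_if_ident_unique[OF _ z(1)] z(2) by blast
qed

lemma zero_if_terminal:
 assumes "is_terminal \<E> z"
 shows "is_zero \<E> z"
proof -
 have z: "z \<in> Obj \<E>" "\<exists>!f. f \<in> hom \<E> z z" using assms by (auto simp: is_terminal_def)
 obtain w where "is_zero \<E> w" using zero_exists by blast
 thus ?thesis using E.zero_if_ident_unique[OF _ z(1)] z(2) by blast
qed

lemma shr_val_zero:
 assumes "u \<in> Mor K L" "F \<in> \<O> K" "b \<in> Obj L" "\<And>a. a \<in> Obj K \<Longrightarrow> \<not> le L (FO u a) b"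
 shows "is_zero \<E> (val L b (shr u F))"
 using zero_if_initial[OF shr_val_initial[OF assms]] .

lemma sta_val_zero:
 assumes "u \<in> Mor K L" "F \<in> \<O> K" "b \<in> Obj L" "\<And>a. a \<in> Obj K \<Longrightarrow> \<not> le L b (FO u a)"
 shows "is_zero \<E> (val L b (sta u F))"
 using zero_if_terminal[OF sta_val_terminal[OF assms]] .

lemma iso_supported:
 assumes t: "t \<in> Mor K L" and \<kappa>: "\<kappa> \<in> \<H> L P Q" "\<I> K (resa t \<kappa>)"
  and off: "\<And>b. b \<in> Obj L \<Longrightarrow> b \<notin> FO t ` Obj K \<Longrightarrow> is_zero \<E> (val L b P) \<and> is_zero \<E> (val L b Q)"
 shows "\<I> L \<kappa>"
proof (rule iso_pointwise[OF MorD(5)[OF t] \<kappa>(1)])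
 fix b assume b: "b \<in> Obj L"
 show "is_iso \<E> (vala L b \<kappa>)"
 proof (cases "b \<in> FO t ` Obj K")
  case True
  then obtain a where a: "a \<in> Obj K" "b = FO t a" by auto
  thus ?thesis
   using resa_iso[OF Mor_pt[OF MorD(4)[OF t] a(1)] resa_hom[OF t \<kappa>(1)] \<kappa>(2)] vala_resa[OF t a(1) \<kappa>(1)] by simp
 next
  case False
  thus ?thesis using E.iso_zero[OF _ _ vala_hom[OF MorD(5)[OF t] b \<kappa>(1)]] off[OF b] by blast
 qed
qed

text \<open>This is extension by zero. A left Kan extension vanishes at points with no image point
  below them, so by hypothesis it and \<open>Q\<close> are both zero off the image; on the image the
  comparison is invertible because \<open>t\<close> is an embedding.\<close>

lemma luniv_supported:
 assumes t: "embedding K L t" and Q: "Q \<in> \<O> L"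
  and off: "\<And>b. b \<in> Obj L \<Longrightarrow> b \<notin> FO t ` Obj K \<Longrightarrow>
   is_zero \<E> (val L b Q) \<and> (\<forall>a \<in> Obj K. \<not> le L (FO t a) b)"
 shows "lext K t Q"
proof -
 have tm: "t \<in> Mor K L" using t by (simp add: embedding_def)
 interpret K: category "\<D> K" using cat[OF MorD(4)[OF tm]] .
 have tQ: "res t Q \<in> \<O> K" using res_obj[OF tm Q] .
 note U = shr_luniv[OF tm tQ]
 obtain \<kappa> where \<kappa>: "\<kappa> \<in> \<H> L (shr t (res t Q)) Q" "resa t \<kappa> *[K] eta t (res t Q) = idn K (res t Q)"
  using shr_ex[OF tm tQ Q K.ident_hom[OF tQ]] .
 have "\<I> K (resa t \<kappa>)"
  using K.iso_cancel_right[OF U(3) resa_hom[OF tm \<kappa>(1)] _ eta_iso[OF t tQ]] \<kappa>(2) K.iso_ident[OF tQ] by simp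
 hence "\<I> L \<kappa>" by (rule iso_supported[OF tm \<kappa>(1)]) (use shr_val_zero[OF tm tQ] off in blast)
 thus ?thesis using luniv_postcomp[OF pull(1)[OF tm] U(1), of \<kappa> Q] pull[OF tm] \<kappa> by simp
qed

lemma runiv_supported:
 assumes t: "embedding K L t" and Q: "Q \<in> \<O> L"
  and off: "\<And>b. b \<in> Obj L \<Longrightarrow> b \<notin> FO t ` Obj K \<Longrightarrow>
   is_zero \<E> (val L b Q) \<and> (\<forall>a \<in> Obj K. \<not> le L b (FO t a))"
 shows "rext K t Q"
proof -
 have tm: "t \<in> Mor K L" using t by (simp add: embedding_def)
 interpret K: category "\<D> K" using cat[OF MorD(4)[OF tm]] .
 have tQ: "res t Q \<in> \<O> K" using res_obj[OF tm Q] .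
 note U = sta_runiv[OF tm tQ]
 obtain \<kappa> where \<kappa>: "\<kappa> \<in> \<H> L Q (sta t (res t Q))" "eps t (res t Q) *[K] resa t \<kappa> = idn K (res t Q)"
  using sta_ex[OF tm tQ Q K.ident_hom[OF tQ]] .
 have "\<I> K (resa t \<kappa>)"
  using K.iso_cancel_left[OF resa_hom[OF tm \<kappa>(1)] U(3) _ eps_iso[OF t tQ]] \<kappa>(2) K.iso_ident[OF tQ] by simp
 hence "\<I> L \<kappa>" by (rule iso_supported[OF tm \<kappa>(1)]) (use sta_val_zero[OF tm tQ] off in blast)
 thus ?thesis using runiv_postcomp[OF pull(1)[OF tm] U(1), of \<kappa> Q] pull[OF tm] \<kappa> by simp
qed

end

section \<open>Cofibers as universal arrows to objects with null source\<close>

section \<open>Cofibers\<close>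

definition prj_ar :: "'u::infinite scat \<Rightarrow> 'u sftor"
 where "prj_ar A = mono_ftor (ar A) A cfst"

definition map_ar :: "'u::infinite sftor \<Rightarrow> 'u sftor"
 where "map_ar u = mono_ftor (ar (Src u)) (ar (Tgt u)) (\<lambda>x. cpair (FO u (cfst x)) (csnd x))"

lemma Mor_prj_ar: "thin A \<Longrightarrow> prj_ar A \<in> Mor (ar A) A"
 unfolding prj_ar_def Mor_def by (auto intro!: shape_mono_ftor)

lemma FO_prj_ar: "a \<in> Obj A \<Longrightarrow> i \<in> Obj arrow_cat \<Longrightarrow> FO (prj_ar A) (cpair a i) = a"
 unfolding prj_ar_def by (subst mono_ftor_simps) auto

lemma Mor_map_ar:
 assumes "u \<in> Mor A B"
 shows "map_ar u \<in> Mor (ar A) (ar B)"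
proof -
 note u = MorD[OF assms]
 have "shape (mono_ftor (ar A) (ar B) (\<lambda>x. cpair (FO u (cfst x)) (csnd x)))"
  by (rule shape_mono_ftor) (use u Mor_obj[OF assms] Mor_le[OF assms] in auto)
 thus ?thesis unfolding map_ar_def Mor_def using u by simp
qed

lemma FO_map_ar: "u \<in> Mor A B \<Longrightarrow> a \<in> Obj A \<Longrightarrow> i \<in> Obj arrow_cat \<Longrightarrow> FO (map_ar u) (cpair a i) = cpair (FO u a) i"
 unfolding map_ar_def by (subst mono_ftor_simps) (auto dest: MorD)

lemma prj_ar_s: "thin A \<Longrightarrow> prj_ar A \<circ>\<^sub>F s0 A = id_ftor A" "thin A \<Longrightarrow> prj_ar A \<circ>\<^sub>F s1 A = id_ftor A"
 by (rule Mor_eqI[OF Mor_comp[OF Mor_s(1) Mor_prj_ar] Mor_id]; simp add: FO_comp[OF Mor_s(1)] FO_prj_ar)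
   (rule Mor_eqI[OF Mor_comp[OF Mor_s(2) Mor_prj_ar] Mor_id]; simp add: FO_comp[OF Mor_s(2)] FO_prj_ar)

lemma map_ar_s:
 assumes "u \<in> Mor A B"
 shows "map_ar u \<circ>\<^sub>F s0 A = s0 B \<circ>\<^sub>F u" "map_ar u \<circ>\<^sub>F s1 A = s1 B \<circ>\<^sub>F u"
proof -
 note u = MorD[OF assms]
 show "map_ar u \<circ>\<^sub>F s0 A = s0 B \<circ>\<^sub>F u"
  by (rule Mor_eqI[OF Mor_comp[OF Mor_s(1)[OF u(4)] Mor_map_ar[OF assms]] Mor_comp[OF assms Mor_s(1)[OF u(5)]]])
    (simp add: FO_comp[OF Mor_s(1)[OF u(4)]] FO_comp[OF assms] FO_map_ar[OF assms] Mor_obj[OF assms])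
 show "map_ar u \<circ>\<^sub>F s1 A = s1 B \<circ>\<^sub>F u"
  by (rule Mor_eqI[OF Mor_comp[OF Mor_s(2)[OF u(4)] Mor_map_ar[OF assms]] Mor_comp[OF assms Mor_s(2)[OF u(5)]]])
    (simp add: FO_comp[OF Mor_s(2)[OF u(4)]] FO_comp[OF assms] FO_map_ar[OF assms] Mor_obj[OF assms])
qed

lemma fle_s_prj_ar: "thin A \<Longrightarrow> fle (s0 A \<circ>\<^sub>F prj_ar A) (id_ftor (ar A))" "thin A \<Longrightarrow> fle (id_ftor (ar A)) (s1 A \<circ>\<^sub>F prj_ar A)"
proof -
 assume A: "thin A"
 hence T: "thin (ar A)" by simp
 show "fle (s0 A \<circ>\<^sub>F prj_ar A) (id_ftor (ar A))"
  by (rule Mor_fleI[OF Mor_comp[OF Mor_prj_ar[OF A] Mor_s(1)[OF A]] Mor_id[OF T]])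
    (use A in \<open>auto simp: FO_comp[OF Mor_prj_ar[OF A]] FO_prj_ar le_refl\<close>)
 show "fle (id_ftor (ar A)) (s1 A \<circ>\<^sub>F prj_ar A)"
  by (rule Mor_fleI[OF Mor_id[OF T] Mor_comp[OF Mor_prj_ar[OF A] Mor_s(2)[OF A]]])
    (use A in \<open>auto simp: FO_comp[OF Mor_prj_ar[OF A]] FO_prj_ar le_refl\<close>)
qed

context pointed_derivator
begin

lemma bd_prj_ar:
 assumes "thin A" "Y \<in> \<O> A"
 shows "res (s0 A) (res (prj_ar A) Y) = Y" "res (s1 A) (res (prj_ar A) Y) = Y"
  "bd A (res (prj_ar A) Y) = idn A Y"
proof -
 show s: "res (s0 A) (res (prj_ar A) Y) = Y" "res (s1 A) (res (prj_ar A) Y) = Y"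
  using res_comp[OF Mor_s(1)[OF assms(1)] Mor_prj_ar[OF assms(1)] assms(2)]
   res_comp[OF Mor_s(2)[OF assms(1)] Mor_prj_ar[OF assms(1)] assms(2)] prj_ar_s[OF assms(1)] res_id[OF assms] by simp_all
 show "bd A (res (prj_ar A) Y) = idn A Y"
  using tr_res[OF fle_s[OF assms(1)] Mor_s(1)[OF assms(1)] Mor_prj_ar[OF assms(1)] assms(2)]
   prj_ar_s[OF assms(1)] tr_id[OF Mor_id[OF assms(1)] assms(2)] res_id[OF assms] by simp
qed

text \<open>The projection is adjoint to the inclusion of the source end, so the free object on
  \<open>Y\<close> at the source is the identity arrow of \<open>Y\<close>.\<close>

lemma luniv_prj_ar:
 assumes "thin A" "Y \<in> \<O> A"
 shows "luniv (pull D (s0 A)) Y (res (prj_ar A) Y) (idn A Y)"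
 using luniv_res[OF Mor_s(1)[OF assms(1)] Mor_prj_ar[OF assms(1)] fle_s_prj_ar(1)[OF assms(1)] _ assms(2)]
  prj_ar_s[OF assms(1)] tr_id[OF Mor_id[OF assms(1)] assms(2)] res_id[OF assms]
  fle_refl[OF MorD(1)[OF Mor_id[OF assms(1)]]] by simp

text \<open>\<open>null_src\<close> singles out the objects \<open>0 \<rightarrow> Y\<close> of \<open>D(A \<times> [1])\<close>; the universal arrow to one of them computes the cofiber.\<close>

definition null_src :: "'a scat \<Rightarrow> 'b \<Rightarrow> bool"
 where "null_src A Z \<longleftrightarrow> Z \<in> \<O> (ar A) \<and> (\<forall>a \<in> Obj A. is_zero \<E> (val (ar A) (cpair a (cnat 0)) Z))"

definition cofiber :: "'a scat \<Rightarrow> 'b \<Rightarrow> 'b \<Rightarrow> 'c \<Rightarrow> bool"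
 where "cofiber A F Z r \<longleftrightarrow> null_src A Z \<and> r \<in> \<H> (ar A) F Z \<and>
  (\<forall>Z' f. null_src A Z' \<longrightarrow> f \<in> \<H> (ar A) F Z' \<longrightarrow> (\<exists>!g. g \<in> \<H> (ar A) Z Z' \<and> g *[ar A] r = f))"

lemma null_src_obj: "null_src A Z \<Longrightarrow> Z \<in> \<O> (ar A)"
 by (simp add: null_src_def)

lemma null_src_off:
 assumes "thin A" "null_src A Z" "b \<in> Obj (ar A)" "b \<notin> FO (s1 A) ` Obj A"
 shows "is_zero \<E> (val (ar A) b Z) \<and> (\<forall>a \<in> Obj A. \<not> le (ar A) (FO (s1 A) a) b)"
proof -
 obtain a where "a \<in> Obj A" "b = cpair a (cnat 0) \<or> b = cpair a (cnat 1)" using assms(3) by auto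
 hence "b = cpair a (cnat 0)" "a \<in> Obj A" using assms(4) by (auto simp: image_iff)
 thus ?thesis using assms(1,2) by (auto simp: null_src_def)
qed

lemma lext_null_src: "thin A \<Longrightarrow> null_src A Z \<Longrightarrow> lext A (s1 A) Z"
 using luniv_supported[OF embedding_s(2) null_src_obj null_src_off] by blast

lemma null_src_shr:
 assumes "thin A" "W \<in> \<O> A"
 shows "null_src A (shr (s1 A) W)" "eta (s1 A) W \<in> \<H> A W (res (s1 A) (shr (s1 A) W))"
  "\<I> A (eta (s1 A) W)"
proof -
 note U = shr_luniv[OF Mor_s(2)[OF assms(1)] assms(2)]
 show "null_src A (shr (s1 A) W)"
  unfolding null_src_def
  using U(2) shr_val_zero[OF Mor_s(2)[OF assms(1)] assms(2)] assms(1) by simp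
 show "eta (s1 A) W \<in> \<H> A W (res (s1 A) (shr (s1 A) W))" by (rule U(3))
 show "\<I> A (eta (s1 A) W)" using eta_iso[OF embedding_s(2)[OF assms(1)] assms(2)] .
qed

lemma cofiberD:
 assumes "cofiber A F Z r"
 shows "null_src A Z" "r \<in> \<H> (ar A) F Z" "Z \<in> \<O> (ar A)"
 using assms by (auto simp: cofiber_def null_src_def)

lemma cofiberE:
 assumes "cofiber A F Z r" "null_src A Z'" "f \<in> \<H> (ar A) F Z'"
 obtains g where "g \<in> \<H> (ar A) Z Z'" "g *[ar A] r = f"
 using assms unfolding cofiber_def by blast

lemma cofiber_eqI:
 assumes A: "thin A" and c: "cofiber A F Z r" and Z': "null_src A Z'" and g: "g \<in> \<H> (ar A) Z Z'"
  and h: "h \<in> \<H> (ar A) Z Z'" and eq: "g *[ar A] r = h *[ar A] r"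
 shows "g = h"
proof -
 interpret R: category "\<D> (ar A)" using cat A by simp
 have "g *[ar A] r \<in> \<H> (ar A) F Z'" using R.comp_hom[OF cofiberD(2)[OF c] g] .
 hence "\<exists>!k. k \<in> \<H> (ar A) Z Z' \<and> k *[ar A] r = g *[ar A] r"
  using c Z' unfolding cofiber_def by blast
 thus ?thesis using g h eq by metis
qed

lemma cofiberI:
 assumes "null_src A Z" "r \<in> \<H> (ar A) F Z"
  "\<And>Z' f. null_src A Z' \<Longrightarrow> f \<in> \<H> (ar A) F Z' \<Longrightarrow> \<exists>g. g \<in> \<H> (ar A) Z Z' \<and> g *[ar A] r = f"
  "\<And>Z' g h. null_src A Z' \<Longrightarrow> g \<in> \<H> (ar A) Z Z' \<Longrightarrow> h \<in> \<H> (ar A) Z Z' \<Longrightarrow>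
   g *[ar A] r = h *[ar A] r \<Longrightarrow> g = h"
 shows "cofiber A F Z r"
 unfolding cofiber_def
proof (intro conjI allI impI)
 fix Z' f assume *: "null_src A Z'" "f \<in> \<H> (ar A) F Z'"
 show "\<exists>!g. g \<in> \<H> (ar A) Z Z' \<and> g *[ar A] r = f"
  by (rule ex_ex1I) (use assms(3)[OF *] assms(4)[OF *(1)] in auto)
qed (use assms in auto)

text \<open>The unit of the extension along the embedding \<open>s1 A\<close> is invertible, so an
  arrow between extended objects is determined by, and rebuilt from, its restriction.\<close>

lemma shr_s1_full:
 assumes A: "thin A" and W: "W \<in> \<O> A" and V: "V \<in> \<O> A"
  and k: "k \<in> \<H> (ar A) (shr (s1 A) V) (shr (s1 A) W)"
 obtains g where "g \<in> \<H> A V W" "FA (lower_shriek D (s1 A)) g = k"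
proof -
 interpret A: category "\<D> A" using cat[OF A] .
 note s = Mor_s(2)[OF A] and ft = shriek_ftor[OF Mor_s(2)[OF A]]
 note nV = null_src_shr[OF A V] and nW = null_src_shr[OF A W]
 obtain e where e: "e \<in> \<H> A (res (s1 A) (shr (s1 A) W)) W"
  "eta (s1 A) W *[A] e = idn A (res (s1 A) (shr (s1 A) W))"
  using A.isoE[OF nW(3,2)] by metis
 note k1 = resa_hom[OF s k]
 define g where "g = e *[A] (resa (s1 A) k *[A] eta (s1 A) V)"
 have g: "g \<in> \<H> A V W" unfolding g_def using A.comp_hom[OF A.comp_hom[OF nV(2) k1] e(1)] .
 have Lg: "FA (lower_shriek D (s1 A)) g \<in> \<H> (ar A) (shr (s1 A) V) (shr (s1 A) W)"
  using ftorD(4)[OF ft(1)] g ft by simp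
 have adj: "is_ntrans (shriek_unit D (s1 A))" "NDom (shriek_unit D (s1 A)) = id_ftor (\<D> A)"
  "NCod (shriek_unit D (s1 A)) = pull D (s1 A) \<circ>\<^sub>F lower_shriek D (s1 A)"
  using shriek_adjunction[OF s] ft by (auto simp: adjunction_def)
 have "eta (s1 A) W *[A] g = resa (s1 A) (FA (lower_shriek D (s1 A)) g) *[A] eta (s1 A) V"
  using ntransD(6)[OF adj(1), of g V W] adj(2,3) g ft by (simp add: hom_def)
 moreover have "eta (s1 A) W *[A] g = resa (s1 A) k *[A] eta (s1 A) V"
  unfolding g_def using A.comp_assoc[OF A.comp_hom[OF nV(2) k1] e(1) nW(2)] e(2)
   A.ident_left[OF A.comp_hom[OF nV(2) k1]] by simp
 ultimately have "FA (lower_shriek D (s1 A)) g = k"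
  using shr_eqI[OF s V Lg k] by simp
 thus thesis using that[OF g] by blast
qed

lemma null_src_iso_shr:
 assumes A: "thin A" and Z: "null_src A Z"
 obtains \<theta> where "\<theta> \<in> \<H> (ar A) (shr (s1 A) (res (s1 A) Z)) Z" "\<I> (ar A) \<theta>"
proof -
 note s = Mor_s(2)[OF A]
 interpret A: category "\<D> A" using cat[OF A] .
 have W: "res (s1 A) Z \<in> \<O> A" using res_obj[OF s null_src_obj[OF Z]] .
 obtain \<theta> where \<theta>: "\<theta> \<in> \<H> (ar A) (shr (s1 A) (res (s1 A) Z)) Z"
  "resa (s1 A) \<theta> *[A] eta (s1 A) (res (s1 A) Z) = idn A (res (s1 A) Z)"
  using shr_ex[OF s W null_src_obj[OF Z] A.ident_hom[OF W]] .
 show thesis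
  using that[OF \<theta>(1)] luniv_iso[OF pull(1)[OF s] shr_luniv(1)[OF s W] lext_null_src[OF A Z], of \<theta>] \<theta> pull[OF s] by simp
qed

text \<open>In presheaf terms \<open>s1 A\<close> includes a sieve, so \<open>der6_open\<close>
  provides a left adjoint of the extension by zero along it. The unit of this adjunction at
  \<open>F\<close> is universal among arrows to extensions by zero, and every object with null
  source is one up to isomorphism.\<close>

lemma cofiber_ex:
 assumes A: "thin A" and F: "F \<in> \<O> (ar A)"
 shows "\<exists>Z r. cofiber A F Z r"
proof -
 note s = Mor_s(2)[OF A] and ft = shriek_ftor[OF Mor_s(2)[OF A]]
 interpret A: category "\<D> A" using cat[OF A] .
 interpret R: category "\<D> (ar A)" using cat A by simp
 have sH: "hom (ar A) (FO (s1 A) x) (FO (s1 A) y) = {cpair f k | f k. f \<in> hom A x y \<and> k \<in> hom arrow_cat (cnat 1) (cnat 1)}"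
  if "x \<in> Obj A" "y \<in> Obj A" for x y
  using hom_prod_cat[OF A thin_arrow] that by simp
 have k1: "k = Ident arrow_cat (cnat 1)" if "k \<in> hom arrow_cat (cnat 1) (cnat 1)" for k
  using thin_eqI[OF thin_arrow that category.ident_hom[OF thin_category[OF thin_arrow]]] by simp
 have FAs: "FA (s1 A) f = cpair f (Ident arrow_cat (cnat 1))" if "f \<in> hom A x y" for f x y
  using that by (simp add: slot_def hom_def)
 have "open_immersion (s1 A)"
  unfolding open_immersion_def
 proof (intro conjI ballI impI)
  show "is_ftor (s1 A)" using MorD(6)[OF s] .
  show "inj_on (FO (s1 A)) (Obj (Src (s1 A)))" by (auto simp: inj_on_def)
  show "full (s1 A)"
   unfolding full_def
  proof (intro ballI subsetI)
   fix x y h assume xy: "x \<in> Obj (Src (s1 A))" "y \<in> Obj (Src (s1 A))" "h \<in> hom (Tgt (s1 A)) (FO (s1 A) x) (FO (s1 A) y)"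
   then obtain f k where fk: "h = cpair f k" "f \<in> hom A x y" "k \<in> hom arrow_cat (cnat 1) (cnat 1)"
    using sH[of x y] by auto
   hence "h = FA (s1 A) f" using k1[OF fk(3)] FAs[OF fk(2)] by simp
   thus "h \<in> FA (s1 A) ` hom (Src (s1 A)) x y" using fk(2) by simp
  qed
  show "faithful (s1 A)" using FAs by (auto simp: faithful_def inj_on_def)
  fix b a assume b: "b \<in> Obj (Tgt (s1 A))" and a: "a \<in> Obj (Src (s1 A))" and ne: "hom (Tgt (s1 A)) b (FO (s1 A) a) \<noteq> {}"
  obtain a' i where b': "b = cpair a' i" "a' \<in> Obj A" "i \<in> {cnat 0, cnat 1}" using b by auto
  have "le (ar A) (cpair a (cnat 1)) b" using ne a by (simp add: le_def)
  hence "i = cnat 1" using b' A by auto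
  thus "b \<in> FO (s1 A) ` Obj (Src (s1 A))" using b' by (auto simp: image_iff)
 qed
 then obtain l \<eta> \<epsilon> where "adjunction l (lower_shriek D (s1 A)) \<eta> \<epsilon>"
  using der6_open[of "s1 A"] unfolding has_left_adjoint_def by blast
 from adjunction_luniv[OF this, of F]
 have lu: "luniv (lower_shriek D (s1 A)) F (FO l F) (NC \<eta> F)" using F ft by simp
 let ?C = "FO l F" and ?Z = "shr (s1 A) (FO l F)"
 have C: "?C \<in> \<O> A" and r: "NC \<eta> F \<in> \<H> (ar A) F ?Z" using lunivD[OF lu] ft by auto
 have "cofiber A F ?Z (NC \<eta> F)"
 proof (rule cofiberI)
  show "null_src A ?Z" using null_src_shr(1)[OF A C] .
  show "NC \<eta> F \<in> \<H> (ar A) F ?Z" by fact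
  fix Z' assume Z': "null_src A Z'"
  let ?W = "res (s1 A) Z'"
  have W: "?W \<in> \<O> A" using res_obj[OF s null_src_obj[OF Z']] .
  obtain \<theta> where \<theta>: "\<theta> \<in> \<H> (ar A) (shr (s1 A) ?W) Z'" "\<I> (ar A) \<theta>"
   using null_src_iso_shr[OF A Z'] .
  obtain \<psi> where \<psi>: "\<psi> \<in> \<H> (ar A) Z' (shr (s1 A) ?W)" "\<theta> *[ar A] \<psi> = idn (ar A) Z'" "\<I> (ar A) \<psi>"
   using R.isoE[OF \<theta>(2,1)] by metis
  show "\<exists>g. g \<in> \<H> (ar A) ?Z Z' \<and> g *[ar A] NC \<eta> F = f" if f: "f \<in> \<H> (ar A) F Z'" for f
  proof -
   obtain g where g: "g \<in> \<H> A ?C ?W" "FA (lower_shriek D (s1 A)) g *[ar A] NC \<eta> F = \<psi> *[ar A] f"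
    using lunivE[OF lu, of ?W "\<psi> *[ar A] f"] ft W R.comp_hom[OF f \<psi>(1)] by auto
   have Lg: "FA (lower_shriek D (s1 A)) g \<in> \<H> (ar A) ?Z (shr (s1 A) ?W)" using ftorD(4)[OF ft(1)] g(1) ft by simp
   have "(\<theta> *[ar A] FA (lower_shriek D (s1 A)) g) *[ar A] NC \<eta> F = f"
    using R.comp_assoc[OF r Lg \<theta>(1)] R.comp_assoc[OF f \<psi>(1) \<theta>(1)] g(2) \<psi>(2) R.ident_left[OF f] by simp
   thus ?thesis using R.comp_hom[OF Lg \<theta>(1)] by blast
  qed
  show "g = h" if g: "g \<in> \<H> (ar A) ?Z Z'" and h: "h \<in> \<H> (ar A) ?Z Z'"
   and eq: "g *[ar A] NC \<eta> F = h *[ar A] NC \<eta> F" for g h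
  proof -
   \<comment> \<open>By fullness both arrows become values of the extension functor, where the
     universal property of the unit applies.\<close>
   obtain g' where g': "g' \<in> \<H> A ?C ?W" "FA (lower_shriek D (s1 A)) g' = \<psi> *[ar A] g"
    using shr_s1_full[OF A W C R.comp_hom[OF g \<psi>(1)]] .
   obtain h' where h': "h' \<in> \<H> A ?C ?W" "FA (lower_shriek D (s1 A)) h' = \<psi> *[ar A] h"
    using shr_s1_full[OF A W C R.comp_hom[OF h \<psi>(1)]] .
   have "(\<psi> *[ar A] g) *[ar A] NC \<eta> F = (\<psi> *[ar A] h) *[ar A] NC \<eta> F"
    using R.comp_assoc[OF r g \<psi>(1)] R.comp_assoc[OF r h \<psi>(1)] eq by simp
   hence "g' = h'" using luniv_eqI[OF ft(1) lu, of g' ?W h'] ft g' h' by simp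
   thus ?thesis using R.iso_cancel_mono[OF \<psi>(3,1) g h] g' h' by simp
  qed
 qed
 thus ?thesis by blast
qed

lemma cofiber_unique:
 assumes A: "thin A" and c: "cofiber A F Z r" and c': "cofiber A G Z' r'" and h: "h \<in> \<H> (ar A) F G" "\<I> (ar A) h"
 obtains k where "k \<in> \<H> (ar A) Z Z'" "\<I> (ar A) k"
proof -
 interpret R: category "\<D> (ar A)" using cat A by simp
 note Z = cofiberD[OF c] and Z' = cofiberD[OF c']
 obtain h' where h': "h' \<in> \<H> (ar A) G F" "h' *[ar A] h = idn (ar A) F" "h *[ar A] h' = idn (ar A) G"
  using R.isoE[OF h(2,1)] by metis
 obtain k where k: "k \<in> \<H> (ar A) Z Z'" "k *[ar A] r = r' *[ar A] h" using cofiberE[OF c Z'(1) R.comp_hom[OF h(1) Z'(2)]] .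
 obtain l where l: "l \<in> \<H> (ar A) Z' Z" "l *[ar A] r' = r *[ar A] h'" using cofiberE[OF c' Z(1) R.comp_hom[OF h'(1) Z(2)]] .
 have "(l *[ar A] k) *[ar A] r = idn (ar A) Z *[ar A] r"
  using R.comp_assoc[OF Z(2) k(1) l(1)] R.comp_assoc[OF h(1) Z'(2) l(1)] R.comp_assoc[OF h(1) h'(1) Z(2)] k(2) l(2) h'(2)
   R.ident_right[OF Z(2)] R.ident_left[OF Z(2)] by simp
 hence 1: "l *[ar A] k = idn (ar A) Z"
  using cofiber_eqI[OF A c Z(1) R.comp_hom[OF k(1) l(1)] R.ident_hom[OF Z(3)]] by blast
 have "(k *[ar A] l) *[ar A] r' = idn (ar A) Z' *[ar A] r'"
  using R.comp_assoc[OF Z'(2) l(1) k(1)] R.comp_assoc[OF h'(1) Z(2) k(1)] R.comp_assoc[OF h'(1) h(1) Z'(2)] k(2) l(2) h'(3)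
   R.ident_right[OF Z'(2)] R.ident_left[OF Z'(2)] by simp
 hence "k *[ar A] l = idn (ar A) Z'"
  using cofiber_eqI[OF A c' Z'(1) R.comp_hom[OF l(1) k(1)] R.ident_hom[OF Z'(3)]] by blast
 thus thesis using that[OF k(1)] R.isoI[OF k(1) l(1) 1] by blast
qed

text \<open>Cofibers are computed pointwise, because \<open>(n \<times> [1])\<^sub>*\<close> preserves objects of the form \<open>0 \<rightarrow> Y\<close>.\<close>

lemma cofiber_pt:
 assumes A: "thin A" and n: "n \<in> Obj A" and c: "cofiber A F Z r"
 defines "v \<equiv> map_ar (pt A n)"
 shows "cofiber e_cat (res v F) (res v Z) (resa v r)"
proof -
 have pn: "pt A n \<in> Mor e_cat A" using Mor_pt[OF A n] .
 have v: "v \<in> Mor (ar e_cat) (ar A)" unfolding v_def using Mor_map_ar[OF pn] .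
 have vx: "FO v (cpair (cnat 0) i) = cpair n i" if "i \<in> {cnat 0, cnat 1}" for i
  unfolding v_def using FO_map_ar[OF pn, of "cnat 0" i] that by auto
 interpret R: category "\<D> (ar A)" using cat A by simp
 interpret Q: category "\<D> (ar e_cat)" using cat by simp
 have Te: "thin (ar e_cat)" "thin (ar A)" using A by simp_all
 note Z = cofiberD[OF c]
 have nZ: "null_src e_cat (res v Z)"
  unfolding null_src_def
  using res_obj[OF v Z(3)] val_res[OF v _ Z(3), of "cpair (cnat 0) (cnat 0)"] vx[of "cnat 0"] Z(1) n
  by (simp add: null_src_def)
 have R: "null_src A (sta v Z')" if Z': "null_src e_cat Z'" for Z'
  unfolding null_src_def
 proof (intro conjI ballI)
  note U = sta_runiv[OF v null_src_obj[OF Z']]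
  show "sta v Z' \<in> \<O> (ar A)" by (rule U(2))
  fix a assume a: "a \<in> Obj A"
  have x: "cpair (cnat 0) (cnat 0) \<in> Obj (ar e_cat)" by simp
  have b: "cpair a (cnat 0) \<in> Obj (ar A)" using a by simp
  \<comment> \<open>The value at \<open>(a, 0)\<close> is the one at the least point of the fiber
    over \<open>n\<close> lying above it. This is the source end if \<open>a\<close> is below
    \<open>n\<close>; otherwise there is no such point.\<close>
  show "is_zero \<E> (val (ar A) (cpair a (cnat 0)) (sta v Z'))"
  proof (cases "le A a n")
   case True
   have l: "le (ar A) (cpair a (cnat 0)) (FO v (cpair (cnat 0) (cnat 0)))"
    using True vx[of "cnat 0"] A by simp
   have "le (ar e_cat) (cpair (cnat 0) (cnat 0)) y" if "y \<in> Obj (ar e_cat)" for y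
    using that le_refl[OF thin_e] by auto
   from sta_val[OF v null_src_obj[OF Z'] x l this]
   have i: "is_iso \<E> (vala (ar e_cat) (cpair (cnat 0) (cnat 0)) (eps v Z') **
     step (ar A) (cpair a (cnat 0)) (FO v (cpair (cnat 0) (cnat 0))) (sta v Z'))" by blast
   have h: "vala (ar e_cat) (cpair (cnat 0) (cnat 0)) (eps v Z') **
     step (ar A) (cpair a (cnat 0)) (FO v (cpair (cnat 0) (cnat 0))) (sta v Z') \<in>
     hom \<E> (val (ar A) (cpair a (cnat 0)) (sta v Z')) (val (ar e_cat) (cpair (cnat 0) (cnat 0)) Z')"
    using E.comp_hom[OF step_hom[OF Te(2) l U(2)]] vala_hom[OF Te(1) x U(3)] val_res[OF v x U(2)] by simp
   obtain j where "j \<in> hom \<E> (val (ar e_cat) (cpair (cnat 0) (cnat 0)) Z') (val (ar A) (cpair a (cnat 0)) (sta v Z'))"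
    "is_iso \<E> j" using E.isoE[OF i h] by metis
   moreover have "is_zero \<E> (val (ar e_cat) (cpair (cnat 0) (cnat 0)) Z')" using Z' by (simp add: null_src_def)
   ultimately show ?thesis using E.zero_if_iso by blast
  next
   case False
   have "\<not> le (ar A) (cpair a (cnat 0)) (FO v y)" if "y \<in> Obj (ar e_cat)" for y
    using that vx False A by auto
   thus ?thesis using sta_val_zero[OF v null_src_obj[OF Z'] b] by blast
  qed
 qed
 show ?thesis
 proof (rule cofiberI)
  show "null_src e_cat (res v Z)" by fact
  show "resa v r \<in> \<H> (ar e_cat) (res v F) (res v Z)" using resa_hom[OF v Z(2)] .
  have F: "F \<in> \<O> (ar A)" using R.hom_objs[OF Z(2)] by simp
  fix Z' assume Z': "null_src e_cat Z'"
  note U = sta_runiv[OF v null_src_obj[OF Z']]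
  show "\<exists>g. g \<in> \<H> (ar e_cat) (res v Z) Z' \<and> g *[ar e_cat] resa v r = f"
   if f: "f \<in> \<H> (ar e_cat) (res v F) Z'" for f
  proof -
   obtain f' where f': "f' \<in> \<H> (ar A) F (sta v Z')" "eps v Z' *[ar e_cat] resa v f' = f"
    using pull_runivE[OF v U(1) F f] .
   obtain g where g: "g \<in> \<H> (ar A) Z (sta v Z')" "g *[ar A] r = f'"
    using cofiberE[OF c R[OF Z'] f'(1)] .
   have "(eps v Z' *[ar e_cat] resa v g) *[ar e_cat] resa v r = f"
    using Q.comp_assoc[OF resa_hom[OF v Z(2)] resa_hom[OF v g(1)] U(3)] resa_comp[OF v Z(2) g(1)] g(2) f'(2) by simp
   thus ?thesis using Q.comp_hom[OF resa_hom[OF v g(1)] U(3)] by blast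
  qed
  show "g = h" if g: "g \<in> \<H> (ar e_cat) (res v Z) Z'" and h: "h \<in> \<H> (ar e_cat) (res v Z) Z'"
   and eq: "g *[ar e_cat] resa v r = h *[ar e_cat] resa v r" for g h
  proof -
   obtain g' where g': "g' \<in> \<H> (ar A) Z (sta v Z')" "eps v Z' *[ar e_cat] resa v g' = g"
    using pull_runivE[OF v U(1) Z(3) g] .
   obtain h' where h': "h' \<in> \<H> (ar A) Z (sta v Z')" "eps v Z' *[ar e_cat] resa v h' = h"
    using pull_runivE[OF v U(1) Z(3) h] .
   have "eps v Z' *[ar e_cat] resa v (k *[ar A] r) = (eps v Z' *[ar e_cat] resa v k) *[ar e_cat] resa v r"
    if "k \<in> \<H> (ar A) Z (sta v Z')" for k
    using Q.comp_assoc[OF resa_hom[OF v Z(2)] resa_hom[OF v that] U(3)] resa_comp[OF v Z(2) that] by simp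
   hence "g' *[ar A] r = h' *[ar A] r"
    using pull_runiv_eqI[OF v U(1) R.comp_hom[OF Z(2) g'(1)] R.comp_hom[OF Z(2) h'(1)]] g' h' eq by simp
   thus ?thesis using cofiber_eqI[OF A c R[OF Z'] g'(1) h'(1)] g'(2) h'(2) by simp
  qed
 qed
qed

end

lemma (in category) coproduct_bool_desc:
 assumes "is_coproduct C UNIV (\<lambda>b. if b then x else y) P inn" "f \<in> hom C x Q" "g \<in> hom C y Q"
 obtains k where "k \<in> hom C P Q" "k \<cdot> inn True = f" "k \<cdot> inn False = g"
proof -
 have "(if b then f else g) \<in> hom C (if b then x else y) Q" for b using assms(2,3) by simp
 moreover have "Q \<in> Obj C" using hom_objs[OF assms(2)] by simp
 ultimately obtain k where k: "k \<in> hom C P Q" "\<And>b. b \<in> UNIV \<Longrightarrow> k \<cdot> inn b = (if b then f else g)"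
  using coproduct_desc[OF assms(1), of Q "\<lambda>b. if b then f else g"] by blast
 show thesis using that[OF k(1)] k(2)[of True] k(2)[of False] by simp
qed

lemma s_e: "s0 e_cat = pt (ar e_cat) (cpair (cnat 0) (cnat 0))" "s1 e_cat = pt (ar e_cat) (cpair (cnat 0) (cnat 1))"
 by (rule Mor_eqI[OF Mor_s(1)[OF thin_e] Mor_pt]; simp)
   (rule Mor_eqI[OF Mor_s(2)[OF thin_e] Mor_pt]; simp)

context pointed_derivator
begin

lemma coproduct_bool_ex:
 assumes A: "thin A" and X: "X \<in> \<O> A" and Y: "Y \<in> \<O> A"
 obtains P inn where "is_coproduct (\<D> A) UNIV (\<lambda>b. if b then X else Y) P inn"
proof -
 have "inj_on (\<lambda>b. cnat (if b then 0 else 1) :: 'a) UNIV" by (auto simp: inj_on_def split: if_splits)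
 hence "\<exists>P inn. is_coproduct (\<D> A) UNIV (\<lambda>b. if b then X else Y) P inn"
  by (rule coproduct_ex[OF A]) (use X Y in simp)
 thus thesis using that by blast
qed

lemma null_src_e: "null_src e_cat Z \<longleftrightarrow> Z \<in> \<O> (ar e_cat) \<and> is_zero \<E> (res (s0 e_cat) Z)"
 unfolding null_src_def s_e by simp

text \<open>If the arrow of \<open>F\<close> includes a summand with complement \<open>V\<close>,
  then \<open>F\<close> is the identity arrow of its source plus the arrow
  \<open>0 \<rightarrow> V\<close>: the comparison from this coproduct is invertible at both ends,
  which \<open>iso_slots\<close> detects.\<close>

lemma split_coproduct:
 assumes F: "F \<in> \<O> (ar e_cat)" and \<sigma>: "\<sigma> \<in> hom \<E> V (res (s1 e_cat) F)"
  and cop: "is_coproduct \<E> UNIV (\<lambda>b. if b then res (s0 e_cat) F else V) (res (s1 e_cat) F)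
   (\<lambda>b. if b then bd e_cat F else \<sigma>)"
 obtains \<alpha> \<beta> where
  "is_coproduct (\<D> (ar e_cat)) UNIV (\<lambda>b. if b then res (prj_ar e_cat) (res (s0 e_cat) F) else shr (s1 e_cat) V) F
   (\<lambda>b. if b then \<alpha> else \<beta>)"
  "\<alpha> \<in> \<H> (ar e_cat) (res (prj_ar e_cat) (res (s0 e_cat) F)) F"
  "\<beta> \<in> \<H> (ar e_cat) (shr (s1 e_cat) V) F" "resa (s1 e_cat) \<beta> ** eta (s1 e_cat) V = \<sigma>"
proof -
 let ?T = "ar e_cat :: 'a scat" and ?s = "s0 e_cat :: 'a sftor" and ?t = "s1 e_cat :: 'a sftor"
 let ?X = "res (prj_ar e_cat) (res ?s F)" and ?Y = "shr ?t V"
 have Te: "thin ?T" by simp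
 interpret T: category "\<D> ?T" using cat[OF Te] .
 note s = Mor_s(1)[OF thin_e, where 'a = 'a] Mor_s(2)[OF thin_e, where 'a = 'a]
 have F0: "res ?s F \<in> Obj \<E>" and V: "V \<in> Obj \<E>"
  using res_obj[OF s(1) F] E.hom_objs[OF \<sigma>] by auto
 have X: "?X \<in> \<O> ?T" using res_obj[OF Mor_prj_ar[OF thin_e] F0] .
 note pX = bd_prj_ar[OF thin_e F0] and nY = null_src_shr[OF thin_e V] and Y = null_src_obj[OF null_src_shr(1)[OF thin_e V]]
 obtain \<alpha> where \<alpha>: "\<alpha> \<in> \<H> ?T ?X F" "resa ?s \<alpha> ** Ident \<E> (res ?s F) = Ident \<E> (res ?s F)"
  using pull_lunivE[OF s(1) luniv_prj_ar[OF thin_e F0] F E.ident_hom[OF F0]] .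
 have \<alpha>0: "resa ?s \<alpha> = Ident \<E> (res ?s F)" using \<alpha>(2) E.ident_right[OF resa_hom[OF s(1) \<alpha>(1)]] pX(1) by simp
 obtain \<beta> where \<beta>: "\<beta> \<in> \<H> ?T ?Y F" "resa ?t \<beta> ** eta ?t V = \<sigma>" using shr_ex[OF s(2) V F \<sigma>] .
 \<comment> \<open>\<alpha> is the identity at the source, so compatibility with the underlying
   arrows forces its value at the target.\<close>
 have \<alpha>1: "resa ?t \<alpha> = bd e_cat F"
  using bd_nat[OF thin_e \<alpha>(1)] \<alpha>0 pX(2,3) E.ident_right[OF bd_hom[OF thin_e F]] E.ident_right[OF resa_hom[OF s(2) \<alpha>(1)]] by simp
 obtain Q inn where Q: "is_coproduct (\<D> ?T) UNIV (\<lambda>b. if b then ?X else ?Y) Q inn"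
  using coproduct_bool_ex[OF Te X Y] .
 note inn = T.coproductD(2)[OF Q UNIV_I]
 obtain \<theta> where \<theta>: "\<theta> \<in> \<H> ?T Q F" and "\<theta> *[?T] inn True = \<alpha>" "\<theta> *[?T] inn False = \<beta>"
  using T.coproduct_bool_desc[OF Q \<alpha>(1) \<beta>(1)] .
 hence \<theta>b: "\<theta> *[?T] inn b = (if b then \<alpha> else \<beta>)" for b by (cases b) simp_all
 have "is_coproduct \<E> {True} (\<lambda>b. res ?s (if b then ?X else ?Y)) (res ?s Q) (\<lambda>b. resa ?s (inn b))"
  using E.coproduct_drop_zeros[OF res_coproduct[OF s(1) Q], of "{True}"] nY(1) by (auto simp: null_src_e)
 from E.coproduct_single[OF this] have "is_iso \<E> (resa ?s \<theta>)"
  using E.iso_cancel_right[OF resa_hom[OF s(1) inn] resa_hom[OF s(1) \<theta>]] resa_comp[OF s(1) inn \<theta>, of True]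
   \<theta>b[of True] \<alpha>0 E.iso_ident[OF F0] by simp
 moreover have "is_iso \<E> (resa ?t \<theta>)"
 proof -
  let ?e = "\<lambda>b. if b then Ident \<E> (res ?s F) else eta ?t V"
  have e: "?e b \<in> hom \<E> (if b then res ?s F else V) (res ?t (if b then ?X else ?Y))" "is_iso \<E> (?e b)" for b
   using nY(2,3) pX(2) E.ident_hom[OF F0] E.iso_ident[OF F0] by auto
  have "resa ?t \<theta> ** (resa ?t (inn b) ** ?e b) = (if b then bd e_cat F else \<sigma>)" for b
   using E.comp_assoc[OF e(1)[of b] resa_hom[OF s(2) inn[of b]] resa_hom[OF s(2) \<theta>]] resa_comp[OF s(2) inn \<theta>, of b] \<theta>b[of b]
    \<alpha>1 \<beta>(2) E.ident_right[OF bd_hom[OF thin_e F]] by (cases b) simp_all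
  thus ?thesis
   by (rule E.coproduct_iso[OF E.coproduct_precomp[OF res_coproduct[OF s(2) Q] e] cop resa_hom[OF s(2) \<theta>]])
 qed
 ultimately have \<theta>i: "\<I> ?T \<theta>" using iso_slots[OF thin_e \<theta>] by blast
 have "is_coproduct (\<D> ?T) UNIV (\<lambda>b. if b then ?X else ?Y) F (\<lambda>b. if b then \<alpha> else \<beta>)"
  using T.coproduct_postcomp[OF Q \<theta> \<theta>i] by (simp add: \<theta>b)
 thus thesis using that \<alpha>(1) \<beta> by blast
qed

text \<open>The summand that is an identity arrow has exactly one arrow to any object with null
  source. Arrows from \<open>F\<close> to such an object are therefore arbitrary arrows on
  \<open>V\<close>, and the cofiber of \<open>F\<close> has \<open>V\<close> at its target.\<close>

lemma cofiber_split:
 assumes c: "cofiber e_cat F Z r" and \<sigma>: "\<sigma> \<in> hom \<E> V (res (s1 e_cat) F)"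
  and cop: "is_coproduct \<E> UNIV (\<lambda>b. if b then res (s0 e_cat) F else V) (res (s1 e_cat) F)
   (\<lambda>b. if b then bd e_cat F else \<sigma>)"
 shows "is_iso \<E> (resa (s1 e_cat) r ** \<sigma>)"
proof -
 let ?T = "ar e_cat :: 'a scat" and ?s = "s0 e_cat :: 'a sftor" and ?t = "s1 e_cat :: 'a sftor"
 have Te: "thin ?T" by simp
 interpret T: category "\<D> ?T" using cat[OF Te] .
 have s: "?s \<in> Mor e_cat ?T" "?t \<in> Mor e_cat ?T" by (simp_all add: Mor_slot)
 note Z = cofiberD[OF c]
 have F: "F \<in> \<O> ?T" using T.hom_objs[OF Z(2)] by simp
 have F0: "res ?s F \<in> Obj \<E>" and V: "V \<in> Obj \<E>"
  using res_obj[OF s(1) F] E.hom_objs[OF \<sigma>] by auto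
 let ?X = "res (prj_ar e_cat) (res ?s F)" and ?Y = "shr ?t V"
 obtain \<alpha> \<beta> where Q: "is_coproduct (\<D> ?T) UNIV (\<lambda>b. if b then ?X else ?Y) F (\<lambda>b. if b then \<alpha> else \<beta>)"
  and \<alpha>: "\<alpha> \<in> \<H> ?T ?X F"
  and \<beta>: "\<beta> \<in> \<H> ?T ?Y F" "resa ?t \<beta> ** eta ?t V = \<sigma>"
  using split_coproduct[OF F \<sigma> cop] .
 note lX = luniv_prj_ar[OF thin_e F0]
 have uniqX: "f = g" if Z': "null_src e_cat Z'" and f: "f \<in> \<H> ?T ?X Z'" and g: "g \<in> \<H> ?T ?X Z'" for f g Z'
 proof -
  have z: "is_zero \<E> (res ?s Z')" using Z' by (simp add: null_src_e)
  show ?thesis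
   using pull_luniv_eqI[OF s(1) lX f g] E.to_zero_eq[OF z resa_hom[OF s(1) f] resa_hom[OF s(1) g]] by simp
 qed
 have exX: "\<exists>f. f \<in> \<H> ?T ?X Z'" if Z': "null_src e_cat Z'" for Z'
  using Z' E.zeroD(3)[of "res ?s Z'" "res ?s F"] F0 pull_lunivE[OF s(1) lX] by (metis null_src_e)
 have c\<sigma>: "resa ?t (f *[?T] \<beta>) ** eta ?t V = resa ?t f ** \<sigma>" if f: "f \<in> \<H> ?T F Z'" for f Z'
  using resa_comp[OF s(2) \<beta>(1) f] E.comp_assoc[OF shr_luniv(3)[OF s(2) V] resa_hom[OF s(2) \<beta>(1)] resa_hom[OF s(2) f]] \<beta>(2)
  by simp
 have uniq: "f = g" if Z': "null_src e_cat Z'" and f: "f \<in> \<H> ?T F Z'" and g: "g \<in> \<H> ?T F Z'"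
  and eq: "resa ?t f ** \<sigma> = resa ?t g ** \<sigma>" for f g Z'
 proof (rule T.coproduct_eqI[OF Q f g])
  fix b :: bool
  have "f *[?T] \<alpha> = g *[?T] \<alpha>" using uniqX[OF Z' T.comp_hom[OF \<alpha> f] T.comp_hom[OF \<alpha> g]] .
  moreover have "f *[?T] \<beta> = g *[?T] \<beta>"
   using shr_eqI[OF s(2) V T.comp_hom[OF \<beta>(1) f] T.comp_hom[OF \<beta>(1) g]] c\<sigma>[OF f] c\<sigma>[OF g] eq by simp
  ultimately show "f *[?T] (if b then \<alpha> else \<beta>) = g *[?T] (if b then \<alpha> else \<beta>)" by simp
 qed
 have exist: "\<exists>f. f \<in> \<H> ?T F Z' \<and> resa ?t f ** \<sigma> = \<tau>"
  if Z': "null_src e_cat Z'" and \<tau>: "\<tau> \<in> hom \<E> V (res ?t Z')" for Z' \<tau>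
 proof -
  obtain a where a: "a \<in> \<H> ?T ?X Z'" using exX[OF Z'] by blast
  obtain b where b: "b \<in> \<H> ?T ?Y Z'" "resa ?t b ** eta ?t V = \<tau>"
   using shr_ex[OF s(2) V null_src_obj[OF Z'] \<tau>] .
  obtain f where f: "f \<in> \<H> ?T F Z'" "f *[?T] \<beta> = b"
   using T.coproduct_bool_desc[OF Q a b(1)] by auto
  thus ?thesis using c\<sigma>[OF f(1)] b(2) by auto
 qed
 let ?m = "resa ?t r ** \<sigma>"
 have m: "?m \<in> hom \<E> V (res ?t Z)" using E.comp_hom[OF \<sigma> resa_hom[OF s(2) Z(2)]] .
 note nY = null_src_shr[OF thin_e V]
 obtain f where f: "f \<in> \<H> ?T F ?Y" "resa ?t f ** \<sigma> = eta ?t V" using exist[OF nY(1,2)] by blast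
 obtain k where k: "k \<in> \<H> ?T Z ?Y" "k *[?T] r = f" using cofiberE[OF c nY(1) f(1)] .
 have km: "resa ?t k ** ?m = eta ?t V"
  using E.comp_assoc[OF \<sigma> resa_hom[OF s(2) Z(2)] resa_hom[OF s(2) k(1)]] resa_comp[OF s(2) Z(2) k(1)] k(2) f(2) by simp
 obtain e where e: "e \<in> hom \<E> (res ?t ?Y) V" "e ** eta ?t V = Ident \<E> V"
  using E.isoE[OF nY(3,2)] by metis
 \<comment> \<open>The candidate inverse comes from the arrow induced on the cofiber by the
   projection of \<open>F\<close> to \<open>0 \<rightarrow> V\<close>.\<close>
 define n where "n = e ** resa ?t k"
 have n: "n \<in> hom \<E> (res ?t Z) V" unfolding n_def using E.comp_hom[OF resa_hom[OF s(2) k(1)] e(1)] .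
 have nm: "n ** ?m = Ident \<E> V"
  unfolding n_def using E.comp_assoc[OF m resa_hom[OF s(2) k(1)] e(1)] km e(2) by simp
 obtain l where l: "l \<in> \<H> ?T Z Z" "resa ?t l = ?m ** n"
  using lext_ex[OF s(2) lext_null_src[OF thin_e Z(1)] Z(3) E.comp_hom[OF n m]] .
 have "resa ?t (l *[?T] r) ** \<sigma> = ?m"
  using resa_comp[OF s(2) Z(2) l(1)] E.comp_assoc[OF \<sigma> resa_hom[OF s(2) Z(2)] resa_hom[OF s(2) l(1)]] l(2)
   E.comp_assoc[OF m n m] nm E.ident_right[OF m] by simp
 \<comment> \<open>The idempotent \<open>?m ** n\<close>, extended to an endomorphism
   \<open>l\<close> of the cofiber, fixes \<open>r\<close>; universality of \<open>r\<close> makes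
   it the identity.\<close>
 hence "l *[?T] r = r" using uniq[OF Z(1) T.comp_hom[OF Z(2) l(1)] Z(2)] by simp
 hence "l = idn ?T Z"
  using cofiber_eqI[OF thin_e c Z(1) l(1) T.ident_hom[OF Z(3)]] T.ident_left[OF Z(2)] by simp
 hence "?m ** n = Ident \<E> (res ?t Z)" using l(2) resa_ident[OF s(2) Z(3)] by simp
 thus ?thesis using E.isoI[OF m n nm] by blast
qed

lemma cofiber_bd_zero:
 assumes "cofiber e_cat F Z r"
 shows "is_zero_arrow \<E> (resa (s1 e_cat) r ** bd e_cat F)"
proof -
 note Z = cofiberD[OF assms]
 have "is_zero \<E> (res (s0 e_cat) Z)" using Z(1) by (simp add: null_src_e)
 hence "is_zero_arrow \<E> (resa (s0 e_cat) r)"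
  using E.zero_arrow_via_zero[OF resa_hom[OF Mor_s(1)[OF thin_e] Z(2)]] by blast
 thus ?thesis
  using E.zero_arrow_comp[OF resa_hom[OF Mor_s(1)[OF thin_e] Z(2)] bd_hom[OF thin_e Z(3)]] bd_nat[OF thin_e Z(2)] by simp
qed

end

section \<open>Cocartesian squares, cofibers and products in squares\<close>

section \<open>Squares\<close>

text \<open>The counit is the transpose of an identity, so it is invertible exactly when that
  identity is a universal arrow. This turns \<open>cocartesian\<close> into a condition of the form
  \<open>lext\<close>.\<close>

lemma iso_counit_iff:
 assumes "adjunction F G \<eta> \<epsilon>" "y \<in> Obj (Tgt F)"
 shows "is_iso (Tgt F) (NC \<epsilon> y) \<longleftrightarrow> luniv G (FO G y) y (Ident (Tgt G) (FO G y))"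
proof -
 note A = adjunctionD[OF assms(1)]
 interpret S: category "Src F" using ftorD(1)[OF A(1)] .
 interpret T: category "Tgt F" using ftorD(2)[OF A(1)] .
 have Gy: "FO G y \<in> Obj (Src F)" using ftorD(3)[OF A(2)] assms(2) A(3,4) by simp
 note \<epsilon> = A(7)[OF assms(2)]
 have lu: "luniv G (FO G y) (FO F (FO G y)) (NC \<eta> (FO G y))" using adjunction_luniv[OF assms(1)] Gy A(4) by simp
 show ?thesis
 proof
  assume "is_iso (Tgt F) (NC \<epsilon> y)"
  thus "luniv G (FO G y) y (Ident (Tgt G) (FO G y))"
   using luniv_if_transpose_iso[OF assms(1) S.ident_hom[OF Gy] assms(2)] A(4) ftorD(5)[OF A(1) Gy] T.ident_right[OF \<epsilon>] by simp
 next
  assume "luniv G (FO G y) y (Ident (Tgt G) (FO G y))"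
  from luniv_iso[OF A(2) lu this, of "NC \<epsilon> y"] show "is_iso (Tgt F) (NC \<epsilon> y)" using \<epsilon> A(10)[OF assms(2)] A(3,4) by simp
 qed
qed

lemma iso_unit_iff:
 assumes "adjunction F G \<eta> \<epsilon>" "x \<in> Obj (Src F)"
 shows "is_iso (Src F) (NC \<eta> x) \<longleftrightarrow> runiv F (FO F x) x (Ident (Tgt F) (FO F x))"
proof -
 note A = adjunctionD[OF assms(1)]
 interpret S: category "Src F" using ftorD(1)[OF A(1)] .
 interpret T: category "Tgt F" using ftorD(2)[OF A(1)] .
 have Fx: "FO F x \<in> Obj (Tgt F)" using ftorD(3)[OF A(1)] assms(2) by simp
 note \<eta> = A(5)[OF assms(2)]
 show ?thesis
 proof
  assume "is_iso (Src F) (NC \<eta> x)"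
  thus "runiv F (FO F x) x (Ident (Tgt F) (FO F x))"
   using runiv_if_transpose_iso[OF assms(1) T.ident_hom[OF Fx] assms(2)] ftorD(5)[OF A(2), of "FO F x"] Fx A(3,4) S.ident_left[OF \<eta>] by simp
 next
  assume "runiv F (FO F x) x (Ident (Tgt F) (FO F x))"
  from runiv_iso[OF A(1) adjunction_runiv[OF assms(1) Fx] this \<eta> A(9)[OF assms(2)]] show "is_iso (Src F) (NC \<eta> x)" .
 qed
qed

text \<open>Rows and edges of a diagram are restrictions along \<open>line\<close>; degenerate grids
  made from one arrow are restrictions along \<open>collapse\<close>.\<close>

definition line :: "(nat \<times> nat) set \<Rightarrow> nat \<times> nat \<Rightarrow> nat \<times> nat \<Rightarrow> 'u::infinite sftor"
 where "line P p q = mono_ftor (ar e_cat) (grid P) (\<lambda>x. gcode (if csnd x = cnat 0 then p else q))"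

definition collapse :: "(nat \<times> nat) set \<Rightarrow> (nat \<times> nat \<Rightarrow> nat) \<Rightarrow> 'u::infinite sftor"
 where "collapse P k = mono_ftor (grid P) (ar e_cat) (\<lambda>x. cpair (cnat 0) (cnat (k (inv gcode x))))"

lemma line:
 assumes "p \<in> P" "q \<in> P" "fst p \<le> fst q" "snd p \<le> snd q"
 shows "line P p q \<in> Mor (ar e_cat) (grid P)"
  "FO (line P p q) (cpair (cnat 0) (cnat 0)) = gcode p" "FO (line P p q) (cpair (cnat 0) (cnat (Suc 0))) = gcode q"
proof -
 have "shape (mono_ftor (ar e_cat) (grid P) (\<lambda>x. gcode (if csnd x = cnat 0 then p else q)))"
 proof (rule shape_mono_ftor)
  fix x y assume "x \<in> Obj (ar e_cat)" "y \<in> Obj (ar e_cat)" "le (ar e_cat) x y"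
  thus "le (grid P) (gcode (if csnd x = cnat 0 then p else q)) (gcode (if csnd y = cnat 0 then p else q))"
   using assms by auto
 qed (use assms in auto)
 thus "line P p q \<in> Mor (ar e_cat) (grid P)" by (simp add: line_def Mor_def)
 show "FO (line P p q) (cpair (cnat 0) (cnat 0)) = gcode p" "FO (line P p q) (cpair (cnat 0) (cnat (Suc 0))) = gcode q"
  by (simp_all add: line_def)
qed

lemma embedding_line:
 assumes "p \<in> P" "q \<in> P" "fst p \<le> fst q" "snd p \<le> snd q" "p \<noteq> q"
 shows "embedding (ar e_cat) (grid P) (line P p q)"
proof -
 have "\<not> (fst q \<le> fst p \<and> snd q \<le> snd p)" using assms by (auto simp: prod_eq_iff)
 thus ?thesis
  unfolding embedding_def using assms(1-4) by (auto simp: line[OF assms(1-4)] line(2,3)[OF assms(1-4)] le_refl[OF thin_e])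
qed

lemma collapse:
 assumes "\<And>p. p \<in> P \<Longrightarrow> k p = 0 \<or> k p = Suc 0" "\<And>p q. p \<in> P \<Longrightarrow> q \<in> P \<Longrightarrow> fst p \<le> fst q \<Longrightarrow> snd p \<le> snd q \<Longrightarrow> k p \<le> k q"
 shows "(collapse P k :: 'a::infinite sftor) \<in> Mor (grid P) (ar e_cat)"
  "p \<in> P \<Longrightarrow> FO (collapse P k :: 'a sftor) (gcode p) = cpair (cnat 0) (cnat (k p))"
proof -
 have "shape (mono_ftor (grid P) (ar e_cat) (\<lambda>x. cpair (cnat 0) (cnat (k (inv gcode x)))) :: 'a sftor)"
 proof (rule shape_mono_ftor)
  fix x :: 'a assume "x \<in> Obj (grid P)"
  then obtain p where "p \<in> P" "x = gcode p" by auto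
  thus "cpair (cnat 0) (cnat (k (inv gcode x))) \<in> Obj (ar e_cat :: 'a scat)" using assms(1)[of p] by auto
 qed (use assms in \<open>auto simp: le_refl[OF thin_e]\<close>)
 thus "(collapse P k :: 'a sftor) \<in> Mor (grid P) (ar e_cat)" by (simp add: collapse_def Mor_def)
 show "p \<in> P \<Longrightarrow> FO (collapse P k :: 'a sftor) (gcode p) = cpair (cnat 0) (cnat (k p))" by (simp add: collapse_def)
qed

lemma Mor_grid_map:
 assumes "\<And>p. p \<in> P \<Longrightarrow> h p \<in> Q"
  "\<And>p q. p \<in> P \<Longrightarrow> q \<in> P \<Longrightarrow> fst p \<le> fst q \<Longrightarrow> snd p \<le> snd q \<Longrightarrow> fst (h p) \<le> fst (h q) \<and> snd (h p) \<le> snd (h q)"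
 shows "grid_map P Q h \<in> Mor (grid P) (grid Q)"
 using shape_grid_map[OF assms] by (simp add: Mor_def)

lemma embedding_incl:
 assumes "P \<subseteq> Q"
 shows "embedding (grid P) (grid Q) (grid_map P Q id :: 'a::infinite sftor)"
proof -
 have "(grid_map P Q id :: 'a sftor) \<in> Mor (grid P) (grid Q)" by (rule Mor_grid_map) (use assms in auto)
 thus ?thesis unfolding embedding_def using subsetD[OF assms] by auto
qed

lemma grid_map_line:
 assumes "p \<in> P" "q \<in> P" "fst p \<le> fst q" "snd p \<le> snd q"
  "(grid_map P Q h :: 'a::infinite sftor) \<in> Mor (grid P) (grid Q)" "h p \<in> Q" "h q \<in> Q" "fst (h p) \<le> fst (h q)" "snd (h p) \<le> snd (h q)"
 shows "(grid_map P Q h :: 'a sftor) \<circ>\<^sub>F line P p q = line Q (h p) (h q)"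
 by (rule Mor_eqI[OF Mor_comp[OF line(1)[OF assms(1-4)] assms(5)] line(1)[OF assms(6-9)]])
   (use assms(1,2) in \<open>auto simp: FO_comp[OF line(1)[OF assms(1-4)]] line(2,3)[OF assms(1-4)] line(2,3)[OF assms(6-9)]\<close>)

lemma line_s:
 assumes "p \<in> P" "q \<in> P" "fst p \<le> fst q" "snd p \<le> snd q"
 shows "line P p q \<circ>\<^sub>F s0 e_cat = pt (grid P) (gcode p)" "line P p q \<circ>\<^sub>F s1 e_cat = pt (grid P) (gcode q)"
 unfolding s_e by (simp_all add: comp_pt[OF line(1)[OF assms]] line(2,3)[OF assms])

lemma fle_line:
 assumes "p \<in> P" "q \<in> P" "fst p \<le> fst q" "snd p \<le> snd q" "p' \<in> P" "q' \<in> P" "fst p' \<le> fst q'" "snd p' \<le> snd q'"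
  "fst p \<le> fst p'" "snd p \<le> snd p'" "fst q \<le> fst q'" "snd q \<le> snd q'"
 shows "fle (line P p q) (line P p' q')"
 by (rule Mor_fleI[OF line(1)[OF assms(1-4)] line(1)[OF assms(5-8)]])
   (use assms in \<open>auto simp: line(2,3)[OF assms(1-4)] line(2,3)[OF assms(5-8)]\<close>)

lemma square_simps [simp]:
 "(a, b) \<in> square \<longleftrightarrow> a \<in> {0, Suc 0} \<and> b \<in> {0, Suc 0}"
 "(a, b) \<in> ul_corner \<longleftrightarrow> (a, b) \<in> square \<and> (a, b) \<noteq> (Suc 0, Suc 0)"
 "(a, b) \<in> lr_corner \<longleftrightarrow> (a, b) \<in> square \<and> (a, b) \<noteq> (0, 0)"
 "(a, b) \<in> rect \<longleftrightarrow> a \<in> {0, Suc 0} \<and> b \<in> {0, Suc 0, 2}"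
 by (auto simp: square_def ul_corner_def lr_corner_def rect_def)

context derivator
begin

lemma lextI:
 assumes t: "t \<in> Mor K L" and Q: "Q \<in> \<O> L"
  and ex: "\<And>S f. S \<in> \<O> L \<Longrightarrow> f \<in> \<H> K (res t Q) (res t S) \<Longrightarrow> \<exists>g. g \<in> \<H> L Q S \<and> resa t g = f"
  and eq: "\<And>S g h. g \<in> \<H> L Q S \<Longrightarrow> h \<in> \<H> L Q S \<Longrightarrow> resa t g = resa t h \<Longrightarrow> g = h"
 shows "lext K t Q"
proof (rule lunivI, unfold pull(2,3)[OF t])
 interpret K: category "\<D> K" using cat[OF MorD(4)[OF t]] .
 have r: "resa t g *[K] idn K (res t Q) = resa t g" if "g \<in> \<H> L Q S" for g S
  using K.ident_right[OF resa_hom[OF t that]] .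
 show "Q \<in> \<O> L" by fact
 show "idn K (res t Q) \<in> \<H> K (res t Q) (res t Q)" using K.ident_hom[OF res_obj[OF t Q]] .
 fix S
 show "\<exists>g. g \<in> \<H> L Q S \<and> resa t g *[K] idn K (res t Q) = f"
  if sf: "S \<in> \<O> L" "f \<in> \<H> K (res t Q) (res t S)" for f
 proof -
  obtain g where "g \<in> \<H> L Q S" "resa t g = f" using ex[OF sf] by blast
  thus ?thesis using r by blast
 qed
 show "g = h" if "g \<in> \<H> L Q S" "h \<in> \<H> L Q S"
  "resa t g *[K] idn K (res t Q) = resa t h *[K] idn K (res t Q)" for g h
  using eq[OF that(1,2)] that(3) r[OF that(1)] r[OF that(2)] by simp
qed

lemma lext_shr:
 assumes t: "embedding K L t" and F: "F \<in> \<O> K"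
 shows "lext K t (shr t F)"
proof -
 have tm: "t \<in> Mor K L" using t by (simp add: embedding_def)
 interpret K: category "\<D> K" using cat[OF MorD(4)[OF tm]] .
 interpret L: category "\<D> L" using cat[OF MorD(5)[OF tm]] .
 note U = shr_luniv[OF tm F]
 obtain e where e: "e \<in> \<H> K (res t (shr t F)) F" "eta t F *[K] e = idn K (res t (shr t F))" "\<I> K e"
  using K.isoE[OF eta_iso[OF t F] U(3)] by metis
 show ?thesis
  using luniv_precomp[OF pull(1)[OF tm] U(1), of e "res t (shr t F)"] pull[OF tm] e by simp
qed

lemma cocartesian_iff:
 assumes "S \<in> \<O> (grid square)"
 shows "cocartesian D S \<longleftrightarrow> lext (grid ul_corner) (grid_map ul_corner square id) S"
proof -
 have i: "grid_map ul_corner square id \<in> Mor (grid ul_corner) (grid square)"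
  by (rule Mor_grid_map) auto
 show ?thesis
  unfolding cocartesian_def using iso_counit_iff[OF shriek_adjunction[OF i], of S] shriek_ftor[OF i] pull[OF i] assms by simp
qed

lemma cartesian_iff:
 assumes "S \<in> \<O> (grid square)"
 shows "cartesian D S \<longleftrightarrow> rext (grid lr_corner) (grid_map lr_corner square id) S"
proof -
 have i: "grid_map lr_corner square id \<in> Mor (grid lr_corner) (grid square)"
  by (rule Mor_grid_map) auto
 show ?thesis
  unfolding cartesian_def using iso_unit_iff[OF star_adjunction[OF i], of S] pull[OF i] assms by simp
qed

text \<open>Arrows out of a coproduct are tested on the summands, both over \<open>L\<close> and
  over \<open>K\<close>, because restriction is also a left adjoint and preserves the
  coproduct.\<close>

lemma lext_coproduct:
 assumes t: "t \<in> Mor K L" and P: "is_coproduct (\<D> L) I G P inn" and G: "\<And>i. i \<in> I \<Longrightarrow> lext K t (G i)"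
 shows "lext K t P"
proof -
 interpret K: category "\<D> K" using cat[OF MorD(4)[OF t]] .
 interpret L: category "\<D> L" using cat[OF MorD(5)[OF t]] .
 note inn = L.coproductD[OF P] and tP = res_coproduct[OF t P]
 show ?thesis
 proof (rule lextI[OF t inn(1)])
  fix S f assume S: "S \<in> \<O> L" and f: "f \<in> \<H> K (res t P) (res t S)"
  have "\<exists>g. g \<in> \<H> L (G i) S \<and> resa t g = f *[K] resa t (inn i)" if "i \<in> I" for i
   by (rule lext_ex[OF t G[OF that] S K.comp_hom[OF resa_hom[OF t inn(2)[OF that]] f]]) blast
  then obtain g where g: "\<And>i. i \<in> I \<Longrightarrow> g i \<in> \<H> L (G i) S" "\<And>i. i \<in> I \<Longrightarrow> resa t (g i) = f *[K] resa t (inn i)"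
   by metis
  obtain k where k: "k \<in> \<H> L P S" "\<And>i. i \<in> I \<Longrightarrow> k *[L] inn i = g i"
   using L.coproduct_desc[OF P S, of g] g(1) by metis
  have "resa t k = f"
   by (rule K.coproduct_eqI[OF tP resa_hom[OF t k(1)] f]) (use resa_comp[OF t inn(2) k(1)] k(2) g(2) in simp)
  thus "\<exists>g. g \<in> \<H> L P S \<and> resa t g = f" using k(1) by blast
 next
  fix S g h assume g: "g \<in> \<H> L P S" and h: "h \<in> \<H> L P S" and eq: "resa t g = resa t h"
  show "g = h"
  proof (rule L.coproduct_eqI[OF P g h])
   fix i assume i: "i \<in> I"
   show "g *[L] inn i = h *[L] inn i"
    using lext_eqI[OF t G[OF i] L.comp_hom[OF inn(2)[OF i] g] L.comp_hom[OF inn(2)[OF i] h]]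
     resa_comp[OF t inn(2)[OF i] g] resa_comp[OF t inn(2)[OF i] h] eq by simp
  qed
 qed
qed

text \<open>\<open>c\<^sup>*\<close> is left adjoint to restriction along its section, and so is its restriction to \<open>K\<close> if the
 section factors through \<open>K\<close>.\<close>

lemma lext_degenerate:
 assumes i: "embedding K L i" and c: "c \<in> Mor L E" and s': "s' \<in> Mor E K"
  and cs: "c \<circ>\<^sub>F (i \<circ>\<^sub>F s') = id_ftor E" and sc: "fle ((i \<circ>\<^sub>F s') \<circ>\<^sub>F c) (id_ftor L)" and G: "G \<in> \<O> E"
 shows "lext K i (res c G)"
proof -
 have im: "i \<in> Mor K L" using i by (simp add: embedding_def)
 note K = MorD(4)[OF im] and L = MorD(5)[OF im] and E = MorD(5)[OF c]
 note s = Mor_comp[OF s' im] and ci = Mor_comp[OF im c]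
 have cs': "(c \<circ>\<^sub>F i) \<circ>\<^sub>F s' = id_ftor E" using comp_assoc_Mor[OF s' im c] cs by simp
 have sc': "fle (s' \<circ>\<^sub>F (c \<circ>\<^sub>F i)) (id_ftor K)"
 proof (rule Mor_fleI[OF Mor_comp[OF ci s'] Mor_id[OF K]])
  fix x assume x: "x \<in> Obj K"
  have "le L (FO ((i \<circ>\<^sub>F s') \<circ>\<^sub>F c) (FO i x)) (FO (id_ftor L) (FO i x))"
   using fleD(5)[OF sc, of "FO i x"] Mor_obj[OF im x] MorD[OF Mor_comp[OF c s]] by simp
  hence "le L (FO i (FO s' (FO c (FO i x)))) (FO i x)"
   using x Mor_obj[OF im x] by (simp add: FO_comp[OF c] FO_comp[OF s'] Mor_obj[OF c])
  thus "le K (FO (s' \<circ>\<^sub>F (c \<circ>\<^sub>F i)) x) (FO (id_ftor K) x)"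
   using i x by (simp add: embedding_def FO_comp[OF ci] FO_comp[OF im] Mor_obj[OF s'] Mor_obj[OF c] Mor_obj[OF im])
 qed
 have r1: "fle (id_ftor E) (c \<circ>\<^sub>F (i \<circ>\<^sub>F s'))" "fle (id_ftor E) ((c \<circ>\<^sub>F i) \<circ>\<^sub>F s')"
  using fle_refl[OF MorD(1)[OF Mor_id[OF E]]] cs cs' by simp_all
 have tri: "tr (id_ftor E) (id_ftor E) G = idn E G" using tr_id[OF Mor_id[OF E] G] res_id[OF E G] by simp
 have lu: "luniv (pull D (i \<circ>\<^sub>F s')) G (res c G) (idn E G)"
  using luniv_res[OF s c sc r1(1) G] cs tri by simp
 have lu': "luniv (pull D s') G (res (c \<circ>\<^sub>F i) G) (idn E G)"
  using luniv_res[OF s' ci sc' r1(2) G] cs' tri by simp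
 have cG: "res c G \<in> \<O> L" using res_obj[OF c G] .
 have icG: "res (c \<circ>\<^sub>F i) G = res i (res c G)" using res_comp[OF im c G] .
 have sG: "res (i \<circ>\<^sub>F s') (res c G) = G" "res s' (res i (res c G)) = G"
  using res_comp[OF s c G] cs res_id[OF E G] res_comp[OF s' im cG] by simp_all
 interpret E: category "\<D> E" using cat[OF E] .
 show ?thesis
 proof (rule lextI[OF im cG])
  fix T f assume T: "T \<in> \<O> L" and f: "f \<in> \<H> K (res i (res c G)) (res i T)"
  have sf: "resa s' f \<in> \<H> E G (res (i \<circ>\<^sub>F s') T)"
   using resa_hom[OF s' f] sG res_comp[OF s' im T] by simp
  obtain g where g: "g \<in> \<H> L (res c G) T" "resa (i \<circ>\<^sub>F s') g *[E] idn E G = resa s' f"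
   using pull_lunivE[OF s lu T sf] .
  have "resa s' (resa i g) *[E] idn E G = resa s' f *[E] idn E G"
   using g(2) resa_resa[OF s' im g(1)] E.ident_right[OF sf] by simp
  hence "resa i g = f"
   using luniv_eqI[OF pull(1)[OF s'] lu', of "resa i g" "res i T" f] pull[OF s'] resa_hom[OF im g(1)] f icG by simp
  thus "\<exists>g. g \<in> \<H> L (res c G) T \<and> resa i g = f" using g(1) by blast
 next
  fix T g h assume g: "g \<in> \<H> L (res c G) T" and h: "h \<in> \<H> L (res c G) T" and eq: "resa i g = resa i h"
  have "resa (i \<circ>\<^sub>F s') g = resa (i \<circ>\<^sub>F s') h"
   using resa_resa[OF s' im g] resa_resa[OF s' im h] eq by simp
  thus "g = h"
   using pull_luniv_eqI[OF s lu g h] by simp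
 qed
qed

lemma line_val:
 assumes "p \<in> P" "q \<in> P" "fst p \<le> fst q" "snd p \<le> snd q" "S \<in> \<O> (grid P)"
 shows "res (s0 e_cat) (res (line P p q) S) = val (grid P) (gcode p) S"
  "res (s1 e_cat) (res (line P p q) S) = val (grid P) (gcode q) S"
  "bd e_cat (res (line P p q) S) = step (grid P) (gcode p) (gcode q) S"
proof -
 note l = line(1)[OF assms(1-4)] and s = Mor_s[OF thin_e]
 show "res (s0 e_cat) (res (line P p q) S) = val (grid P) (gcode p) S"
  "res (s1 e_cat) (res (line P p q) S) = val (grid P) (gcode q) S"
  using res_comp[OF s(1) l assms(5)] res_comp[OF s(2) l assms(5)] by (simp_all only: line_s[OF assms(1-4)])
 show "bd e_cat (res (line P p q) S) = step (grid P) (gcode p) (gcode q) S"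
  using tr_res[OF fle_s[OF thin_e] s(1) l assms(5)] by (simp only: line_s[OF assms(1-4)])
qed

end

context pointed_derivator
begin

text \<open>Arrows from the bottom row to \<open>Z\<close> are arrows from \<open>S\<close> to the
  square with both rows \<open>Z\<close>, which is a right Kan extension along the bottom row. As
  \<open>S\<close> is cocartesian, these are arrows on the corner; and as the lower left vertex of
  the target is zero, they are arrows from the top row.\<close>

lemma cocartesian_cofiber:
 assumes S: "S \<in> \<O> (grid square)" and co: "cocartesian D S" and z: "is_zero \<E> (val (grid square) (gcode (Suc 0, 0)) S)"
 shows "cofiber e_cat (res (line square (0,0) (0,Suc 0)) S) (res (line square (Suc 0,0) (Suc 0,Suc 0)) S)
  (tr (line square (0,0) (0,Suc 0)) (line square (Suc 0,0) (Suc 0,Suc 0)) S)"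
proof -
 let ?Q = "grid square :: 'a scat" and ?U = "grid ul_corner :: 'a scat" and ?E = "ar e_cat :: 'a scat"
 let ?i = "grid_map ul_corner square id :: 'a sftor" and ?c = "collapse square snd :: 'a sftor"
 let ?top = "line square (0,0) (0,Suc 0) :: 'a sftor" and ?bot = "line square (Suc 0,0) (Suc 0,Suc 0) :: 'a sftor"
 let ?t = "line ul_corner (0,0) (0,Suc 0) :: 'a sftor"
 have tE: "thin ?E" by simp
 have ul: "ul_corner \<subseteq> square" by auto
 have i: "?i \<in> Mor ?U ?Q" by (rule Mor_grid_map) auto
 have top: "?top \<in> Mor ?E ?Q" "FO ?top (cpair (cnat 0) (cnat 0)) = gcode (0,0)" "FO ?top (cpair (cnat 0) (cnat (Suc 0))) = gcode (0,Suc 0)"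
  by (rule line; simp)+
 have bot: "?bot \<in> Mor ?E ?Q" "FO ?bot (cpair (cnat 0) (cnat 0)) = gcode (Suc 0,0)" "FO ?bot (cpair (cnat 0) (cnat (Suc 0))) = gcode (Suc 0,Suc 0)"
  by (rule line; simp)+
 have t: "embedding ?E ?U ?t" by (rule embedding_line) auto
 hence tm: "?t \<in> Mor ?E ?U" by (simp add: embedding_def)
 have FOt: "FO ?t (cpair (cnat 0) (cnat 0)) = gcode (0,0)" "FO ?t (cpair (cnat 0) (cnat (Suc 0))) = gcode (0,Suc 0)"
  by (rule line; simp)+
 have it: "?i \<circ>\<^sub>F ?t = ?top" using grid_map_line[OF _ _ _ _ i, of "(0,0)" "(0,Suc 0)"] by simp
 have c: "?c \<in> Mor ?Q ?E" "\<And>p. p \<in> square \<Longrightarrow> FO ?c (gcode p) = cpair (cnat 0) (cnat (snd p))"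
  by (rule collapse; auto)+
 have fl: "fle ?top ?bot" by (rule fle_line) auto
 have cb: "?c \<circ>\<^sub>F ?bot = id_ftor ?E"
  by (rule Mor_eqI[OF Mor_comp[OF bot(1) c(1)] Mor_id[OF tE]]) (use bot c(2) in \<open>auto simp: FO_comp[OF bot(1)]\<close>)
 have ct: "?c \<circ>\<^sub>F ?top = id_ftor ?E"
  by (rule Mor_eqI[OF Mor_comp[OF top(1) c(1)] Mor_id[OF tE]]) (use top c(2) in \<open>auto simp: FO_comp[OF top(1)]\<close>)
 have bc: "fle (id_ftor ?Q) (?bot \<circ>\<^sub>F ?c)"
  by (rule Mor_fleI[OF Mor_id[OF thin_grid] Mor_comp[OF c(1) bot(1)]])
    (use bot c(2) in \<open>auto simp: FO_comp[OF c(1)]\<close>)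
 interpret E2: category "\<D> ?E" using cat[OF tE] .
 interpret Q: category "\<D> ?Q" using cat[OF thin_grid] .
 have idE: "fle (id_ftor ?E) (id_ftor ?E)" using fle_refl[OF MorD(1)[OF Mor_id[OF tE]]] .
 have idtr: "tr (id_ftor ?E) (id_ftor ?E) Z = idn ?E Z" if "Z \<in> \<O> ?E" for Z
  using tr_id[OF Mor_id[OF tE] that] res_id[OF tE that] by simp
 have ru: "runiv (pull D ?bot) Z (res ?c Z) (idn ?E Z)" if "Z \<in> \<O> ?E" for Z
  using runiv_res[OF c(1) bot(1) _ bc that] cb idE idtr[OF that] by simp
 have cZ: "res ?c Z \<in> \<O> ?Q" "res ?bot (res ?c Z) = Z" "res ?top (res ?c Z) = Z"
  "tr ?top ?bot (res ?c Z) = idn ?E Z" if Z: "Z \<in> \<O> ?E" for Z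
  using res_obj[OF c(1) Z] res_comp[OF bot(1) c(1) Z] res_comp[OF top(1) c(1) Z] cb ct res_id[OF tE Z]
   tr_res[OF fl top(1) c(1) Z] idtr[OF Z] by simp_all
 have ext: "lext ?U ?i S" using cocartesian_iff[OF S] co by simp
 note \<tau> = tr_hom[OF fl top(1) S]
 \<comment> \<open>Under these identifications, restriction to the top row is composition with the
   vertical arrow of the square.\<close>
 have key: "resa ?bot g *[?E] tr ?top ?bot S = resa ?t (resa ?i g)"
  if Z: "Z \<in> \<O> ?E" and g: "g \<in> \<H> ?Q S (res ?c Z)" for g Z
 proof -
  have "resa ?bot g *[?E] tr ?top ?bot S = idn ?E Z *[?E] resa ?top g"
   using tr_nat[OF fl top(1) g] cZ(4)[OF Z] by simp
  also have "\<dots> = resa ?top g" using E2.ident_left[of "resa ?top g"] resa_hom[OF top(1) g] cZ(3)[OF Z] by simp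
  finally show ?thesis using resa_resa[OF tm i g] it by simp
 qed
 have off: "is_zero \<E> (val ?U b (res ?i (res ?c Z))) \<and> (\<forall>a\<in>Obj ?E. \<not> le ?U b (FO ?t a))"
  if Z: "null_src e_cat Z" and b: "b \<in> Obj ?U" "b \<notin> FO ?t ` Obj ?E" for b Z
 proof -
  have ZE: "Z \<in> \<O> ?E" using Z by (simp add: null_src_def)
  obtain p where p: "b = gcode p" "p \<in> ul_corner" using b(1) by auto
  have "b \<noteq> gcode (0,0)" "b \<noteq> gcode (0,Suc 0)" using b(2) FOt by (auto simp: image_iff)
  hence pb: "b = gcode (Suc 0,0)" using p by (cases p) auto
  have "val ?U b (res ?i (res ?c Z)) = val ?E (cpair (cnat 0) (cnat 0)) Z"
   using val_res[OF i b(1) cZ(1)[OF ZE]] val_res[OF c(1) _ ZE, of "gcode (Suc 0,0)"] c(2)[of "(Suc 0,0)"] pb by simp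
  thus ?thesis using Z FOt pb by (auto simp: null_src_def)
 qed
 show ?thesis
 proof (rule cofiberI)
  show "null_src e_cat (res ?bot S)"
   unfolding null_src_def using res_obj[OF bot(1) S] val_res[OF bot(1) _ S] z bot(2) by simp
  show "tr ?top ?bot S \<in> \<H> ?E (res ?top S) (res ?bot S)" by (rule \<tau>)
  fix Z assume Z: "null_src e_cat Z"
  hence ZE: "Z \<in> \<O> ?E" by (simp add: null_src_def)
  have icZ: "res ?i (res ?c Z) \<in> \<O> ?U" using res_obj[OF i cZ(1)[OF ZE]] .
  have tS: "res ?t (res ?i S) = res ?top S" "res ?t (res ?i (res ?c Z)) = Z"
   using res_comp[OF tm i S] res_comp[OF tm i cZ(1)[OF ZE]] it cZ(3)[OF ZE] by simp_all

  show "\<exists>g. g \<in> \<H> ?E (res ?bot S) Z \<and> g *[?E] tr ?top ?bot S = f" if f: "f \<in> \<H> ?E (res ?top S) Z" for f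
  proof -
   obtain f1 where f1: "f1 \<in> \<H> ?U (res ?i S) (res ?i (res ?c Z))" "resa ?t f1 = f"
    using rext_ex[OF tm runiv_supported[OF t icZ off[OF Z]] res_obj[OF i S]] f tS by metis
   obtain f2 where f2: "f2 \<in> \<H> ?Q S (res ?c Z)" "resa ?i f2 = f1"
    using lext_ex[OF i ext cZ(1)[OF ZE] f1(1)] .
   show ?thesis using key[OF ZE f2(1)] f2 f1(2) resa_hom[OF bot(1) f2(1)] cZ(2)[OF ZE] by auto
  qed
  show "g = h" if g: "g \<in> \<H> ?E (res ?bot S) Z" and h: "h \<in> \<H> ?E (res ?bot S) Z"
   and eq: "g *[?E] tr ?top ?bot S = h *[?E] tr ?top ?bot S" for g h
  proof -
   have "\<exists>k. k \<in> \<H> ?Q S (res ?c Z) \<and> resa ?bot k = l" if l: "l \<in> \<H> ?E (res ?bot S) Z" for l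
   proof -
    obtain k where k: "k \<in> \<H> ?Q S (res ?c Z)" "idn ?E Z *[?E] resa ?bot k = l"
     using pull_runivE[OF bot(1) ru[OF ZE] S l] .
    thus ?thesis using E2.ident_left[of "resa ?bot k"] resa_hom[OF bot(1) k(1)] cZ(2)[OF ZE] by auto
   qed
   then obtain g' h' where g': "g' \<in> \<H> ?Q S (res ?c Z)" "resa ?bot g' = g"
    and h': "h' \<in> \<H> ?Q S (res ?c Z)" "resa ?bot h' = h" using g h by metis
   have "resa ?t (resa ?i g') = resa ?t (resa ?i h')" using key[OF ZE g'(1)] key[OF ZE h'(1)] g'(2) h'(2) eq by simp
   hence "resa ?i g' = resa ?i h'"
    using rext_eqI[OF tm runiv_supported[OF t icZ off[OF Z]] resa_hom[OF i g'(1)] resa_hom[OF i h'(1)]] by blast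
   hence "g' = h'" using lext_eqI[OF i ext g'(1) h'(1)] by blast
   thus ?thesis using g' h' by simp
  qed
 qed
qed

end

context pointed_derivator
begin

text \<open>Arrows from \<open>res h T\<close> to \<open>U\<close> are to be compared with those to
  \<open>U'\<close>, the right extension of \<open>res i U\<close>. Transposed along
  \<open>h\<close>, they become arrows from \<open>T\<close> to \<open>sta h U\<close> and
  \<open>sta h U'\<close>, which are determined on \<open>K\<close>. At a point of \<open>K\<close>
  these objects have the values of \<open>U\<close> and \<open>U'\<close> at the least point of
  \<open>Q\<close> above it, which comes from \<open>V\<close>, where \<open>U\<close> and
  \<open>U'\<close> agree, or they are both zero; this is what \<open>least\<close>
  provides.\<close>

lemma lext_res:
 assumes w: "w \<in> Mor K L" and T: "T \<in> \<O> L" and ext: "lext K w T" and h: "h \<in> Mor Q L" and i: "embedding V Q i"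
  and least: "\<And>p. p \<in> Obj K \<Longrightarrow> (\<forall>x \<in> Obj Q. \<not> le L (FO w p) (FO h x)) \<or>
   (\<exists>x \<in> Obj V. le L (FO w p) (FO h (FO i x)) \<and> (\<forall>y \<in> Obj Q. le L (FO w p) (FO h y) \<longrightarrow> le Q (FO i x) y))"
 shows "lext V i (res h T)"
proof -
 have im: "i \<in> Mor V Q" using i by (simp add: embedding_def)
 note K = MorD(4)[OF w] and L = MorD(5)[OF w] and Q = MorD(5)[OF im] and V = MorD(4)[OF im]
 interpret K: category "\<D> K" using cat[OF K] .
 interpret L: category "\<D> L" using cat[OF L] .
 interpret Q: category "\<D> Q" using cat[OF Q] .
 interpret V: category "\<D> V" using cat[OF V] .
 have hT: "res h T \<in> \<O> Q" using res_obj[OF h T] .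
 \<comment> \<open>\<nu> compares \<open>U\<close> with its right extension from \<open>V\<close>,
   and \<open>N\<close> is the arrow it induces on right extensions along \<open>h\<close>.\<close>
 have key: "\<exists>U' \<nu> N. U' \<in> \<O> Q \<and> \<nu> \<in> \<H> Q U U' \<and> N \<in> \<H> L (sta h U) (sta h U') \<and> U' = sta i (res i U) \<and>
   eps i (res i U) *[V] resa i \<nu> = idn V (res i U) \<and>
   eps h U' *[Q] resa h N = \<nu> *[Q] eps h U \<and> \<I> K (resa w N)"
  if U: "U \<in> \<O> Q" for U
 proof -
  define U' where "U' = sta i (res i U)"
  have iU: "res i U \<in> \<O> V" using res_obj[OF im U] .
  note U' = sta_runiv[OF im iU, folded U'_def]
  obtain \<nu> where \<nu>: "\<nu> \<in> \<H> Q U U'" "eps i (res i U) *[V] resa i \<nu> = idn V (res i U)"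
   using sta_ex[OF im iU U V.ident_hom[OF iU]] unfolding U'_def .
  note hU = sta_runiv[OF h U] and hU' = sta_runiv[OF h U'(2)]
  obtain N where N: "N \<in> \<H> L (sta h U) (sta h U')" "eps h U' *[Q] resa h N = \<nu> *[Q] eps h U"
   using sta_ex[OF h U'(2) hU(2) Q.comp_hom[OF hU(3) \<nu>(1)]] .
  have "\<I> V (resa i \<nu>)"
   using V.iso_cancel_left[OF resa_hom[OF im \<nu>(1)] U'(3)] \<nu>(2) V.iso_ident[OF iU] eps_iso[OF i iU] by simp
  note \<nu>i = resa_iso[OF Mor_pt[OF V] resa_hom[OF im \<nu>(1)] this]
  have "\<I> K (resa w N)"
  proof (rule iso_pointwise[OF K resa_hom[OF w N(1)]])
   fix p assume p: "p \<in> Obj K"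
   have wp: "FO w p \<in> Obj L" using Mor_obj[OF w p] .
   have Np: "vala L (FO w p) N \<in> hom \<E> (val L (FO w p) (sta h U)) (val L (FO w p) (sta h U'))"
    using vala_hom[OF L wp N(1)] .
   have "is_iso \<E> (vala L (FO w p) N)"
    using least[OF p]
   proof
    assume none: "\<forall>x \<in> Obj Q. \<not> le L (FO w p) (FO h x)"
    thus ?thesis using E.iso_zero[OF _ _ Np] sta_val_zero[OF h U wp] sta_val_zero[OF h U'(2) wp] by blast
   next
    assume "\<exists>x \<in> Obj V. le L (FO w p) (FO h (FO i x)) \<and> (\<forall>y \<in> Obj Q. le L (FO w p) (FO h y) \<longrightarrow> le Q (FO i x) y)"
    then obtain x where x: "x \<in> Obj V" "le L (FO w p) (FO h (FO i x))" "\<And>y. y \<in> Obj Q \<Longrightarrow> le L (FO w p) (FO h y) \<Longrightarrow> le Q (FO i x) y"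
     by blast
    let ?x = "FO i x"
    have ix: "?x \<in> Obj Q" using Mor_obj[OF im x(1)] .
    have \<nu>x: "is_iso \<E> (vala Q ?x \<nu>)" using \<nu>i[OF x(1)] vala_resa[OF im x(1) \<nu>(1)] by simp
    define a where "a W = vala Q ?x (eps h W) ** step L (FO w p) (FO h ?x) (sta h W)" for W
    have st: "step L (FO w p) (FO h ?x) (sta h W) \<in> hom \<E> (val L (FO w p) (sta h W)) (val L (FO h ?x) (sta h W))"
     "vala Q ?x (eps h W) \<in> hom \<E> (val L (FO h ?x) (sta h W)) (val Q ?x W)"
     "a W \<in> hom \<E> (val L (FO w p) (sta h W)) (val Q ?x W)"
     "is_iso \<E> (a W)" if W: "W \<in> \<O> Q" for W
    proof -
     note hW = sta_runiv[OF h W]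
     show 1: "step L (FO w p) (FO h ?x) (sta h W) \<in> hom \<E> (val L (FO w p) (sta h W)) (val L (FO h ?x) (sta h W))"
      using step_hom[OF L x(2) hW(2)] .
     show 2: "vala Q ?x (eps h W) \<in> hom \<E> (val L (FO h ?x) (sta h W)) (val Q ?x W)"
      using vala_hom[OF Q ix hW(3)] val_res[OF h ix hW(2)] by simp
     show "a W \<in> hom \<E> (val L (FO w p) (sta h W)) (val Q ?x W)" unfolding a_def using E.comp_hom[OF 1 2] .
     show "is_iso \<E> (a W)" unfolding a_def by (rule sta_val[OF h W ix x(2) x(3)])
    qed
    have Nx: "vala L (FO h ?x) N \<in> hom \<E> (val L (FO h ?x) (sta h U)) (val L (FO h ?x) (sta h U'))"
     using vala_hom[OF L Mor_obj[OF h ix] N(1)] .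
    have \<nu>h: "vala Q ?x \<nu> \<in> hom \<E> (val Q ?x U) (val Q ?x U')" using vala_hom[OF Q ix \<nu>(1)] .
    have "a U' ** vala L (FO w p) N
      = vala Q ?x (eps h U') ** (vala L (FO h ?x) N ** step L (FO w p) (FO h ?x) (sta h U))"
     unfolding a_def using E.comp_assoc[OF Np st(1,2)[OF U'(2)]] step_nat[OF L x(2) N(1)] by simp
    also have "\<dots> = (vala Q ?x (eps h U') ** vala Q ?x (resa h N)) ** step L (FO w p) (FO h ?x) (sta h U)"
     using E.comp_assoc[OF st(1)[OF U] Nx st(2)[OF U'(2)]] vala_resa[OF h ix N(1)] by simp
    also have "\<dots> = vala Q ?x \<nu> ** a U"
     unfolding a_def resa_comp[OF Mor_pt[OF Q ix] resa_hom[OF h N(1)] hU'(3), symmetric] N(2)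
      resa_comp[OF Mor_pt[OF Q ix] hU(3) \<nu>(1)] by (rule E.comp_assoc[OF st(1,2)[OF U] \<nu>h])
    finally show ?thesis
     using E.iso_cancel_left[OF Np st(3)[OF U'(2)]] st(4)[OF U'(2)] E.iso_comp[OF st(3)[OF U] \<nu>h st(4)[OF U] \<nu>x] by simp
   qed
   thus "is_iso \<E> (vala K p (resa w N))" using vala_resa[OF w p N(1)] by simp
  qed
  thus ?thesis using U'(2) \<nu> N U'_def by blast
 qed
 show ?thesis
 proof (rule lextI[OF im hT])
  fix U f assume U: "U \<in> \<O> Q" and f: "f \<in> \<H> V (res i (res h T)) (res i U)"
  obtain U' \<nu> N where U': "U' \<in> \<O> Q" "U' = sta i (res i U)" and \<nu>: "\<nu> \<in> \<H> Q U U'"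
   "eps i (res i U) *[V] resa i \<nu> = idn V (res i U)"
   and N: "N \<in> \<H> L (sta h U) (sta h U')" "eps h U' *[Q] resa h N = \<nu> *[Q] eps h U" "\<I> K (resa w N)"
   using key[OF U] by blast
  have iU: "res i U \<in> \<O> V" using res_obj[OF im U] .
  note hU = sta_runiv[OF h U] and hU' = sta_runiv[OF h U'(1)] and ei = sta_runiv(3)[OF im iU, folded U'(2)]
  obtain f1 where f1: "f1 \<in> \<H> Q (res h T) U'" "eps i (res i U) *[V] resa i f1 = f"
   using sta_ex[OF im iU hT f] unfolding U'(2) .
  obtain f2 where f2: "f2 \<in> \<H> L T (sta h U')" "eps h U' *[Q] resa h f2 = f1"
   using sta_ex[OF h U'(1) T f1(1)] .
  obtain N' where N': "N' \<in> \<H> K (res w (sta h U')) (res w (sta h U))" "resa w N *[K] N' = idn K (res w (sta h U'))"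
   using K.isoE[OF N(3) resa_hom[OF w N(1)]] by metis
  obtain g1 where g1: "g1 \<in> \<H> L T (sta h U)" "resa w g1 = N' *[K] resa w f2"
   using lext_ex[OF w ext hU(2) K.comp_hom[OF resa_hom[OF w f2(1)] N'(1)]] .
  have "resa w (N *[L] g1) = resa w f2"
   using resa_comp[OF w g1(1) N(1)] g1(2) K.comp_assoc[OF resa_hom[OF w f2(1)] N'(1) resa_hom[OF w N(1)]]
    N'(2) K.ident_left[OF resa_hom[OF w f2(1)]] by simp
  hence Ng: "N *[L] g1 = f2" using lext_eqI[OF w ext L.comp_hom[OF g1(1) N(1)] f2(1)] by simp
  let ?g = "eps h U *[Q] resa h g1"
  note hg1 = resa_hom[OF h g1(1)]
  have g: "?g \<in> \<H> Q (res h T) U" using Q.comp_hom[OF hg1 hU(3)] .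
  have "\<nu> *[Q] ?g = f1"
   using Q.comp_assoc[OF hg1 hU(3) \<nu>(1)] Q.comp_assoc[OF hg1 resa_hom[OF h N(1)] hU'(3)] N(2)
    resa_comp[OF h g1(1) N(1)] Ng f2(2) by simp
  hence "resa i ?g = f"
   using V.comp_assoc[OF resa_hom[OF im g] resa_hom[OF im \<nu>(1)] ei] resa_comp[OF im g \<nu>(1)] \<nu>(2)
    V.ident_left[OF resa_hom[OF im g]] f1(2) by simp
  thus "\<exists>g. g \<in> \<H> Q (res h T) U \<and> resa i g = f" using g by blast
 next
  fix U g g' assume g: "g \<in> \<H> Q (res h T) U" and g': "g' \<in> \<H> Q (res h T) U" and eq: "resa i g = resa i g'"
  have U: "U \<in> \<O> Q" using Q.hom_objs[OF g] by simp
  obtain U' \<nu> N where U': "U' \<in> \<O> Q" "U' = sta i (res i U)" and \<nu>: "\<nu> \<in> \<H> Q U U'"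
   and N: "N \<in> \<H> L (sta h U) (sta h U')" "eps h U' *[Q] resa h N = \<nu> *[Q] eps h U" "\<I> K (resa w N)"
   using key[OF U] by blast
  have iU: "res i U \<in> \<O> V" using res_obj[OF im U] .
  note hU = sta_runiv[OF h U] and hU' = sta_runiv[OF h U'(1)]
  have eq1: "\<nu> *[Q] g = \<nu> *[Q] g'"
   using sta_eqI[OF im iU, of "\<nu> *[Q] g" "res h T" "\<nu> *[Q] g'"] Q.comp_hom[OF g \<nu>] Q.comp_hom[OF g' \<nu>] U'(2)
    resa_comp[OF im g \<nu>] resa_comp[OF im g' \<nu>] eq by simp
  obtain k where k: "k \<in> \<H> L T (sta h U)" "eps h U *[Q] resa h k = g" using sta_ex[OF h U T g] .
  obtain k' where k': "k' \<in> \<H> L T (sta h U)" "eps h U *[Q] resa h k' = g'" using sta_ex[OF h U T g'] .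
  have tr: "eps h U' *[Q] resa h (N *[L] l) = \<nu> *[Q] (eps h U *[Q] resa h l)"
   if l: "l \<in> \<H> L T (sta h U)" for l
   using Q.comp_assoc[OF resa_hom[OF h l] hU(3) \<nu>] Q.comp_assoc[OF resa_hom[OF h l] resa_hom[OF h N(1)] hU'(3)] N(2)
    resa_comp[OF h l N(1)] by simp
  have "N *[L] k = N *[L] k'"
   using sta_eqI[OF h U'(1) L.comp_hom[OF k(1) N(1)] L.comp_hom[OF k'(1) N(1)]] tr[OF k(1)] tr[OF k'(1)] k(2) k'(2) eq1 by simp
  hence "resa w N *[K] resa w k = resa w N *[K] resa w k'"
   using resa_comp[OF w k(1) N(1)] resa_comp[OF w k'(1) N(1)] by simp
  hence "resa w k = resa w k'"
   using K.iso_cancel_mono[OF N(3) resa_hom[OF w N(1)] resa_hom[OF w k(1)] resa_hom[OF w k'(1)]] by simp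
  hence "k = k'" using lext_eqI[OF w ext k(1) k'(1)] by simp
  thus "g = g'" using k(2) k'(2) by simp
 qed
qed

text \<open>On the lower right corner, the square is a right Kan extension from the two middle
  vertices, because the last vertex is zero. These vertices form a disjoint union of two points,
  over which \<open>der1\<close> turns arrows into pairs. Testing with constant squares, which are
  free on the upper left vertex, gives the product.\<close>

lemma cartesian_product:
 assumes S: "S \<in> \<O> (grid square)" and ca: "cartesian D S"
  and z: "is_zero \<E> (val (grid square) (gcode (Suc 0, Suc 0)) S)"
 shows "is_product \<E> UNIV
  (\<lambda>b. if b then val (grid square) (gcode (0, Suc 0)) S else val (grid square) (gcode (Suc 0, 0)) S)
  (val (grid square) (gcode (0, 0)) S)
  (\<lambda>b. if b then step (grid square) (gcode (0, 0)) (gcode (0, Suc 0)) S else step (grid square) (gcode (0, 0)) (gcode (Suc 0, 0)) S)"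
proof -
 let ?Q = "grid square :: 'a scat" and ?V = "grid lr_corner :: 'a scat" and ?e = "e_cat :: 'a scat"
 let ?i = "grid_map lr_corner square id :: 'a sftor"
 define I where "I = {cnat 0, cnat (Suc 0) :: 'a}"
 define C where "C = coprod_cat I (\<lambda>_. ?e)"
 define q :: "'a \<Rightarrow> nat \<times> nat" where "q c = (if c = cnat 0 then (0, Suc 0) else (Suc 0, 0))" for c
 define t where "t = mono_ftor C ?V (\<lambda>x. gcode (q (cfst x)))"
 have tC: "thin C" unfolding C_def by simp
 have OC: "Obj C = {cpair c (cnat 0) | c. c \<in> I}" unfolding C_def by auto
 have lC: "le C (cpair c (cnat 0)) (cpair d (cnat 0)) \<longleftrightarrow> c = d" if "c \<in> I" for c d
  unfolding C_def using that le_refl[OF thin_e, of "cnat 0 :: 'a"] by simp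
 have t: "embedding C ?V t"
 proof -
  have "shape t" unfolding t_def
   by (rule shape_mono_ftor[OF tC thin_grid]) (auto simp: OC lC q_def I_def le_refl)
  thus ?thesis unfolding embedding_def by (auto simp: t_def Mor_def OC lC q_def I_def)
 qed
 hence tm: "t \<in> Mor C ?V" by (simp add: embedding_def)
 have i: "?i \<in> Mor ?V ?Q" by (rule Mor_grid_map) auto
 have inc: "coprod_incl I (\<lambda>_. ?e) c \<in> Mor ?e C" if "c \<in> I" for c unfolding C_def using that by (simp add: Mor_def)
 have tinc: "t \<circ>\<^sub>F coprod_incl I (\<lambda>_. ?e) c = pt ?V (gcode (q c))" if "c \<in> I" for c
  by (rule Mor_eqI[OF Mor_comp[OF inc[OF that] tm] Mor_pt]) (use that in \<open>auto simp: FO_comp[OF inc[OF that]] t_def OC q_def I_def\<close>)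
 have iS: "res ?i S \<in> \<O> ?V" using res_obj[OF i S] .
 have ext: "rext ?V ?i S" using cartesian_iff[OF S] ca by simp
 have off: "is_zero \<E> (val ?V v (res ?i S)) \<and> (\<forall>a\<in>Obj C. \<not> le ?V v (FO t a))"
  if v: "v \<in> Obj ?V" "v \<notin> FO t ` Obj C" for v
 proof -
  obtain p where p: "v = gcode p" "p \<in> lr_corner" using v(1) by auto
  have "v \<noteq> gcode (0, Suc 0)" "v \<noteq> gcode (Suc 0, 0)" using v(2) by (auto simp: image_iff t_def OC I_def q_def)
  hence "v = gcode (Suc 0, Suc 0)" using p by (cases p) auto
  thus ?thesis using val_res[OF i v(1) S] z by (auto simp: t_def OC I_def q_def)
 qed
 have ru: "rext C t (res ?i S)" by (rule runiv_supported[OF t iS off])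
 let ?in = "coprod_incl I (\<lambda>_. ?e)" and ?w = "\<lambda>X. res t (res ?i X)" and ?v = "\<lambda>d. val ?Q (gcode (q d))" and ?va = "\<lambda>d. vala ?Q (gcode (q d))"
 have qV: "gcode (q d) \<in> Obj ?V" "FO ?i (gcode (q d)) = gcode (q d)" "gcode (q d) \<in> Obj ?Q" "le ?Q (gcode (0, 0)) (gcode (q d))" for d
  by (auto simp: q_def)
 have w: "?w X \<in> \<O> C" if "X \<in> \<O> ?Q" for X using res_obj[OF tm res_obj[OF i that]] .
 have wv: "res (?in d) (?w X) = ?v d X" if "X \<in> \<O> ?Q" "d \<in> I" for d X
  using res_comp[OF inc[OF that(2)] tm res_obj[OF i that(1)]] tinc[OF that(2)] val_res[OF i qV(1) that(1)] qV(2) by simp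
 have wa: "resa t (resa ?i g) \<in> \<H> C (?w X) (?w Y)" if "g \<in> \<H> ?Q X Y" for g X Y
  using resa_hom[OF tm resa_hom[OF i that]] .
 have wva: "resa (?in d) (resa t (resa ?i g)) = ?va d g" if "g \<in> \<H> ?Q X Y" "d \<in> I" for d g X Y
  using resa_resa[OF inc[OF that(2)] tm resa_hom[OF i that(1)]] tinc[OF that(2)] vala_resa[OF i qV(1) that(1)] qV(2) by simp
 let ?p = "pt ?Q (gcode (0, 0))" and ?c = "to_e ?Q"
 have p0: "gcode (0, 0) \<in> Obj ?Q" by auto
 have p: "?p \<in> Mor ?e ?Q" and c: "?c \<in> Mor ?Q ?e" using Mor_pt[OF thin_grid p0] Mor_to_e[OF thin_grid] by simp_all
 have cp: "?c \<circ>\<^sub>F ?p = id_ftor ?e" using to_e_comp[OF p] to_e_e by simp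
 have pc: "fle (?p \<circ>\<^sub>F ?c) (id_ftor ?Q)"
  by (rule Mor_fleI[OF Mor_comp[OF c p] Mor_id[OF thin_grid]]) (auto simp: FO_comp[OF c])
 have idtr: "tr (id_ftor ?e) (id_ftor ?e) U = idn ?e U" if "U \<in> \<O> ?e" for U
  using tr_id[OF Mor_id[OF thin_e] that] res_id[OF thin_e that] by simp
 have lu: "luniv (pull D ?p) U (res ?c U) (idn ?e U)" if "U \<in> \<O> ?e" for U
  using luniv_res[OF p c pc _ that] cp idtr[OF that] fle_refl[OF MorD(1)[OF Mor_id[OF thin_e]]] by simp
 have cU: "res ?c U \<in> \<O> ?Q" "x \<in> Obj ?Q \<Longrightarrow> val ?Q x (res ?c U) = U"
  "x \<in> Obj ?Q \<Longrightarrow> y \<in> Obj ?Q \<Longrightarrow> le ?Q x y \<Longrightarrow> step ?Q x y (res ?c U) = idn ?e U" if U: "U \<in> \<O> ?e" for U x y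
  using res_obj[OF c U] val_res[OF c _ U] val_e[OF U] step_res[OF c _ U] step_id[OF thin_e _ U, of "cnat 0"] by simp_all
 have bij: "\<exists>!g. g \<in> \<H> ?Q (res ?c U) S \<and> (\<forall>d\<in>I. ?va d g = f d)"
  if U: "U \<in> \<O> ?e" and f: "\<And>d. d \<in> I \<Longrightarrow> f d \<in> \<H> ?e U (?v d S)" for U f
 proof -
  note cUQ = cU(1)[OF U]
  have "f d \<in> \<H> ?e (res (?in d) (?w (res ?c U))) (res (?in d) (?w S))" if "d \<in> I" for d
   using f[OF that] wv[OF S that] wv[OF cUQ that] cU(2)[OF U qV(3)] by simp
  then obtain f' where f': "f' \<in> \<H> C (?w (res ?c U)) (?w S)" "\<forall>d\<in>I. resa (?in d) f' = f d"
   and u: "\<And>k. k \<in> \<H> C (?w (res ?c U)) (?w S) \<Longrightarrow> \<forall>d\<in>I. resa (?in d) k = f d \<Longrightarrow> k = f'"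
   using coprod_hom[of I "\<lambda>_. ?e", folded C_def, OF thin_e w[OF cUQ] w[OF S], of f] by metis
  obtain f2 where f2: "f2 \<in> \<H> ?V (res ?i (res ?c U)) (res ?i S)" "resa t f2 = f'"
   using rext_ex[OF tm ru res_obj[OF i cUQ] f'(1)] by blast
  obtain g where g: "g \<in> \<H> ?Q (res ?c U) S" "resa ?i g = f2" using rext_ex[OF i ext cUQ f2(1)] .
  have "\<forall>d\<in>I. ?va d g = f d" using wva[OF g(1)] g(2) f2(2) f'(2) by auto
  moreover have "h = g" if h: "h \<in> \<H> ?Q (res ?c U) S" "\<forall>d\<in>I. ?va d h = f d" for h
  proof -
   have "resa t (resa ?i h) = f'" using u[OF wa[OF h(1)]] wva[OF h(1)] h(2) by simp
   hence "resa ?i h = resa ?i g" using rext_eqI[OF tm ru resa_hom[OF i h(1)] resa_hom[OF i g(1)]] g(2) f2(2) by simp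
   thus ?thesis by (rule rext_eqI[OF i ext h(1) g(1)])
  qed
  ultimately show ?thesis using g(1) by blast
 qed
 let ?st = "\<lambda>d. step ?Q (gcode (0, 0)) (gcode (q d)) S" and ?S0 = "val ?Q (gcode (0, 0)) S"
 have vg: "vala ?Q (gcode (0, 0)) g \<in> hom \<E> U ?S0" "?st d ** vala ?Q (gcode (0, 0)) g = ?va d g"
  if U: "U \<in> \<O> ?e" and g: "g \<in> \<H> ?Q (res ?c U) S" for U g d
  using vala_hom[OF thin_grid p0 g] cU(2)[OF U p0] vala_hom[OF thin_grid qV(3)[of d] g] cU(2)[OF U qV(3)[of d]]
   step_nat[OF thin_grid qV(4)[of d] g] cU(3)[OF U p0 qV(3)[of d] qV(4)[of d]] E.ident_right by auto
 have key: "\<exists>!k. k \<in> hom \<E> U ?S0 \<and> (\<forall>d\<in>I. ?st d ** k = f d)"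
  if U: "U \<in> Obj \<E>" and f: "\<And>d. d \<in> I \<Longrightarrow> f d \<in> hom \<E> U (?v d S)" for U f
 proof -
  have lift: "\<exists>g. g \<in> \<H> ?Q (res ?c U) S \<and> vala ?Q (gcode (0, 0)) g = k" if k: "k \<in> hom \<E> U ?S0" for k
  proof -
   obtain g where g: "g \<in> \<H> ?Q (res ?c U) S" "vala ?Q (gcode (0, 0)) g ** idn ?e U = k"
    using pull_lunivE[OF p lu[OF U] S k] .
   thus ?thesis using E.ident_right[OF vg(1)[OF U g(1)]] by auto
  qed
  obtain g where g: "g \<in> \<H> ?Q (res ?c U) S" "\<forall>d\<in>I. ?va d g = f d"
   and u: "\<And>h. h \<in> \<H> ?Q (res ?c U) S \<Longrightarrow> \<forall>d\<in>I. ?va d h = f d \<Longrightarrow> h = g"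
   using ex1E[OF bij[OF U f]] by metis
  show ?thesis
  proof (rule ex1I[of _ "vala ?Q (gcode (0, 0)) g"])
   show "vala ?Q (gcode (0, 0)) g \<in> hom \<E> U ?S0 \<and> (\<forall>d\<in>I. ?st d ** vala ?Q (gcode (0, 0)) g = f d)"
    using vg[OF U g(1)] g(2) by simp
   fix k assume k: "k \<in> hom \<E> U ?S0 \<and> (\<forall>d\<in>I. ?st d ** k = f d)"
   obtain h where h: "h \<in> \<H> ?Q (res ?c U) S" "vala ?Q (gcode (0, 0)) h = k" using lift k by blast
   thus "k = vala ?Q (gcode (0, 0)) g" using u[OF h(1)] vg(2)[OF U h(1)] k by simp
  qed
 qed
 show ?thesis
  unfolding is_product_def is_coproduct_def op_simps
 proof (intro conjI ballI allI impI)
  show "?S0 \<in> Obj \<E>" using val_obj[OF thin_grid p0 S] .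
  show "(if s then step ?Q (gcode (0, 0)) (gcode (0, Suc 0)) S else step ?Q (gcode (0, 0)) (gcode (Suc 0, 0)) S)
   \<in> hom \<E> ?S0 (if s then val ?Q (gcode (0, Suc 0)) S else val ?Q (gcode (Suc 0, 0)) S)" for s
   using step_hom[OF thin_grid _ S] by auto
  fix U f assume U: "U \<in> Obj \<E>"
   and f: "\<forall>s\<in>UNIV. f s \<in> hom \<E> U (if s then val ?Q (gcode (0, Suc 0)) S else val ?Q (gcode (Suc 0, 0)) S)"
  have "f (d = cnat 0) \<in> hom \<E> U (?v d S)" for d
   using f[rule_format, of True] f[rule_format, of False] by (cases "d = cnat 0") (simp_all add: q_def)
  from key[OF U this] show "\<exists>!k. k \<in> hom \<E> U ?S0 \<and> (\<forall>s\<in>UNIV. (if s then step ?Q (gcode (0, 0)) (gcode (0, Suc 0)) S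
    else step ?Q (gcode (0, 0)) (gcode (Suc 0, 0)) S) ** k = f s)"
   by (simp add: I_def q_def all_bool_eq)
 qed
qed

end

section \<open>Triangles as extensions from a frame\<close>

section \<open>Biproducts and triangles\<close>

text \<open>The free data of a standard triangle: the first edge and the two zeros. The other two
  vertices of \<open>rect\<close> are to be pushouts, so triangles are left extensions from
  here.\<close>

definition frame :: "(nat \<times> nat) set"
 where "frame = {(0, 0), (0, Suc 0), (0, 2), (Suc 0, 0)}"

lemma frame_simps [simp]: "(a, b) \<in> frame \<longleftrightarrow> a = 0 \<and> b \<in> {0, Suc 0, 2} \<or> a = Suc 0 \<and> b = 0"
 by (auto simp: frame_def)

lemma frame_rect: "grid_map frame rect id \<in> Mor (grid frame) (grid rect)"
 by (rule Mor_grid_map) auto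

lemma subsquare_map:
 assumes "k 0 \<le> k (Suc 0)" "k (Suc 0) \<le> 2"
 shows "grid_map square rect (\<lambda>(r, c). (r, k c)) \<in> Mor (grid square) (grid rect)"
proof -
 have "k 0 \<in> {0, Suc 0, 2}" "k (Suc 0) \<in> {0, Suc 0, 2}" using assms by auto
 thus ?thesis by (intro Mor_grid_map) (use assms(1) in auto)
qed

context derivator
begin

text \<open>Composing the universal arrow of \<open>R\<close> with the isomorphism over
  \<open>K\<close> gives a second universal arrow for \<open>res t Q\<close>, and universal arrows
  are unique.\<close>

lemma lext_iso:
 assumes t: "t \<in> Mor K L" and Q: "lext K t Q" and R: "lext K t R" and g: "g \<in> \<H> L Q R" and i: "\<I> K (resa t g)"
 shows "\<I> L g"
proof -
 interpret K: category "\<D> K" using cat[OF MorD(4)[OF t]] .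
 note tg = resa_hom[OF t g]
 have "luniv (pull D t) (res t Q) R (resa t g)"
  using luniv_precomp[OF pull(1)[OF t] R, of "resa t g" "res t Q"] pull[OF t] tg i K.ident_left[OF tg] by simp
 from luniv_iso[OF pull(1)[OF t] Q this, of g] show ?thesis using pull[OF t] g K.ident_right[OF tg] by simp
qed

lemma rext_iso:
 assumes t: "t \<in> Mor K L" and Q: "rext K t Q" and R: "rext K t R" and g: "g \<in> \<H> L Q R" and i: "\<I> K (resa t g)"
 shows "\<I> L g"
proof -
 interpret K: category "\<D> K" using cat[OF MorD(4)[OF t]] .
 note tg = resa_hom[OF t g]
 have "runiv (pull D t) (res t R) Q (resa t g)"
  using runiv_precomp[OF pull(1)[OF t] Q, of "resa t g" "res t R"] pull[OF t] tg i K.ident_right[OF tg] by simp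
 from runiv_iso[OF pull(1)[OF t] R this, of g] show ?thesis using pull[OF t] g K.ident_left[OF tg] by simp
qed

lemma subsquare_obj:
 assumes "T \<in> \<O> (grid rect)" "k 0 \<le> k (Suc 0)" "k (Suc 0) \<le> 2"
 shows "subsquare D T k \<in> \<O> (grid square)"
  "p \<in> square \<Longrightarrow> val (grid square) (gcode p) (subsquare D T k) = val (grid rect) (gcode (fst p, k (snd p))) T"
  "p \<in> square \<Longrightarrow> q \<in> square \<Longrightarrow> fst p \<le> fst q \<Longrightarrow> snd p \<le> snd q \<Longrightarrow>
   step (grid square) (gcode p) (gcode q) (subsquare D T k) = step (grid rect) (gcode (fst p, k (snd p))) (gcode (fst q, k (snd q))) T"
 unfolding subsquare_def using res_obj[OF subsquare_map[OF assms(2,3)] assms(1)]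
  val_res[OF subsquare_map[OF assms(2,3)] _ assms(1), of "gcode p"] step_res[OF subsquare_map[OF assms(2,3)] _ assms(1), of "gcode p" "gcode q"]
 by (simp_all add: case_prod_unfold)

end

context pointed_derivator
begin

text \<open>The points of the square above a given vertex of the frame, if any, have a least one,
  which lies in the upper left corner. So \<open>lext_res\<close> treats the left, the right and the
  outer square at once.\<close>

lemma subsquare_cocartesian:
 assumes T: "T \<in> \<O> (grid rect)" and ext: "lext (grid frame) (grid_map frame rect id) T"
  and k: "k 0 \<le> k (Suc 0)" "k (Suc 0) \<le> 2"
 shows "cocartesian D (subsquare D T k)"
proof -
 have ul: "ul_corner \<subseteq> square" by auto
 have "lext (grid ul_corner) (grid_map ul_corner square id) (res (grid_map square rect (\<lambda>(r, c). (r, k c))) T)"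
 proof (rule lext_res[OF frame_rect T ext subsquare_map[OF k] embedding_incl[OF ul]])
  fix x :: 'a assume "x \<in> Obj (grid frame)"
  then obtain p where p: "x = gcode p" "p \<in> frame" by auto
  have k2: "k 0 \<in> {0, Suc 0, 2}" "k (Suc 0) \<in> {0, Suc 0, 2}" using k by auto
  obtain r c where rc: "p = (r, c)" by (cases p)
  \<comment> \<open>In the four cases the least point above \<open>(r, c)\<close> is
    \<open>(1, 0)\<close>, \<open>(0, 0)\<close>, \<open>(0, 1)\<close>, or there is none.\<close>
  have "r = Suc 0 \<and> c = 0 \<or> r = 0 \<and> c \<le> k 0 \<or> r = 0 \<and> k 0 < c \<and> c \<le> k (Suc 0) \<or> r = 0 \<and> k (Suc 0) < c"
   using p rc by auto
  thus "(\<forall>y\<in>Obj (grid square). \<not> le (grid rect) (FO (grid_map frame rect id) x) (FO (grid_map square rect (\<lambda>(r, c). (r, k c))) y)) \<or>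
   (\<exists>v\<in>Obj (grid ul_corner).
     le (grid rect) (FO (grid_map frame rect id) x) (FO (grid_map square rect (\<lambda>(r, c). (r, k c))) (FO (grid_map ul_corner square id) v)) \<and>
     (\<forall>y\<in>Obj (grid square). le (grid rect) (FO (grid_map frame rect id) x) (FO (grid_map square rect (\<lambda>(r, c). (r, k c))) y) \<longrightarrow>
       le (grid square) (FO (grid_map ul_corner square id) v) y))"
  proof (elim disjE)
   assume a: "r = Suc 0 \<and> c = 0"
   show ?thesis
    by (rule disjI2, rule bexI[of _ "gcode (Suc 0, 0)"]) (use p rc k2 a in auto)
  next
   assume a: "r = 0 \<and> c \<le> k 0"
   show ?thesis
    by (rule disjI2, rule bexI[of _ "gcode (0, 0)"]) (use p rc k2 a in auto)
  next
   assume a: "r = 0 \<and> k 0 < c \<and> c \<le> k (Suc 0)"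
   show ?thesis
    by (rule disjI2, rule bexI[of _ "gcode (0, Suc 0)"]) (use p rc k2 a in auto)
  next
   assume a: "r = 0 \<and> k (Suc 0) < c"
   show ?thesis
    by (rule disjI1) (use p rc k2 k a in auto)
  qed
 qed
 thus ?thesis using cocartesian_iff[OF subsquare_obj(1)[OF T k]] by (simp add: subsquare_def)
qed

text \<open>Extension from the frame takes the place of the two cocartesian squares in
  \<open>standard_triangle\<close>: it implies them, and it says directly how arrows out of
  \<open>T\<close> are constructed.\<close>

definition triangle :: "'b \<Rightarrow> bool"
 where "triangle T \<longleftrightarrow> T \<in> \<O> (grid rect) \<and> lext (grid frame) (grid_map frame rect id) T \<and>
  is_zero \<E> (val (grid rect) (gcode (0, 2)) T) \<and> is_zero \<E> (val (grid rect) (gcode (Suc 0, 0)) T)"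

text \<open>Right extension from the first edge to the frame puts zeros at the other vertices,
  because no vertex of the edge lies above them; left extension to \<open>rect\<close> fills in the
  pushouts.\<close>

lemma triangle_ex:
 assumes F: "F \<in> \<O> (ar e_cat)"
 obtains T \<alpha> where "triangle T" "\<alpha> \<in> \<H> (ar e_cat) (res (line rect (0, 0) (0, Suc 0)) T) F" "\<I> (ar e_cat) \<alpha>"
proof -
 let ?k = "line frame (0, 0) (0, Suc 0) :: 'a sftor" and ?w = "grid_map frame rect id :: 'a sftor" and ?E = "ar e_cat :: 'a scat"
 have k: "embedding ?E (grid frame) ?k" by (rule embedding_line) auto
 hence km: "?k \<in> Mor ?E (grid frame)" by (simp add: embedding_def)
 have FOk: "FO ?k x \<in> {gcode (0, 0), gcode (0, Suc 0)}" if "x \<in> Obj ?E" for x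
  using that by (auto simp: line)
 note w = frame_rect[where 'a = 'a]
 have fr: "frame \<subseteq> rect" by auto
 have l: "?w \<circ>\<^sub>F ?k = line rect (0, 0) (0, Suc 0)" by (subst grid_map_line) (use w in auto)
 define R where "R = sta ?k F"
 define T where "T = shr ?w R"
 interpret E2: category "\<D> ?E" using cat by simp
 note R = sta_runiv[OF km F, folded R_def]
 note T = shr_luniv[OF w R(2), folded T_def]
 have ei: "\<I> (grid frame) (eta ?w R)" using eta_iso[OF embedding_incl[OF fr] R(2)] .
 interpret G: category "\<D> (grid frame)" using cat[OF thin_grid] .
 have z: "is_zero \<E> (val (grid rect) (gcode p) T)" if p: "p \<in> {(0, 2), (Suc 0, 0)}" for p
 proof -
  have pf: "gcode p \<in> Obj (grid frame)" "FO ?w (gcode p) = gcode p" using p by auto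
  have "\<not> le (grid frame) (gcode p) (FO ?k a)" if "a \<in> Obj ?E" for a using FOk[OF that] p by auto
  hence "is_zero \<E> (val (grid frame) (gcode p) R)"
   unfolding R_def by (rule sta_val_zero[OF km F pf(1)])
  from E.zero_if_iso[OF this vala_hom[OF thin_grid pf(1) T(3)] resa_iso[OF Mor_pt[OF thin_grid pf(1)] T(3) ei]]
  show ?thesis using val_res[OF w pf(1) T(2)] pf(2) by simp
 qed
 obtain e' where e': "e' \<in> \<H> (grid frame) (res ?w T) R" "\<I> (grid frame) e'"
  using G.isoE[OF ei T(3)] by metis
 have "eps ?k F *[?E] resa ?k e' \<in> \<H> ?E (res (line rect (0, 0) (0, Suc 0)) T) F"
  "\<I> ?E (eps ?k F *[?E] resa ?k e')"
  using E2.comp_hom[OF resa_hom[OF km e'(1)] R(3)] res_comp[OF km w T(2)] l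
   E2.iso_comp[OF resa_hom[OF km e'(1)] R(3) resa_iso[OF km e'] eps_iso[OF k F]] by simp_all
 moreover have "triangle T"
  unfolding triangle_def using T(2) z lext_shr[OF embedding_incl[OF fr] R(2)] T_def by simp
 ultimately show thesis using that by blast
qed

text \<open>The arrow extends over the frame because the target is a right extension by zero there,
  and over \<open>rect\<close> because the source is a left extension.\<close>

lemma triangle_map:
 assumes T: "triangle T" and T': "triangle T'"
  and f: "f \<in> \<H> (ar e_cat) (res (line rect (0, 0) (0, Suc 0)) T) (res (line rect (0, 0) (0, Suc 0)) T')"
 obtains \<theta> where "\<theta> \<in> \<H> (grid rect) T T'" "resa (line rect (0, 0) (0, Suc 0)) \<theta> = f"
proof -
 let ?k = "line frame (0, 0) (0, Suc 0) :: 'a sftor" and ?w = "grid_map frame rect id :: 'a sftor" and ?E = "ar e_cat :: 'a scat"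
 have k: "embedding ?E (grid frame) ?k" by (rule embedding_line) auto
 hence km: "?k \<in> Mor ?E (grid frame)" by (simp add: embedding_def)
 note w = frame_rect[where 'a = 'a]
 have l: "?w \<circ>\<^sub>F ?k = line rect (0, 0) (0, Suc 0)" by (subst grid_map_line) (use w in auto)
 have TT: "T \<in> \<O> (grid rect)" "T' \<in> \<O> (grid rect)" using T T' by (simp_all add: triangle_def)
 have off: "is_zero \<E> (val (grid frame) v (res ?w T')) \<and> (\<forall>a\<in>Obj ?E. \<not> le (grid frame) v (FO ?k a))"
  if v: "v \<in> Obj (grid frame)" "v \<notin> FO ?k ` Obj ?E" for v
 proof -
  obtain p where p: "v = gcode p" "p \<in> frame" using v(1) by auto
  have "v \<noteq> gcode (0, 0)" "v \<noteq> gcode (0, Suc 0)" using v(2) by (auto simp: image_iff line)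
  hence "p = (0, 2) \<or> p = (Suc 0, 0)" using p by (cases p) auto
  thus ?thesis using T' val_res[OF w v(1) TT(2)] p by (auto simp: triangle_def line)
 qed
 obtain f1 where f1: "f1 \<in> \<H> (grid frame) (res ?w T) (res ?w T')" "resa ?k f1 = f"
  using rext_ex[OF km runiv_supported[OF k res_obj[OF w TT(2)] off] res_obj[OF w TT(1)], of f] f
   res_comp[OF km w TT(1)] res_comp[OF km w TT(2)] l by (metis (no_types, lifting))
 obtain \<theta> where "\<theta> \<in> \<H> (grid rect) T T'" "resa ?w \<theta> = f1"
  using lext_ex[OF w _ TT(2) f1(1)] T by (auto simp: triangle_def)
 thus thesis using that[of \<theta>] f1(2) resa_resa[OF km w] l by metis
qed

lemma triangle_cofiber:
 assumes T: "T \<in> \<O> (grid rect)" and z: "is_zero \<E> (val (grid rect) (gcode (Suc 0, 0)) T)"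
  and co: "cocartesian D (subsquare D T (\<lambda>c. c))"
 shows "cofiber e_cat (res (line rect (0, 0) (0, Suc 0)) T) (res (line rect (Suc 0, 0) (Suc 0, Suc 0)) T)
  (tr (line rect (0, 0) (0, Suc 0)) (line rect (Suc 0, 0) (Suc 0, Suc 0)) T)"
proof -
 let ?h = "grid_map square rect (\<lambda>(r, c). (r, c)) :: 'a sftor"
 have h: "?h \<in> Mor (grid square) (grid rect)" by (rule subsquare_map) auto
 have S: "subsquare D T (\<lambda>c. c) \<in> \<O> (grid square)" "subsquare D T (\<lambda>c. c) = res ?h T"
  using res_obj[OF h T] by (simp_all add: subsquare_def)
 have l: "?h \<circ>\<^sub>F line square (0, 0) (0, Suc 0) = line rect (0, 0) (0, Suc 0)"
  "?h \<circ>\<^sub>F line square (Suc 0, 0) (Suc 0, Suc 0) = line rect (Suc 0, 0) (Suc 0, Suc 0)"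
  by (subst grid_map_line; use h in auto)+
 have L: "line square (0, 0) (0, Suc 0) \<in> Mor (ar e_cat) (grid square)" "line square (Suc 0, 0) (Suc 0, Suc 0) \<in> Mor (ar e_cat) (grid square)"
  by (rule line; simp)+
 have fl: "fle (line square (0, 0) (0, Suc 0)) (line square (Suc 0, 0) (Suc 0, Suc 0))" by (rule fle_line) auto
 have "is_zero \<E> (val (grid square) (gcode (Suc 0, 0)) (subsquare D T (\<lambda>c. c)))"
  using subsquare_obj(2)[OF T, of "\<lambda>c. c" "(Suc 0, 0)"] z by simp
 from cocartesian_cofiber[OF S(1) co this, unfolded S(2)] show ?thesis
  unfolding tr_res[OF fl L(1) h T] res_comp[OF L(1) h T, symmetric] res_comp[OF L(2) h T, symmetric] l .
qed

end

context triangulated_derivator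
begin

text \<open>The outer square is cocartesian with two zero vertices, so invertibility at
  \<open>(0, 0)\<close> passes to its last vertex \<open>(1, 2)\<close>. By \<open>der7\<close> the
  right square is also cartesian, so \<open>(0, 1)\<close> is recovered from its other three
  vertices. This stands in for the five lemma, as subtraction of arrows is not yet
  available.\<close>

lemma triangle_iso:
 assumes T: "triangle T" and T': "triangle T'" and \<theta>: "\<theta> \<in> \<H> (grid rect) T T'"
  and i: "is_iso \<E> (vala (grid rect) (gcode (0, 0)) \<theta>)" "is_iso \<E> (vala (grid rect) (gcode (Suc 0, Suc 0)) \<theta>)"
 shows "is_iso \<E> (vala (grid rect) (gcode (0, Suc 0)) \<theta>)"
proof -
 note t = T[unfolded triangle_def] and t' = T'[unfolded triangle_def]
 define sq :: "(nat \<Rightarrow> nat) \<Rightarrow> 'a sftor" where "sq k = grid_map square rect (\<lambda>(r, c). (r, k c))" for k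
 have ul: "grid_map ul_corner square id \<in> Mor (grid ul_corner) (grid square)" by (rule Mor_grid_map) auto
 have lr: "grid_map lr_corner square id \<in> Mor (grid lr_corner) (grid square)" by (rule Mor_grid_map) auto
 have sub: "sq k \<in> Mor (grid square) (grid rect)" "subsquare D T k = res (sq k) T" "subsquare D T' k = res (sq k) T'"
  "resa (sq k) \<theta> \<in> \<H> (grid square) (subsquare D T k) (subsquare D T' k)"
  "cocartesian D (subsquare D T k)" "cocartesian D (subsquare D T' k)"
  "subsquare D T k \<in> \<O> (grid square)" "subsquare D T' k \<in> \<O> (grid square)"
  "p \<in> square \<Longrightarrow> vala (grid square) (gcode p) (resa (sq k) \<theta>) = vala (grid rect) (gcode (fst p, k (snd p))) \<theta>"
  if k: "k 0 \<le> k (Suc 0)" "k (Suc 0) \<le> 2" for k p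
 proof -
  show sq: "sq k \<in> Mor (grid square) (grid rect)" unfolding sq_def by (rule subsquare_map[OF k])
  show "subsquare D T k = res (sq k) T" "subsquare D T' k = res (sq k) T'" by (simp_all add: subsquare_def sq_def)
  thus "resa (sq k) \<theta> \<in> \<H> (grid square) (subsquare D T k) (subsquare D T' k)" using resa_hom[OF sq \<theta>] by simp
  show "cocartesian D (subsquare D T k)" "cocartesian D (subsquare D T' k)"
   using t t' subsquare_cocartesian[OF _ _ k] by blast+
  show "subsquare D T k \<in> \<O> (grid square)" "subsquare D T' k \<in> \<O> (grid square)"
   using t t' subsquare_obj(1)[OF _ k] by blast+
  show "vala (grid square) (gcode p) (resa (sq k) \<theta>) = vala (grid rect) (gcode (fst p, k (snd p))) \<theta>" if "p \<in> square"
   using vala_resa[OF sq _ \<theta>, of "gcode p"] that by (simp add: sq_def case_prod_unfold)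
 qed
 have zi: "is_iso \<E> (vala (grid rect) (gcode p) \<theta>)" if p: "p = (0, 2) \<or> p = (Suc 0, 0)" for p
 proof -
  have "gcode p \<in> Obj (grid rect)" using p by auto
  from E.iso_zero[OF _ _ vala_hom[OF thin_grid this \<theta>]] show ?thesis using t t' p by blast
 qed
 have o: "2 * 0 \<le> 2 * Suc 0" "2 * Suc 0 \<le> (2 :: nat)" "0 + 1 \<le> Suc 0 + (1 :: nat)" "Suc 0 + 1 \<le> (2 :: nat)" by simp_all
 note A = sub[of "\<lambda>c. 2 * c", OF o(1,2)] and B = sub[of "\<lambda>c. c + 1", OF o(3,4)]
 have "\<I> (grid ul_corner) (resa (grid_map ul_corner square id) (resa (sq (\<lambda>c. 2 * c)) \<theta>))"
 proof (rule iso_pointwise[OF thin_grid resa_hom[OF ul A(4)]])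
  fix x :: 'a assume x: "x \<in> Obj (grid ul_corner)"
  then obtain p where p: "x = gcode p" "p \<in> ul_corner" by auto
  hence "p = (0, 0) \<or> p = (0, Suc 0) \<or> p = (Suc 0, 0)" by (cases p) auto
  thus "is_iso \<E> (vala (grid ul_corner) x (resa (grid_map ul_corner square id) (resa (sq (\<lambda>c. 2 * c)) \<theta>)))"
   using vala_resa[OF ul x A(4)] A(9)[of p] i(1) zi p by (auto simp: numeral_2_eq_2[symmetric])
 qed
 from lext_iso[OF ul _ _ A(4) this] have "\<I> (grid square) (resa (sq (\<lambda>c. 2 * c)) \<theta>)"
  using cocartesian_iff[OF A(7)] cocartesian_iff[OF A(8)] A(5,6) by simp
 from resa_iso[OF Mor_pt[OF thin_grid] A(4) this, of "gcode (Suc 0, Suc 0)"]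
 have i12: "is_iso \<E> (vala (grid rect) (gcode (Suc 0, 2)) \<theta>)"
  using A(9)[of "(Suc 0, Suc 0)"] by (simp add: numeral_2_eq_2)
 have "\<I> (grid lr_corner) (resa (grid_map lr_corner square id) (resa (sq (\<lambda>c. c + 1)) \<theta>))"
 proof (rule iso_pointwise[OF thin_grid resa_hom[OF lr B(4)]])
  fix x :: 'a assume x: "x \<in> Obj (grid lr_corner)"
  then obtain p where p: "x = gcode p" "p \<in> lr_corner" by auto
  hence "p = (0, Suc 0) \<or> p = (Suc 0, 0) \<or> p = (Suc 0, Suc 0)" by (cases p) auto
  thus "is_iso \<E> (vala (grid lr_corner) x (resa (grid_map lr_corner square id) (resa (sq (\<lambda>c. c + 1)) \<theta>)))"
   using vala_resa[OF lr x B(4)] B(9)[of p] i(2) i12 zi p by (auto simp: numeral_2_eq_2)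
 qed
 from rext_iso[OF lr _ _ B(4) this] have "\<I> (grid square) (resa (sq (\<lambda>c. c + 1)) \<theta>)"
  using cartesian_iff[OF B(7)] cartesian_iff[OF B(8)] der7[OF B(7)] der7[OF B(8)] B(5,6) by simp
 from resa_iso[OF Mor_pt[OF thin_grid] B(4) this, of "gcode (0, 0)"] show ?thesis using B(9)[of "(0, 0)"] by simp
qed

end

context pointed_derivator
begin

abbreviation "vx T p \<equiv> val (grid rect) (gcode p) T"
abbreviation "sx T p q \<equiv> step (grid rect) (gcode p) (gcode q) T"

lemma triangle_on_arrow:
 assumes d: "d \<in> hom \<E> P P'"
 obtains T a b where "triangle T" "a \<in> hom \<E> (vx T (0, 0)) P" "is_iso \<E> a"
  "b \<in> hom \<E> (vx T (0, Suc 0)) P'" "is_iso \<E> b"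
  "b ** sx T (0, 0) (0, Suc 0) = d ** a"
proof -
 obtain F x y where F: "F \<in> \<O> (ar e_cat)" "x \<in> hom \<E> (res (s0 e_cat) F) P" "is_iso \<E> x"
  "y \<in> hom \<E> (res (s1 e_cat) F) P'" "is_iso \<E> y" "y ** bd e_cat F = d ** x"
  using der5_lift[OF thin_e d] by blast
 obtain T \<alpha> where T: "triangle T" and \<alpha>: "\<alpha> \<in> \<H> (ar e_cat) (res (line rect (0, 0) (0, Suc 0)) T) F" "\<I> (ar e_cat) \<alpha>"
  using triangle_ex[OF F(1)] .
 have TO: "T \<in> \<O> (grid rect)" using T by (simp add: triangle_def)
 note s = Mor_s[OF thin_e] and lv = line_val[of "(0, 0)" rect "(0, Suc 0)", OF _ _ _ _ TO, simplified]
 have \<alpha>0: "resa (s0 e_cat) \<alpha> \<in> hom \<E> (vx T (0, 0)) (res (s0 e_cat) F)" "is_iso \<E> (resa (s0 e_cat) \<alpha>)"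
  using resa_hom[OF s(1) \<alpha>(1)] lv(1) resa_iso[OF s(1) \<alpha>] by simp_all
 have \<alpha>1: "resa (s1 e_cat) \<alpha> \<in> hom \<E> (vx T (0, Suc 0)) (res (s1 e_cat) F)" "is_iso \<E> (resa (s1 e_cat) \<alpha>)"
  using resa_hom[OF s(2) \<alpha>(1)] lv(2) resa_iso[OF s(2) \<alpha>] by simp_all
 have st: "sx T (0, 0) (0, Suc 0) \<in> hom \<E> (vx T (0, 0)) (vx T (0, Suc 0))" by (rule step_hom[OF thin_grid _ TO]) simp
 have "bd e_cat F ** resa (s0 e_cat) \<alpha> = resa (s1 e_cat) \<alpha> ** sx T (0, 0) (0, Suc 0)"
  using bd_nat[OF thin_e \<alpha>(1)] lv(3) by simp
 hence "(y ** resa (s1 e_cat) \<alpha>) ** sx T (0, 0) (0, Suc 0) = d ** (x ** resa (s0 e_cat) \<alpha>)"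
  using E.comp_assoc[OF st \<alpha>1(1) F(4)] E.comp_assoc[OF \<alpha>0(1) bd_hom[OF thin_e F(1)] F(4)] F(6) E.comp_assoc[OF \<alpha>0(1) F(2) d] by simp
 thus thesis
  using that[OF T E.comp_hom[OF \<alpha>0(1) F(2)] E.iso_comp[OF \<alpha>0(1) F(2) \<alpha>0(2) F(3)] E.comp_hom[OF \<alpha>1(1) F(4)] E.iso_comp[OF \<alpha>1(1) F(4) \<alpha>1(2) F(5)]] by simp
qed

text \<open>The commutative square on the first edges is made coherent by \<open>der5_full\<close>,
  and \<open>triangle_map\<close> extends the result.\<close>

lemma triangle_map_ex:
 assumes T: "triangle T" and T': "triangle T'" and a: "a \<in> hom \<E> (vx T (0, 0)) (vx T' (0, 0))"
  and b: "b \<in> hom \<E> (vx T (0, Suc 0)) (vx T' (0, Suc 0))"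
  and eq: "b ** sx T (0, 0) (0, Suc 0) = sx T' (0, 0) (0, Suc 0) ** a"
 obtains \<theta> where "\<theta> \<in> \<H> (grid rect) T T'" "vala (grid rect) (gcode (0, 0)) \<theta> = a" "vala (grid rect) (gcode (0, Suc 0)) \<theta> = b"
proof -
 have TO: "T \<in> \<O> (grid rect)" "T' \<in> \<O> (grid rect)" using T T' by (simp_all add: triangle_def)
 let ?l = "line rect (0, 0) (0, Suc 0) :: 'a sftor"
 have l: "?l \<in> Mor (ar e_cat) (grid rect)" by (rule line) auto
 have ls: "?l \<circ>\<^sub>F s0 e_cat = pt (grid rect) (gcode (0, 0))" "?l \<circ>\<^sub>F s1 e_cat = pt (grid rect) (gcode (0, Suc 0))"
  by (rule line_s; simp)+
 note lv = line_val[of "(0, 0)" rect "(0, Suc 0)", OF _ _ _ _ TO(1), simplified] line_val[of "(0, 0)" rect "(0, Suc 0)", OF _ _ _ _ TO(2), simplified]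
 obtain f where f: "f \<in> \<H> (ar e_cat) (res ?l T) (res ?l T')" "resa (s0 e_cat) f = a" "resa (s1 e_cat) f = b"
  by (rule der5_full[OF thin_e res_obj[OF l TO(1)] res_obj[OF l TO(2)], of a b]) (use a b eq lv in simp_all)
 obtain \<theta> where \<theta>: "\<theta> \<in> \<H> (grid rect) T T'" "resa ?l \<theta> = f" using triangle_map[OF T T' f(1)] .
 show thesis
  using that[OF \<theta>(1)] resa_resa[OF Mor_s(1)[OF thin_e] l \<theta>(1)] resa_resa[OF Mor_s(2)[OF thin_e] l \<theta>(1)] f(2,3) \<theta>(2) by (simp only: ls)
qed

lemma triangle_cofiber_step:
 assumes T: "triangle T"
 shows "cofiber e_cat (res (line rect (0, 0) (0, Suc 0)) T) (res (line rect (Suc 0, 0) (Suc 0, Suc 0)) T)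
  (tr (line rect (0, 0) (0, Suc 0)) (line rect (Suc 0, 0) (Suc 0, Suc 0)) T)"
  "resa (s1 e_cat) (tr (line rect (0, 0) (0, Suc 0)) (line rect (Suc 0, 0) (Suc 0, Suc 0)) T) = sx T (0, Suc 0) (Suc 0, Suc 0)"
  "sx T (0, 0) (0, Suc 0) \<in> hom \<E> (vx T (0, 0)) (vx T (0, Suc 0))"
  "sx T (0, Suc 0) (Suc 0, Suc 0) \<in> hom \<E> (vx T (0, Suc 0)) (vx T (Suc 0, Suc 0))"
  "is_zero_arrow \<E> (sx T (0, Suc 0) (Suc 0, Suc 0) ** sx T (0, 0) (0, Suc 0))"
proof -
 have TO: "T \<in> \<O> (grid rect)" using T by (simp add: triangle_def)
 show c: "cofiber e_cat (res (line rect (0, 0) (0, Suc 0)) T) (res (line rect (Suc 0, 0) (Suc 0, Suc 0)) T)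
  (tr (line rect (0, 0) (0, Suc 0)) (line rect (Suc 0, 0) (Suc 0, Suc 0)) T)"
  using triangle_cofiber[OF TO] subsquare_cocartesian[OF TO, of "\<lambda>c. c"] T by (simp add: triangle_def)
 have l: "line rect (0, 0) (0, Suc 0) \<in> Mor (ar e_cat) (grid rect)" by (rule line) auto
 have ls: "line rect (0, 0) (0, Suc 0) \<circ>\<^sub>F s1 e_cat = pt (grid rect) (gcode (0, Suc 0))"
  "line rect (Suc 0, 0) (Suc 0, Suc 0) \<circ>\<^sub>F s1 e_cat = pt (grid rect) (gcode (Suc 0, Suc 0))"
  by (rule line_s; simp)+
 have fl: "fle (line rect (0, 0) (0, Suc 0)) (line rect (Suc 0, 0) (Suc 0, Suc 0))" by (rule fle_line) auto
 show r: "resa (s1 e_cat) (tr (line rect (0, 0) (0, Suc 0)) (line rect (Suc 0, 0) (Suc 0, Suc 0)) T) = sx T (0, Suc 0) (Suc 0, Suc 0)"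
  using resa_tr[OF fl l Mor_s(2)[OF thin_e] TO] by (simp only: ls)
 show "sx T (0, 0) (0, Suc 0) \<in> hom \<E> (vx T (0, 0)) (vx T (0, Suc 0))"
  "sx T (0, Suc 0) (Suc 0, Suc 0) \<in> hom \<E> (vx T (0, Suc 0)) (vx T (Suc 0, Suc 0))"
  by (rule step_hom[OF thin_grid _ TO]; simp)+
 show "is_zero_arrow \<E> (sx T (0, Suc 0) (Suc 0, Suc 0) ** sx T (0, 0) (0, Suc 0))"
  using cofiber_bd_zero[OF c] r line_val(3)[of "(0, 0)" rect "(0, Suc 0)", OF _ _ _ _ TO] by simp
qed

end

section \<open>Additivity of D(e)\<close>

context triangulated_derivator
begin

text \<open>Let \<open>W\<close> be the arrow from \<open>y\<close> to zero. Pulled back to the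
  square along the row and the column coordinate, it gives two degenerate, hence cocartesian,
  squares. Their coproduct has two copies of \<open>y\<close> at \<open>(0, 0)\<close>, one at each
  middle vertex and zero at \<open>(1, 1)\<close>. It is cocartesian, so cartesian by
  \<open>der7\<close>, and the coproduct at \<open>(0, 0)\<close> is also a product.\<close>

lemma square_biproduct_ex:
 assumes y: "y \<in> Obj \<E>"
 shows "\<exists>b inn prj. is_square_biproduct \<E> y b inn prj"
proof -
 let ?E = "ar e_cat :: 'a scat" and ?Q = "grid square :: 'a scat" and ?U = "grid ul_corner :: 'a scat"
 let ?i = "grid_map ul_corner square id :: 'a sftor"
 let ?v = "\<lambda>p. val ?Q (gcode p)" and ?va = "\<lambda>p. vala ?Q (gcode p)"
 have tE: "thin ?E" by simp
 define W where "W = sta (s0 e_cat) y"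
 \<comment> \<open>Restricting the extension returns \<open>y\<close> only up to isomorphism;
   \<open>e'\<close> and the counit are therefore built into \<open>inn'\<close> and
   \<open>prj\<close>.\<close>
 define X where "X = res (s0 e_cat) W"
 note s = Mor_s[OF thin_e] and W = sta_runiv[OF Mor_s(1)[OF thin_e] y, folded W_def, folded X_def]
 have e: "is_iso \<E> (eps (s0 e_cat) y)" using eps_iso[OF embedding_s(1)[OF thin_e] y] .
 obtain e' where e': "e' \<in> hom \<E> y X" "eps (s0 e_cat) y ** e' = Ident \<E> y" "is_iso \<E> e'"
  using E.isoE[OF e W(3)] by metis
 have X: "X \<in> Obj \<E>" "X = val ?E (cpair (cnat 0) (cnat 0)) W"
  using res_obj[OF s(1) W(2)] by (simp_all add: X_def s_e)
 have W1: "is_zero \<E> (val ?E (cpair (cnat 0) (cnat (Suc 0))) W)"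
  unfolding W_def by (rule sta_val_zero[OF s(1) y]) auto
 define c :: "bool \<Rightarrow> 'a sftor" where "c b = collapse square (if b then fst else snd)" for b
 define S where "S b = res (c b) W" for b
 have c: "c b \<in> Mor ?Q ?E" "p \<in> square \<Longrightarrow> FO (c b) (gcode p) = cpair (cnat 0) (cnat (if b then fst p else snd p))" for b p
  unfolding c_def by (cases b; simp; rule collapse; auto)+
 have S: "S b \<in> \<O> ?Q" "p \<in> square \<Longrightarrow> ?v p (S b) = val ?E (cpair (cnat 0) (cnat (if b then fst p else snd p))) W" for b p
  unfolding S_def using res_obj[OF c(1) W(2)] val_res[OF c(1) _ W(2), of "gcode p"] c(2) by auto
 \<comment> \<open>Each square is constant along one coordinate, and the section of the other
   coordinate runs inside the upper left corner, as \<open>lext_degenerate\<close> requires.\<close>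
 have Sl: "lext ?U ?i (S b)" for b
 proof -
  define q where "q = (if b then (Suc 0, 0) else (0, Suc 0) :: nat \<times> nat)"
  have q: "q \<in> ul_corner" "q \<in> square" by (auto simp: q_def)
  let ?l = "line ul_corner (0, 0) q :: 'a sftor" and ?m = "line square (0, 0) q :: 'a sftor"
  have ul: "ul_corner \<subseteq> square" by auto
  note i = embedding_incl[OF ul, where 'a = 'a]
  have im: "?i \<in> Mor ?U ?Q" using i by (simp add: embedding_def)
  have l: "?l \<in> Mor ?E ?U" "?i \<circ>\<^sub>F ?l = ?m" using line(1)[of "(0, 0)" ul_corner q] grid_map_line[of "(0, 0)" ul_corner q square id] q im by auto
  have m: "?m \<in> Mor ?E ?Q" "FO ?m (cpair (cnat 0) (cnat 0)) = gcode (0, 0)" "FO ?m (cpair (cnat 0) (cnat (Suc 0))) = gcode q"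
   by (rule line; use q in simp)+
  show ?thesis unfolding S_def
  proof (rule lext_degenerate[OF i c(1) l(1) _ _ W(2)], unfold l(2))
   show "c b \<circ>\<^sub>F ?m = id_ftor ?E"
   proof (rule Mor_eqI[OF Mor_comp[OF m(1) c(1)] Mor_id[OF tE]])
    have "FO (c b) (gcode q) = cpair (cnat 0) (cnat (Suc 0))" "FO (c b) (gcode (0, 0)) = cpair (cnat 0) (cnat 0)"
     using c(2)[OF q(2), of b] c(2)[of "(0, 0)" b] by (auto simp: q_def)
    thus "FO (c b \<circ>\<^sub>F ?m) x = FO (id_ftor ?E) x" if "x \<in> Obj ?E" for x
     using that m by (auto simp: FO_comp[OF m(1)])
   qed
   show "fle (?m \<circ>\<^sub>F c b) (id_ftor ?Q)"
    by (rule Mor_fleI[OF Mor_comp[OF c(1) m(1)] Mor_id[OF thin_grid]])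
     (use m c(2) q in \<open>auto simp: FO_comp[OF c(1)] q_def split: if_splits\<close>)
  qed
 qed
 obtain R inn where R: "is_coproduct (\<D> ?Q) UNIV (\<lambda>b. if b then S True else S False) R inn"
  using coproduct_bool_ex[OF thin_grid S(1) S(1)] .
 have "(\<lambda>b. if b then S True else S False) = S" by (auto simp: fun_eq_iff)
 with R have R: "is_coproduct (\<D> ?Q) UNIV S R inn" by simp
 interpret Q: category "\<D> ?Q" using cat[OF thin_grid] .
 have inn: "R \<in> \<O> ?Q" "inn b \<in> \<H> ?Q (S b) R" for b using Q.coproductD[OF R] by simp_all
 have "lext ?U ?i R" by (rule lext_coproduct[OF _ R Sl]) (rule Mor_grid_map; auto)
 hence ca: "cartesian D R" using cocartesian_iff[OF inn(1)] der7[OF inn(1)] by simp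
 have cop: "is_coproduct \<E> UNIV (\<lambda>b. ?v p (S b)) (?v p R) (\<lambda>b. ?va p (inn b))" if "p \<in> square" for p
  by (rule res_coproduct[OF Mor_pt[OF thin_grid] R]) (use that in simp)
 have z11: "is_zero \<E> (?v (Suc 0, Suc 0) R)"
  by (rule zero_if_initial[OF E.coproduct_zeros[OF cop]]) (use S(2)[of "(Suc 0, Suc 0)"] W1 in auto)
 have v: "?va p (inn b) \<in> hom \<E> (?v p (S b)) (?v p R)" if "p \<in> square" for p b
  using vala_hom[OF thin_grid _ inn(2)] that by simp
 \<comment> \<open>The middle vertex at which the summand \<open>b\<close> survives while the other
   vanishes; the projections are the edges to these two vertices.\<close>
 define q where "q b = (if b then (0, Suc 0) else (Suc 0, 0) :: nat \<times> nat)" for b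
 have q: "q b \<in> square" "q b \<noteq> q (\<not> b)" "?v (q b) (S b) = X" "is_zero \<E> (?v (q (\<not> b)) (S b))"
  "?v (0, 0) (S b) = X" "le ?Q (gcode (0, 0)) (gcode (q b))" for b
  using S(2)[of "(0, Suc 0)"] S(2)[of "(Suc 0, 0)"] S(2)[of "(0, 0)"] W1 X(2) by (auto simp: q_def)
 have J: "is_iso \<E> (?va (q b) (inn b))" for b
 proof -
  have "is_coproduct \<E> {b} (\<lambda>a. ?v (q b) (S a)) (?v (q b) R) (\<lambda>a. ?va (q b) (inn a))"
   by (rule E.coproduct_drop_zeros[OF cop[OF q(1)]]) (use q(4)[of "\<not> b"] in \<open>auto simp: doubleton_eq_iff\<close>)
  thus ?thesis by (rule E.coproduct_single)
 qed
 have vq: "?va (q b) (inn b) \<in> hom \<E> X (?v (q b) R)" for b using v[OF q(1)[of b], of b] q(3) by simp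
 have "\<exists>j. j \<in> hom \<E> (?v (q b) R) X \<and> j ** ?va (q b) (inn b) = Ident \<E> X \<and> is_iso \<E> j" for b
  using E.isoE[OF J vq] by metis
 then obtain j where j: "\<And>b. j b \<in> hom \<E> (?v (q b) R) X"
  "\<And>b. j b ** ?va (q b) (inn b) = Ident \<E> X" "\<And>b. is_iso \<E> (j b)" by metis
 let ?e = "eps (s0 e_cat) y"
 let ?st = "\<lambda>b. step ?Q (gcode (0, 0)) (gcode (q b)) R"
 define prj where "prj b = (?e ** j b) ** ?st b" for b
 define inn' where "inn' b = ?va (0, 0) (inn b) ** e'" for b
 have st: "?st b \<in> hom \<E> (?v (0, 0) R) (?v (q b) R)" for b
  using step_hom[OF thin_grid q(6) inn(1)] .
 have ej: "?e ** j b \<in> hom \<E> (?v (q b) R) y" for b using E.comp_hom[OF j(1) W(3)] .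
 have "(if b then ?v (0, Suc 0) R else ?v (Suc 0, 0) R) = ?v (q b) R"
  "(if b then step ?Q (gcode (0, 0)) (gcode (0, Suc 0)) R else step ?Q (gcode (0, 0)) (gcode (Suc 0, 0)) R) = ?st b" for b
  by (simp_all add: q_def)
 with cartesian_product[OF inn(1) ca z11]
 have pr: "is_product \<E> UNIV (\<lambda>b. ?v (q b) R) (?v (0, 0) R) ?st" by simp
 have pr': "is_product \<E> UNIV (\<lambda>_. y) (?v (0, 0) R) prj"
  unfolding prj_def by (rule E.product_postcomp[OF pr]) (use ej E.iso_comp[OF j(1) W(3) j(3) e] in simp_all)
 have v0: "?va (0, 0) (inn b) \<in> hom \<E> X (?v (0, 0) R)" for b using v[of "(0, 0)" b] q(5) by simp
 have co: "is_coproduct \<E> UNIV (\<lambda>_. y) (?v (0, 0) R) inn'"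
  unfolding inn'_def by (rule E.coproduct_precomp[OF cop]) (use q(5) e' in simp_all)
 have pi: "prj a ** inn' b = (?e ** j a) **
   ((?va (q a) (inn b) ** step ?Q (gcode (0, 0)) (gcode (q a)) (S b)) ** e')" for a b
  unfolding prj_def inn'_def using E.comp_assoc[OF E.comp_hom[OF e'(1) v0] st ej] E.comp_assoc[OF e'(1) v0 st]
   step_nat[OF thin_grid q(6) inn(2)] by simp
 have stS: "step ?Q (gcode (0, 0)) (gcode (q a)) (S b) \<in> hom \<E> X (?v (q a) (S b))" for a b
  using step_hom[OF thin_grid q(6) S(1)] q(5) by simp
 have "step ?Q (gcode (0, 0)) (gcode (q b)) (S b) = Ident \<E> X" for b
 proof -
  have "step ?Q (gcode (0, 0)) (gcode (q b)) (S b) = step ?E (cpair (cnat 0) (cnat 0)) (cpair (cnat 0) (cnat 0)) W"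
   unfolding S_def step_res[OF c(1) q(6) W(2)] by (cases b) (simp_all add: c(2) q_def)
  thus ?thesis using step_id[OF tE _ W(2)] X(2) by simp
 qed
 hence "prj b ** inn' b = Ident \<E> y" for b
  unfolding pi using E.ident_right[OF vq] E.comp_assoc[OF E.comp_hom[OF e'(1) vq] j(1) W(3)] E.comp_assoc[OF e'(1) vq j(1)] j(2) E.ident_left[OF e'(1)] e'(2) by simp
 moreover have "is_zero_arrow \<E> (prj (\<not> b) ** inn' b)" for b
 proof -
  let ?s = "step ?Q (gcode (0, 0)) (gcode (q (\<not> b))) (S b)" and ?v = "?va (q (\<not> b)) (inn b)"
  note v' = v[OF q(1)[of "\<not> b"], of b]
  have "is_zero_arrow \<E> ?s" using E.zero_arrow_via_zero[OF stS] q(4) by blast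
  hence "is_zero_arrow \<E> (?v ** ?s)" using E.zero_arrow_comp[OF stS v'] by blast
  hence "is_zero_arrow \<E> ((?v ** ?s) ** e')" using E.zero_arrow_comp[OF e'(1) E.comp_hom[OF stS v']] by blast
  thus ?thesis unfolding pi using E.zero_arrow_comp[OF E.comp_hom[OF e'(1) E.comp_hom[OF stS v']] ej] by blast
 qed
 ultimately show ?thesis using co pr' unfolding is_square_biproduct_def by blast
qed

sublocale E: semiadditive "\<E>"
 by unfold_locales (rule square_biproduct_ex)

text \<open>The shear map of \<open>y \<oplus> y\<close> is the identity on the first summand and on the quotient by it, hence
 invertible, since a morphism of triangles which is invertible at two vertices is so at the third.\<close>

lemma negative_ex:
 assumes y: "y \<in> Obj \<E>"
 shows "\<exists>n e. n \<in> hom \<E> y y \<and> is_sum \<E> n (Ident \<E> y) e \<and> is_zero_arrow \<E> e"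
proof -
 let ?c = "\<lambda>g f. g ** f"
 obtain b inn prj where b: "is_square_biproduct \<E> y b inn prj" using square_biproduct_ex[OF y] by blast
 obtain q where q: "q \<in> hom \<E> b y" "\<And>s. ?c q (inn s) = Ident \<E> y" using E.codiagonal_ex[OF b] by blast
 note B = E.biproductD[OF b]
 \<comment> \<open>The shear, which sends a pair \<open>(x, x')\<close> to
   \<open>(x + x', x')\<close>.\<close>
 obtain \<phi> where \<phi>: "\<phi> \<in> hom \<E> b b" "?c (prj True) \<phi> = q" "?c (prj False) \<phi> = prj False"
  using E.pair_ex[OF b q(1) B(7)] .
 have \<phi>i: "?c \<phi> (inn True) = inn True"
 proof (rule E.product_eqI[OF B(2) E.comp_hom[OF B(6) \<phi>(1)] B(6)])
  fix s
  show "?c (prj s) (?c \<phi> (inn True)) = ?c (prj s) (inn True)"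
   using E.comp_assoc[OF B(6)[of True] \<phi>(1) B(7)[of s]] \<phi>(2,3) q(2) B(3)[of True] by (cases s) simp_all
 qed
 obtain T a \<beta> where T: "triangle T" and a: "a \<in> hom \<E> (vx T (0, 0)) y" "is_iso \<E> a"
  and \<beta>: "\<beta> \<in> hom \<E> (vx T (0, Suc 0)) b" "is_iso \<E> \<beta>" and a\<beta>: "?c \<beta> (sx T (0, 0) (0, Suc 0)) = ?c (inn True) a"
  using triangle_on_arrow[OF B(6)] .
 note co = triangle_cofiber_step[OF T]
 have TO: "T \<in> \<O> (grid rect)" using T by (simp add: triangle_def)
 let ?s = "sx T (0, 0) (0, Suc 0)" and ?r = "sx T (0, Suc 0) (Suc 0, Suc 0)"
 obtain \<beta>' where \<beta>': "\<beta>' \<in> hom \<E> b (vx T (0, Suc 0))" "?c \<beta>' \<beta> = Ident \<E> (vx T (0, Suc 0))"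
  "?c \<beta> \<beta>' = Ident \<E> b" "is_iso \<E> \<beta>'" using E.isoE[OF \<beta>(2,1)] .
 have s: "?c \<beta>' (?c (inn True) a) = ?s"
  using a\<beta> E.comp_assoc[OF co(3) \<beta>(1) \<beta>'(1)] \<beta>'(2) E.ident_left[OF co(3)] by simp
 \<comment> \<open>The second inclusion is a complement of the first edge, so the cofiber in the
   triangle on \<open>inn True\<close> is \<open>y\<close> up to isomorphism.\<close>
 define \<sigma> where "\<sigma> = ?c \<beta>' (inn False)"
 have \<sigma>: "\<sigma> \<in> hom \<E> y (vx T (0, Suc 0))" unfolding \<sigma>_def using E.comp_hom[OF B(6) \<beta>'(1)] .
 have "is_coproduct \<E> UNIV (\<lambda>i. if i then vx T (0, 0) else y) (vx T (0, Suc 0))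
   (\<lambda>i. ?c \<beta>' (?c (inn i) (if i then a else Ident \<E> y)))"
  by (rule E.coproduct_postcomp[OF E.coproduct_precomp[OF B(1)] \<beta>'(1,4)]) (use a E.ident_hom[OF y] E.iso_ident[OF y] in simp_all)
 moreover have "?c \<beta>' (?c (inn i) (if i then a else Ident \<E> y)) = (if i then ?s else \<sigma>)" for i
  using s E.ident_right[OF B(6)] by (simp add: \<sigma>_def)
 ultimately have cop: "is_coproduct \<E> UNIV (\<lambda>i. if i then vx T (0, 0) else y) (vx T (0, Suc 0)) (\<lambda>i. if i then ?s else \<sigma>)"
  by simp
 have r\<sigma>: "is_iso \<E> (?c ?r \<sigma>)"
 proof -
  have m: "(0, 0) \<in> rect" "(0, Suc 0) \<in> rect" "fst (0 :: nat, 0 :: nat) \<le> fst (0 :: nat, Suc 0)" "snd (0 :: nat, 0 :: nat) \<le> snd (0 :: nat, Suc 0)"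
   by simp_all
  show ?thesis by (rule cofiber_split[OF co(1), of \<sigma> y, unfolded co(2) line_val[OF m TO], OF \<sigma> cop])
 qed
 have \<beta>\<phi>: "?c \<beta>' (?c \<phi> \<beta>) \<in> hom \<E> (vx T (0, Suc 0)) (vx T (0, Suc 0))" using E.comp_hom[OF E.comp_hom[OF \<beta>(1) \<phi>(1)] \<beta>'(1)] .
 have T00: "vx T (0, 0) \<in> Obj \<E>" using E.hom_objs[OF a(1)] by simp
 have "?c (?c \<beta>' (?c \<phi> \<beta>)) ?s = ?c ?s (Ident \<E> (vx T (0, 0)))"
  using E.comp_assoc[OF co(3) E.comp_hom[OF \<beta>(1) \<phi>(1)] \<beta>'(1)] E.comp_assoc[OF co(3) \<beta>(1) \<phi>(1)] a\<beta>
   E.comp_assoc[OF a(1) B(6)[of True] \<phi>(1)] \<phi>i s E.ident_right[OF co(3)] by simp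
 then obtain \<theta> where \<theta>: "\<theta> \<in> \<H> (grid rect) T T" "vala (grid rect) (gcode (0, 0)) \<theta> = Ident \<E> (vx T (0, 0))"
  "vala (grid rect) (gcode (0, Suc 0)) \<theta> = ?c \<beta>' (?c \<phi> \<beta>)"
  using triangle_map_ex[OF T T E.ident_hom[OF T00] \<beta>\<phi>] by blast
 have \<theta>1: "vala (grid rect) (gcode (Suc 0, Suc 0)) \<theta> \<in> hom \<E> (vx T (Suc 0, Suc 0)) (vx T (Suc 0, Suc 0))"
  by (rule vala_hom[OF thin_grid _ \<theta>(1)]) simp
 \<comment> \<open>The quotient by the first summand; it vanishes there, hence factors through the
   second projection.\<close>
 define u where "u = ?c ?r \<beta>'"
 have u: "u \<in> hom \<E> b (vx T (Suc 0, Suc 0))" unfolding u_def using E.comp_hom[OF \<beta>'(1) co(4)] .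
 have "is_zero_arrow \<E> (?c u (inn True))"
 proof -
  obtain a' where a': "a' \<in> hom \<E> y (vx T (0, 0))" "?c a a' = Ident \<E> y" using E.isoE[OF a(2,1)] by metis
  have "?c u (inn True) = ?c (?c ?r ?s) a'"
   unfolding u_def using E.comp_assoc[OF a'(1) co(3,4)] s E.comp_assoc[OF a'(1) E.comp_hom[OF a(1) B(6)[of True]] \<beta>'(1)]
    E.comp_assoc[OF a'(1) a(1) B(6)] a'(2) E.ident_right[OF B(6)] E.comp_assoc[OF B(6) \<beta>'(1) co(4)] by simp
  thus ?thesis using E.zero_arrow_comp[OF a'(1) E.comp_hom[OF co(3,4)]] co(5) by simp
 qed
 hence up: "u = ?c (?c u (inn False)) (prj False)"
  using E.biproduct_prj_eqI[OF b u, of False] by simp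
 have uF: "?c u (inn False) = ?c ?r \<sigma>" unfolding u_def \<sigma>_def using E.comp_assoc[OF B(6) \<beta>'(1) co(4)] .
 note r\<sigma>h = E.comp_hom[OF \<sigma> co(4)]
 \<comment> \<open>The shear changes the second inclusion only by the first one, so it induces the
   identity on the quotient.\<close>
 have "?c (vala (grid rect) (gcode (Suc 0, Suc 0)) \<theta>) (?c ?r \<sigma>) = ?c ?r \<sigma>"
 proof -
  have "?c (vala (grid rect) (gcode (Suc 0, Suc 0)) \<theta>) ?r = ?c ?r (?c \<beta>' (?c \<phi> \<beta>))"
   using step_nat[OF thin_grid _ \<theta>(1), of "gcode (0, Suc 0)" "gcode (Suc 0, Suc 0)"] \<theta>(3) by simp
  also have "\<dots> = ?c u (?c \<phi> \<beta>)" unfolding u_def using E.comp_assoc[OF E.comp_hom[OF \<beta>(1) \<phi>(1)] \<beta>'(1) co(4)] by simp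
  finally have "?c (vala (grid rect) (gcode (Suc 0, Suc 0)) \<theta>) (?c ?r \<sigma>) = ?c (?c u (?c \<phi> \<beta>)) \<sigma>"
   using E.comp_assoc[OF \<sigma> co(4) \<theta>1] by simp
  also have "\<dots> = ?c u (?c \<phi> (?c \<beta> \<sigma>))"
   using E.comp_assoc[OF \<sigma> E.comp_hom[OF \<beta>(1) \<phi>(1)] u] E.comp_assoc[OF \<sigma> \<beta>(1) \<phi>(1)] by simp
  also have "?c \<beta> \<sigma> = inn False"
   unfolding \<sigma>_def using E.comp_assoc[OF B(6) \<beta>'(1) \<beta>(1)] \<beta>'(3) E.ident_left[OF B(6)] by simp
  also have "?c u (?c \<phi> (inn False)) = ?c (?c u (inn False)) (?c (prj False) (?c \<phi> (inn False)))"
   by (subst up) (rule E.comp_assoc[OF E.comp_hom[OF B(6) \<phi>(1)] B(7) E.comp_hom[OF B(6) u]])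
  also have "?c (prj False) (?c \<phi> (inn False)) = Ident \<E> y"
   using E.comp_assoc[OF B(6)[of False] \<phi>(1) B(7)[of False]] \<phi>(3) B(3)[of False] by simp
  finally show ?thesis using uF E.ident_right[OF r\<sigma>h] by simp
 qed
 hence "is_iso \<E> (vala (grid rect) (gcode (Suc 0, Suc 0)) \<theta>)"
  using E.iso_cancel_right[OF r\<sigma>h \<theta>1] r\<sigma> by simp
 from triangle_iso[OF T T \<theta>(1) _ this] have "is_iso \<E> (?c \<beta>' (?c \<phi> \<beta>))"
  using \<theta>(2,3) E.iso_ident[OF T00] by simp
 hence "is_iso \<E> \<phi>"
  using E.iso_cancel_left[OF E.comp_hom[OF \<beta>(1) \<phi>(1)] \<beta>'(1) _ \<beta>'(4)] E.iso_cancel_right[OF \<beta>(1) \<phi>(1) _ \<beta>(2)] by blast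
 then obtain \<psi> where \<psi>: "\<psi> \<in> hom \<E> b b" "?c \<phi> \<psi> = Ident \<E> b" using E.isoE[OF _ \<phi>(1)] by metis
 \<comment> \<open>The preimage of \<open>(0, 1)\<close> under the shear. Its second coordinate is
   the identity and the sum of its coordinates is zero, so its first coordinate is the desired
   negative.\<close>
 let ?k = "?c \<psi> (inn False)"
 have k: "?k \<in> hom \<E> y b" using E.comp_hom[OF B(6) \<psi>(1)] .
 have \<phi>k: "?c \<phi> ?k = inn False" using E.comp_assoc[OF B(6) \<psi>(1) \<phi>(1)] \<psi>(2) E.ident_left[OF B(6)] by simp
 have "?c q ?k = ?c (prj True) (inn False)" using E.comp_assoc[OF k \<phi>(1) B(7)] \<phi>(2) \<phi>k by metis
 moreover have "?c (prj False) ?k = Ident \<E> y" using E.comp_assoc[OF k \<phi>(1) B(7)] \<phi>(3) \<phi>k B(3) by metis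
 ultimately have "is_sum \<E> (?c (prj True) ?k) (Ident \<E> y) (?c q ?k)" "is_zero_arrow \<E> (?c q ?k)"
  using E.is_sum_iff[OF b q k] B(4)[of False] by simp_all
 thus ?thesis using E.comp_hom[OF k B(7)] by blast
qed

sublocale E: additive "\<E>"
 by unfold_locales (rule negative_ex)

end

section \<open>Distinguished triangles compared with cofibers\<close>

context triangulated_derivator
begin

lemma vertex_edge:
 assumes T: "T \<in> \<O> (grid rect)" and p: "p \<in> rect"
 shows "vertex D T p = vx T p" "q \<in> rect \<Longrightarrow> fst p \<le> fst q \<Longrightarrow> snd p \<le> snd q \<Longrightarrow> edge D T p q = sx T p q"
proof -
 have d: "FO (diag D (grid rect)) T = diag_obj D (grid rect) T" using T by (simp add: diag_def)
 show "vertex D T p = vx T p" unfolding vertex_def d using p by (simp add: diag_obj_def op_cat_simps)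
 show "q \<in> rect \<Longrightarrow> fst p \<le> fst q \<Longrightarrow> snd p \<le> snd q \<Longrightarrow> edge D T p q = sx T p q"
  unfolding edge_def d using diag_obj_ftor(2)[OF thin_grid T hom_grid[OF p]] by simp
qed

lemma suspension_ftor: "is_ftor (suspension D)" "Src (suspension D) = \<E>" "Tgt (suspension D) = \<E>"
 and corner_pushout_ftor: "is_ftor (corner_pushout D)" "Src (corner_pushout D) = \<D> (grid ul_corner)" "Tgt (corner_pushout D) = \<E>"
 and corner_pushout_FO: "X \<in> \<O> (grid ul_corner) \<Longrightarrow>
  FO (corner_pushout D) X = val (grid square) (gcode (Suc 0, Suc 0)) (shr (grid_map ul_corner square id) X)"
 and suspension_FO: "Y \<in> Obj \<E> \<Longrightarrow>
  FO (suspension D) Y = FO (corner_pushout D) (sta (pt (grid ul_corner) (gcode (0, 0))) Y)"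
proof -
 have i: "grid_map ul_corner square id \<in> Mor (grid ul_corner) (grid square)" by (rule Mor_grid_map) auto
 have p: "pt (grid square) (gcode (1, 1)) \<in> Mor e_cat (grid square)" "pt (grid ul_corner) (gcode (0, 0)) \<in> Mor e_cat (grid ul_corner)"
  by (rule Mor_pt; simp)+
 note F = shriek_ftor[OF i] pull[OF p(1)] star_ftor[OF p(2)]
 show c: "is_ftor (corner_pushout D)" "Src (corner_pushout D) = \<D> (grid ul_corner)" "Tgt (corner_pushout D) = \<E>"
  unfolding corner_pushout_def using F by (auto intro!: is_ftor_comp)
 show "is_ftor (suspension D)" "Src (suspension D) = \<E>" "Tgt (suspension D) = \<E>"
  unfolding suspension_def using F c by (auto intro!: is_ftor_comp)
 show "FO (corner_pushout D) X = val (grid square) (gcode (Suc 0, Suc 0)) (shr (grid_map ul_corner square id) X)" if "X \<in> \<O> (grid ul_corner)"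
  unfolding corner_pushout_def using F that by simp
 show "FO (suspension D) Y = FO (corner_pushout D) (sta (pt (grid ul_corner) (gcode (0, 0))) Y)" if "Y \<in> Obj \<E>"
  unfolding suspension_def using F that by simp
qed

text \<open>The outer square being cocartesian makes the arrow to \<open>W\<close> in the definition
  of \<open>connecting\<close> invertible, so \<open>inv_arr\<close> is meaningful there.\<close>

lemma connecting_hom:
 assumes T: "T \<in> \<O> (grid rect)" and co: "cocartesian D (subsquare D T (\<lambda>c. 2 * c))"
 shows "connecting D T \<in> hom \<E> (vx T (Suc 0, Suc 0)) (FO (suspension D) (vx T (0, 0)))"
proof -
 let ?C = "subsquare D T (\<lambda>c. 2 * c)" and ?i = "grid_map ul_corner square id :: 'a sftor"
 let ?p = "pt (grid ul_corner) (gcode (0, 0)) :: 'a sftor" and ?r = "pt (grid square) (gcode (1, 1)) :: 'a sftor"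
 have i: "?i \<in> Mor (grid ul_corner) (grid square)" by (rule Mor_grid_map) auto
 have p: "?p \<in> Mor e_cat (grid ul_corner)" and r: "?r \<in> Mor e_cat (grid square)" by (rule Mor_pt; simp)+
 have C: "?C \<in> \<O> (grid square)" using subsquare_obj(1)[OF T, of "\<lambda>c. 2 * c"] by simp
 have C0: "val (grid square) (gcode (0, 0)) ?C = vx T (0, 0)" using subsquare_obj(2)[OF T, of "\<lambda>c. 2 * c" "(0, 0)"] by simp
 have C1: "res ?r ?C = vx T (Suc 0, 2)" using subsquare_obj(2)[OF T, of "\<lambda>c. 2 * c" "(Suc 0, Suc 0)"] by simp
 have iC: "res ?i ?C \<in> \<O> (grid ul_corner)" using res_obj[OF i C] .
 have pC: "res ?p (res ?i ?C) = vx T (0, 0)" using val_res[OF i _ C, of "gcode (0, 0)"] C0 by simp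
 have u: "NC (star_unit D ?p) (res ?i ?C) \<in> \<H> (grid ul_corner) (res ?i ?C) (sta ?p (vx T (0, 0)))"
  using lunivD(2)[OF adjunction_luniv[OF star_adjunction[OF p]], of "res ?i ?C"] star_ftor[OF p] iC pC by simp
 have to_susp: "FA (corner_pushout D) (NC (star_unit D ?p) (res ?i ?C)) \<in> hom \<E> (val (grid square) (gcode (Suc 0, Suc 0)) (shr ?i (res ?i ?C))) (FO (suspension D) (vx T (0, 0)))"
  using ftorD(4)[OF corner_pushout_ftor(1), of _ "res ?i ?C"] u corner_pushout_ftor(2,3) corner_pushout_FO[OF iC]
   suspension_FO[OF val_obj[OF thin_grid _ T], of "gcode (0, 0)"] by simp
 have ce: "NC (shriek_counit D ?i) ?C \<in> \<H> (grid square) (shr ?i (res ?i ?C)) ?C"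
  using runivD(2)[OF adjunction_runiv[OF shriek_adjunction[OF i]], of ?C] shriek_ftor[OF i] C by simp
 have W: "resa ?r (NC (shriek_counit D ?i) ?C) \<in> hom \<E> (res ?r (shr ?i (res ?i ?C))) (vx T (Suc 0, 2))"
  "is_iso \<E> (resa ?r (NC (shriek_counit D ?i) ?C))"
  using resa_hom[OF r ce] C1 resa_iso[OF r ce] co by (simp_all add: cocartesian_def)
 have e: "edge D T (1, 1) (1, 2) \<in> hom \<E> (vx T (Suc 0, Suc 0)) (vx T (Suc 0, 2))"
  using vertex_edge(2)[OF T, of "(1, 1)" "(1, 2)"] step_hom[OF thin_grid _ T, of "gcode (Suc 0, Suc 0)" "gcode (Suc 0, 2)"] by simp
 show ?thesis
  unfolding connecting_def Let_def using E.comp_hom[OF E.comp_hom[OF e E.inv_arr_hom(1)[OF W(2,1)]]] to_susp by simp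
qed

text \<open>A triangle with first edge \<open>d\<close> is available only up to isomorphisms
  \<open>a\<close> and \<open>b\<close>. Its arrows are transported along these, the connecting
  arrow by means of the suspension of \<open>a'\<close>.\<close>

lemma distinguished_ex:
 assumes d: "d \<in> hom \<E> P P'"
 shows "\<exists>M g h. distinguished D P P' M d g h"
proof -
 let ?c = "\<lambda>g f. g ** f"
 obtain T a b where T: "triangle T" and a: "a \<in> hom \<E> (vx T (0, 0)) P" "is_iso \<E> a"
  and b: "b \<in> hom \<E> (vx T (0, Suc 0)) P'" "is_iso \<E> b" and ab: "?c b (sx T (0, 0) (0, Suc 0)) = ?c d a"
  using triangle_on_arrow[OF d] .
 have TO: "T \<in> \<O> (grid rect)" and lx: "lext (grid frame) (grid_map frame rect id) T"
  and z: "is_zero \<E> (vx T (0, 2))" "is_zero \<E> (vx T (Suc 0, 0))" using T by (simp_all add: triangle_def)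
 note co = subsquare_cocartesian[OF TO lx] and st = triangle_cofiber_step[OF T] and v = vertex_edge[OF TO]
 have std: "standard_triangle D T"
  unfolding standard_triangle_def using TO z v(1)[of "(0, 2)"] v(1)[of "(1, 0)"] co[of "\<lambda>c. c"] co[of "\<lambda>c. c + 1"] by simp
 obtain a' where a': "a' \<in> hom \<E> P (vx T (0, 0))" "?c a' a = Ident \<E> (vx T (0, 0))" "?c a a' = Ident \<E> P" "is_iso \<E> a'"
  using E.isoE[OF a(2,1)] .
 obtain b' where b': "b' \<in> hom \<E> P' (vx T (0, Suc 0))" "?c b' b = Ident \<E> (vx T (0, Suc 0))" "?c b b' = Ident \<E> P'" "is_iso \<E> b'"
  using E.isoE[OF b(2,1)] .
 let ?M = "vx T (Suc 0, Suc 0)" and ?s = "sx T (0, 0) (0, Suc 0)" and ?r = "sx T (0, Suc 0) (Suc 0, Suc 0)"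
 have M: "?M \<in> Obj \<E>" using E.hom_objs[OF st(4)] by simp
 have "\<exists>h. h \<in> hom \<E> ?M (FO (suspension D) P) \<and> ?c (FA (suspension D) a') h = connecting D T"
 proof -
  have \<delta>: "connecting D T \<in> hom \<E> ?M (FO (suspension D) (vx T (0, 0)))"
   using connecting_hom[OF TO] co[of "\<lambda>c. 2 * c"] by simp
  have sa: "FA (suspension D) a' \<in> hom \<E> (FO (suspension D) P) (FO (suspension D) (vx T (0, 0)))"
   "is_iso \<E> (FA (suspension D) a')"
   using ftorD(4)[OF suspension_ftor(1), of a' P] ftor_iso[OF suspension_ftor(1), of a' P] a'(1,4) suspension_ftor(2,3) by simp_all
  obtain k where k: "k \<in> hom \<E> (FO (suspension D) (vx T (0, 0))) (FO (suspension D) P)"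
   "?c (FA (suspension D) a') k = Ident \<E> (FO (suspension D) (vx T (0, 0)))"
   using E.isoE[OF sa(2,1)] by metis
  show ?thesis using E.comp_hom[OF \<delta> k(1)] E.comp_assoc[OF \<delta> k(1) sa(1)] k(2) E.ident_left[OF \<delta>] by auto
 qed
 then obtain h where h: "h \<in> hom \<E> ?M (FO (suspension D) P)" "?c (FA (suspension D) a') h = connecting D T" by blast
 have \<delta>: "connecting D T \<in> hom \<E> ?M (FO (suspension D) (vx T (0, 0)))"
  using connecting_hom[OF TO] co[of "\<lambda>c. 2 * c"] by simp
 have "?c b' d = ?c ?s a'"
 proof -
  have "?c (?c b' d) a = ?c (?c ?s a') a"
   using E.comp_assoc[OF a(1) d b'(1)] ab E.comp_assoc[OF st(3) b(1) b'(1)] b'(2) E.ident_left[OF st(3)]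
    E.comp_assoc[OF a(1) a'(1) st(3)] a'(2) E.ident_right[OF st(3)] by simp
  thus ?thesis using E.iso_cancel_epi[OF a(2,1) E.comp_hom[OF d b'(1)] E.comp_hom[OF a'(1) st(3)]] by simp
 qed
 moreover have "?c (Ident \<E> ?M) (?c ?r b') = ?c ?r b'" using E.ident_left[OF E.comp_hom[OF b'(1) st(4)]] .
 moreover have "?c (FA (suspension D) a') h = ?c (connecting D T) (Ident \<E> ?M)" using h(2) E.ident_right[OF \<delta>] by simp
 moreover have "vertex D T (0, 0) = vx T (0, 0)" "vertex D T (0, 1) = vx T (0, Suc 0)" "vertex D T (1, 1) = ?M"
  "edge D T (0, 0) (0, 1) = ?s" "edge D T (0, 1) (1, 1) = ?r"
  using v(1)[of "(0, 0)"] v(1)[of "(0, Suc 0)"] v(1)[of "(Suc 0, Suc 0)"] v(2)[of "(0, 0)" "(0, Suc 0)"] v(2)[of "(0, Suc 0)" "(Suc 0, Suc 0)"]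
  by simp_all
 ultimately have "distinguished D P P' ?M d (?c ?r b') h"
  unfolding distinguished_def using d E.comp_hom[OF b'(1) st(4)] h(1) std a'(1,4) b'(1,4) E.ident_hom[OF M] E.iso_ident[OF M]
  by (intro conjI exI[of _ T] exI[of _ a'] exI[of _ b'] exI[of _ "Ident \<E> ?M"]) simp_all
 thus ?thesis by blast
qed

text \<open>\<open>F\<close> and the first edge of the standard triangle have isomorphic underlying
  arrows. \<open>der5_full\<close> lifts this isomorphism to D(ar e_cat), where the bottom row of
  the left square is a cofiber and cofibers are unique.\<close>

lemma distinguished_cofiber:
 assumes ds: "distinguished D P P' M d g h" and F: "F \<in> \<O> (ar e_cat)"
  and a: "a \<in> hom \<E> (res (s0 e_cat) F) P" "is_iso \<E> a"
  and b: "b \<in> hom \<E> (res (s1 e_cat) F) P'" "is_iso \<E> b"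
  and ab: "b ** bd e_cat F = d ** a" and c: "cofiber e_cat F Z r"
 shows "isomorphic \<E> (res (s1 e_cat) Z) M"
proof -
 let ?c = "\<lambda>g f. g ** f"
 obtain T x y z where T: "standard_triangle D T"
  and x: "x \<in> hom \<E> P (vertex D T (0, 0))" "is_iso \<E> x"
  and y: "y \<in> hom \<E> P' (vertex D T (0, 1))" "is_iso \<E> y"
  and z: "z \<in> hom \<E> M (vertex D T (1, 1))" "is_iso \<E> z" and xy: "?c y d = ?c (edge D T (0, 0) (0, 1)) x"
  and d: "d \<in> hom \<E> P P'"
  using ds unfolding distinguished_def by blast
 have TO: "T \<in> \<O> (grid rect)" using T by (simp add: standard_triangle_def)
 let ?l = "line rect (0, 0) (0, Suc 0) :: 'a sftor" and ?m = "line rect (Suc 0, 0) (Suc 0, Suc 0) :: 'a sftor"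
 have l: "?l \<in> Mor (ar e_cat) (grid rect)" and m: "?m \<in> Mor (ar e_cat) (grid rect)" by (rule line; simp)+
 have lv: "res (s0 e_cat) (res ?l T) = vertex D T (0, 0)" "res (s1 e_cat) (res ?l T) = vertex D T (0, 1)"
  "bd e_cat (res ?l T) = edge D T (0, 0) (0, 1)" "res (s1 e_cat) (res ?m T) = vertex D T (1, 1)"
  using line_val[of "(0, 0)" rect "(0, Suc 0)", OF _ _ _ _ TO] line_val(2)[of "(Suc 0, 0)" rect "(Suc 0, Suc 0)", OF _ _ _ _ TO]
   vertex_edge(1)[OF TO, of "(0, 0)"] vertex_edge(1)[OF TO, of "(0, Suc 0)"] vertex_edge(1)[OF TO, of "(Suc 0, Suc 0)"]
   vertex_edge(2)[OF TO, of "(0, 0)" "(0, Suc 0)"] by simp_all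
 have cT: "cofiber e_cat (res ?l T) (res ?m T) (tr ?l ?m T)"
  by (rule triangle_cofiber[OF TO]) (use T vertex_edge(1)[OF TO, of "(Suc 0, 0)"] in \<open>simp_all add: standard_triangle_def\<close>)
 have e: "edge D T (0, 0) (0, 1) \<in> hom \<E> (vertex D T (0, 0)) (vertex D T (0, 1))"
  using bd_hom[OF thin_e res_obj[OF l TO]] lv by simp
 have "?c (?c y b) (bd e_cat F) = ?c (edge D T (0, 0) (0, 1)) (?c x a)"
  using E.comp_assoc[OF bd_hom[OF thin_e F] b(1) y(1)] ab E.comp_assoc[OF a(1) d y(1)] xy E.comp_assoc[OF a(1) x(1) e] by simp
 then obtain \<kappa> where \<kappa>: "\<kappa> \<in> \<H> (ar e_cat) F (res ?l T)" "resa (s0 e_cat) \<kappa> = ?c x a" "resa (s1 e_cat) \<kappa> = ?c y b"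
  using der5_full[OF thin_e F res_obj[OF l TO], of "?c x a" "?c y b"] E.comp_hom[OF a(1) x(1)] E.comp_hom[OF b(1) y(1)] lv by metis
 have \<kappa>i: "\<I> (ar e_cat) \<kappa>"
  by (rule iso_slots[OF thin_e \<kappa>(1)]) (use \<kappa>(2,3) E.iso_comp[OF a(1) x(1) a(2) x(2)] E.iso_comp[OF b(1) y(1) b(2) y(2)] in simp_all)
 obtain k where k: "k \<in> \<H> (ar e_cat) Z (res ?m T)" "\<I> (ar e_cat) k" using cofiber_unique[OF thin_e c cT \<kappa>(1) \<kappa>i] .
 have "isomorphic \<E> (res (s1 e_cat) Z) (vertex D T (1, 1))"
  using E.isomorphicI[OF resa_hom[OF Mor_s(2)[OF thin_e] k(1)] resa_iso[OF Mor_s(2)[OF thin_e] k]] lv(4) by simp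
 thus ?thesis using E.isomorphic_trans E.isomorphic_sym[OF E.isomorphicI[OF z]] by blast
qed

end

section \<open>Left Kan extension commutes with the ends of an arrow and with cofibers\<close>

section \<open>Homotopy colimits of arrows\<close>

context derivator
begin

text \<open>Writing \<open>W\<close> as \<open>res b N\<close> up to isomorphism, arrows from
  \<open>res b (shr m F)\<close> to \<open>W\<close> are arrows from \<open>shr m F\<close> to
  \<open>N\<close>, hence from \<open>F\<close> to \<open>res m N\<close>, hence from
  \<open>res a F\<close> to \<open>res a (res m N)\<close>, which is \<open>res p W\<close> up to
  isomorphism. The hypothesis supplies an \<open>N\<close> for which the first and the last step are
  bijective.\<close>

lemma luniv_restrict:
 assumes m: "m \<in> Mor K L" and a: "a \<in> Mor A K" and b: "b \<in> Mor B L" and p: "p \<in> Mor A B" and sq: "m \<circ>\<^sub>F a = b \<circ>\<^sub>F p"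
  and F: "F \<in> \<O> K"
  and N: "\<And>W. W \<in> \<O> B \<Longrightarrow> \<exists>N \<epsilon>. N \<in> \<O> L \<and> rext B b N \<and> rext A a (res m N) \<and> \<epsilon> \<in> \<H> B (res b N) W \<and> \<I> B \<epsilon>"
 shows "luniv (pull D p) (res a F) (res b (shr m F)) (resa a (eta m F))"
proof (rule lunivI, unfold pull(2,3)[OF p])
 interpret A: category "\<D> A" using cat[OF MorD(4)[OF p]] .
 interpret B: category "\<D> B" using cat[OF MorD(5)[OF p]] .
 interpret K: category "\<D> K" using cat[OF MorD(4)[OF m]] .
 note G = shr_luniv[OF m F]
 have e: "res a (res m T) = res p (res b T)" if "T \<in> \<O> L" for T using res_comp[OF a m that] res_comp[OF p b that] sq by simp
 have ea: "resa a (resa m g) = resa p (resa b g)" if "g \<in> \<H> L X Y" for g X Y using resa_resa[OF a m that] resa_resa[OF p b that] sq by simp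
 show "res b (shr m F) \<in> \<O> B" using res_obj[OF b G(2)] .
 show u: "resa a (eta m F) \<in> \<H> A (res a F) (res p (res b (shr m F)))" using resa_hom[OF a G(3)] e[OF G(2)] by simp
 have tr: "resa p (resa b g) *[A] resa a (eta m F) = resa a (resa m g *[K] eta m F)"
  if g: "g \<in> \<H> L (shr m F) T" for g T
  using resa_comp[OF a G(3) resa_hom[OF m g]] ea[OF g] by simp
 fix W
 show "\<exists>g. g \<in> \<H> B (res b (shr m F)) W \<and> resa p g *[A] resa a (eta m F) = f"
  if W: "W \<in> \<O> B" and f: "f \<in> \<H> A (res a F) (res p W)" for f
 proof -
  obtain N \<epsilon> where N: "N \<in> \<O> L" "rext B b N" "rext A a (res m N)" "\<epsilon> \<in> \<H> B (res b N) W" "\<I> B \<epsilon>"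
   using N[OF W] by blast
  obtain \<epsilon>' where \<epsilon>': "\<epsilon>' \<in> \<H> B W (res b N)" "\<epsilon> *[B] \<epsilon>' = idn B W" using B.isoE[OF N(5,4)] by metis
  have "resa p \<epsilon>' *[A] f \<in> \<H> A (res a F) (res a (res m N))"
   using A.comp_hom[OF f resa_hom[OF p \<epsilon>'(1)]] e[OF N(1)] by simp
  then obtain f2 where f2: "f2 \<in> \<H> K F (res m N)" "resa a f2 = resa p \<epsilon>' *[A] f" using rext_ex[OF a N(3) F] by blast
  obtain g where g: "g \<in> \<H> L (shr m F) N" "resa m g *[K] eta m F = f2" using shr_ex[OF m F N(1) f2(1)] .
  note bg = resa_hom[OF b g(1)]
  have "resa p (\<epsilon> *[B] resa b g) *[A] resa a (eta m F) = resa p \<epsilon> *[A] (resa p \<epsilon>' *[A] f)"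
   using resa_comp[OF p bg N(4)] A.comp_assoc[OF u resa_hom[OF p bg] resa_hom[OF p N(4)]] tr[OF g(1)] g(2) f2(2) by simp
  also have "\<dots> = f"
   using A.comp_assoc[OF f resa_hom[OF p \<epsilon>'(1)] resa_hom[OF p N(4)]] resa_comp[OF p \<epsilon>'(1) N(4)] \<epsilon>'(2) resa_ident[OF p W] A.ident_left[OF f] by simp
  finally show ?thesis using B.comp_hom[OF bg N(4)] by blast
 qed
 show "h = h'" if h: "h \<in> \<H> B (res b (shr m F)) W" and h': "h' \<in> \<H> B (res b (shr m F)) W"
  and eq: "resa p h *[A] resa a (eta m F) = resa p h' *[A] resa a (eta m F)" for h h'
 proof -
  have W: "W \<in> \<O> B" using B.hom_objs[OF h] by simp
  obtain N \<epsilon> where N: "N \<in> \<O> L" "rext B b N" "rext A a (res m N)" "\<epsilon> \<in> \<H> B (res b N) W" "\<I> B \<epsilon>"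
   using N[OF W] by blast
  obtain \<epsilon>' where \<epsilon>': "\<epsilon>' \<in> \<H> B W (res b N)" "\<I> B \<epsilon>'" using B.isoE[OF N(5,4)] by metis
  have "\<exists>k. k \<in> \<H> L (shr m F) N \<and> resa b k = \<epsilon>' *[B] l \<and>
    resa a (resa m k *[K] eta m F) = resa p \<epsilon>' *[A] (resa p l *[A] resa a (eta m F))"
   if l: "l \<in> \<H> B (res b (shr m F)) W" for l
  proof -
   obtain k where k: "k \<in> \<H> L (shr m F) N" "resa b k = \<epsilon>' *[B] l" using rext_ex[OF b N(2) G(2) B.comp_hom[OF l \<epsilon>'(1)]] .
   show ?thesis
    using k tr[OF k(1)] resa_comp[OF p l \<epsilon>'(1)] A.comp_assoc[OF u resa_hom[OF p l] resa_hom[OF p \<epsilon>'(1)]] by auto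
  qed
  then obtain k k' where k: "k \<in> \<H> L (shr m F) N" "resa b k = \<epsilon>' *[B] h"
    "resa a (resa m k *[K] eta m F) = resa p \<epsilon>' *[A] (resa p h *[A] resa a (eta m F))"
   and k': "k' \<in> \<H> L (shr m F) N" "resa b k' = \<epsilon>' *[B] h'"
    "resa a (resa m k' *[K] eta m F) = resa p \<epsilon>' *[A] (resa p h' *[A] resa a (eta m F))"
   using h h' by metis
  have "resa m k *[K] eta m F = resa m k' *[K] eta m F"
   using rext_eqI[OF a N(3) K.comp_hom[OF G(3) resa_hom[OF m k(1)]] K.comp_hom[OF G(3) resa_hom[OF m k'(1)]]] k(3) k'(3) eq by simp
  hence "\<epsilon>' *[B] h = \<epsilon>' *[B] h'" using shr_eqI[OF m F k(1) k'(1)] k(2) k'(2) by simp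
  thus "h = h'" using B.iso_cancel_mono[OF \<epsilon>'(2,1) h h'] by simp
 qed
qed

end

context pointed_derivator
begin

text \<open>At the source end take for \<open>N\<close> the arrow from \<open>W\<close> to zero, at
  the target end the identity arrow of \<open>W\<close>. Both are right extensions from the end in
  question, and restriction along \<open>map_ar p\<close> preserves this property.\<close>

lemma shr_slots:
 assumes p: "p \<in> Mor A B" and F: "F \<in> \<O> (ar A)"
 shows "luniv (pull D p) (res (s0 A) F) (res (s0 B) (shr (map_ar p) F)) (resa (s0 A) (eta (map_ar p) F))"
  and "luniv (pull D p) (res (s1 A) F) (res (s1 B) (shr (map_ar p) F)) (resa (s1 A) (eta (map_ar p) F))"
proof -
 note A = MorD(4)[OF p] and B = MorD(5)[OF p] and m = Mor_map_ar[OF p]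
 note sA = Mor_s[OF A] and sB = Mor_s[OF B]
 interpret B: category "\<D> B" using cat[OF B] .
 show "luniv (pull D p) (res (s0 A) F) (res (s0 B) (shr (map_ar p) F)) (resa (s0 A) (eta (map_ar p) F))"
 proof (rule luniv_restrict[OF m sA(1) sB(1) p map_ar_s(1)[OF p] F])
  fix W assume W: "W \<in> \<O> B"
  note N = sta_runiv[OF sB(1) W]
  have z: "is_zero \<E> (val (ar B) (cpair b (cnat 1)) (sta (s0 B) W))" if "b \<in> Obj B" for b
   by (rule sta_val_zero[OF sB(1) W]) (use that B in auto)
  have "rext B (s0 B) (sta (s0 B) W)"
  proof (rule runiv_supported[OF embedding_s(1)[OF B] N(2)])
   fix x assume "x \<in> Obj (ar B)" "x \<notin> FO (s0 B) ` Obj B"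
   then obtain b where "b \<in> Obj B" "x = cpair b (cnat 1)" by (auto simp: image_iff)
   thus "is_zero \<E> (val (ar B) x (sta (s0 B) W)) \<and> (\<forall>a\<in>Obj B. \<not> le (ar B) x (FO (s0 B) a))"
    using z B by auto
  qed
  moreover have "rext A (s0 A) (res (map_ar p) (sta (s0 B) W))"
  proof (rule runiv_supported[OF embedding_s(1)[OF A] res_obj[OF m N(2)]])
   fix x assume x: "x \<in> Obj (ar A)" "x \<notin> FO (s0 A) ` Obj A"
   then obtain a where a: "a \<in> Obj A" "x = cpair a (cnat 1)" by (auto simp: image_iff)
   thus "is_zero \<E> (val (ar A) x (res (map_ar p) (sta (s0 B) W))) \<and> (\<forall>a\<in>Obj A. \<not> le (ar A) x (FO (s0 A) a))"
    using val_res[OF m x(1) N(2)] z[OF Mor_obj[OF p a(1)]] FO_map_ar[OF p a(1), of "cnat 1"] A by auto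
  qed
  ultimately show "\<exists>N \<epsilon>. N \<in> \<O> (ar B) \<and> rext B (s0 B) N \<and> rext A (s0 A) (res (map_ar p) N) \<and>
    \<epsilon> \<in> \<H> B (res (s0 B) N) W \<and> \<I> B \<epsilon>"
   using N eps_iso[OF embedding_s(1)[OF B] W] by blast
 qed
 have r: "rext K (s1 K) (res (prj_ar K) V)" if K: "thin K" and V: "V \<in> \<O> K" for K V
  using runiv_res[OF Mor_prj_ar[OF K] Mor_s(2)[OF K] _ fle_s_prj_ar(2)[OF K] V] prj_ar_s(2)[OF K] bd_prj_ar(2)[OF K V]
   fle_refl[OF MorD(1)[OF Mor_id[OF K]]] tr_id[OF Mor_id[OF K] V] res_id[OF K V] by simp
 have mp: "prj_ar B \<circ>\<^sub>F map_ar p = p \<circ>\<^sub>F prj_ar A"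
  by (rule Mor_eqI[OF Mor_comp[OF m Mor_prj_ar[OF B]] Mor_comp[OF Mor_prj_ar[OF A] p]])
    (auto simp: FO_comp[OF m] FO_comp[OF Mor_prj_ar[OF A]] FO_map_ar[OF p] FO_prj_ar Mor_obj[OF p])
 show "luniv (pull D p) (res (s1 A) F) (res (s1 B) (shr (map_ar p) F)) (resa (s1 A) (eta (map_ar p) F))"
 proof (rule luniv_restrict[OF m sA(2) sB(2) p map_ar_s(2)[OF p] F])
  fix W assume W: "W \<in> \<O> B"
  have "res (map_ar p) (res (prj_ar B) W) = res (prj_ar A) (res p W)"
   using res_comp[OF m Mor_prj_ar[OF B] W] res_comp[OF Mor_prj_ar[OF A] p W] mp by simp
  thus "\<exists>N \<epsilon>. N \<in> \<O> (ar B) \<and> rext B (s1 B) N \<and> rext A (s1 A) (res (map_ar p) N) \<and>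
    \<epsilon> \<in> \<H> B (res (s1 B) N) W \<and> \<I> B \<epsilon>"
   using res_obj[OF Mor_prj_ar[OF B] W] r[OF B W] r[OF A res_obj[OF p W]] bd_prj_ar(2)[OF B W] B.ident_hom[OF W] B.iso_ident[OF W] by metis
 qed
qed

text \<open>Restriction along \<open>map_ar p\<close> preserves null sources, so its left adjoint
  carries the universal arrow of the cofiber to one over \<open>B\<close>; the target of the cofiber
  gets extended along \<open>p\<close>.\<close>

lemma cofiber_shr:
 assumes p: "p \<in> Mor A B" and c: "cofiber A F Z r"
 shows "\<exists>Z' r'. cofiber B (shr (map_ar p) F) Z' r' \<and> isomorphic (\<D> B) (shr p (res (s1 A) Z)) (res (s1 B) Z')"
proof -
 note A = MorD(4)[OF p] and B = MorD(5)[OF p] and m = Mor_map_ar[OF p]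
 note sA = Mor_s(2)[OF A] and sB = Mor_s(2)[OF B] and Zc = cofiberD[OF c]
 let ?m = "map_ar p" and ?X = "res (s1 A) Z"
 have TA: "thin (ar A)" and TB: "thin (ar B)" using A B by simp_all
 interpret A: category "\<D> A" using cat[OF A] .
 interpret B: category "\<D> B" using cat[OF B] .
 interpret K: category "\<D> (ar A)" using cat[OF TA] .
 interpret L: category "\<D> (ar B)" using cat[OF TB] .
 have F: "F \<in> \<O> (ar A)" using K.hom_objs[OF Zc(2)] by simp
 have X: "?X \<in> \<O> A" using res_obj[OF sA Zc(3)] .
 define Y where "Y = shr p ?X"
 define Z' where "Z' = shr (s1 B) Y"
 note Y = shr_luniv[OF p X, folded Y_def]
 note Z' = shr_luniv[OF sB Y(2), folded Z'_def]
 have ns: "null_src B Z'" unfolding Z'_def using null_src_shr(1)[OF B Y(2)] .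
 have lZ: "lext A (s1 A) Z" using luniv_supported[OF embedding_s(2)[OF A] Zc(3) null_src_off[OF A Zc(1)]] by blast
 have e: "res (s1 A) (res ?m T) = res p (res (s1 B) T)" if "T \<in> \<O> (ar B)" for T
  using res_comp[OF sA m that] res_comp[OF p sB that] map_ar_s(2)[OF p] by simp
 have ea: "resa (s1 A) (resa ?m g) = resa p (resa (s1 B) g)" if "g \<in> \<H> (ar B) U V" for g U V
  using resa_resa[OF sA m that] resa_resa[OF p sB that] map_ar_s(2)[OF p] by simp
 have nm: "null_src A (res ?m N)" if "null_src B N" for N
  using that res_obj[OF m] val_res[OF m _ null_src_obj[OF that]] FO_map_ar[OF p, of _ "cnat 0"] Mor_obj[OF p] by (simp add: null_src_def)
 have pY: "resa p (eta (s1 B) Y) \<in> \<H> A (res p Y) (res (s1 A) (res ?m Z'))" using resa_hom[OF p Z'(3)] e[OF Z'(2)] by simp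
 have "resa p (eta (s1 B) Y) *[A] eta p ?X \<in> \<H> A ?X (res (s1 A) (res ?m Z'))" using A.comp_hom[OF Y(3) pY] .
 \<comment> \<open>An arrow out of \<open>Z\<close> is determined by its target end, where the unit
   of the extension along \<open>p\<close> is prescribed.\<close>
 then obtain \<chi> where \<chi>: "\<chi> \<in> \<H> (ar A) Z (res ?m Z')" "resa (s1 A) \<chi> = resa p (eta (s1 B) Y) *[A] eta p ?X"
  using lext_ex[OF sA lZ res_obj[OF m Z'(2)]] by blast
 note G = shr_luniv[OF m F]
 obtain r' where r': "r' \<in> \<H> (ar B) (shr ?m F) Z'" "resa ?m r' *[ar A] eta ?m F = \<chi> *[ar A] r"
  using shr_ex[OF m F Z'(2) K.comp_hom[OF Zc(2) \<chi>(1)]] .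
 have res\<chi>: "resa (s1 A) (resa ?m g *[ar A] \<chi>) = resa p (resa (s1 B) g *[B] eta (s1 B) Y) *[A] eta p ?X"
  if g: "g \<in> \<H> (ar B) Z' N" for g N
 proof -
  have "resa p (resa (s1 B) g) \<in> \<H> A (res (s1 A) (res ?m Z')) (res p (res (s1 B) N))"
   using resa_hom[OF p resa_hom[OF sB g]] e[OF Z'(2)] by simp
  thus ?thesis
   using resa_comp[OF sA \<chi>(1) resa_hom[OF m g]] ea[OF g] \<chi>(2) A.comp_assoc[OF Y(3) pY] resa_comp[OF p Z'(3) resa_hom[OF sB g]] by simp
 qed
 have trr: "resa ?m (g *[ar B] r') *[ar A] eta ?m F = (resa ?m g *[ar A] \<chi>) *[ar A] r"
  if g: "g \<in> \<H> (ar B) Z' N" for g N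
  using resa_comp[OF m r'(1) g] K.comp_assoc[OF G(3) resa_hom[OF m r'(1)] resa_hom[OF m g]] r'(2)
   K.comp_assoc[OF Zc(2) \<chi>(1) resa_hom[OF m g]] by simp
 have "cofiber B (shr ?m F) Z' r'"
 proof (rule cofiberI[OF ns r'(1)])
  fix N assume N: "null_src B N"
  note NO = null_src_obj[OF N]
  show "\<exists>g. g \<in> \<H> (ar B) Z' N \<and> g *[ar B] r' = f" if f: "f \<in> \<H> (ar B) (shr ?m F) N" for f
  proof -
   obtain f1 where f1: "f1 \<in> \<H> (ar A) Z (res ?m N)" "f1 *[ar A] r = resa ?m f *[ar A] eta ?m F"
    using cofiberE[OF c nm[OF N] K.comp_hom[OF G(3) resa_hom[OF m f]]] .
   have "resa (s1 A) f1 \<in> \<H> A ?X (res p (res (s1 B) N))" using resa_hom[OF sA f1(1)] e[OF NO] by simp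
   then obtain f2 where f2: "f2 \<in> \<H> B Y (res (s1 B) N)" "resa p f2 *[A] eta p ?X = resa (s1 A) f1"
    using shr_ex[OF p X res_obj[OF sB NO]] unfolding Y_def by blast
   obtain g where g: "g \<in> \<H> (ar B) Z' N" "resa (s1 B) g *[B] eta (s1 B) Y = f2"
    using shr_ex[OF sB Y(2) NO f2(1)] unfolding Z'_def .
   have "resa ?m g *[ar A] \<chi> = f1"
    using lext_eqI[OF sA lZ K.comp_hom[OF \<chi>(1) resa_hom[OF m g(1)]] f1(1)] res\<chi>[OF g(1)] g(2) f2(2) by simp
   hence "g *[ar B] r' = f"
    using shr_eqI[OF m F L.comp_hom[OF r'(1) g(1)] f] trr[OF g(1)] f1(2) by simp
   thus ?thesis using g(1) by blast
  qed
  show "g = h" if g: "g \<in> \<H> (ar B) Z' N" and h: "h \<in> \<H> (ar B) Z' N" and eq: "g *[ar B] r' = h *[ar B] r'" for g h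
  proof -
   have "resa ?m g *[ar A] \<chi> = resa ?m h *[ar A] \<chi>"
    using cofiber_eqI[OF A c nm[OF N] K.comp_hom[OF \<chi>(1) resa_hom[OF m g]] K.comp_hom[OF \<chi>(1) resa_hom[OF m h]]] trr[OF g] trr[OF h] eq by simp
   hence "resa p (resa (s1 B) g *[B] eta (s1 B) Y) *[A] eta p ?X = resa p (resa (s1 B) h *[B] eta (s1 B) Y) *[A] eta p ?X"
    using res\<chi>[OF g] res\<chi>[OF h] by simp
   hence "resa (s1 B) g *[B] eta (s1 B) Y = resa (s1 B) h *[B] eta (s1 B) Y"
    using shr_eqI[OF p X, folded Y_def, OF B.comp_hom[OF Z'(3) resa_hom[OF sB g]] B.comp_hom[OF Z'(3) resa_hom[OF sB h]]] by simp
   thus "g = h" using shr_eqI[OF sB Y(2), folded Z'_def, OF g h] by simp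
  qed
 qed
 moreover have "isomorphic (\<D> B) Y (res (s1 B) Z')"
  using B.isomorphicI[OF Z'(3)] eta_iso[OF embedding_s(2)[OF B] Y(2)] by (simp add: Z'_def)
 ultimately show ?thesis unfolding Y_def by blast
qed

end

section \<open>Free objects over the natural numbers and two-term resolutions\<close>

section \<open>Resolutions of sequences\<close>

text \<open>\<open>d\<close> includes the first summands minus a shift raising the index by one. An
  arrow \<open>h\<close> with prescribed composite with \<open>d\<close> and prescribed last
  component must have \<open>m\<close>-th component equal to that of \<open>h \<cdot> d\<close> plus
  the \<open>m + 1\<close>-st component after \<open>f m\<close>; descending recursion from
  \<open>n\<close> determines it.\<close>

lemma (in additive) difference_coproduct:
 assumes P: "is_coproduct C {..n} L P i" and R: "is_coproduct C {..<n} L R j"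
  and f: "\<And>m. f m \<in> hom C (L m) (L (Suc m))" and d: "d \<in> hom C R P"
  and dj: "\<And>m. m < n \<Longrightarrow> d \<cdot> j m = i m \<ominus> i (Suc m) \<cdot> f m"
 shows "is_coproduct C UNIV (\<lambda>b. if b then R else L n) P (\<lambda>b. if b then d else i n)"
proof (rule coproductI)
 note i = coproductD[OF P] and j = coproductD[OF R]
 have cd: "k \<cdot> d \<cdot> j m = (k \<cdot> i m) \<ominus> ((k \<cdot> i (Suc m)) \<cdot> f m)" "k \<cdot> i m \<in> hom C (L m) Q" "(k \<cdot> i (Suc m)) \<cdot> f m \<in> hom C (L m) Q"
  if k: "k \<in> hom C P Q" and m: "m < n" for k Q m
 proof -
  have im: "i m \<in> hom C (L m) P" "i (Suc m) \<in> hom C (L (Suc m)) P" "j m \<in> hom C (L m) R" using i(2) j(2) m by auto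
  show "k \<cdot> i m \<in> hom C (L m) Q" "(k \<cdot> i (Suc m)) \<cdot> f m \<in> hom C (L m) Q"
   using comp_hom[OF im(1) k] comp_hom[OF f comp_hom[OF im(2) k]] .
  show "k \<cdot> d \<cdot> j m = (k \<cdot> i m) \<ominus> ((k \<cdot> i (Suc m)) \<cdot> f m)"
   using comp_assoc[OF im(3) d k] dj[OF m] minus_comp_left[OF im(1) comp_hom[OF f im(2)] k] comp_assoc[OF f im(2) k] by simp
 qed
 show "P \<in> Obj C" by (rule i(1))
 show "(if b then d else i n) \<in> hom C (if b then R else L n) P" for b using d i(2)[of n] by simp
 show "\<exists>k. k \<in> hom C P Q \<and> (\<forall>b\<in>UNIV. k \<cdot> (if b then d else i n) = t b)"
  if Q: "Q \<in> Obj C" and t: "\<And>b. b \<in> UNIV \<Longrightarrow> t b \<in> hom C (if b then R else L n) Q" for Q t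
 proof -
  have t': "t True \<in> hom C R Q" "t False \<in> hom C (L n) Q" using t[of True] t[of False] by simp_all
  \<comment> \<open>The recursion runs from the top: \<open>g k\<close> is the component on the
    summand \<open>n - k\<close>.\<close>
  define g where "g = rec_nat (t False) (\<lambda>k h. (t True \<cdot> j (n - Suc k)) \<oplus> (h \<cdot> f (n - Suc k)))"
  have g0: "g 0 = t False" and gS: "g (Suc k) = (t True \<cdot> j (n - Suc k)) \<oplus> (g k \<cdot> f (n - Suc k))" for k by (simp_all add: g_def)
  have tj: "t True \<cdot> j m \<in> hom C (L m) Q" if "m < n" for m using comp_hom[OF j(2) t'(1)] that by simp
  have gh: "k \<le> n \<Longrightarrow> g k \<in> hom C (L (n - k)) Q" for k
  proof (induction k)
   case (Suc k)
   hence "g k \<in> hom C (L (Suc (n - Suc k))) Q" by (simp add: Suc_diff_Suc)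
   from comp_hom[OF f this] show ?case using is_sum_plus(2)[OF tj, of "n - Suc k" "g k \<cdot> f (n - Suc k)"] gS Suc.prems by simp
  qed (simp add: g0 t')
  obtain h where h: "h \<in> hom C P Q" "\<And>m. m \<in> {..n} \<Longrightarrow> h \<cdot> i m = g (n - m)"
   using coproduct_desc[OF P Q, of "\<lambda>m. g (n - m)"] gh[of "n - _"] by (metis atMost_iff diff_diff_cancel diff_le_self)
  have "h \<cdot> d = t True"
  proof (rule coproduct_eqI[OF R comp_hom[OF d h(1)] t'(1)])
   fix m assume "m \<in> {..<n}"
   hence m: "m < n" by simp
   hence "g (n - m) = (t True \<cdot> j m) \<oplus> (g (n - Suc m) \<cdot> f m)" using gS[of "n - Suc m"] by (simp add: Suc_diff_Suc)
   thus "h \<cdot> d \<cdot> j m = t True \<cdot> j m"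
    using cd[OF h(1) m] h(2)[of m] h(2)[of "Suc m"] m minus_eq_iff(2)[OF cd(2,3)[OF h(1) m] tj[OF m]] by simp
  qed
  moreover have "h \<cdot> i n = t False" using h(2)[of n] g0 by simp
  ultimately show ?thesis using h(1) by (intro exI[of _ h]) simp
 qed
 show "k = l" if k: "k \<in> hom C P Q" and l: "l \<in> hom C P Q"
  and eq: "\<And>b. b \<in> UNIV \<Longrightarrow> k \<cdot> (if b then d else i n) = l \<cdot> (if b then d else i n)" for Q k l
 proof (rule coproduct_eqI[OF P k l])
  fix m assume "m \<in> {..n}"
  hence "m \<le> n" by simp
  thus "k \<cdot> i m = l \<cdot> i m"
  proof (induction m rule: inc_induct)
   case base
   show ?case using eq[of False] by simp
  next
   case (step m)
   note K = cd[OF k step(2)] and L = cd[OF l step(2)]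
   have "(k \<cdot> i m) \<ominus> ((k \<cdot> i (Suc m)) \<cdot> f m) = (l \<cdot> i m) \<ominus> ((k \<cdot> i (Suc m)) \<cdot> f m)"
    using K(1) L(1) step(3) eq[of True] by simp
   thus ?case
    using minus_eq_iff(2)[OF K(2,3) minus_eq_iff(1)[OF K(2,3)]] minus_eq_iff(2)[OF L(2) K(3) minus_eq_iff(1)[OF K(2,3)]] by simp
  qed
 qed
qed

context pointed_derivator
begin

abbreviation "vn n F \<equiv> val nat_op (cnat n) F"
abbreviation "va n f \<equiv> vala nat_op (cnat n) f"
abbreviation "src F \<equiv> res (s0 nat_op) F"
abbreviation "tgt F \<equiv> res (s1 nat_op) F"
abbreviation "tgta f \<equiv> resa (s1 nat_op) f"
abbreviation "sn m n F \<equiv> step nat_op (cnat m) (cnat n) F"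

lemma vn: "F \<in> \<O> nat_op \<Longrightarrow> vn n F \<in> Obj \<E>" by (rule val_obj) auto
lemma va: "f \<in> \<H> nat_op X Y \<Longrightarrow> va n f \<in> hom \<E> (vn n X) (vn n Y)" by (rule vala_hom) auto
lemma va_comp: "f \<in> \<H> nat_op X Y \<Longrightarrow> g \<in> \<H> nat_op Y Z \<Longrightarrow> va n (g *[nat_op] f) = va n g ** va n f"
 by (rule resa_comp[OF Mor_pt]) auto
lemma sn: "F \<in> \<O> nat_op \<Longrightarrow> m \<le> n \<Longrightarrow> sn m n F \<in> hom \<E> (vn m F) (vn n F)" by (rule step_hom) auto
lemma sn_nat: "f \<in> \<H> nat_op X Y \<Longrightarrow> m \<le> n \<Longrightarrow> sn m n Y ** va m f = va n f ** sn m n X" by (rule step_nat) auto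

text \<open>The coproduct of the Kan extensions of the \<open>L m\<close> along the points
  \<open>s m\<close>, described by its generators \<open>e m\<close>. The middle clauses give its
  mapping property and the last one its values, in which the generator \<open>m\<close> is visible
  from degree \<open>s m\<close> on.\<close>

definition free :: "(nat \<Rightarrow> nat) \<Rightarrow> (nat \<Rightarrow> 'b) \<Rightarrow> 'b \<Rightarrow> (nat \<Rightarrow> 'c) \<Rightarrow> bool"
 where "free s L P e \<longleftrightarrow> P \<in> \<O> nat_op \<and> (\<forall>m. e m \<in> hom \<E> (L m) (vn (s m) P)) \<and>
  (\<forall>Q \<in> \<O> nat_op. \<forall>t. (\<forall>m. t m \<in> hom \<E> (L m) (vn (s m) Q)) \<longrightarrow>
    (\<exists>k. k \<in> \<H> nat_op P Q \<and> (\<forall>m. va (s m) k ** e m = t m))) \<and>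
  (\<forall>Q k l. k \<in> \<H> nat_op P Q \<longrightarrow> l \<in> \<H> nat_op P Q \<longrightarrow> (\<forall>m. va (s m) k ** e m = va (s m) l ** e m) \<longrightarrow> k = l) \<and>
  (\<forall>n. is_coproduct \<E> {m. s m \<le> n} L (vn n P) (\<lambda>m. sn (s m) n P ** e m))"

lemma freeD:
 assumes "free s L P e"
 shows "P \<in> \<O> nat_op" "e m \<in> hom \<E> (L m) (vn (s m) P)"
  "is_coproduct \<E> {m. s m \<le> n} L (vn n P) (\<lambda>m. sn (s m) n P ** e m)" "L m \<in> Obj \<E>"
proof -
 note P = assms[unfolded free_def]
 show "P \<in> \<O> nat_op" using P by simp
 show e: "e m \<in> hom \<E> (L m) (vn (s m) P)" for m using P by simp
 show "is_coproduct \<E> {m. s m \<le> n} L (vn n P) (\<lambda>m. sn (s m) n P ** e m)" using P by blast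
 show "L m \<in> Obj \<E>" using E.hom_objs[OF e] by simp
qed

lemma free_map:
 assumes "free s L P e" "Q \<in> \<O> nat_op" "\<And>m. t m \<in> hom \<E> (L m) (vn (s m) Q)"
 obtains k where "k \<in> \<H> nat_op P Q" "\<And>m. va (s m) k ** e m = t m"
proof -
 have "\<forall>Q \<in> \<O> nat_op. \<forall>t. (\<forall>m. t m \<in> hom \<E> (L m) (vn (s m) Q)) \<longrightarrow>
    (\<exists>k. k \<in> \<H> nat_op P Q \<and> (\<forall>m. va (s m) k ** e m = t m))"
  using assms(1) by (simp add: free_def)
 from this[rule_format, OF assms(2,3)] show thesis using that by auto
qed

lemma free_eqI:
 assumes "free s L P e" "k \<in> \<H> nat_op P Q" "l \<in> \<H> nat_op P Q" "\<And>m. va (s m) k ** e m = va (s m) l ** e m"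
 shows "k = l"
proof -
 have "\<forall>Q k l. k \<in> \<H> nat_op P Q \<longrightarrow> l \<in> \<H> nat_op P Q \<longrightarrow> (\<forall>m. va (s m) k ** e m = va (s m) l ** e m) \<longrightarrow> k = l"
  using assms(1) by (simp add: free_def)
 from this[rule_format, OF assms(2-4)] show ?thesis .
qed

text \<open>The extension of \<open>L m\<close> from a single point is zero before degree
  \<open>s m\<close> and isomorphic to \<open>L m\<close> from there on. Evaluation preserves
  coproducts, and the zero summands drop out.\<close>

lemma free_ex:
 assumes L: "\<And>m. L m \<in> Obj \<E>"
 shows "\<exists>P e. free s L P e"
proof -
 let ?p = "\<lambda>m. pt nat_op (cnat (s m)) :: 'a sftor"
 have p: "?p m \<in> Mor e_cat nat_op" for m by (rule Mor_pt) auto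
 interpret A: category "\<D> nat_op" using cat[OF thin_nat_op] .
 define G where "G m = shr (?p m) (L m)" for m
 define u where "u m = eta (?p m) (L m)" for m
 have G: "luniv (pull D (?p m)) (L m) (G m) (u m)" "G m \<in> \<O> nat_op" "u m \<in> hom \<E> (L m) (vn (s m) (G m))" for m
  unfolding G_def u_def by (rule shr_luniv[OF p L])+
 have "inj_on (cnat :: nat \<Rightarrow> 'a) UNIV" using inj_cnat by simp
 from coproduct_ex[OF thin_nat_op this, of G] obtain P inn where P: "is_coproduct (\<D> nat_op) UNIV G P inn" using G(2) by blast
 have inn: "P \<in> \<O> nat_op" "inn m \<in> \<H> nat_op (G m) P" for m using A.coproductD[OF P] by simp_all
 define e where "e m = va (s m) (inn m) ** u m" for m
 have e: "e m \<in> hom \<E> (L m) (vn (s m) P)" for m unfolding e_def using E.comp_hom[OF G(3) va[OF inn(2)]] .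
 have ke: "va (s m) k ** e m = va (s m) (k *[nat_op] inn m) ** u m" if "k \<in> \<H> nat_op P Q" for k Q m
  unfolding e_def va_comp[OF inn(2) that] using E.comp_assoc[OF G(3) va[OF inn(2)] va[OF that]] by simp
 have "\<exists>k. k \<in> \<H> nat_op P Q \<and> (\<forall>m. va (s m) k ** e m = t m)"
  if Q: "Q \<in> \<O> nat_op" and t: "\<And>m. t m \<in> hom \<E> (L m) (vn (s m) Q)" for Q t
 proof -
  have "\<exists>k. k \<in> \<H> nat_op (G m) Q \<and> va (s m) k ** u m = t m" for m
   using shr_ex[OF p L Q t, of m] unfolding G_def u_def by blast
  then obtain k where k: "\<And>m. k m \<in> \<H> nat_op (G m) Q" "\<And>m. va (s m) (k m) ** u m = t m" by metis
  obtain h where "h \<in> \<H> nat_op P Q" "\<And>m. m \<in> UNIV \<Longrightarrow> h *[nat_op] inn m = k m" by (rule A.coproduct_desc[OF P Q k(1)]) blast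
  thus ?thesis using ke k(2) by (intro exI[of _ h]) simp
 qed
 moreover have "k = l" if k: "k \<in> \<H> nat_op P Q" and l: "l \<in> \<H> nat_op P Q"
  and eq: "\<And>m. va (s m) k ** e m = va (s m) l ** e m" for Q k l
 proof (rule A.coproduct_eqI[OF P k l])
  fix m
  show "k *[nat_op] inn m = l *[nat_op] inn m"
   using shr_eqI[OF p[of m] L[of m], folded G_def u_def, OF A.comp_hom[OF inn(2) k] A.comp_hom[OF inn(2) l]] eq[of m] ke[OF k] ke[OF l] by simp
 qed
 moreover have "is_coproduct \<E> {m. s m \<le> n} L (vn n P) (\<lambda>m. sn (s m) n P ** e m)" for n
 proof -
  have "is_coproduct \<E> UNIV (\<lambda>m. vn n (G m)) (vn n P) (\<lambda>m. va n (inn m))"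
   by (rule res_coproduct[OF Mor_pt[OF thin_nat_op] P]) auto
  hence c: "is_coproduct \<E> {m. s m \<le> n} (\<lambda>m. vn n (G m)) (vn n P) (\<lambda>m. va n (inn m))"
  proof (rule E.coproduct_drop_zeros)
   fix m assume "m \<notin> {m. s m \<le> n}"
   thus "is_zero \<E> (vn n (G m))" unfolding G_def by (intro shr_val_zero[OF p L]) auto
  qed simp
  have g: "sn (s m) n (G m) ** u m \<in> hom \<E> (L m) (vn n (G m))" "is_iso \<E> (sn (s m) n (G m) ** u m)" if "s m \<le> n" for m
  proof -
   show "sn (s m) n (G m) ** u m \<in> hom \<E> (L m) (vn n (G m))" using E.comp_hom[OF G(3) sn[OF G(2) that]] .
   show "is_iso \<E> (sn (s m) n (G m) ** u m)"
    using shr_val[OF p[of m] L[of m], of "cnat 0" "cnat n"] that vala_e[OF G(3)[of m]] le_refl[OF thin_e, of "cnat 0 :: 'a"] by (simp add: G_def u_def)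
  qed
  have "is_coproduct \<E> {m. s m \<le> n} L (vn n P) (\<lambda>m. va n (inn m) ** (sn (s m) n (G m) ** u m))"
   by (rule E.coproduct_precomp[OF c]) (use g in simp_all)
  moreover have "va n (inn m) ** (sn (s m) n (G m) ** u m) = sn (s m) n P ** e m" if m: "s m \<le> n" for m
   using E.comp_assoc[OF G(3) sn[OF G(2) m] va[OF inn(2)]]
    sn_nat[OF inn(2) m] E.comp_assoc[OF G(3) va[OF inn(2)] sn[OF inn(1) m]] by (simp add: e_def)
  ultimately show ?thesis unfolding is_coproduct_def by simp
 qed
 ultimately have "free s L P e" unfolding free_def by (intro conjI allI ballI impI inn(1) e) simp_all
 thus ?thesis by blast
qed

text \<open>An arrow from \<open>P\<close> to the constant sequence on \<open>V\<close> is a family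
  of arrows from the \<open>L m\<close> to \<open>V\<close>, whatever their degrees; so the homotopy
  colimit is the coproduct of the \<open>L m\<close>.\<close>

lemma free_colim:
 assumes P: "free s L P e" and W: "is_coproduct \<E> UNIV L W inn"
 obtains \<pi> where "\<pi> \<in> \<H> nat_op P (res (to_e nat_op) W)" "\<And>m. va (s m) \<pi> ** e m = inn m"
  "luniv (pull D (to_e nat_op)) P W \<pi>"
proof -
 let ?p = "to_e nat_op :: 'a sftor"
 have p: "?p \<in> Mor nat_op e_cat" by (rule Mor_to_e) simp
 note inn = E.coproductD[OF W]
 note P' = freeD[OF P]
 have pv: "vn n (res ?p V) = V" if "V \<in> Obj \<E>" for n V
  using val_res[OF p _ that, of "cnat n"] val_e[OF that] by simp
 have pva: "va n (resa ?p k) = k" if "k \<in> hom \<E> U V" for n k U V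
  using vala_resa[OF p _ that, of "cnat n"] vala_e[OF that] by simp
 interpret A: category "\<D> nat_op" using cat[OF thin_nat_op] .
 obtain \<pi> where \<pi>: "\<pi> \<in> \<H> nat_op P (res ?p W)" "\<And>m. va (s m) \<pi> ** e m = inn m"
  using free_map[OF P res_obj[OF p inn(1)], of inn] inn(2) pv[OF inn(1)] by auto
 have tr: "va (s m) (resa ?p k *[nat_op] \<pi>) ** e m = k ** inn m" if k: "k \<in> hom \<E> W V" for k V m
  using va_comp[OF \<pi>(1) resa_hom[OF p k]] E.comp_assoc[OF P'(2) va[OF \<pi>(1)] va[OF resa_hom[OF p k]]] \<pi>(2) pva[OF k] by simp
 have "luniv (pull D ?p) P W \<pi>"
 proof (rule lunivI, unfold pull(2,3)[OF p])
  show "W \<in> Obj \<E>" "\<pi> \<in> \<H> nat_op P (res ?p W)" by fact+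
  show "\<exists>g. g \<in> hom \<E> W V \<and> resa ?p g *[nat_op] \<pi> = f" if V: "V \<in> Obj \<E>" and f: "f \<in> \<H> nat_op P (res ?p V)" for V f
  proof -
   have "va (s m) f ** e m \<in> hom \<E> (L m) V" for m using E.comp_hom[OF P'(2) va[OF f]] pv[OF V] by simp
   then obtain g where g: "g \<in> hom \<E> W V" "\<And>m. m \<in> UNIV \<Longrightarrow> g ** inn m = va (s m) f ** e m"
    using E.coproduct_desc[OF W V, of "\<lambda>m. va (s m) f ** e m"] by blast
   have "resa ?p g *[nat_op] \<pi> = f"
    by (rule free_eqI[OF P A.comp_hom[OF \<pi>(1) resa_hom[OF p g(1)]] f]) (use tr[OF g(1)] g(2) in simp)
   thus ?thesis using g(1) by blast
  qed
  show "g = h" if g: "g \<in> hom \<E> W V" and h: "h \<in> hom \<E> W V" and eq: "resa ?p g *[nat_op] \<pi> = resa ?p h *[nat_op] \<pi>" for V g h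
   by (rule E.coproduct_eqI[OF W g h]) (use tr[OF g] tr[OF h] eq in metis)
 qed
 thus thesis using that \<pi> by blast
qed

text \<open>\<open>der5_lift\<close> reproduces the ends of an arrow only up to isomorphism, and the
  generators have to follow.\<close>

lemma free_iso:
 assumes P: "free s L P e" and h: "h \<in> \<H> nat_op P P'" "\<I> nat_op h"
 shows "free s L P' (\<lambda>m. va (s m) h ** e m)"
proof -
 interpret A: category "\<D> nat_op" using cat[OF thin_nat_op] .
 note p = freeD[OF P]
 have P': "P' \<in> \<O> nat_op" using A.hom_objs[OF h(1)] by simp
 obtain h' where h': "h' \<in> \<H> nat_op P' P" "h' *[nat_op] h = idn nat_op P" using A.isoE[OF h(2,1)] by metis
 have e: "va (s m) h ** e m \<in> hom \<E> (L m) (vn (s m) P')" for m using E.comp_hom[OF p(2) va[OF h(1)]] .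
 have tr: "va (s m) k ** (va (s m) h ** e m) = va (s m) (k *[nat_op] h) ** e m" if "k \<in> \<H> nat_op P' Q" for k m Q
  using E.comp_assoc[OF p(2) va[OF h(1)] va[OF that]] va_comp[OF h(1) that] by simp
 have "\<exists>k. k \<in> \<H> nat_op P' Q \<and> (\<forall>m. va (s m) k ** (va (s m) h ** e m) = t m)"
  if Q: "Q \<in> \<O> nat_op" and t: "\<forall>m. t m \<in> hom \<E> (L m) (vn (s m) Q)" for Q t
 proof -
  obtain k where k: "k \<in> \<H> nat_op P Q" "\<And>m. va (s m) k ** e m = t m"
   by (rule free_map[OF P Q t[rule_format]]) blast
  have "(k *[nat_op] h') *[nat_op] h = k" using A.comp_assoc[OF h(1) h'(1) k(1)] h'(2) A.ident_right[OF k(1)] by simp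
  thus ?thesis using tr[OF A.comp_hom[OF h'(1) k(1)]] k(2) A.comp_hom[OF h'(1) k(1)] by auto
 qed
 moreover have "k = l" if k: "k \<in> \<H> nat_op P' Q" and l: "l \<in> \<H> nat_op P' Q"
  and eq: "\<And>m. va (s m) k ** (va (s m) h ** e m) = va (s m) l ** (va (s m) h ** e m)" for Q k l
  by (rule A.iso_cancel_epi[OF h(2,1) k l], rule free_eqI[OF P A.comp_hom[OF h(1) k] A.comp_hom[OF h(1) l]])
   (use eq in \<open>simp only: tr[OF k] tr[OF l]\<close>)
 moreover have "is_coproduct \<E> {m. s m \<le> n} L (vn n P') (\<lambda>m. sn (s m) n P' ** (va (s m) h ** e m))" for n
 proof -
  have "is_iso \<E> (va n h)" using resa_iso[OF Mor_pt[OF thin_nat_op] h, of "cnat n"] by simp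
  note c = E.coproduct_postcomp[OF p(3) va[OF h(1)] this]
  have "va n h ** (sn (s m) n P ** e m) = sn (s m) n P' ** (va (s m) h ** e m)" if m: "s m \<le> n" for m
   using E.comp_assoc[OF p(2) sn[OF p(1) m] va[OF h(1)]] sn_nat[OF h(1) m] E.comp_assoc[OF p(2) va[OF h(1)] sn[OF P' m]] by simp
  thus ?thesis using c unfolding is_coproduct_def by simp
 qed
 ultimately show ?thesis unfolding free_def by (intro conjI allI ballI impI P' e) simp_all
qed

end

context triangulated_derivator
begin

text \<open>On the generator \<open>n\<close>, \<open>d\<close> is the difference of the two ways to
  reach degree \<open>n + 1\<close>: by the transition of \<open>P0\<close>, or by
  \<open>f n\<close> and the next generator. Naturality of \<open>u\<close> and bilinearity of
  subtraction in D(e) evaluate the composite.\<close>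

lemma difference_comp:
 assumes P0: "free (\<lambda>n. n) L P0 e0" and P1: "free Suc L P1 e1" and f: "\<And>n. f n \<in> hom \<E> (L n) (L (Suc n))"
  and d: "d \<in> \<H> nat_op P1 P0" "va (Suc n) d ** e1 n = E.diff_arr (sn n (Suc n) P0 ** e0 n) (e0 (Suc n) ** f n)"
  and u: "u \<in> \<H> nat_op P0 Q"
 shows "va (Suc n) (u *[nat_op] d) ** e1 n =
  E.diff_arr (sn n (Suc n) Q ** (va n u ** e0 n)) ((va (Suc n) u ** e0 (Suc n)) ** f n)"
proof -
 note p0 = freeD[OF P0] and p1 = freeD[OF P1]
 have n: "n \<le> Suc n" and Q: "Q \<in> \<O> nat_op" using category.hom_objs[OF cat u] by simp_all
 have "va (Suc n) (u *[nat_op] d) ** e1 n = va (Suc n) u ** E.diff_arr (sn n (Suc n) P0 ** e0 n) (e0 (Suc n) ** f n)"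
  using va_comp[OF d(1) u] E.comp_assoc[OF p1(2) va[OF d(1)] va[OF u]] d(2) by simp
 thus ?thesis
  using E.minus_comp_left[OF E.comp_hom[OF p0(2) sn[OF p0(1) n]] E.comp_hom[OF f p0(2)] va[OF u]]
   E.comp_assoc[OF p0(2) sn[OF p0(1) n] va[OF u]] sn_nat[OF u n]
   E.comp_assoc[OF p0(2) va[OF u] sn[OF Q n]] E.comp_assoc[OF f p0(2) va[OF u]] by simp
qed

text \<open>The two-term resolution \<open>0 \<rightarrow> \<Oplus> (n+1)\<^sub>! L n \<rightarrow> \<Oplus> n\<^sub>! L n\<close> of a sequence \<open>L\<close>, lifted to \<open>F \<in> D(nat_op \<times> [1])\<close>,
 with cofiber \<open>Z\<close>.\<close>

definition resolution where "resolution L f e0 e1 F Z r \<longleftrightarrow> F \<in> \<O> (ar nat_op) \<and>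
  free (\<lambda>n. n) L (tgt F) e0 \<and> free Suc L (src F) e1 \<and> (\<forall>n. f n \<in> hom \<E> (L n) (L (Suc n))) \<and>
  (\<forall>n. va (Suc n) (bd nat_op F) ** e1 n = E.diff_arr (sn n (Suc n) (tgt F) ** e0 n) (e0 (Suc n) ** f n)) \<and>
  cofiber nat_op F Z r"

lemma resolutionD:
 assumes R: "resolution L f e0 e1 F Z r"
 shows "F \<in> \<O> (ar nat_op)" "free (\<lambda>n. n) L (tgt F) e0" "free Suc L (src F) e1" "f n \<in> hom \<E> (L n) (L (Suc n))"
  "va (Suc n) (bd nat_op F) ** e1 n = E.diff_arr (sn n (Suc n) (tgt F) ** e0 n) (e0 (Suc n) ** f n)"
  "cofiber nat_op F Z r" "r \<in> \<H> (ar nat_op) F Z" "bd nat_op F \<in> \<H> nat_op (src F) (tgt F)"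
  "tgta r \<in> \<H> nat_op (tgt F) (tgt Z)"
  "sn n (Suc n) (tgt F) ** e0 n \<in> hom \<E> (L n) (vn (Suc n) (tgt F))" "e0 (Suc n) ** f n \<in> hom \<E> (L n) (vn (Suc n) (tgt F))"
proof -
 show F: "F \<in> \<O> (ar nat_op)" and P0: "free (\<lambda>n. n) L (tgt F) e0" and f: "f n \<in> hom \<E> (L n) (L (Suc n))" and c: "cofiber nat_op F Z r"
  and "free Suc L (src F) e1" "va (Suc n) (bd nat_op F) ** e1 n = E.diff_arr (sn n (Suc n) (tgt F) ** e0 n) (e0 (Suc n) ** f n)"
  using R by (simp_all add: resolution_def)
 show "r \<in> \<H> (ar nat_op) F Z" "bd nat_op F \<in> \<H> nat_op (src F) (tgt F)" "tgta r \<in> \<H> nat_op (tgt F) (tgt Z)"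
  using cofiberD(2)[OF c] bd_hom[OF thin_nat_op F] resa_hom[OF Mor_s(2)[OF thin_nat_op] cofiberD(2)[OF c]] .
 note p0 = freeD[OF P0]
 show "sn n (Suc n) (tgt F) ** e0 n \<in> hom \<E> (L n) (vn (Suc n) (tgt F))" "e0 (Suc n) ** f n \<in> hom \<E> (L n) (vn (Suc n) (tgt F))"
  using E.comp_hom[OF p0(2) sn[OF p0(1)]] E.comp_hom[OF f p0(2)] by simp_all
qed

lemma resolution_ex:
 assumes f: "\<And>n. f n \<in> hom \<E> (L n) (L (Suc n))"
 obtains e0 e1 F Z r where "resolution L f e0 e1 F Z r"
proof -
 let ?A = "nat_op :: 'a scat"
 have L: "L n \<in> Obj \<E>" for n using E.hom_objs[OF f] by simp
 obtain P0 e0 where P0: "free (\<lambda>n. n) L P0 e0" using free_ex[of L] L by blast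
 obtain P1 e1 where P1: "free Suc L P1 e1" using free_ex[of L] L by blast
 note p0 = freeD[OF P0] and p1 = freeD[OF P1]
 interpret A: category "\<D> ?A" using cat[OF thin_nat_op] .
 have "E.diff_arr (sn n (Suc n) P0 ** e0 n) (e0 (Suc n) ** f n) \<in> hom \<E> (L n) (vn (Suc n) P0)" for n
  by (rule E.minus_eq_iff(1)[OF E.comp_hom[OF p0(2) sn[OF p0(1)]] E.comp_hom[OF f p0(2)]]) simp
 then obtain d where d: "d \<in> \<H> ?A P1 P0" "\<And>n. va (Suc n) d ** e1 n = E.diff_arr (sn n (Suc n) P0 ** e0 n) (e0 (Suc n) ** f n)"
  using free_map[OF P1 p0(1), of "\<lambda>n. E.diff_arr (sn n (Suc n) P0 ** e0 n) (e0 (Suc n) ** f n)"] by blast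
 obtain F a b where F: "F \<in> \<O> (ar ?A)" "a \<in> \<H> ?A (src F) P1" "\<I> ?A a" "b \<in> \<H> ?A (tgt F) P0" "\<I> ?A b"
  "b *[?A] bd ?A F = d *[?A] a"
  using der5_lift[OF thin_nat_op d(1)] by blast
 obtain Z r where Z: "cofiber ?A F Z r" using cofiber_ex[OF thin_nat_op F(1)] by blast
 obtain a' where a': "a' \<in> \<H> ?A P1 (src F)" "a *[?A] a' = idn ?A P1" "\<I> ?A a'" using A.isoE[OF F(3,2)] by metis
 obtain b' where b': "b' \<in> \<H> ?A P0 (tgt F)" "b' *[?A] b = idn ?A (tgt F)" "\<I> ?A b'" using A.isoE[OF F(5,4)] by metis
 note bF = bd_hom[OF thin_nat_op F(1)]
 have "b' *[?A] d = b' *[?A] (d *[?A] (a *[?A] a'))" using a'(2) A.ident_right[OF d(1)] by simp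
 also have "\<dots> = bd ?A F *[?A] a'"
  using A.comp_assoc[OF a'(1) F(2) d(1)] F(6)[symmetric] A.comp_assoc[OF a'(1) bF F(4)]
   A.comp_assoc[OF A.comp_hom[OF a'(1) bF] F(4) b'(1)] b'(2) A.ident_left[OF A.comp_hom[OF a'(1) bF]] by simp
 finally have "va (Suc n) (bd ?A F) ** (va (Suc n) a' ** e1 n) = va (Suc n) (b' *[?A] d) ** e1 n" for n
  using E.comp_assoc[OF p1(2) va[OF a'(1)] va[OF bF]] va_comp[OF a'(1) bF] by simp
 hence "resolution L f (\<lambda>n. va n b' ** e0 n) (\<lambda>n. va (Suc n) a' ** e1 n) F Z r"
  unfolding resolution_def
  using F(1) free_iso[OF P0 b'(1,3)] free_iso[OF P1 a'(1,3)] f Z difference_comp[OF P0 P1 f d b'(1)] by simp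
 thus thesis by (rule that)
qed

text \<open>Evaluation at \<open>n\<close> commutes with cofibers. There the source has the
  generators below \<open>n\<close> and the target those up to \<open>n\<close>, so
  \<open>difference_coproduct\<close> exhibits \<open>L n\<close> as the complement and
  \<open>cofiber_split\<close> applies. Compatibility with \<open>f\<close> is the vanishing of the
  difference in the cofiber, read on the generator \<open>n\<close> in degree
  \<open>n + 1\<close>.\<close>

lemma resolution_iso:
 assumes R: "resolution L f e0 e1 F Z r"
 shows "va n (tgta r) ** e0 n \<in> hom \<E> (L n) (vn n (tgt Z))" "is_iso \<E> (va n (tgta r) ** e0 n)"
  "(va (Suc n) (tgta r) ** e0 (Suc n)) ** f n = sn n (Suc n) (tgt Z) ** (va n (tgta r) ** e0 n)"
proof -
 let ?A = "nat_op :: 'a scat" and ?P0 = "tgt F" and ?P1 = "src F" and ?d = "bd nat_op F" and ?q = "tgta r"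
 note R = resolutionD[OF R]
 note F = R(1) and f = R(4) and d = R(8) and q = R(9) and Z = R(6) and p0 = freeD[OF R(2)] and p1 = freeD[OF R(3)]
  and s = Mor_s[OF thin_nat_op] and se = Mor_s[OF thin_e]
 have Zo: "Z \<in> \<O> (ar ?A)" "tgt Z \<in> \<O> ?A" using cofiberD(3)[OF Z] res_obj[OF s(2)] by simp_all
 show qe: "va n ?q ** e0 n \<in> hom \<E> (L n) (vn n (tgt Z))" for n using E.comp_hom[OF p0(2) va[OF q]] .
 have n: "cnat n \<in> Obj ?A" by simp
 define v where "v = map_ar (pt ?A (cnat n))"
 have pn: "pt ?A (cnat n) \<in> Mor e_cat ?A" by (rule Mor_pt) auto
 have v: "v \<in> Mor (ar e_cat) (ar ?A)" unfolding v_def by (rule Mor_map_ar[OF pn])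
 have vs: "v \<circ>\<^sub>F s0 e_cat = s0 ?A \<circ>\<^sub>F pt ?A (cnat n)" "v \<circ>\<^sub>F s1 e_cat = s1 ?A \<circ>\<^sub>F pt ?A (cnat n)" unfolding v_def using map_ar_s[OF pn] .
 have ev: "res (s0 e_cat) (res v F) = vn n ?P1" "res (s1 e_cat) (res v F) = vn n ?P0" "bd e_cat (res v F) = va n ?d"
  using res_comp[OF se(1) v F] res_comp[OF pn s(1) F] res_comp[OF se(2) v F] res_comp[OF pn s(2) F] vs
   tr_res[OF fle_s[OF thin_e] se(1) v F] resa_tr[OF fle_s[OF thin_nat_op] s(1) pn F] by simp_all
 have i: "is_coproduct \<E> {..n} L (vn n ?P0) (\<lambda>m. sn m n ?P0 ** e0 m)" using p0(3)[of n] by (simp add: atMost_def)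
 \<comment> \<open>The offset by one: the generator \<open>m\<close> of the source is present in
   degree \<open>n\<close> once \<open>Suc m \<le> n\<close>, hence the strict bound.\<close>
 have j: "is_coproduct \<E> {..<n} L (vn n ?P1) (\<lambda>m. sn (Suc m) n ?P1 ** e1 m)" using p1(3)[of n] by (simp add: lessThan_def Suc_le_eq)
 have dj: "va n ?d ** (sn (Suc m) n ?P1 ** e1 m) = E.diff_arr (sn m n ?P0 ** e0 m) ((sn (Suc m) n ?P0 ** e0 (Suc m)) ** f m)" if "m < n" for m
 proof -
  have m: "Suc m \<le> n" "m \<le> Suc m" using that by simp_all
  have "va n ?d ** (sn (Suc m) n ?P1 ** e1 m) = sn (Suc m) n ?P0 ** (va (Suc m) ?d ** e1 m)"
   using E.comp_assoc[OF p1(2) sn[OF p1(1) m(1)] va[OF d]] sn_nat[OF d m(1)] E.comp_assoc[OF p1(2) va[OF d] sn[OF p0(1) m(1)]] by simp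
  also have "\<dots> = E.diff_arr (sn (Suc m) n ?P0 ** (sn m (Suc m) ?P0 ** e0 m)) (sn (Suc m) n ?P0 ** (e0 (Suc m) ** f m))"
   unfolding R(5) by (rule E.minus_comp_left[OF R(10,11) sn[OF p0(1) m(1)]])
  finally show ?thesis
   using E.comp_assoc[OF p0(2) sn[OF p0(1) m(2)] sn[OF p0(1) m(1)]] E.comp_assoc[OF f p0(2) sn[OF p0(1) m(1)]]
    step_comp[OF thin_nat_op, of "cnat m" "cnat (Suc m)" "cnat n" ?P0] p0(1) m by simp
 qed
 have id0: "sn n n ?P0 ** e0 n = e0 n" using step_id[OF thin_nat_op n p0(1)] E.ident_left[OF p0(2)] by simp
 have "is_coproduct \<E> UNIV (\<lambda>c. if c then vn n ?P1 else L n) (vn n ?P0) (\<lambda>c. if c then va n ?d else e0 n)"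
  using E.difference_coproduct[OF i j f va[OF d] dj] unfolding id0 .
 from cofiber_split[OF cofiber_pt[OF thin_nat_op n Z, folded v_def], unfolded ev, OF p0(2) this]
 show "is_iso \<E> (va n ?q ** e0 n)" using resa_resa[OF se(2) v R(7)] resa_resa[OF pn s(2) R(7)] vs by simp
 have nn: "n \<le> Suc n" by simp
 have "E.diff_arr (va (Suc n) ?q ** (sn n (Suc n) ?P0 ** e0 n)) (va (Suc n) ?q ** (e0 (Suc n) ** f n)) = va (Suc n) ?q ** (va (Suc n) ?d ** e1 n)"
  unfolding R(5) using E.minus_comp_left[OF R(10,11) va[OF q]] by simp
 moreover have "is_zero_arrow \<E> (va (Suc n) ?q ** (va (Suc n) ?d ** e1 n))"
 proof -
  note r0 = resa_hom[OF s(1) R(7)] and bZ = bd_hom[OF thin_nat_op Zo(1)]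
  have "va (Suc n) ?q ** va (Suc n) ?d = va (Suc n) (bd ?A Z) ** va (Suc n) (resa (s0 ?A) r)"
   using bd_nat[OF thin_nat_op R(7)] va_comp[OF d q] va_comp[OF r0 bZ] by simp
  moreover have "is_zero \<E> (vn (Suc n) (src Z))"
   using cofiberD(1)[OF Z] val_res[OF s(1) _ Zo(1), of "cnat (Suc n)"] by (simp add: null_src_def)
  ultimately have "is_zero_arrow \<E> (va (Suc n) ?q ** va (Suc n) ?d)" using E.zero_arrowI[OF _ va[OF r0] va[OF bZ]] by simp
  thus ?thesis
   using E.zero_arrow_comp[OF p1(2) E.comp_hom[OF va[OF d] va[OF q]]] E.comp_assoc[OF p1(2) va[OF d] va[OF q]] by simp
 qed
 ultimately have "va (Suc n) ?q ** (sn n (Suc n) ?P0 ** e0 n) = va (Suc n) ?q ** (e0 (Suc n) ** f n)"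
  using E.minus_eq_iff[OF E.comp_hom[OF R(10) va[OF q]] E.comp_hom[OF R(11) va[OF q]]] E.plus_zero(2)[OF E.comp_hom[OF R(11) va[OF q]]] by metis
 thus "(va (Suc n) ?q ** e0 (Suc n)) ** f n = sn n (Suc n) (tgt Z) ** (va n ?q ** e0 n)"
  using E.comp_assoc[OF f p0(2) va[OF q]] E.comp_assoc[OF p0(2) sn[OF p0(1) nn] va[OF q]] sn_nat[OF q nn]
   E.comp_assoc[OF p0(2) va[OF q] sn[OF Zo(2) nn]] by simp
qed

end

context triangulated_derivator
begin

lemma resolution_comp_d:
 assumes R: "resolution L f e0 e1 F Z r" and u: "u \<in> \<H> nat_op (tgt F) Q"
 shows "va (Suc n) (u *[nat_op] bd nat_op F) ** e1 n =
  E.diff_arr (sn n (Suc n) Q ** (va n u ** e0 n)) ((va (Suc n) u ** e0 (Suc n)) ** f n)"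
 using difference_comp[OF resolutionD(2-4,8,5)[OF R] u] .

text \<open>The square of underlying arrows lifts by \<open>der5_full\<close>, and the lift induces
  an arrow of cofibers. The result depends on the lift, hence the bare existence statement.\<close>

lemma resolution_cofiber_map:
 assumes R: "resolution L f e0 e1 F Z r" and G: "G \<in> \<O> (ar nat_op)"
  and h0: "h0 \<in> \<H> nat_op (src F) (src G)" and h1: "h1 \<in> \<H> nat_op (tgt F) (tgt G)"
  and eq: "h1 *[nat_op] bd nat_op F = bd nat_op G *[nat_op] h0" and N: "null_src nat_op N" and t: "t \<in> \<H> (ar nat_op) G N"
 obtains w where "w \<in> \<H> nat_op (tgt Z) (tgt N)" "w *[nat_op] tgta r = tgta t *[nat_op] h1"
proof -
 note r = resolutionD[OF R] and s = Mor_s(2)[OF thin_nat_op]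
 obtain k where k: "k \<in> \<H> (ar nat_op) F G" "tgta k = h1" using der5_full[OF thin_nat_op r(1) G h0 h1 eq] by metis
 obtain g where g: "g \<in> \<H> (ar nat_op) Z N" "g *[ar nat_op] r = t *[ar nat_op] k"
  using cofiberE[OF r(6) N category.comp_hom[OF cat k(1) t]] by auto
 thus thesis using that[OF resa_hom[OF s g(1)]] resa_comp[OF s r(7) g(1)] resa_comp[OF s k(1) t] k(2) by simp
qed

text \<open>\<phi> acts on the generators of both free objects, and these actions commute with the
  differences because \<phi> commutes with the transition arrows.\<close>

lemma resolution_map:
 assumes R: "resolution L f e0 e1 F Z r" and R': "resolution L' f' e0' e1' F' Z' r'"
  and \<phi>: "\<And>n. \<phi> n \<in> hom \<E> (L n) (L' n)" "\<And>n. \<phi> (Suc n) ** f n = f' n ** \<phi> n"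
 obtains w where "w \<in> \<H> nat_op (tgt Z) (tgt Z')"
  "\<And>n. va n w ** (va n (tgta r) ** e0 n) = (va n (tgta r') ** e0' n) ** \<phi> n"
proof -
 let ?A = "nat_op :: 'a scat" and ?d = "bd nat_op F" and ?d' = "bd nat_op F'"
 note r = resolutionD[OF R] and r' = resolutionD[OF R']
 interpret A: category "\<D> ?A" using cat[OF thin_nat_op] .
 note p0 = freeD[OF r(2)] and p1 = freeD[OF r(3)] and p0' = freeD[OF r'(2)] and p1' = freeD[OF r'(3)]
 obtain u0 where u0: "u0 \<in> \<H> ?A (tgt F) (tgt F')" "\<And>n. va n u0 ** e0 n = e0' n ** \<phi> n"
  by (rule free_map[OF r(2) p0'(1) E.comp_hom[OF \<phi>(1) p0'(2)]]) blast
 obtain u1 where u1: "u1 \<in> \<H> ?A (src F) (src F')" "\<And>n. va (Suc n) u1 ** e1 n = e1' n ** \<phi> n"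
  by (rule free_map[OF r(3) p1'(1) E.comp_hom[OF \<phi>(1) p1'(2)]]) blast
 have "u0 *[?A] ?d = ?d' *[?A] u1"
 proof (rule free_eqI[OF r(3) A.comp_hom[OF r(8) u0(1)] A.comp_hom[OF u1(1) r'(8)]])
  fix n
  have n: "n \<le> Suc n" by simp
  have "va (Suc n) (u0 *[?A] ?d) ** e1 n = E.diff_arr ((sn n (Suc n) (tgt F') ** e0' n) ** \<phi> n) ((e0' (Suc n) ** f' n) ** \<phi> n)"
   unfolding resolution_comp_d[OF R u0(1)] u0(2)
   using E.comp_assoc[OF \<phi>(1) p0'(2) sn[OF p0'(1) n]] E.comp_assoc[OF r(4) \<phi>(1) p0'(2)] \<phi>(2) E.comp_assoc[OF \<phi>(1) r'(4) p0'(2)] by simp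
  also have "\<dots> = va (Suc n) ?d' ** (e1' n ** \<phi> n)"
   using E.minus_comp_right[OF r'(10,11) \<phi>(1)] r'(5) E.comp_assoc[OF \<phi>(1) p1'(2) va[OF r'(8)]] by simp
  also have "\<dots> = va (Suc n) (?d' *[?A] u1) ** e1 n"
   using u1(2) va_comp[OF u1(1) r'(8)] E.comp_assoc[OF p1(2) va[OF u1(1)] va[OF r'(8)]] by simp
  finally show "va (Suc n) (u0 *[?A] ?d) ** e1 n = va (Suc n) (?d' *[?A] u1) ** e1 n" .
 qed
 from resolution_cofiber_map[OF R r'(1) u1(1) u0(1) this cofiberD(1,2)[OF r'(6)]]
 obtain w where w: "w \<in> \<H> ?A (tgt Z) (tgt Z')" "w *[?A] tgta r = tgta r' *[?A] u0" .
 hence "va n w ** va n (tgta r) = va n (tgta r') ** va n u0" for n using va_comp[OF r(9) w(1)] va_comp[OF u0(1) r'(9)] by simp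
 hence "va n w ** (va n (tgta r) ** e0 n) = (va n (tgta r') ** e0' n) ** \<phi> n" for n
  using E.comp_assoc[OF p0(2) va[OF r(9)] va[OF w(1)]] E.comp_assoc[OF p0(2) va[OF u0(1)] va[OF r'(9)]] u0(2) E.comp_assoc[OF \<phi>(1) p0'(2) va[OF r'(9)]] by simp
 thus thesis using that w(1) by blast
qed

text \<open>The identities of the \<open>vn n X\<close> extend to an augmentation \<epsilon>. It
  annihilates the difference, since on the generator \<open>n\<close> both terms become the
  transition arrow of \<open>X\<close>. So it factors through the cofiber, and there it is
  invertible in each degree by \<open>resolution_iso\<close>.\<close>

lemma resolution_of_diagram:
 assumes X: "X \<in> \<O> nat_op" and R: "resolution (\<lambda>n. vn n X) (\<lambda>n. sn n (Suc n) X) e0 e1 F Z r"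
 shows "isomorphic (\<D> nat_op) (tgt Z) X"
proof -
 let ?A = "nat_op :: 'a scat" and ?d = "bd nat_op F" and ?q = "tgta r"
 note r = resolutionD[OF R] and s = Mor_s[OF thin_nat_op]
 interpret A: category "\<D> ?A" using cat[OF thin_nat_op] .
 note p0 = freeD[OF r(2)] and p1 = freeD[OF r(3)]
 obtain \<epsilon> where \<epsilon>: "\<epsilon> \<in> \<H> ?A (tgt F) X" "\<And>n. va n \<epsilon> ** e0 n = Ident \<E> (vn n X)"
  by (rule free_map[OF r(2) X E.ident_hom[OF vn[OF X]]]) blast
 \<comment> \<open>\<open>X\<close> placed at the target of an arrow with zero source, the form in
   which a cofiber can map to it.\<close>
 define N where "N = shr (s1 ?A) X"
 define u where "u = eta (s1 ?A) X"
 note N = null_src_shr[OF thin_nat_op X, folded N_def u_def]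
 note NO = null_src_obj[OF N(1)]
 have N0: "src N \<in> \<O> ?A" "is_zero \<E> (vn n (src N))" for n
  using res_obj[OF s(1) NO] N(1) val_res[OF s(1) _ NO, of "cnat n"] by (simp_all add: null_src_def)
 have "\<exists>t. t \<in> hom \<E> (vn n X) (vn (Suc n) (src N))" for n using E.zeroD(3)[OF N0(2) vn[OF X]] by blast
 then obtain t where t: "\<And>n. t n \<in> hom \<E> (vn n X) (vn (Suc n) (src N))" by metis
 \<comment> \<open>Any arrow to the null source serves here; it is produced generator by
   generator.\<close>
 obtain z where z: "z \<in> \<H> ?A (src F) (src N)" by (rule free_map[OF r(3) N0(1) t]) blast
 note bN = bd_hom[OF thin_nat_op NO] and u\<epsilon> = A.comp_hom[OF \<epsilon>(1) N(2)]
 have "u *[?A] \<epsilon> *[?A] ?d = bd ?A N *[?A] z"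
 proof (rule free_eqI[OF r(3) A.comp_hom[OF r(8) u\<epsilon>] A.comp_hom[OF z bN]])
  fix n
  have h: "va (Suc n) (u *[?A] \<epsilon> *[?A] ?d) ** e1 n \<in> hom \<E> (vn n X) (vn (Suc n) (tgt N))"
   "va (Suc n) (bd ?A N *[?A] z) ** e1 n \<in> hom \<E> (vn n X) (vn (Suc n) (tgt N))"
   using E.comp_hom[OF p1(2) va[OF A.comp_hom[OF r(8) u\<epsilon>]]] E.comp_hom[OF p1(2) va[OF A.comp_hom[OF z bN]]] .
  have \<epsilon>d: "va (Suc n) (\<epsilon> *[?A] ?d) ** e1 n \<in> hom \<E> (vn n X) (vn (Suc n) X)" using E.comp_hom[OF p1(2) va[OF A.comp_hom[OF r(8) \<epsilon>(1)]]] .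
  have "va (Suc n) (\<epsilon> *[?A] ?d) ** e1 n = E.diff_arr (sn n (Suc n) X) (sn n (Suc n) X)"
   unfolding resolution_comp_d[OF R \<epsilon>(1)] \<epsilon>(2) using E.ident_right[OF r(4)] E.ident_left[OF r(4)] by simp
  hence "is_zero_arrow \<E> (va (Suc n) u ** (va (Suc n) (\<epsilon> *[?A] ?d) ** e1 n))"
   using E.zero_arrow_comp[OF \<epsilon>d va[OF N(2)]] E.minus_self[OF r(4)] by simp
  moreover have "va (Suc n) (u *[?A] \<epsilon> *[?A] ?d) ** e1 n = va (Suc n) u ** (va (Suc n) (\<epsilon> *[?A] ?d) ** e1 n)"
   using A.comp_assoc[OF r(8) \<epsilon>(1) N(2)] va_comp[OF A.comp_hom[OF r(8) \<epsilon>(1)] N(2)] E.comp_assoc[OF p1(2) va[OF A.comp_hom[OF r(8) \<epsilon>(1)]] va[OF N(2)]] by simp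
  moreover have "is_zero_arrow \<E> (va (Suc n) (bd ?A N *[?A] z))"
   unfolding va_comp[OF z bN] by (rule E.zero_arrowI[OF N0(2) va[OF z] va[OF bN]])
  hence "is_zero_arrow \<E> (va (Suc n) (bd ?A N *[?A] z) ** e1 n)"
   using E.zero_arrow_comp[OF p1(2) va[OF A.comp_hom[OF z bN]]] by blast
  ultimately show "va (Suc n) (u *[?A] \<epsilon> *[?A] ?d) ** e1 n = va (Suc n) (bd ?A N *[?A] z) ** e1 n"
   using E.zero_arrow_unique[OF _ _ h] by simp
 qed
 from resolution_cofiber_map[OF R NO z u\<epsilon> this N(1) category.ident_hom[OF cat NO]]
 obtain w where w: "w \<in> \<H> ?A (tgt Z) (tgt N)"
  "w *[?A] ?q = resa (s1 ?A) (idn (ar ?A) N) *[?A] (u *[?A] \<epsilon>)" by auto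
 hence wq: "w *[?A] ?q = u *[?A] \<epsilon>" using resa_ident[OF s(2) NO] A.ident_left[OF u\<epsilon>] by simp
 have "\<I> ?A w"
 proof (rule iso_pointwise[OF thin_nat_op w(1)])
  fix x :: 'a assume "x \<in> Obj ?A"
  then obtain n where x: "x = cnat n" by auto
  have "va n w ** (va n ?q ** e0 n) = va n u"
   using va_comp[OF r(9) w(1)] va_comp[OF \<epsilon>(1) N(2)] wq E.comp_assoc[OF p0(2) va[OF r(9)] va[OF w(1)]]
    E.comp_assoc[OF p0(2) va[OF \<epsilon>(1)] va[OF N(2)]] \<epsilon>(2) E.ident_right[OF va[OF N(2)]] by simp
  moreover have "is_iso \<E> (va n u)" using resa_iso[OF Mor_pt[OF thin_nat_op] N(2,3), of "cnat n"] by simp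
  ultimately show "is_iso \<E> (vala ?A x w)"
   using E.iso_cancel_right[OF resolution_iso(1)[OF R] va[OF w(1)]] resolution_iso(2)[OF R] x by simp
 qed
 from A.isomorphicI[OF w(1) this] show ?thesis using A.isomorphic_trans A.isomorphic_sym[OF A.isomorphicI[OF N(2,3)]] by blast
qed

text \<open>Extended along \<open>to_e nat_op\<close>, the lifted resolution has two copies of the
  coproduct of the \<open>L n\<close> as its ends and the identity minus \<sigma> as its arrow. The
  target of its cofiber is the homotopy colimit of \<open>tgt Z\<close> by
  \<open>cofiber_shr\<close>, and \<open>M\<close> by \<open>distinguished_cofiber\<close>.\<close>

lemma resolution_hocolim:
 assumes R: "resolution L f e0 e1 F Z r" and W: "is_coproduct \<E> UNIV L W inn"
  and \<sigma>: "\<sigma> \<in> hom \<E> W W" "\<And>n. \<sigma> ** inn n = inn (Suc n) ** f n"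
  and ds: "distinguished D W W M (E.diff_arr (Ident \<E> W) \<sigma>) g h"
 shows "isomorphic \<E> (shr (to_e nat_op) (tgt Z)) M"
proof -
 let ?A = "nat_op :: 'a scat" and ?d = "bd nat_op F" and ?p = "to_e nat_op :: 'a sftor"
 have p: "?p \<in> Mor ?A e_cat" by (rule Mor_to_e) simp
 note r = resolutionD[OF R] and s = Mor_s[OF thin_nat_op] and m = Mor_map_ar[OF p]
 interpret A: category "\<D> ?A" using cat[OF thin_nat_op] .
 note p0 = freeD[OF r(2)] and p1 = freeD[OF r(3)] and inn = E.coproductD[OF W]
 obtain \<pi>0 where \<pi>0: "\<pi>0 \<in> \<H> ?A (tgt F) (res ?p W)" "\<And>n. va n \<pi>0 ** e0 n = inn n" "luniv (pull D ?p) (tgt F) W \<pi>0"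
  by (rule free_colim[OF r(2) W]) blast
 obtain \<pi>1 where \<pi>1: "\<pi>1 \<in> \<H> ?A (src F) (res ?p W)" "\<And>n. va (Suc n) \<pi>1 ** e1 n = inn n" "luniv (pull D ?p) (src F) W \<pi>1"
  by (rule free_colim[OF r(3) W]) blast
 define \<delta> where "\<delta> = E.diff_arr (Ident \<E> W) \<sigma>"
 note iW = E.ident_hom[OF inn(1)]
 have \<delta>: "\<delta> \<in> hom \<E> W W" unfolding \<delta>_def by (rule E.minus_eq_iff(1)[OF iW \<sigma>(1)])
 note p\<delta> = resa_hom[OF p \<delta>]
 \<comment> \<open>In a constant sequence the step from degree \<open>n\<close> to
   \<open>n + 1\<close> is an identity, so on the generator \<open>n\<close> the difference becomes
   \<open>inn n\<close> minus \<open>inn (Suc n)\<close> after \<open>f n\<close>.\<close>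
 have \<pi>d: "resa ?p \<delta> *[?A] \<pi>1 = \<pi>0 *[?A] ?d"
 proof (rule free_eqI[OF r(3) A.comp_hom[OF \<pi>1(1) p\<delta>] A.comp_hom[OF r(8) \<pi>0(1)]])
  fix n
  have pv: "va (Suc n) (resa ?p \<delta>) = \<delta>" using vala_resa[OF p _ \<delta>, of "cnat (Suc n)"] vala_e[OF \<delta>] by simp
  have i: "inn n \<in> hom \<E> (L n) W" for n using inn(2) by simp
  have ps: "sn n (Suc n) (res ?p W) = Ident \<E> W"
   using step_res[OF p _ inn(1), of "cnat n" "cnat (Suc n)"] step_id[OF thin_e _ inn(1), of "cnat 0"] val_e[OF inn(1)] by simp
  have "va (Suc n) (resa ?p \<delta> *[?A] \<pi>1) ** e1 n = \<delta> ** inn n"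
   using va_comp[OF \<pi>1(1) p\<delta>] E.comp_assoc[OF p1(2)[of n] va[OF \<pi>1(1)] va[OF p\<delta>]] \<pi>1(2) pv by simp
  also have "\<dots> = E.diff_arr (inn n) (inn (Suc n) ** f n)"
   unfolding \<delta>_def using E.minus_comp_right[OF iW \<sigma>(1) i] E.ident_left[OF i] \<sigma>(2) by simp
  also have "\<dots> = va (Suc n) (\<pi>0 *[?A] ?d) ** e1 n"
   unfolding resolution_comp_d[OF R \<pi>0(1)] \<pi>0(2) ps using E.ident_left[OF i] by simp
  finally show "va (Suc n) (resa ?p \<delta> *[?A] \<pi>1) ** e1 n = va (Suc n) (\<pi>0 *[?A] ?d) ** e1 n" .
 qed
 let ?m = "map_ar ?p" let ?G = "shr ?m F" let ?\<eta> = "eta ?m F"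
 note G = shr_luniv[OF m r(1)]
 note u = shr_slots[OF p r(1)]
 \<comment> \<open>Both ends of the extended object and \<open>W\<close> carry universal arrows for
   the same objects, hence the isomorphisms \<alpha> and \<beta>.\<close>
 obtain \<alpha> where \<alpha>: "\<alpha> \<in> hom \<E> (res (s0 e_cat) ?G) W" "is_iso \<E> \<alpha>" "resa ?p \<alpha> *[?A] resa (s0 ?A) ?\<eta> = \<pi>1"
  using luniv_ex_iso[OF pull(1)[OF p] u(1) \<pi>1(3)] pull[OF p] by auto
 obtain \<beta> where \<beta>: "\<beta> \<in> hom \<E> (res (s1 e_cat) ?G) W" "is_iso \<E> \<beta>" "resa ?p \<beta> *[?A] resa (s1 ?A) ?\<eta> = \<pi>0"
  using luniv_ex_iso[OF pull(1)[OF p] u(2) \<pi>0(3)] pull[OF p] by auto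
 note bG = bd_hom[OF thin_e G(2)] and bF = r(8)
 have pbd: "bd ?A (res ?m ?G) = resa ?p (bd e_cat ?G)"
  using tr_res[OF fle_s[OF thin_nat_op] s(1) m G(2)] resa_tr[OF fle_s[OF thin_e] Mor_s(1)[OF thin_e] p G(2)] map_ar_s[OF p] by simp
 have u0: "resa (s0 ?A) ?\<eta> \<in> \<H> ?A (res (s0 ?A) F) (res ?p (res (s0 e_cat) ?G))" using lunivD(2)[OF u(1)] pull[OF p] by simp
 have u1: "resa (s1 ?A) ?\<eta> \<in> \<H> ?A (res (s1 ?A) F) (res ?p (res (s1 e_cat) ?G))" using lunivD(2)[OF u(2)] pull[OF p] by simp
 have "resa ?p (\<beta> ** bd e_cat ?G) *[?A] resa (s0 ?A) ?\<eta> = resa ?p (\<delta> ** \<alpha>) *[?A] resa (s0 ?A) ?\<eta>"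
 proof -
  have "resa ?p (\<beta> ** bd e_cat ?G) *[?A] resa (s0 ?A) ?\<eta> = resa ?p \<beta> *[?A] (resa (s1 ?A) ?\<eta> *[?A] ?d)"
   using resa_comp[OF p bG \<beta>(1)] A.comp_assoc[OF u0 resa_hom[OF p bG] resa_hom[OF p \<beta>(1)]] bd_nat[OF thin_nat_op G(3)] pbd by simp
  also have "\<dots> = resa ?p \<delta> *[?A] \<pi>1" using A.comp_assoc[OF bF u1 resa_hom[OF p \<beta>(1)]] \<beta>(3) \<pi>d by simp
  also have "\<dots> = resa ?p (\<delta> ** \<alpha>) *[?A] resa (s0 ?A) ?\<eta>"
   unfolding \<alpha>(3)[symmetric] using resa_comp[OF p \<alpha>(1) \<delta>] A.comp_assoc[OF u0 resa_hom[OF p \<alpha>(1)] p\<delta>] by simp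
  finally show ?thesis .
 qed
 hence "\<beta> ** bd e_cat ?G = \<delta> ** \<alpha>"
  using pull_luniv_eqI[OF p u(1) E.comp_hom[OF bG \<beta>(1)] E.comp_hom[OF \<alpha>(1) \<delta>]] by simp
 moreover obtain Z' r' where Z': "cofiber e_cat ?G Z' r'" "isomorphic \<E> (shr ?p (tgt Z)) (res (s1 e_cat) Z')"
  using cofiber_shr[OF p r(6)] by blast
 ultimately have "isomorphic \<E> (res (s1 e_cat) Z') M"
  using distinguished_cofiber[OF ds G(2) \<alpha>(1,2) \<beta>(1,2) _ Z'(1)] by (simp add: \<delta>_def)
 thus ?thesis using E.isomorphic_trans[OF Z'(2)] by blast
qed

end

section \<open>From resolutions back to diagrams: sequences as functors on the natural
  numbers\<close>

lemma arr_isomorphic_fun_cat: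
 assumes \<phi>: "is_ntrans \<phi>" "NDom \<phi> = F" "NCod \<phi> = G" and \<psi>: "is_ntrans \<psi>" "NDom \<psi> = F'" "NCod \<psi> = G'"
  and a: "is_ntrans a" "NDom a = F" "NCod a = F'" and b: "is_ntrans b" "NDom b = G" "NCod b = G'"
  and S: "Src F = A" "Tgt F = B"
  and i: "\<And>x. x \<in> Obj A \<Longrightarrow> is_iso B (NC a x)" "\<And>x. x \<in> Obj A \<Longrightarrow> is_iso B (NC b x)"
  and eq: "\<And>x. x \<in> Obj A \<Longrightarrow> NC b x \<cdot>[B] NC \<phi> x = NC \<psi> x \<cdot>[B] NC a x"
 shows "arr_isomorphic (fun_cat A B) \<phi> \<psi>"
proof -
 have S': "Src F' = A" "Tgt F' = B" "Src G = A" "Tgt G = B"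
  using ntransD(3,4)[OF a(1)] ntransD(3,4)[OF \<phi>(1)] a \<phi> S by simp_all
 have "b \<cdot>[fun_cat A B] \<phi> = vcomp b \<phi>" "\<psi> \<cdot>[fun_cat A B] a = vcomp \<psi> a"
  unfolding fun_cat_def by (subst mk_cat_simps; use assms(1-14) S' in simp)+
 moreover have "vcomp b \<phi> = vcomp \<psi> a"
  unfolding vcomp_def mk_ntrans_def using assms(1-14) S' eq by (auto intro!: restrict_ext)
 moreover have "is_iso (fun_cat A B) a" "is_iso (fun_cat A B) b"
  using is_iso_fun_catI[OF a(1)] is_iso_fun_catI[OF b(1)] i a b S S' by simp_all
 moreover have "\<phi> \<in> hom (fun_cat A B) F G" "\<psi> \<in> hom (fun_cat A B) F' G'" "a \<in> hom (fun_cat A B) F F'" "b \<in> hom (fun_cat A B) G G'"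
  unfolding hom_fun_cat using assms S' by simp_all
 ultimately show ?thesis
  unfolding arr_isomorphic_def Bex_def by (intro conjI exI[of _ a] exI[of _ b]) (simp_all add: hom_def)
qed

lemma Obj_nat_cat [simp]: "Obj nat_cat = range cnat"
 by (simp add: nat_cat_def Obj_chain)

lemma hom_nat_cat: "f \<in> hom nat_cat x y \<Longrightarrow> \<exists>m n. m \<le> n \<and> x = cnat m \<and> y = cnat n \<and> f = cpair (cnat m) (cnat n)"
proof -
 assume f: "f \<in> hom nat_cat x y"
 interpret N: category nat_cat using thin_category[OF thin_chain[of UNIV, folded nat_cat_def]] .
 obtain m n where mn: "x = cnat m" "y = cnat n" using N.hom_objs[OF f] by auto
 hence "m \<le> n" using le_chain[of n UNIV m] f by (auto simp: le_def nat_cat_def)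
 thus ?thesis using hom_chain[of m UNIV n] f mn by (auto simp: nat_cat_def)
qed

lemma nat_arr: "m \<le> n \<Longrightarrow> cpair (cnat m) (cnat n) \<in> hom nat_cat (cnat m) (cnat n)"
 unfolding nat_cat_def by (subst hom_chain) auto

text \<open>Every arrow of \<open>nat_cat\<close> is an identity or a composite of successor steps,
  so naturality propagates from the steps by induction.\<close>

lemma seq_ntrans:
 assumes F: "is_ftor F" "Src F = nat_cat" and G: "is_ftor G" "Src G = nat_cat" and T: "Tgt G = Tgt F"
  and c: "\<And>n. c n \<in> hom (Tgt F) (seq_obj F n) (seq_obj G n)"
  and nat: "\<And>n. c (Suc n) \<cdot>[Tgt F] seq_arr F n = seq_arr G n \<cdot>[Tgt F] c n"
 shows "is_ntrans (mk_ntrans F G (\<lambda>x. c (inv cnat x)))"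
proof (rule mk_ntransI[OF F(1) G(1) _ T])
 interpret N: category "nat_cat :: 'a scat" using ftorD(1)[OF F(1)] F(2) by simp
 interpret C: category "Tgt F" using ftorD(2)[OF F(1)] .
 have i: "inv cnat (cnat n :: 'a) = n" for n using inv_f_f[OF inj_cnat] .
 show "Src G = Src F" using F G by simp
 show "c (inv cnat x) \<in> hom (Tgt F) (FO F x) (FO G x)" if "x \<in> Obj (Src F)" for x
  using that c F(2) i by (auto simp: seq_obj_def)
 show "c (inv cnat y) \<cdot>[Tgt F] FA F f = FA G f \<cdot>[Tgt F] c (inv cnat x)" if f: "f \<in> hom (Src F) x y" for x y f
 proof -
  have "f \<in> hom nat_cat x y" using f F(2) by simp
  from hom_nat_cat[OF this] obtain m n where mn: "m \<le> n" "x = cnat m" "y = cnat n" "f = cpair (cnat m) (cnat n)" by blast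
  have "c n \<cdot>[Tgt F] FA F (cpair (cnat m) (cnat n)) = FA G (cpair (cnat m) (cnat n)) \<cdot>[Tgt F] c m"
   using mn(1)
  proof (induction n rule: dec_induct)
   case base
   have "cpair (cnat m) (cnat m) = Ident nat_cat (cnat m :: 'a)"
    using hom_nat_cat[OF N.ident_hom[of "cnat m"]] by simp
   moreover have "cnat m \<in> Obj (nat_cat :: 'a scat)" by simp
   ultimately show ?case
    using ftorD(5)[OF F(1), of "cnat m"] ftorD(5)[OF G(1), of "cnat m"] F(2) G(2) T c[of m] C.ident_left[OF c] C.ident_right[OF c]
    by (simp add: seq_obj_def)
  next
   case (step n)
   let ?p = "cpair (cnat m) (cnat n) :: 'a" and ?s = "cpair (cnat n) (cnat (Suc n)) :: 'a"
   have h: "?p \<in> hom nat_cat (cnat m) (cnat n)" "?s \<in> hom nat_cat (cnat n) (cnat (Suc n))" using step(1) by (simp_all add: nat_arr)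
   have pc: "cpair (cnat m) (cnat (Suc n)) = ?s \<cdot>[nat_cat] ?p"
    using hom_nat_cat[OF N.comp_hom[OF h]] by simp
   have FF: "FA F ?p \<in> hom (Tgt F) (seq_obj F m) (seq_obj F n)" "FA F ?s \<in> hom (Tgt F) (seq_obj F n) (seq_obj F (Suc n))"
    "FA G ?p \<in> hom (Tgt F) (seq_obj G m) (seq_obj G n)" "FA G ?s \<in> hom (Tgt F) (seq_obj G n) (seq_obj G (Suc n))"
    using ftorD(4)[OF F(1), unfolded F(2), OF h(1)] ftorD(4)[OF F(1), unfolded F(2), OF h(2)]
     ftorD(4)[OF G(1), unfolded G(2) T, OF h(1)] ftorD(4)[OF G(1), unfolded G(2) T, OF h(2)] by (simp_all add: seq_obj_def)
   show ?case
    unfolding pc ftorD(6)[OF F(1), unfolded F(2), OF h] ftorD(6)[OF G(1), unfolded G(2) T, OF h]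
    using C.comp_assoc[OF FF(1,2) c] nat[of n] C.comp_assoc[OF FF(1) c FF(4)] step(3) C.comp_assoc[OF c FF(3,4)]
    by (simp add: seq_arr_def)
  qed
  thus ?thesis using mn i by simp
 qed
qed

context triangulated_derivator
begin

lemma diag_seq:
 assumes X: "X \<in> \<O> nat_op"
 shows "FO (diag D nat_op) X = diag_obj D nat_op X" "is_ftor (diag_obj D nat_op X)" "Src (diag_obj D nat_op X) = nat_cat"
  "Tgt (diag_obj D nat_op X) = \<E>" "seq_obj (diag_obj D nat_op X) n = vn n X" "seq_arr (diag_obj D nat_op X) n = sn n (Suc n) X"
proof -
 show "FO (diag D nat_op) X = diag_obj D nat_op X" using X by (simp add: diag_def)
 show "is_ftor (diag_obj D nat_op X)" using diag_obj_ftor(1)[OF thin_nat_op X] .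
 show "Src (diag_obj D nat_op X) = nat_cat" "Tgt (diag_obj D nat_op X) = \<E>" by (simp_all add: diag_obj_def)
 show "seq_obj (diag_obj D nat_op X) n = vn n X" by (simp add: seq_obj_def diag_obj_def)
 show "seq_arr (diag_obj D nat_op X) n = sn n (Suc n) X"
  unfolding seq_arr_def by (rule diag_obj_ftor(2)[OF thin_nat_op X]) (simp add: hom_op_cat nat_arr)
qed

lemma diag_seq_arr:
 assumes w: "w \<in> \<H> nat_op X Y"
 shows "is_ntrans (FA (diag D nat_op) w)" "NDom (FA (diag D nat_op) w) = diag_obj D nat_op X"
  "NCod (FA (diag D nat_op) w) = diag_obj D nat_op Y" "NC (FA (diag D nat_op) w) (cnat n) = va n w"
proof -
 interpret A: category "\<D> nat_op" using cat[OF thin_nat_op] .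
 have X: "X \<in> \<O> nat_op" and Y: "Y \<in> \<O> nat_op" using A.hom_objs[OF w] by auto
 note x = diag_seq[OF X] and y = diag_seq[OF Y]
 have e: "FA (diag D nat_op) w = mk_ntrans (diag_obj D nat_op X) (diag_obj D nat_op Y) (\<lambda>i. vala nat_op i w)"
  using w by (simp add: diag_def hom_def)
 have "mk_ntrans (diag_obj D nat_op X) (diag_obj D nat_op Y) (\<lambda>i. vala nat_op i w) =
   mk_ntrans (diag_obj D nat_op X) (diag_obj D nat_op Y) (\<lambda>i. va (inv cnat i) w)"
  unfolding mk_ntrans_def x(3) by (auto simp: inv_f_f[OF inj_cnat] intro!: restrict_ext)
 moreover have "is_ntrans (mk_ntrans (diag_obj D nat_op X) (diag_obj D nat_op Y) (\<lambda>i. va (inv cnat i) w))"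
  by (rule seq_ntrans[OF x(2,3) y(2,3)]) (use x y va[OF w] sn_nat[OF w] in simp_all)
 ultimately show "is_ntrans (FA (diag D nat_op) w)" unfolding e by simp
 show "NDom (FA (diag D nat_op) w) = diag_obj D nat_op X" "NCod (FA (diag D nat_op) w) = diag_obj D nat_op Y"
  "NC (FA (diag D nat_op) w) (cnat n) = va n w"
  unfolding e by (simp_all add: x(3))
qed

text \<open>The inverses of the isomorphisms in \<open>resolution_iso\<close> run from the diagram
  of \<open>tgt Z\<close> to the sequence; they respect the transition arrows since the isomorphisms
  do and can be cancelled.\<close>

lemma resolution_lifts:
 assumes X: "is_ftor X" "Src X = nat_cat" "Tgt X = \<E>" and R: "resolution (seq_obj X) (seq_arr X) e0 e1 F Z r"
 obtains \<zeta> where "is_ntrans \<zeta>" "NDom \<zeta> = diag_obj D nat_op (tgt Z)" "NCod \<zeta> = X"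
  "\<And>n. is_iso \<E> (NC \<zeta> (cnat n))" "\<And>n. NC \<zeta> (cnat n) ** (va n (tgta r) ** e0 n) = Ident \<E> (seq_obj X n)"
  "\<And>n. (va n (tgta r) ** e0 n) ** NC \<zeta> (cnat n) = Ident \<E> (vn n (tgt Z))"
  "\<And>n. NC \<zeta> (cnat n) \<in> hom \<E> (vn n (tgt Z)) (seq_obj X n)"
proof -
 note r = resolutionD[OF R] and \<xi> = resolution_iso[OF R]
 let ?X = "tgt Z"
 have Z: "?X \<in> \<O> nat_op" using res_obj[OF Mor_s(2)[OF thin_nat_op] cofiberD(3)[OF r(6)]] .
 note z = diag_seq[OF Z]
 have "\<exists>g. g \<in> hom \<E> (vn n ?X) (seq_obj X n) \<and> g ** (va n (tgta r) ** e0 n) = Ident \<E> (seq_obj X n) \<and>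
   (va n (tgta r) ** e0 n) ** g = Ident \<E> (vn n ?X) \<and> is_iso \<E> g" for n
  using E.isoE[OF \<xi>(2,1)[of n]] by metis
 then obtain g where g: "\<And>n. g n \<in> hom \<E> (vn n ?X) (seq_obj X n)" "\<And>n. g n ** (va n (tgta r) ** e0 n) = Ident \<E> (seq_obj X n)"
  "\<And>n. (va n (tgta r) ** e0 n) ** g n = Ident \<E> (vn n ?X)" "\<And>n. is_iso \<E> (g n)" by metis
 define \<zeta> where "\<zeta> = mk_ntrans (diag_obj D nat_op ?X) X (\<lambda>x. g (inv cnat x))"
 have 1: "is_ntrans \<zeta>"
  unfolding \<zeta>_def
 proof (rule seq_ntrans[OF z(2,3) X(1,2)], unfold z(4-6) X(3))
  fix n
  show "g n \<in> hom \<E> (vn n ?X) (seq_obj X n)" by (rule g(1))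
  have s: "sn n (Suc n) ?X \<in> hom \<E> (vn n ?X) (vn (Suc n) ?X)" using sn[OF Z] by simp
  have "(g (Suc n) ** sn n (Suc n) ?X) ** (va n (tgta r) ** e0 n) = (seq_arr X n ** g n) ** (va n (tgta r) ** e0 n)"
   using E.comp_assoc[OF \<xi>(1) s g(1)] \<xi>(3)[of n, symmetric] E.comp_assoc[OF r(4) \<xi>(1) g(1)] g(2) E.ident_left[OF r(4)]
    E.comp_assoc[OF \<xi>(1) g(1) r(4)] E.ident_right[OF r(4)] by simp
  thus "g (Suc n) ** sn n (Suc n) ?X = seq_arr X n ** g n"
   using E.iso_cancel_epi[OF \<xi>(2,1) E.comp_hom[OF s g(1)] E.comp_hom[OF g(1) r(4)]] by simp
 qed simp
 have 2: "NDom \<zeta> = diag_obj D nat_op ?X" "NCod \<zeta> = X" "NC \<zeta> (cnat n) = g n" for n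
  unfolding \<zeta>_def by (simp, simp, subst mk_ntrans_simps(3), unfold z(3)) (simp_all add: inv_f_f[OF inj_cnat])
 show thesis by (rule that[OF 1 2(1,2)], unfold 2(3)) (rule g)+
qed

lemma seq_arr_hom:
 assumes "is_ftor X" "Src X = nat_cat" "Tgt X = \<E>"
 shows "seq_arr X n \<in> hom \<E> (seq_obj X n) (seq_obj X (Suc n))"
 using ftorD(4)[OF assms(1), of "cpair (cnat n) (cnat (Suc n))"] nat_arr[of n "Suc n"] assms by (simp add: seq_arr_def seq_obj_def)

lemma seq_lift:
 assumes X: "X \<in> Obj (fun_cat nat_cat \<E>)"
 shows "\<exists>G \<in> \<O> nat_op. lifts D nat_op G X"
proof -
 have X': "is_ftor X" "Src X = nat_cat" "Tgt X = \<E>" using X by (simp_all add: fun_cat_def)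
 obtain e0 e1 F Z r where R: "resolution (seq_obj X) (seq_arr X) e0 e1 F Z r"
  using resolution_ex[of "seq_arr X" "seq_obj X", OF seq_arr_hom[OF X']] .
 have Z: "tgt Z \<in> \<O> nat_op" using res_obj[OF Mor_s(2)[OF thin_nat_op] cofiberD(3)[OF resolutionD(6)[OF R]]] .
 note z = diag_seq[OF Z]
 obtain \<zeta> where \<zeta>: "is_ntrans \<zeta>" "NDom \<zeta> = diag_obj D nat_op (tgt Z)" "NCod \<zeta> = X" "\<And>n. is_iso \<E> (NC \<zeta> (cnat n))"
  by (rule resolution_lifts[OF X' R]) blast
 have "is_iso (fun_cat nat_cat \<E>) \<zeta>"
  by (rule is_iso_fun_catI[OF \<zeta>(1)]) (use \<zeta> z in auto)
 moreover have "\<zeta> \<in> hom (fun_cat nat_cat \<E>) (diag_obj D nat_op (tgt Z)) X" unfolding hom_fun_cat using \<zeta> z by simp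
 ultimately have "lifts D nat_op (tgt Z) X" unfolding lifts_def z(1) isomorphic_def by auto
 thus ?thesis using Z by blast
qed

text \<open>Both sequences are resolved, and \<open>resolution_map\<close> supplies an arrow between
  the targets of the cofibers; the isomorphisms from \<open>resolution_lifts\<close> identify it
  with \<open>f\<close> in every degree.\<close>

lemma seq_lift_arr:
 assumes f: "f \<in> Arr (fun_cat nat_cat \<E>)"
 shows "\<exists>f' \<in> Arr (\<D> nat_op). arr_isomorphic (fun_cat nat_cat \<E>) (FA (diag D nat_op) f') f"
proof -
 let ?X = "NDom f" and ?Y = "NCod f"
 have n: "is_ntrans f" and S: "Src ?X = nat_cat" "Tgt ?X = \<E>" using f by (simp_all add: fun_cat_def)
 note nt = ntransD[OF n]
 have X: "is_ftor ?X" and Y: "is_ftor ?Y" "Src ?Y = nat_cat" "Tgt ?Y = \<E>" using nt S by simp_all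
 have ob: "cnat n \<in> Obj nat_cat" for n by simp
 define \<phi> where "\<phi> n = NC f (cnat n)" for n
 have \<phi>: "\<phi> n \<in> hom \<E> (seq_obj ?X n) (seq_obj ?Y n)" "\<phi> (Suc n) ** seq_arr ?X n = seq_arr ?Y n ** \<phi> n" for n
  using nt(5)[of "cnat n"] nt(6)[of "cpair (cnat n) (cnat (Suc n))"] nat_arr[of n "Suc n"] S ob by (simp_all add: \<phi>_def seq_obj_def seq_arr_def)
 obtain e0 e1 F Z r where R: "resolution (seq_obj ?X) (seq_arr ?X) e0 e1 F Z r"
  using resolution_ex[of "seq_arr ?X" "seq_obj ?X", OF seq_arr_hom[OF X S]] .
 obtain e0' e1' F' Z' r' where R': "resolution (seq_obj ?Y) (seq_arr ?Y) e0' e1' F' Z' r'"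
  using resolution_ex[of "seq_arr ?Y" "seq_obj ?Y", OF seq_arr_hom[OF Y]] .
 let ?Z = "tgt Z" and ?Z' = "tgt Z'"
 obtain \<zeta> where \<zeta>: "is_ntrans \<zeta>" "NDom \<zeta> = diag_obj D nat_op ?Z" "NCod \<zeta> = ?X" "\<And>n. is_iso \<E> (NC \<zeta> (cnat n))"
  "\<And>n. (va n (tgta r) ** e0 n) ** NC \<zeta> (cnat n) = Ident \<E> (vn n ?Z)" "\<And>n. NC \<zeta> (cnat n) \<in> hom \<E> (vn n ?Z) (seq_obj ?X n)"
  by (rule resolution_lifts[OF X S R]) blast
 obtain \<zeta>' where \<zeta>': "is_ntrans \<zeta>'" "NDom \<zeta>' = diag_obj D nat_op ?Z'" "NCod \<zeta>' = ?Y" "\<And>n. is_iso \<E> (NC \<zeta>' (cnat n))"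
  "\<And>n. NC \<zeta>' (cnat n) ** (va n (tgta r') ** e0' n) = Ident \<E> (seq_obj ?Y n)" "\<And>n. NC \<zeta>' (cnat n) \<in> hom \<E> (vn n ?Z') (seq_obj ?Y n)"
  by (rule resolution_lifts[OF Y R']) blast
 obtain w where w: "w \<in> \<H> nat_op ?Z ?Z'" "\<And>n. va n w ** (va n (tgta r) ** e0 n) = (va n (tgta r') ** e0' n) ** \<phi> n"
  by (rule resolution_map[OF R R' \<phi>]) blast
 have "NC \<zeta>' (cnat n) ** va n w = \<phi> n ** NC \<zeta> (cnat n)" for n
 proof -
  note \<xi> = resolution_iso(1)[OF R, of n] and \<xi>' = resolution_iso(1)[OF R', of n] and z = \<zeta>(6)[of n] and z' = \<zeta>'(6)[of n] and \<phi>n = \<phi>(1)[of n] and wn = va[OF w(1), of n]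
  have "NC \<zeta>' (cnat n) ** va n w = NC \<zeta>' (cnat n) ** ((va n w ** (va n (tgta r) ** e0 n)) ** NC \<zeta> (cnat n))"
   using E.comp_assoc[OF z \<xi> wn] \<zeta>(5)[of n] E.ident_right[OF wn] by simp
  also have "\<dots> = (NC \<zeta>' (cnat n) ** (va n (tgta r') ** e0' n)) ** (\<phi> n ** NC \<zeta> (cnat n))"
   unfolding w(2) using E.comp_assoc[OF z \<phi>n \<xi>'] E.comp_assoc[OF E.comp_hom[OF z \<phi>n] \<xi>' z'] by simp
  finally show ?thesis using \<zeta>'(5)[of n] E.ident_left[OF E.comp_hom[OF z \<phi>n]] by simp
 qed
 note eq = this
 have Z: "?Z \<in> \<O> nat_op" using res_obj[OF Mor_s(2)[OF thin_nat_op] cofiberD(3)[OF resolutionD(6)[OF R]]] .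
 have "arr_isomorphic (fun_cat nat_cat \<E>) (FA (diag D nat_op) w) f"
  by (rule arr_isomorphic_fun_cat[OF diag_seq_arr(1-3)[OF w(1)] n refl refl \<zeta>(1-3) \<zeta>'(1-3) diag_seq(3,4)[OF Z]])
    (use \<zeta>(4) \<zeta>'(4) eq diag_seq_arr(4)[OF w(1)] in \<open>auto simp: \<phi>_def\<close>)
 moreover have "w \<in> Arr (\<D> nat_op)" using w(1) by (simp add: hom_def)
 ultimately show ?thesis by blast
qed

text \<open>The diagram of \<open>X\<close> is resolved as a bare sequence. The outcome is
  \<open>X\<close> again by \<open>resolution_of_diagram\<close>, so
  \<open>resolution_hocolim\<close> computes the homotopy colimit of \<open>X\<close>. Existence of
  a Milnor colimit comes from completing the identity minus \<sigma> to a distinguished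
  triangle.\<close>

lemma hocolim_Mcolim:
 assumes X: "X \<in> \<O> nat_op"
 shows "\<exists>M. is_Mcolim D (\<lambda>n. vn n X) (\<lambda>n. sn n (Suc n) X) M"
  "is_Mcolim D (\<lambda>n. vn n X) (\<lambda>n. sn n (Suc n) X) M \<Longrightarrow> isomorphic \<E> (hocolim D nat_op X) M"
proof -
 let ?A = "nat_op :: 'a scat" and ?p = "to_e nat_op :: 'a sftor"
 have s: "sn n (Suc n) X \<in> hom \<E> (vn n X) (vn (Suc n) X)" for n using sn[OF X] by simp
 have "inj_on (cnat :: nat \<Rightarrow> 'a) UNIV" using inj_cnat by simp
 from coproduct_ex[OF thin_e this, of "\<lambda>n. vn n X"] obtain P inn where P: "is_coproduct \<E> UNIV (\<lambda>n. vn n X) P inn" using vn[OF X] by blast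
 note inn = E.coproductD[OF P]
 have "inn (Suc n) ** sn n (Suc n) X \<in> hom \<E> (vn n X) P" for n using E.comp_hom[OF s inn(2)] by simp
 then obtain \<sigma> where \<sigma>: "\<sigma> \<in> hom \<E> P P" "\<And>n. n \<in> UNIV \<Longrightarrow> \<sigma> ** inn n = inn (Suc n) ** sn n (Suc n) X"
  by (rule E.coproduct_desc[OF P inn(1)]) blast
 have "minus_arr \<E> (Ident \<E> P) \<sigma> \<in> hom \<E> P P"
  using E.minus_eq_iff(1)[OF E.ident_hom[OF inn(1)] \<sigma>(1)] by (simp add: E.diff_arr_def)
 from distinguished_ex[OF this] show "\<exists>M. is_Mcolim D (\<lambda>n. vn n X) (\<lambda>n. sn n (Suc n) X) M"
  unfolding is_Mcolim_def using P \<sigma>(1) \<sigma>(2)[OF UNIV_I] by fast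
 assume "is_Mcolim D (\<lambda>n. vn n X) (\<lambda>n. sn n (Suc n) X) M"
 then obtain W i \<tau> g h where W: "is_coproduct \<E> UNIV (\<lambda>n. vn n X) W i" "\<tau> \<in> hom \<E> W W" "\<And>n. \<tau> ** i n = i (Suc n) ** sn n (Suc n) X"
  "distinguished D W W M (E.diff_arr (Ident \<E> W) \<tau>) g h"
  unfolding is_Mcolim_def E.diff_arr_def by blast
 obtain e0 e1 F Z r where R: "resolution (\<lambda>n. vn n X) (\<lambda>n. sn n (Suc n) X) e0 e1 F Z r"
  using resolution_ex[of "\<lambda>n. sn n (Suc n) X" "\<lambda>n. vn n X", OF s] .
 have p: "?p \<in> Mor ?A e_cat" by (rule Mor_to_e) simp
 obtain k where k: "k \<in> \<H> ?A (tgt Z) X" "\<I> ?A k"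
  using resolution_of_diagram[OF X R] by (auto simp: isomorphic_def)
 note ft = shriek_ftor[OF p]
 have "isomorphic \<E> (shr ?p (tgt Z)) (shr ?p X)"
  using E.isomorphicI[of "FA (lower_shriek D ?p) k"] ftorD(4)[OF ft(1)] ftor_iso[OF ft(1)] k ft(2,3) by simp
 thus "isomorphic \<E> (hocolim D nat_op X) M"
  unfolding hocolim_def by (rule E.isomorphic_trans[OF E.isomorphic_sym resolution_hocolim[OF R W]])
qed

end

text \<open>\<open>is_Mcolim\<close> is a relation, so the third claim is rendered as the existence
  of a Milnor colimit together with an isomorphism to every one. Functors on \<open>nat_cat\<close>
  are the presheaves on \<open>op_cat nat_cat\<close>, the double opposite being equal to
  \<open>nat_cat\<close>.\<close>

theorem proposition11p3:
 fixes D :: "('u::infinite, 'o, 'a) prederiv"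
 assumes "triangulated_derivator D"
 shows "(\<forall>X \<in> Obj (fun_cat nat_cat (DC D e_cat)).
      \<exists>G \<in> Obj (DC D (op_cat nat_cat)). lifts D (op_cat nat_cat) G X) \<and>
     (\<forall>f \<in> Arr (fun_cat nat_cat (DC D e_cat)).
      \<exists>f' \<in> Arr (DC D (op_cat nat_cat)).
       arr_isomorphic (fun_cat nat_cat (DC D e_cat)) (FA (diag D (op_cat nat_cat)) f') f) \<and>
     (\<forall>X \<in> Obj (DC D (op_cat nat_cat)).
      let S = FO (diag D (op_cat nat_cat)) X
      in (\<exists>M. is_Mcolim D (seq_obj S) (seq_arr S) M) \<and>
        (\<forall>M. is_Mcolim D (seq_obj S) (seq_arr S) M \<longrightarrow>
          isomorphic (DC D e_cat) (hocolim D (op_cat nat_cat) X) M))"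
proof -
 interpret triangulated_derivator D by (rule assms)
 have s: "seq_obj (FO (diag D nat_op) X) = (\<lambda>n. vn n X)" "seq_arr (FO (diag D nat_op) X) = (\<lambda>n. sn n (Suc n) X)"
  if "X \<in> \<O> nat_op" for X
  using diag_seq[OF that] by (auto simp: fun_eq_iff)
 show ?thesis
  using seq_lift seq_lift_arr hocolim_Mcolim by (simp add: Let_def s)
qed

end
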